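(* Let $0<R_1<R_2$, let $(d_\varepsilon)_\varepsilon$ be positive integers, and let $(u_\varepsilon)_\varepsilon$ be a family such that each $u_\varepsilon$ is a minimizer of $E_\varepsilon$ in $\mathcal I_\varepsilon$. Assume that there exists $\delta>0$ such that $|\ln\varepsilon|\ll|d_\varepsilon|\ll\varepsilon^{\delta-1}$. Then $j_\varepsilon/d_\varepsilon\to0$ in $L^2(A)$ as $\varepsilon\to0$. Furthermore, if $a>0$ and $$\tilde\mu_\varepsilon:=\begin{cases}\mu_\varepsilon&\text{in }A,\\0&\text{in }B_{R_2+a}\setminus B_{R_2},\end{cases}$$ then $\tilde\mu_\varepsilon/d_\varepsilon\rightharpoonup\mathcal H^1_{\lfloor\partial B_{R_2}}$ in $\mathcal D'(A_a)$.
   Context: $B_R$ is the open disc of radius $R$ centered at $0$ in $\mathbb R^2\simeq\mathbb C$, $A=B_{R_2}\setminus\overline B_{R_1}$ and $A_a=B_{R_2+a}\setminus\overline B_{R_1}$. The parameter $\varepsilon>0$ tends to $0$, and $a_\varepsilon\ll b_\varepsilon$ means $a_\varepsilon=o(b_\varepsilon)$ as $\varepsilon\to0$. $\theta$ is the polar angle. The Ginzburg-Landau energy is $$E_\varepsilon(u)=\frac12\int_A|\nabla u|^2+\frac1{4\varepsilon^2}\int_A(1-|u|^2)^2,$$ and $$\mathcal I_\varepsilon=\{v\in H^1(A,\mathbb C):\ v=e^{id_\varepsilon\theta}\text{ on }\partial B_{R_2},\ |v|=1\text{ on }\partial B_{R_1}\}.$$ For $a,b\in\mathbb C$, $a\wedge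 b=\frac1{2i}(\bar a b-a\bar b)$. The current and vorticity are $j_\varepsilon=u_\varepsilon\wedge\nabla u_\varepsilon=(u_\varepsilon\wedge\partial_xu_\varepsilon,u_\varepsilon\wedge\partial_yu_\varepsilon)$ and $\mu_\varepsilon=2\partial_xu_\varepsilon\wedge\partial_yu_\varepsilon=\operatorname{curl}j_\varepsilon$. $\mathcal H^1_{\lfloor\partial B_{R_2}}$ is the one-dimensional Hausdorff (arc-length) measure restricted to $\partial B_{R_2}$.
   Formalization: The limit is (1/R_2) times arc length on ∂B_{R_2}, not arc length itself: the total rescaled vorticity near ∂B_{R_2} tends to 2π, while arc length has mass 2πR_2, so the printed limit is false unless R_2 = 1, where the two agree. *)

theory Defs
  imports "HOL-Analysis.Analysis" "HOL-Library.Landau_Symbols"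
begin

text \<open>The plane is the type \<^typ>\<open>complex\<close>; the coordinate directions are \<open>1\<close> and \<open>\<i>\<close>.\<close>

definition annulus :: "real \<Rightarrow> real \<Rightarrow> complex set" where
  "annulus r R = ball 0 R - cball 0 r"

section \<open>Test functions and distributional convergence\<close>

definition pderiv_dir :: "complex \<Rightarrow> (complex \<Rightarrow> real) \<Rightarrow> complex \<Rightarrow> real" where
  "pderiv_dir e f z = frechet_derivative f (at z) e"

fun Ck :: "nat \<Rightarrow> (complex \<Rightarrow> real) \<Rightarrow> bool" where
  "Ck 0 f = continuous_on UNIV f"
| "Ck (Suc k) f = ((\<forall>z. f differentiable at z) \<and> Ck k (pderiv_dir 1 f) \<and> Ck k (pderiv_dir \<i> f))"

definition test_functions :: "complex set \<Rightarrow> (complex \<Rightarrow> real) set" where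
  "test_functions U =
    {f. (\<forall>k. Ck k f) \<and> compact (closure {z. f z \<noteq> 0}) \<and> closure {z. f z \<noteq> 0} \<subseteq> U}"

text \<open>Distributions enter only through their action on (real) test functions. The two functionals
  below are the distributions on \<open>U\<close> given by a function on \<open>U\<close> and by a measure on a subset of \<open>U\<close>.\<close>

definition distr_of_fun :: "complex set \<Rightarrow> (complex \<Rightarrow> real) \<Rightarrow> (complex \<Rightarrow> real) \<Rightarrow> real" where
  "distr_of_fun U f \<phi> = (\<integral>z. f z * \<phi> z \<partial>lebesgue_on U)"

definition distr_of_measure :: "complex measure \<Rightarrow> (complex \<Rightarrow> real) \<Rightarrow> real" where
  "distr_of_measure M \<phi> = (\<integral>z. \<phi> z \<partial>M)"

definition tendsto_distr ::
  "complex set \<Rightarrow> ('a \<Rightarrow> (complex \<Rightarrow> real) \<Rightarrow> real) \<Rightarrow> ((complex \<Rightarrow> real) \<Rightarrow> real) \<Rightarrow> 'a filter \<Rightarrow> bool"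
  where "tendsto_distr U T T\<^sub>0 F \<longleftrightarrow> (\<forall>\<phi>\<in>test_functions U. ((\<lambda>n. T n \<phi>) \<longlongrightarrow> T\<^sub>0 \<phi>) F)"

section \<open>One-dimensional Hausdorff measure\<close>

text \<open>Covers are by bounded sets because \<^const>\<open>diameter\<close> is only meaningful for these.\<close>

definition hausdorff1_pre :: "real \<Rightarrow> complex set \<Rightarrow> ennreal" where
  "hausdorff1_pre \<eta> S =
    (INF C \<in> {C :: nat \<Rightarrow> complex set.
                S \<subseteq> (\<Union>i. C i) \<and> (\<forall>i. bounded (C i) \<and> diameter (C i) \<le> \<eta>)}.
       \<Sum>i. ennreal (diameter (C i)))"

definition hausdorff1 :: "complex set \<Rightarrow> ennreal" where
  "hausdorff1 S = (SUP \<eta> \<in> {0<..}. hausdorff1_pre \<eta> S)"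

text \<open>The restriction of the Hausdorff measure to \<open>\<Gamma>\<close>, as a measure on the Borel subsets of \<open>\<Gamma>\<close>
  (the outer measure \<^const>\<open>hausdorff1\<close> is countably additive on Borel sets).\<close>

definition hausdorff1_on :: "complex set \<Rightarrow> complex measure" where
  "hausdorff1_on \<Gamma> = measure_of \<Gamma> (sets (restrict_space borel \<Gamma>)) hausdorff1"

section \<open>The spaces \<open>L\<^sup>2\<close> and \<open>H\<^sup>1\<close>, and traces\<close>

definition L2 :: "complex measure \<Rightarrow> (complex \<Rightarrow> complex) set" where
  "L2 M = {f \<in> borel_measurable M. integrable M (\<lambda>z. (cmod (f z))\<^sup>2)}"

definition L2_norm :: "complex measure \<Rightarrow> (complex \<Rightarrow> complex) \<Rightarrow> real" where
  "L2_norm M f = sqrt (\<integral>z. (cmod (f z))\<^sup>2 \<partial>M)"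

definition tendsto_L2 ::
  "complex measure \<Rightarrow> ('a \<Rightarrow> complex \<Rightarrow> complex) \<Rightarrow> (complex \<Rightarrow> complex) \<Rightarrow> 'a filter \<Rightarrow> bool" where
  "tendsto_L2 M f g F \<longleftrightarrow>
     (\<forall>\<^sub>F n in F. f n \<in> L2 M) \<and> g \<in> L2 M \<and>
     ((\<lambda>n. L2_norm M (\<lambda>z. f n z - g z)) \<longlongrightarrow> 0) F"

definition is_weak_deriv ::
  "complex set \<Rightarrow> complex \<Rightarrow> (complex \<Rightarrow> complex) \<Rightarrow> (complex \<Rightarrow> complex) \<Rightarrow> bool" where
  "is_weak_deriv A e u w \<longleftrightarrow> w \<in> L2 (lebesgue_on A) \<and>
     (\<forall>\<phi>\<in>test_functions A.
        (\<integral>z. pderiv_dir e \<phi> z *\<^sub>R u z \<partial>lebesgue_on A) = - (\<integral>z. \<phi> z *\<^sub>R w z \<partial>lebesgue_on A))"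

text \<open>Weak derivatives are unique up to null sets; \<open>wderiv\<close> picks a representative.\<close>

definition wderiv :: "complex set \<Rightarrow> complex \<Rightarrow> (complex \<Rightarrow> complex) \<Rightarrow> complex \<Rightarrow> complex" where
  "wderiv A e u = (SOME w. is_weak_deriv A e u w)"

definition sobolev_H1 :: "complex set \<Rightarrow> (complex \<Rightarrow> complex) set" where
  "sobolev_H1 A =
    {u \<in> L2 (lebesgue_on A). (\<exists>w. is_weak_deriv A 1 u w) \<and> (\<exists>w. is_weak_deriv A \<i> u w)}"

definition sobolev_H1_norm :: "complex set \<Rightarrow> (complex \<Rightarrow> complex) \<Rightarrow> real" where
  "sobolev_H1_norm A u =
     sqrt ((L2_norm (lebesgue_on A) u)\<^sup>2 + (L2_norm (lebesgue_on A) (wderiv A 1 u))\<^sup>2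
           + (L2_norm (lebesgue_on A) (wderiv A \<i> u))\<^sup>2)"

text \<open>The trace operator on a part \<open>\<Gamma>\<close> of the boundary is the continuous extension, from the
  \<open>H\<^sup>1\<close> functions continuous up to the boundary (dense for Lipschitz domains) to \<open>H\<^sup>1\<close>, of the
  restriction to \<open>\<Gamma>\<close> with values in \<open>L\<^sup>2(\<Gamma>)\<close>; the following is its graph.\<close>

definition has_trace ::
  "complex set \<Rightarrow> complex set \<Rightarrow> (complex \<Rightarrow> complex) \<Rightarrow> (complex \<Rightarrow> complex) \<Rightarrow> bool" where
  "has_trace A \<Gamma> u g \<longleftrightarrow>
     (\<exists>v :: nat \<Rightarrow> complex \<Rightarrow> complex.
        (\<forall>n. v n \<in> sobolev_H1 A \<and> continuous_on (closure A) (v n)) \<and>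
        (\<lambda>n. sobolev_H1_norm A (\<lambda>z. v n z - u z)) \<longlonglongrightarrow> 0 \<and>
        tendsto_L2 (hausdorff1_on \<Gamma>) v g sequentially)"

section \<open>The Ginzburg--Landau problem\<close>

definition GL_energy :: "real \<Rightarrow> complex set \<Rightarrow> (complex \<Rightarrow> complex) \<Rightarrow> ennreal" where
  "GL_energy \<epsilon> A u =
     ennreal (1 / 2) *
       (\<integral>\<^sup>+z. ennreal ((cmod (wderiv A 1 u z))\<^sup>2 + (cmod (wderiv A \<i> u z))\<^sup>2) \<partial>lebesgue_on A)
     + ennreal (1 / (4 * \<epsilon>\<^sup>2)) * (\<integral>\<^sup>+z. ennreal ((1 - (cmod (u z))\<^sup>2)\<^sup>2) \<partial>lebesgue_on A)"

text \<open>The class \<open>\<I>\<^sub>\<epsilon>\<close> with \<open>d = d\<^sub>\<epsilon>\<close>; boundary values are traces.\<close>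

definition GL_admissible :: "real \<Rightarrow> real \<Rightarrow> nat \<Rightarrow> (complex \<Rightarrow> complex) set" where
  "GL_admissible R\<^sub>1 R\<^sub>2 d =
     {v \<in> sobolev_H1 (annulus R\<^sub>1 R\<^sub>2).
        has_trace (annulus R\<^sub>1 R\<^sub>2) (sphere 0 R\<^sub>2) v (\<lambda>z. cis (real d * Arg z)) \<and>
        (\<exists>g. has_trace (annulus R\<^sub>1 R\<^sub>2) (sphere 0 R\<^sub>1) v g \<and>
             (AE z in hausdorff1_on (sphere 0 R\<^sub>1). cmod (g z) = 1))}"

definition GL_minimizer :: "real \<Rightarrow> real \<Rightarrow> real \<Rightarrow> nat \<Rightarrow> (complex \<Rightarrow> complex) \<Rightarrow> bool" where
  "GL_minimizer \<epsilon> R\<^sub>1 R\<^sub>2 d u \<longleftrightarrow>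
     u \<in> GL_admissible R\<^sub>1 R\<^sub>2 d \<and>
     (\<forall>v\<in>GL_admissible R\<^sub>1 R\<^sub>2 d.
        GL_energy \<epsilon> (annulus R\<^sub>1 R\<^sub>2) u \<le> GL_energy \<epsilon> (annulus R\<^sub>1 R\<^sub>2) v)"

text \<open>The quotient inside \<^const>\<open>Re\<close> is real.\<close>

definition wedge :: "complex \<Rightarrow> complex \<Rightarrow> real" where
  "wedge a b = Re ((cnj a * b - a * cnj b) / (2 * \<i>))"

definition current :: "complex set \<Rightarrow> (complex \<Rightarrow> complex) \<Rightarrow> complex \<Rightarrow> complex" where
  "current A u z = Complex (wedge (u z) (wderiv A 1 u z)) (wedge (u z) (wderiv A \<i> u z))"

definition vorticity :: "complex set \<Rightarrow> (complex \<Rightarrow> complex) \<Rightarrow> complex \<Rightarrow> real" where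
  "vorticity A u z = 2 * wedge (wderiv A 1 u z) (wderiv A \<i> u z)"

definition extended_vorticity :: "complex set \<Rightarrow> (complex \<Rightarrow> complex) \<Rightarrow> complex \<Rightarrow> real" where
  "extended_vorticity A u z = (if z \<in> A then vorticity A u z else 0)"

text \<open>The normalisation of the limit of the rescaled vorticities: on the circle of radius \<open>R\<close> the
  datum \<open>e\<^sup>i\<^sup>d\<^sup>\<theta>\<close> has tangential current \<open>d / R\<close>, so the vorticity measure that it carries, divided
  by \<open>d\<close>, is arc length divided by \<open>R\<close> (total mass \<open>2\<pi>\<close>). For \<open>R = 1\<close> it is arc length itself.\<close>

end

theory Submission
  imports Defs
begin

text \<open>
  Both conclusions come from one estimate: the minimal energy is at most of order
  \<open>d (1 + |ln \<epsilon>|)\<close>, which is \<open>o(d\<^sup>2)\<close> because \<open>|ln \<epsilon>| = o(d)\<close> and \<open>|ln \<epsilon>|\<close> tends to infinity.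

  The energy bound (\<open>comparison_map\<close>) is given by an explicit competitor with \<open>d\<close> vortices lined up along the outer
  circle, in a layer of width of order \<open>1 / d\<close>: there the boundary datum is deformed to a constant, which is then kept
  up to the inner circle. Each vortex costs at most a constant times \<open>1 + |ln \<epsilon>|\<close>.

  A minimizer has modulus at most one (\<open>minimizer_le_1\<close>): composing it with a \<open>C\<^sup>1\<close> contraction of the plane that
  fixes the unit disc keeps the boundary conditions, does not increase the Dirichlet energy, and strictly lowers the potential
  wherever the modulus exceeds one. Hence the current \<open>j = u \<and> \<nabla>u\<close> is dominated by the gradient, its squared \<open>L\<^sup>2\<close> norm is at most
  twice the energy, and \<open>j / d\<close> tends to zero.

  For the vorticity, continue \<open>u\<close> outside the annulus by \<open>e\<^sup>i\<^sup>d\<^sup>\<theta>\<close>. The trace condition on the outer circle makes the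
  result an \<open>H\<^sup>1\<close> function on the larger annulus (\<open>degree_extension\<close>), so its vorticity is the distributional curl of its current there
  (\<open>wedge_identity\<close>). The continuation has modulus one and therefore no vorticity outside; what is left says
  that \<open>\<integral>\<^sub>A \<mu> \<phi>\<close> equals \<open>d\<close> times the integral of \<open>\<phi>(R\<^sub>2 e\<^sup>i\<^sup>t)\<close> over the angle \<open>t\<close>, minus the integral of \<open>\<nabla>\<phi> \<and> j\<close> over \<open>A\<close>.
  This is \<open>vorticity_identity\<close>. After division by \<open>d\<close> the last term is bounded by the norm of \<open>j / d\<close>, which tends to zero, and the
  integral over the angle is the integral against arc length divided by \<open>R\<^sub>2\<close>.

  Three classical facts carry the argument. Weak derivatives are handled by mollification. A function with zero trace extends by zero
  (\<open>zero_trace_extension\<close>), since cutting off near the circle produces an error controlled by the boundary values alone.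
  The one-dimensional Hausdorff measure on a circle is arc length (\<open>hausdorff1_on_circle\<close>), since short chords and arcs have nearly equal length.
\<close>

section \<open>Polar coordinates\<close>

lemma measurable_Complex [measurable (raw)]:
  assumes [measurable]: "f \<in> borel_measurable M" "g \<in> borel_measurable M"
  shows "(\<lambda>x. Complex (f x) (g x)) \<in> borel_measurable M"
  unfolding Complex_eq by measurable

lemma measurable_rcis [measurable (raw)]:
  assumes [measurable]: "f \<in> borel_measurable M" "g \<in> borel_measurable M"
  shows "(\<lambda>x. rcis (f x) (g x)) \<in> borel_measurable M"
  unfolding rcis_def cis.ctr by measurable

lemma lborel_complex:
  "(lborel :: complex measure) = distr (lborel \<Otimes>\<^sub>M lborel) borel (\<lambda>(x, y). Complex x y)"
proof (rule lborel_eqI)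
  have m: "(\<lambda>(x, y). Complex x y) \<in> borel_measurable (lborel \<Otimes>\<^sub>M lborel)"
    unfolding complex_eq_iff Complex_eq by measurable
  fix l u :: complex
  assume le: "\<And>b. b \<in> Basis \<Longrightarrow> l \<bullet> b \<le> u \<bullet> b"
  have "Re l \<le> Re u" "Im l \<le> Im u"
    using le[of 1] le[of \<i>] by (auto simp: Basis_complex_def inner_complex_def)
  moreover have "(\<lambda>(x, y). Complex x y) -` box l u \<inter> space (lborel \<Otimes>\<^sub>M lborel) = {Re l<..<Re u} \<times> {Im l<..<Im u}"
    by (auto simp: box_def Basis_complex_def inner_complex_def space_pair_measure)
  ultimately show "emeasure (distr (lborel \<Otimes>\<^sub>M lborel) borel (\<lambda>(x, y). Complex x y)) (box l u)
      = (\<Prod>b\<in>Basis. (u - l) \<bullet> b)"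
    using m by (subst emeasure_distr)
      (auto simp: Basis_complex_def inner_complex_def lborel.emeasure_pair_measure_Times ennreal_mult)
qed auto

lemma nn_integral_complex:
  assumes [measurable]: "F \<in> borel_measurable borel"
  shows "(\<integral>\<^sup>+z. F z \<partial>(lborel :: complex measure)) = (\<integral>\<^sup>+x. \<integral>\<^sup>+y. F (Complex x y) \<partial>lborel \<partial>lborel)"
proof -
  have m[measurable]: "(\<lambda>(x, y). Complex x y) \<in> borel_measurable (lborel \<Otimes>\<^sub>M lborel)"
    unfolding complex_eq_iff Complex_eq by measurable
  show ?thesis
    by (subst lborel_complex, subst nn_integral_distr)
       (auto simp: lborel.nn_integral_fst[symmetric] split_beta' intro!: nn_integral_cong)
qed

text \<open>The density is the derivative of \<open>tan\<close>, so on intervals this is the fundamental theorem of calculus.\<close>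

lemma lborel_tan:
  "(lborel :: real measure) =
     distr (density lborel (\<lambda>t. ennreal (indicator {-pi/2<..<pi/2} t * (1 + (tan t)\<^sup>2)))) borel tan"
proof (rule lborel_eqI)
  have [measurable]: "(tan::real\<Rightarrow>real) \<in> borel_measurable borel"
    unfolding tan_def by measurable
  fix l u :: real
  assume "\<And>b. b \<in> Basis \<Longrightarrow> l \<bullet> b \<le> u \<bullet> b"
  then have lu: "l \<le> u" by auto
  have bd: "-pi/2 < arctan l" "arctan l \<le> arctan u" "arctan u < pi/2"
    using arctan_lbound[of l] arctan_ubound[of u] lu by (auto simp: arctan_le_iff)
  have "emeasure (distr (density lborel (\<lambda>t. ennreal (indicator {-pi/2<..<pi/2} t * (1 + (tan t)\<^sup>2)))) borel tan) (box l u)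
    = (\<integral>\<^sup>+t. ennreal (indicator {-pi/2<..<pi/2} t * (1 + (tan t)\<^sup>2)) * indicator (tan -` box l u) t \<partial>lborel)"
    by (subst emeasure_distr) (auto simp: emeasure_density measurable_sets_borel[OF \<open>tan \<in> borel_measurable borel\<close>])
  also have "\<dots> = (\<integral>\<^sup>+t. ennreal (1 + (tan t)\<^sup>2) * indicator {arctan l..arctan u} t \<partial>lborel)"
  proof (rule nn_integral_cong_AE)
    have "AE t in lborel. t \<noteq> arctan l" "AE t in lborel. t \<noteq> arctan u"
      by (rule AE_lborel_singleton)+
    then show "AE t in lborel. ennreal (indicator {-pi/2<..<pi/2} t * (1 + (tan t)\<^sup>2)) * indicator (tan -` box l u) t
      = ennreal (1 + (tan t)\<^sup>2) * indicator {arctan l..arctan u} t"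
    proof eventually_elim
      fix t assume t: "t \<noteq> arctan l" "t \<noteq> arctan u"
      show "ennreal (indicator {-pi/2<..<pi/2} t * (1 + (tan t)\<^sup>2)) * indicator (tan -` box l u) t
        = ennreal (1 + (tan t)\<^sup>2) * indicator {arctan l..arctan u} t"
      proof (cases "t \<in> {-pi/2<..<pi/2}")
        case True
        then have "arctan (tan t) = t" by (auto intro: arctan_tan)
        then have "l < tan t \<longleftrightarrow> arctan l < t" "tan t < u \<longleftrightarrow> t < arctan u"
          by (metis arctan_less_iff)+
        then show ?thesis using True t by (auto simp: indicator_def)
      next
        case False
        then show ?thesis using bd by (auto simp: indicator_def)
      qed
    qed
  qed
  also have "\<dots> = ennreal (tan (arctan u) - tan (arctan l))"
  proof (rule nn_integral_FTC_Icc)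
    show "(\<lambda>t. 1 + (tan t)\<^sup>2 :: real) \<in> borel_measurable borel" by measurable
    fix t assume t: "t \<in> {arctan l..arctan u}"
    then have c: "cos t \<noteq> 0"
      using bd cos_gt_zero_pi[of t] by auto
    then show "(tan has_real_derivative 1 + (tan t)\<^sup>2) (at t)"
      using DERIV_tan[OF c] tan_sec[OF c] by (simp add: power_inverse)
  qed (use bd in auto)
  finally show "emeasure (distr (density lborel (\<lambda>t. ennreal (indicator {-pi/2<..<pi/2} t * (1 + (tan t)\<^sup>2)))) borel tan) (box l u)
      = (\<Prod>b\<in>Basis. (u - l) \<bullet> b)"
    by (simp add: tan_arctan)
qed auto

text \<open>On the half plane \<open>Re z > 0\<close> polar coordinates factor into one-dimensional substitutions:
  the slope \<open>y / x\<close> replaces \<open>y\<close>, then \<open>x\<close> is rescaled to the radius with the slope fixed, and finally the slope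
  is written as \<open>tan t\<close>. This avoids a two-dimensional change of variables.\<close>

lemma nn_integral_half_plane_polar:
  assumes [measurable]: "F \<in> borel_measurable borel"
  shows "(\<integral>\<^sup>+z. F z * indicator {z. Re z > 0} z \<partial>lborel) =
    (\<integral>\<^sup>+t. indicator {-pi/2<..<pi/2} t * (\<integral>\<^sup>+r. ennreal r * indicator {0<..} r * F (rcis r t) \<partial>lborel) \<partial>lborel)"
proof -
  have [measurable]: "(tan::real\<Rightarrow>real) \<in> borel_measurable borel"
    unfolding tan_def by measurable
  define K where "K t = (\<integral>\<^sup>+r. F (Complex (r / sqrt (1 + t\<^sup>2)) (r * t / sqrt (1 + t\<^sup>2))) * ennreal (r / (1 + t\<^sup>2)) * indicator {0<..} r \<partial>lborel)" for t :: real
  have [measurable]: "K \<in> borel_measurable borel"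
    unfolding K_def by measurable
  have "(\<integral>\<^sup>+z. F z * indicator {z. Re z > 0} z \<partial>lborel) =
     (\<integral>\<^sup>+x. \<integral>\<^sup>+y. F (Complex x y) * indicator {0<..} x \<partial>lborel \<partial>lborel)"
    by (subst nn_integral_complex) (auto intro!: nn_integral_cong simp: indicator_def)
  also have "\<dots> = (\<integral>\<^sup>+x. \<integral>\<^sup>+t. F (Complex x (x * t)) * ennreal x * indicator {0<..} x \<partial>lborel \<partial>lborel)"
  proof (rule nn_integral_cong)
    fix x :: real
    show "(\<integral>\<^sup>+y. F (Complex x y) * indicator {0<..} x \<partial>lborel) = (\<integral>\<^sup>+t. F (Complex x (x * t)) * ennreal x * indicator {0<..} x \<partial>lborel)"
    proof (cases "x > 0")
      case True
      then show ?thesis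
        by (subst nn_integral_real_affine[where c = x and t = 0])
           (auto simp: nn_integral_cmult[symmetric] ac_simps)
    qed (simp add: indicator_def)
  qed
  also have "\<dots> = (\<integral>\<^sup>+t. \<integral>\<^sup>+x. F (Complex x (x * t)) * ennreal x * indicator {0<..} x \<partial>lborel \<partial>lborel)"
    by (rule lborel_pair.Fubini') measurable
  also have "\<dots> = (\<integral>\<^sup>+t. K t \<partial>lborel)"
  proof (rule nn_integral_cong)
    fix t :: real
    define c where "c = 1 / sqrt (1 + t\<^sup>2)"
    have c: "c > 0" "c * c = 1 / (1 + t\<^sup>2)"
      by (auto simp: c_def add_pos_nonneg)
    have "(\<integral>\<^sup>+x. F (Complex x (x * t)) * ennreal x * indicator {0<..} x \<partial>lborel) =
      (\<integral>\<^sup>+r. ennreal c * (F (Complex (c * r) (c * r * t)) * ennreal (c * r) * indicator {0<..} (c * r)) \<partial>lborel)"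
      using c by (subst nn_integral_real_affine[where c = c and t = 0]) (auto simp: nn_integral_cmult)
    also have "\<dots> = K t"
      unfolding K_def
    proof (rule nn_integral_cong)
      fix r :: real
      show "ennreal c * (F (Complex (c * r) (c * r * t)) * ennreal (c * r) * indicator {0<..} (c * r)) =
        F (Complex (r / sqrt (1 + t\<^sup>2)) (r * t / sqrt (1 + t\<^sup>2))) * ennreal (r / (1 + t\<^sup>2)) * indicator {0<..} r"
      proof (cases "r > 0")
        case True
        have e: "Complex (c * r) (c * r * t) = Complex (r / sqrt (1 + t\<^sup>2)) (r * t / sqrt (1 + t\<^sup>2))"
          by (simp add: c_def)
        have "ennreal c * ennreal (c * r) = ennreal (r / (1 + t\<^sup>2))"
          using c True by (subst ennreal_mult[symmetric]) (auto simp: mult.assoc[symmetric])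
        then show ?thesis
          unfolding e using True c(1) by (simp add: mult.assoc[symmetric] mult.commute[of "F _"])
      qed (use c in \<open>auto simp: indicator_def zero_less_mult_iff\<close>)
    qed
    finally show "(\<integral>\<^sup>+x. F (Complex x (x * t)) * ennreal x * indicator {0<..} x \<partial>lborel) = K t" .
  qed
  also have "\<dots> = (\<integral>\<^sup>+t. ennreal (indicator {-pi/2<..<pi/2} t * (1 + (tan t)\<^sup>2)) * K (tan t) \<partial>lborel)"
    by (subst lborel_tan) (simp add: nn_integral_distr nn_integral_density)
  also have "\<dots> = (\<integral>\<^sup>+t. indicator {-pi/2<..<pi/2} t * (\<integral>\<^sup>+r. ennreal r * indicator {0<..} r * F (rcis r t) \<partial>lborel) \<partial>lborel)"
  proof (rule nn_integral_cong)
    fix t :: real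
    show "ennreal (indicator {-pi/2<..<pi/2} t * (1 + (tan t)\<^sup>2)) * K (tan t) =
      indicator {-pi/2<..<pi/2} t * (\<integral>\<^sup>+r. ennreal r * indicator {0<..} r * F (rcis r t) \<partial>lborel)"
    proof (cases "t \<in> {-pi/2<..<pi/2}")
      case True
      then have c: "cos t > 0" by (auto intro: cos_gt_zero_pi)
      have i: "1 + (tan t)\<^sup>2 = 1 / (cos t)\<^sup>2" using tan_sec[of t] c by (simp add: power_inverse divide_inverse)
      then have s: "sqrt (1 + (tan t)\<^sup>2) = 1 / cos t" using c by (simp add: real_sqrt_divide)
      have [simp]: "tan t * cos t = sin t" "r * tan t * cos t = r * sin t" for r using c by (auto simp: tan_def)
      have "ennreal (1 + (tan t)\<^sup>2) * K (tan t) = (\<integral>\<^sup>+r. ennreal r * indicator {0<..} r * F (rcis r t) \<partial>lborel)"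
        unfolding K_def s
        apply (subst nn_integral_cmult[symmetric])
         apply measurable
        apply (rule nn_integral_cong)
        subgoal for r
        proof (cases "r > 0")
          case True
          have "Complex (r / (1 / cos t)) (r * tan t / (1 / cos t)) = rcis r t" by (simp add: complex_eq_iff)
          moreover have "ennreal (1 + (tan t)\<^sup>2) * ennreal (r / (1 + (tan t)\<^sup>2)) = ennreal r"
            using True c by (subst ennreal_mult[symmetric]) (auto simp: i)
          ultimately show ?thesis using True by (simp add: ac_simps mult.left_commute)
        qed (simp add: indicator_def)
        done
      then show ?thesis using True by simp
    qed simp
  qed
  finally show ?thesis .
qed

lemma lborel_uminus_complex: "distr lborel borel uminus = (lborel :: complex measure)"
  by (subst lborel_affine[of "-1" 0]) (auto simp: density_1 one_ennreal_def[symmetric])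

lemma AE_Re_neq: "AE z in (lborel :: complex measure). Re z \<noteq> 0"
  using AE_lborel_inner_neq[of "1::complex" 0] by (simp add: Basis_complex_def inner_complex_def)

text \<open>This range of angles is the half plane \<open>Re z > 0\<close> followed by its image under \<open>z \<mapsto> -z\<close>.\<close>

abbreviation angles :: "real set" where "angles \<equiv> {-pi/2..<3*pi/2}"

lemma nn_integral_polar:
  assumes [measurable]: "F \<in> borel_measurable borel"
  shows "(\<integral>\<^sup>+z. F z \<partial>lborel) =
    (\<integral>\<^sup>+t. indicator angles t * (\<integral>\<^sup>+r. ennreal r * indicator {0<..} r * F (rcis r t) \<partial>lborel) \<partial>lborel)"
proof -
  have "(\<integral>\<^sup>+z. F z \<partial>lborel) = (\<integral>\<^sup>+z. F z * indicator {z. Re z > 0} z + F z * indicator {z. Re z < 0} z \<partial>lborel)"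
    by (rule nn_integral_cong_AE, rule AE_mp[OF AE_Re_neq]) (auto simp: indicator_def)
  also have "\<dots> = (\<integral>\<^sup>+z. F z * indicator {z. Re z > 0} z \<partial>lborel) + (\<integral>\<^sup>+z. F z * indicator {z. Re z < 0} z \<partial>lborel)"
    by (rule nn_integral_add) measurable
  also have "(\<integral>\<^sup>+z. F z * indicator {z. Re z < 0} z \<partial>lborel) = (\<integral>\<^sup>+z. F (-z) * indicator {z. Re z > 0} z \<partial>lborel)"
    by (subst (1) lborel_uminus_complex[symmetric]) (auto simp: nn_integral_distr indicator_def intro!: nn_integral_cong)
  also have "\<dots> = (\<integral>\<^sup>+t. indicator {-pi/2<..<pi/2} t * (\<integral>\<^sup>+r. ennreal r * indicator {0<..} r * F (- rcis r t) \<partial>lborel) \<partial>lborel)"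
    by (rule nn_integral_half_plane_polar) measurable
  also have "\<dots> = (\<integral>\<^sup>+t. indicator {pi/2<..<3*pi/2} t * (\<integral>\<^sup>+r. ennreal r * indicator {0<..} r * F (rcis r t) \<partial>lborel) \<partial>lborel)"
  proof -
    have "- rcis r t = rcis r (pi + t)" for r t
      by (simp add: rcis_def cis_mult[symmetric])
    moreover have "indicator {pi/2<..<3*pi/2} (pi + t) = (indicator {-pi/2<..<pi/2} t :: ennreal)" for t
      by (auto simp: indicator_def field_simps)
    ultimately show ?thesis
      by (subst (2) nn_integral_real_affine[where c = 1 and t = pi]) simp_all
  qed
  also have "(\<integral>\<^sup>+z. F z * indicator {z. Re z > 0} z \<partial>lborel) =
    (\<integral>\<^sup>+t. indicator {-pi/2<..<pi/2} t * (\<integral>\<^sup>+r. ennreal r * indicator {0<..} r * F (rcis r t) \<partial>lborel) \<partial>lborel)"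
    by (rule nn_integral_half_plane_polar) measurable
  also have "\<dots> + (\<integral>\<^sup>+t. indicator {pi/2<..<3*pi/2} t * (\<integral>\<^sup>+r. ennreal r * indicator {0<..} r * F (rcis r t) \<partial>lborel) \<partial>lborel)
    = (\<integral>\<^sup>+t. (indicator {-pi/2<..<pi/2} t + indicator {pi/2<..<3*pi/2} t) * (\<integral>\<^sup>+r. ennreal r * indicator {0<..} r * F (rcis r t) \<partial>lborel) \<partial>lborel)"
    by (subst nn_integral_add[symmetric]) (auto simp: distrib_right)
  also have "\<dots> = (\<integral>\<^sup>+t. indicator angles t * (\<integral>\<^sup>+r. ennreal r * indicator {0<..} r * F (rcis r t) \<partial>lborel) \<partial>lborel)"
  proof (rule nn_integral_cong_AE)
    have "AE t in lborel. t \<noteq> -pi/2" "AE t in lborel. t \<noteq> pi/2"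
      by (rule AE_lborel_singleton)+
    then show "AE t in lborel. (indicator {-pi/2<..<pi/2} t + indicator {pi/2<..<3*pi/2} t) * (\<integral>\<^sup>+r. ennreal r * indicator {0<..} r * F (rcis r t) \<partial>lborel)
      = indicator angles t * (\<integral>\<^sup>+r. ennreal r * indicator {0<..} r * F (rcis r t) \<partial>lborel)"
      by eventually_elim (auto simp: indicator_def)
  qed
  finally show ?thesis .
qed

text \<open>Polar coordinates as an image measure; in this form they carry Bochner integrals along with nonnegative ones.\<close>

definition polar_measure :: "(real \<times> real) measure" where
  "polar_measure = density (lborel \<Otimes>\<^sub>M lborel) (\<lambda>(t, r). ennreal (indicator angles t * (indicator {0<..} r * r)))"

lemma lborel_polar: "(lborel :: complex measure) = distr polar_measure borel (\<lambda>(t, r). rcis r t)"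
proof (rule measure_eqI)
  fix A :: "complex set" assume "A \<in> sets lborel"
  then have [measurable]: "A \<in> sets borel" by simp
  have "emeasure lborel A = (\<integral>\<^sup>+z. indicator A z \<partial>lborel)" by simp
  also have "\<dots> = (\<integral>\<^sup>+t. indicator angles t * (\<integral>\<^sup>+r. ennreal r * indicator {0<..} r * indicator A (rcis r t) \<partial>lborel) \<partial>lborel)"
    by (rule nn_integral_polar) measurable
  also have "\<dots> = (\<integral>\<^sup>+t. (\<integral>\<^sup>+r. ennreal (indicator angles t * (indicator {0<..} r * r)) * indicator A (rcis r t) \<partial>lborel) \<partial>lborel)"
    by (subst nn_integral_cmult[symmetric]) (auto simp: indicator_def intro!: nn_integral_cong)
  also have "\<dots> = (\<integral>\<^sup>+p. (case p of (t, r) \<Rightarrow> ennreal (indicator angles t * (indicator {0<..} r * r)) * indicator A (rcis r t)) \<partial>(lborel \<Otimes>\<^sub>M lborel))"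
    by (subst lborel.nn_integral_fst[symmetric]) (auto simp: split_beta')
  also have "\<dots> = (\<integral>\<^sup>+p. indicator A (case p of (t, r) \<Rightarrow> rcis r t) \<partial>polar_measure)"
    unfolding polar_measure_def
    by (subst nn_integral_density) (auto simp: split_beta')
  also have "\<dots> = emeasure (distr polar_measure borel (\<lambda>(t, r). rcis r t)) A"
  proof -
    have m: "(\<lambda>(t, r). rcis r t) \<in> borel_measurable polar_measure"
      unfolding polar_measure_def by measurable
    show ?thesis
      by (subst nn_integral_distr[OF m, symmetric]) auto
  qed
  finally show "emeasure lborel A = emeasure (distr polar_measure borel (\<lambda>(t, r). rcis r t)) A" .
qed simp

lemma integral_polar:
  fixes F :: "complex \<Rightarrow> 'b::{banach, second_countable_topology}"
  assumes int: "integrable lborel F"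
  shows "(\<integral>z. F z \<partial>lborel) = (\<integral>t. indicator angles t *\<^sub>R (\<integral>r. (indicator {0<..} r * r) *\<^sub>R F (rcis r t) \<partial>lborel) \<partial>lborel)"
proof -
  have [measurable]: "F \<in> borel_measurable borel" using int by auto
  let ?w = "\<lambda>(t, r). indicator angles t * (indicator {0<..} r * r) :: real"
  have m: "(\<lambda>(t, r). rcis r t) \<in> borel_measurable polar_measure"
    unfolding polar_measure_def by measurable
  have "integrable polar_measure (\<lambda>p. F (case p of (t, r) \<Rightarrow> rcis r t))"
    using int by (subst (asm) lborel_polar) (simp add: integrable_distr_eq[OF m])
  then have i: "integrable (lborel \<Otimes>\<^sub>M lborel) (\<lambda>p. ?w p *\<^sub>R F (case p of (t, r) \<Rightarrow> rcis r t))"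
    unfolding polar_measure_def split_beta'
    by (subst (asm) integrable_density) (auto simp: split_beta' indicator_def)
  have "(\<integral>z. F z \<partial>lborel) = (\<integral>p. F (case p of (t, r) \<Rightarrow> rcis r t) \<partial>polar_measure)"
    by (subst lborel_polar) (simp add: integral_distr[OF m])
  also have "\<dots> = (\<integral>p. ?w p *\<^sub>R F (case p of (t, r) \<Rightarrow> rcis r t) \<partial>(lborel \<Otimes>\<^sub>M lborel))"
    unfolding polar_measure_def split_beta'
    by (subst integral_density) (auto simp: split_beta' indicator_def)
  also have "\<dots> = (\<integral>t. (\<integral>r. ?w (t, r) *\<^sub>R F (rcis r t) \<partial>lborel) \<partial>lborel)"
    using lborel_pair.integral_fst'[OF i] by simp
  also have "\<dots> = (\<integral>t. indicator angles t *\<^sub>R (\<integral>r. (indicator {0<..} r * r) *\<^sub>R F (rcis r t) \<partial>lborel) \<partial>lborel)"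
    by (simp add: scaleR_scaleR[symmetric] del: scaleR_scaleR)
  finally show ?thesis .
qed

section \<open>Arc length on circles\<close>

lemma norm_cis_diff: "norm (cis s - cis t) = 2 * \<bar>sin ((s - t) / 2)\<bar>"
proof -
  have "cis s - cis t = cis ((s + t) / 2) * (cis ((s - t) / 2) - cis (- ((s - t) / 2)))"
    by (simp add: right_diff_distrib cis_mult diff_divide_distrib add_divide_distrib)
  also have "cis ((s - t) / 2) - cis (- ((s - t) / 2)) = 2 * \<i> * of_real (sin ((s - t) / 2))"
    by (simp add: complex_eq_iff)
  finally show ?thesis by (simp add: norm_mult)
qed

lemma norm_cis_diff_le: "norm (cis s - cis t) \<le> \<bar>s - t\<bar>"
  using norm_cis_diff[of s t] abs_sin_x_le_abs_x[of "(s - t) / 2"] by simp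

text \<open>Turns a diameter bound into an interval of the same length, whose Lebesgue measure is known.\<close>

lemma set_subset_interval_of_diam:
  fixes Q :: "real set"
  assumes "Q \<noteq> {}" and "\<And>s t. s \<in> Q \<Longrightarrow> t \<in> Q \<Longrightarrow> \<bar>s - t\<bar> \<le> \<alpha>"
  shows "Q \<subseteq> {Inf Q..Inf Q + \<alpha>}"
proof
  fix q assume q: "q \<in> Q"
  have bb: "bdd_below Q" by (rule bdd_belowI[of _ "q - \<alpha>"]) (use assms(2)[OF q] in \<open>force simp: abs_le_iff\<close>)
  have "q - \<alpha> \<le> Inf Q" by (rule cInf_greatest[OF assms(1)]) (use assms(2)[OF q] in \<open>force simp: abs_le_iff\<close>)
  then show "q \<in> {Inf Q..Inf Q + \<alpha>}" using cInf_lower[OF q bb] by auto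
qed

definition arc_angles :: "real \<Rightarrow> complex set \<Rightarrow> real set" where
  "arc_angles R C = {t \<in> angles. of_real R * cis t \<in> C}"

lemma cis_measurable[measurable]: "cis \<in> borel_measurable borel"
  unfolding cis.ctr by measurable

lemma arc_angles_borel[measurable]: "C \<in> sets borel \<Longrightarrow> arc_angles R C \<in> sets borel"
proof -
  assume [measurable]: "C \<in> sets borel"
  have "{t. of_real R * cis t \<in> C} = (\<lambda>t. of_real R * cis t) -` C" by auto
  moreover have "(\<lambda>t. of_real R * cis t) -` C \<in> sets borel"
    by (rule measurable_sets_borel[of _ borel]) measurable
  ultimately have [measurable]: "{t. of_real R * cis t \<in> C} \<in> sets borel" by simp
  have "arc_angles R C = angles \<inter> {t. of_real R * cis t \<in> C}" by (auto simp: arc_angles_def)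
  then show ?thesis by simp
qed

lemma small_sin_bound:
  fixes K :: real
  assumes "K > 1"
  obtains y where "0 < y" "y < pi / 4" "\<And>x. 0 \<le> x \<Longrightarrow> x \<le> y \<Longrightarrow> x \<le> K * sin x"
proof -
  have "((\<lambda>x::real. sin x / x) \<longlongrightarrow> 1) (at 0)"
    using DERIV_sin[of 0] by (simp add: has_field_derivative_iff)
  then have "\<forall>\<^sub>F x in at 0. sin x / x > 1 / K"
    using assms by (intro order_tendstoD) auto
  then obtain e where e: "e > 0" "\<And>x. x \<noteq> 0 \<Longrightarrow> \<bar>x\<bar> < e \<Longrightarrow> sin x / x > 1 / K"
    unfolding eventually_at by (auto simp: dist_real_def)
  show ?thesis
  proof (rule that[of "min (e/2) (pi/5)"])
    fix x :: real assume x: "0 \<le> x" "x \<le> min (e / 2) (pi / 5)"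
    show "x \<le> K * sin x"
    proof (cases "x = 0")
      case False
      then have "sin x / x > 1 / K" using e x by auto
      then show ?thesis using False x assms by (simp add: field_simps)
    qed simp
  next
    show "min (e / 2) (pi / 5) < pi / 4" by (rule le_less_trans[of _ "pi / 5"]) auto
  qed (use e in auto)
qed

text \<open>If the chord is short the angle is close to it: up to the factor \<open>K\<close>, which can be taken
  arbitrarily close to \<open>1\<close>, a chord of length \<open>\<delta>\<close> on the unit circle spans an angle at most \<open>\<delta>\<close>.\<close>

lemma small_chord_angle:
  assumes "K > 1" "0 < y" "y < pi / 4" and y: "\<And>x. 0 \<le> x \<Longrightarrow> x \<le> y \<Longrightarrow> x \<le> K * sin x"
    and a: "0 \<le> a" "a \<le> pi / 2" and s: "2 * sin a \<le> \<delta>" and \<delta>: "\<delta> < 2 * sin y"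
  shows "2 * a \<le> K * \<delta>"
proof -
  have "sin a < sin y" using s \<delta> by simp
  then have "a < y" using sin_mono_less_eq[of a y] a assms(2,3) by auto
  then have "a \<le> K * sin a" using y a by auto
  also have "\<dots> \<le> K * (\<delta> / 2)" using s assms(1) by (intro mult_left_mono) auto
  finally show ?thesis by simp
qed

text \<open>A set of small diameter meets the circle in a set of angles contained, modulo \<open>2 * pi\<close>, in one
  short interval. The range of angles may cut that interval, and the cut pieces are moved by \<open>2 * pi\<close> to
  disjoint parts of it.\<close>

lemma emeasure_arc_angles_le:
  assumes "R > 0" "K > 1"
  obtains \<eta> where "\<eta> > 0"
    "\<And>C. closed C \<Longrightarrow> bounded C \<Longrightarrow> diameter C \<le> \<eta> \<Longrightarrow> emeasure lborel (arc_angles R C) \<le> ennreal (K * diameter C / R)"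
proof -
  obtain y where y: "0 < y" "y < pi / 4" "\<And>x. 0 \<le> x \<Longrightarrow> x \<le> y \<Longrightarrow> x \<le> K * sin x"
    by (rule small_sin_bound[OF assms(2)]) blast
  have siny: "sin y > 0" using y by (intro sin_gt_zero) auto
  \<comment> \<open>the second bound makes the angular width at most one, so that points of \<open>Q\<close> differ by less than \<open>pi\<close>\<close>
  define \<eta> where "\<eta> = min (R * sin y) (R / K)"
  show ?thesis
  proof (rule that)
    show "\<eta> > 0" using assms siny by (auto simp: \<eta>_def)
    fix C :: "complex set" assume C: "closed C" "bounded C" "diameter C \<le> \<eta>"
    define \<delta> where "\<delta> = diameter C / R"
    define \<alpha> where "\<alpha> = K * \<delta>"
    have \<delta>: "0 \<le> \<delta>" "\<delta> < 2 * sin y" "\<alpha> \<le> 1" "0 \<le> \<alpha>"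
      using C diameter_ge_0[OF C(2)] assms siny
      by (auto simp: \<delta>_def \<eta>_def \<alpha>_def field_simps intro: le_less_trans)
    have chord: "2 * \<bar>sin ((s - t) / 2)\<bar> \<le> \<delta>" if "of_real R * cis s \<in> C" "of_real R * cis t \<in> C" for s t
    proof -
      have "dist (of_real R * cis s) (of_real R * cis t) \<le> diameter C"
        by (rule diameter_bounded_bound[OF C(2) that])
      moreover have "dist (of_real R * cis s) (of_real R * cis t) = R * norm (cis s - cis t)"
        using assms by (simp add: dist_norm right_diff_distrib[symmetric] norm_mult)
      ultimately show ?thesis using assms by (simp add: norm_cis_diff \<delta>_def field_simps)
    qed
    have near: "\<bar>s - t\<bar> \<le> \<alpha>" if "of_real R * cis s \<in> C" "of_real R * cis t \<in> C" "\<bar>s - t\<bar> \<le> pi" for s t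
    proof -
      have "\<bar>sin ((s - t) / 2)\<bar> = sin (\<bar>s - t\<bar> / 2)"
      proof -
        have "sin (\<bar>s - t\<bar> / 2) \<ge> 0" using that(3) by (intro sin_ge_zero) auto
        moreover have "sin (\<bar>s - t\<bar> / 2) = sin ((s - t) / 2) \<or> sin (\<bar>s - t\<bar> / 2) = sin (- ((s - t) / 2))"
          by (cases "s \<ge> t") (simp_all add: minus_divide_left)
        ultimately show ?thesis by auto
      qed
      then have "2 * sin (\<bar>s - t\<bar> / 2) \<le> \<delta>" using chord[OF that(1,2)] by simp
      then show ?thesis
        using small_chord_angle[OF assms(2) y, of "\<bar>s - t\<bar> / 2" \<delta>] that(3) \<delta> by (auto simp: \<alpha>_def)
    qed
    have per: "of_real R * cis (t + 2 * pi) = of_real R * cis t" "of_real R * cis (t - 2 * pi) = of_real R * cis t" for t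
      by (simp_all add: cis_mult[symmetric] cis_divide[symmetric])
    show "emeasure lborel (arc_angles R C) \<le> ennreal (K * diameter C / R)"
    proof (cases "arc_angles R C = {}")
      case False
      then obtain s0 where s0: "s0 \<in> angles" "of_real R * cis s0 \<in> C" by (auto simp: arc_angles_def)
      define Q where "Q = {q. \<bar>q - s0\<bar> \<le> \<alpha> \<and> of_real R * cis q \<in> C}"
      have pi3: "pi > 3" by (rule pi_gt3)
      have "Q \<subseteq> {Inf Q..Inf Q + \<alpha>}"
      proof (rule set_subset_interval_of_diam)
        show "Q \<noteq> {}" using s0 \<delta> by (auto simp: Q_def intro!: exI[of _ s0])
        show "\<bar>s - t\<bar> \<le> \<alpha>" if "s \<in> Q" "t \<in> Q" for s t
          by (rule near) (use that \<delta> pi3 in \<open>auto simp: Q_def\<close>)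
      qed
      moreover define J where "J = {Inf Q..Inf Q + \<alpha>}"
      ultimately have QJ: "Q \<subseteq> J" by simp
      have "arc_angles R C \<subseteq> (J \<inter> angles) \<union> {t \<in> angles. t - 2 * pi \<in> J} \<union> {t \<in> angles. t + 2 * pi \<in> J}"
      proof
        fix t assume "t \<in> arc_angles R C"
        then have t: "t \<in> angles" "of_real R * cis t \<in> C" by (auto simp: arc_angles_def)
        consider "\<bar>t - s0\<bar> \<le> pi" | "t - s0 > pi" | "t - s0 < - pi" by linarith
        then show "t \<in> (J \<inter> angles) \<union> {t \<in> angles. t - 2 * pi \<in> J} \<union> {t \<in> angles. t + 2 * pi \<in> J}"
        proof cases
          case 1
          then have "t \<in> Q" using near[OF t(2) s0(2)] t by (auto simp: Q_def)
          then show ?thesis using QJ t by auto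
        next
          case 2
          then have "t - 2 * pi \<in> Q" using near[of "t - 2 * pi" s0] t s0 unfolding Q_def by (simp add: per(2))
          then show ?thesis using QJ t by auto
        next
          case 3
          then have "t + 2 * pi \<in> Q" using near[of "t + 2 * pi" s0] t s0 unfolding Q_def by (simp add: per(1))
          then show ?thesis using QJ t by auto
        qed
      qed
      then have "emeasure lborel (arc_angles R C) \<le> emeasure lborel ((J \<inter> angles) \<union> {t \<in> angles. t - 2 * pi \<in> J} \<union> {t \<in> angles. t + 2 * pi \<in> J})"
        by (rule emeasure_mono) (auto simp: J_def)
      also have "\<dots> \<le> emeasure lborel (J \<inter> angles) + emeasure lborel {t \<in> angles. t - 2 * pi \<in> J} + emeasure lborel {t \<in> angles. t + 2 * pi \<in> J}"
        by (intro order_trans[OF emeasure_subadditive] add_mono order_refl) (auto simp: J_def)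
      also have "emeasure lborel {t \<in> angles. t - 2 * pi \<in> J} = emeasure lborel {t \<in> J. t + 2 * pi \<in> angles}"
        by (subst lborel_distr_plus[of "2 * pi", symmetric], subst emeasure_distr)
           (auto simp: J_def intro!: arg_cong[where f = "emeasure lborel"])
      also have "emeasure lborel {t \<in> angles. t + 2 * pi \<in> J} = emeasure lborel {t \<in> J. t - 2 * pi \<in> angles}"
        by (subst lborel_distr_plus[of "- 2 * pi", symmetric], subst emeasure_distr)
           (auto simp: J_def intro!: arg_cong[where f = "emeasure lborel"])
      also have "emeasure lborel (J \<inter> angles) + emeasure lborel {t \<in> J. t + 2 * pi \<in> angles} + emeasure lborel {t \<in> J. t - 2 * pi \<in> angles}
        = emeasure lborel ((J \<inter> angles) \<union> {t \<in> J. t + 2 * pi \<in> angles} \<union> {t \<in> J. t - 2 * pi \<in> angles})"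
        by (subst plus_emeasure, auto simp: J_def)+
      also have "\<dots> \<le> emeasure lborel J" by (rule emeasure_mono) (auto simp: J_def)
      also have "\<dots> = ennreal \<alpha>" using \<delta> by (simp add: J_def)
      finally show ?thesis by (simp add: \<alpha>_def \<delta>_def)
    qed simp
  qed
qed

text \<open>Every fine cover of \<open>S\<close> pulls back to a cover of its angles, each piece of which
  is controlled by the diameter of the covering set; closing a covering set does not change its diameter and makes the angle set measurable.\<close>

lemma hausdorff1_circle_ge:
  assumes "R > 0" and [measurable]: "S \<in> sets borel"
  shows "ennreal R * emeasure lborel (arc_angles R S) \<le> hausdorff1 S"
proof -
  \<comment> \<open>the factor \<open>K\<close> is the ratio of arc to chord, which is as close to one as desired for fine covers\<close>
  have main: "ennreal R * emeasure lborel (arc_angles R S) \<le> ennreal K * hausdorff1 S" if K: "K > 1" for K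
  proof -
    obtain \<eta> where \<eta>: "\<eta> > 0"
      "\<And>C. closed C \<Longrightarrow> bounded C \<Longrightarrow> diameter C \<le> \<eta> \<Longrightarrow> emeasure lborel (arc_angles R C) \<le> ennreal (K * diameter C / R)"
      by (rule emeasure_arc_angles_le[OF assms(1) K]) blast
    have "ennreal R / ennreal K * emeasure lborel (arc_angles R S) \<le> hausdorff1_pre \<eta> S"
      unfolding hausdorff1_pre_def
    proof (rule INF_greatest)
      fix C :: "nat \<Rightarrow> complex set"
      assume "C \<in> {C. S \<subseteq> (\<Union>i. C i) \<and> (\<forall>i. bounded (C i) \<and> diameter (C i) \<le> \<eta>)}"
      then have C: "S \<subseteq> (\<Union>i. C i)" "\<And>i. bounded (C i)" "\<And>i. diameter (C i) \<le> \<eta>" by auto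
      have "emeasure lborel (arc_angles R S) \<le> emeasure lborel (\<Union>i. arc_angles R (closure (C i)))"
      proof (rule emeasure_mono)
        show "arc_angles R S \<subseteq> (\<Union>i. arc_angles R (closure (C i)))"
        proof
          fix t assume t: "t \<in> arc_angles R S"
          then obtain i where "of_real R * cis t \<in> C i" using C(1) by (auto simp: arc_angles_def)
          then show "t \<in> (\<Union>i. arc_angles R (closure (C i)))"
            using t closure_subset[of "C i"] by (auto simp: arc_angles_def)
        qed
      qed (auto intro!: sets.countable_UN)
      also have "\<dots> \<le> (\<Sum>i. emeasure lborel (arc_angles R (closure (C i))))"
        by (rule emeasure_subadditive_countably) auto
      also have "\<dots> \<le> (\<Sum>i. ennreal (K / R) * ennreal (diameter (C i)))"
      proof (rule suminf_le)
        fix i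
        have "emeasure lborel (arc_angles R (closure (C i))) \<le> ennreal (K * diameter (closure (C i)) / R)"
          by (rule \<eta>) (use C in \<open>auto simp: diameter_closure\<close>)
        then show "emeasure lborel (arc_angles R (closure (C i))) \<le> ennreal (K / R) * ennreal (diameter (C i))"
          using C K assms(1) by (simp add: diameter_closure ennreal_mult[symmetric] diameter_ge_0)
      qed auto
      also have "\<dots> = ennreal (K / R) * (\<Sum>i. ennreal (diameter (C i)))" by (rule ennreal_suminf_cmult)
      finally have "ennreal (R / K) * emeasure lborel (arc_angles R S) \<le> ennreal (R / K) * (ennreal (K / R) * (\<Sum>i. ennreal (diameter (C i))))"
        by (rule mult_left_mono) simp
      also have "\<dots> = (\<Sum>i. ennreal (diameter (C i)))"
        using K assms(1) by (simp add: mult.assoc[symmetric] ennreal_mult[symmetric])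
      finally show "ennreal R / ennreal K * emeasure lborel (arc_angles R S) \<le> (\<Sum>i. ennreal (diameter (C i)))"
        using K assms(1) by (simp add: divide_ennreal)
    qed
    also have "\<dots> \<le> hausdorff1 S"
      unfolding hausdorff1_def using \<eta>(1) by (intro SUP_upper) auto
    finally have "ennreal K * (ennreal R / ennreal K * emeasure lborel (arc_angles R S)) \<le> ennreal K * hausdorff1 S"
      by (rule mult_left_mono) simp
    then show ?thesis
      using K assms(1) by (simp add: divide_ennreal mult.assoc[symmetric] ennreal_mult[symmetric])
  qed
  show ?thesis
  proof (cases "hausdorff1 S = top")
    case False
    have "((\<lambda>n. ennreal (1 + 1 / real (Suc n)) * hausdorff1 S) \<longlonglongrightarrow> ennreal (1 + 0) * hausdorff1 S)"
      by (intro tendsto_mult_ennreal tendsto_ennrealI tendsto_add tendsto_const lim_1_over_n[THEN LIMSEQ_Suc]) (use False in auto)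
    moreover have "ennreal R * emeasure lborel (arc_angles R S) \<le> ennreal (1 + 1 / real (Suc n)) * hausdorff1 S" for n
      by (rule main) simp
    ultimately show ?thesis
      by (intro LIMSEQ_le_const) auto
  qed simp
qed

text \<open>Outer regularity, in the shape of a sequence of intervals, as a Hausdorff cover requires.\<close>

lemma interval_cover:
  fixes T :: "real set"
  assumes "T \<in> lmeasurable" "T \<subseteq> {a..b}" "e > 0"
  obtains c l :: "nat \<Rightarrow> real" where "\<And>i. l i \<ge> 0" "T \<subseteq> (\<Union>i. {c i..c i + l i})"
    "(\<Sum>i. ennreal (l i)) \<le> ennreal (measure lebesgue T + e)"
proof (cases "a < b")
  case True
  obtain D where D: "countable D" "\<And>K. K \<in> D \<Longrightarrow> K \<subseteq> cbox a b \<and> K \<noteq> {} \<and> (\<exists>c d. K = cbox c d)"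
    "pairwise (\<lambda>A B. interior A \<inter> interior B = {}) D" "T \<subseteq> \<Union>D" "\<Union>D \<in> lmeasurable"
    "measure lebesgue (\<Union>D) \<le> measure lebesgue T + e"
    by (rule measurable_outer_intervals_bounded[of T a b e]) (use assms in auto)
  define g where "g i = (if i \<in> to_nat_on D ` D then from_nat_into D i else {})" for i
  have g: "g i \<in> D" if "i \<in> to_nat_on D ` D" for i using that D(1) by (auto simp: g_def)
  have g0: "g i = {}" if "i \<notin> to_nat_on D ` D" for i using that by (auto simp: g_def)
  have "\<exists>c l. l \<ge> 0 \<and> g i \<subseteq> {c..c + l} \<and> ennreal l = emeasure lborel (interior (g i))" for i
  proof (cases "i \<in> to_nat_on D ` D")
    case True
    then have "g i \<noteq> {} \<and> (\<exists>c d. g i = cbox c d)" using D(2)[OF g] by blast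
    then obtain c d where cd: "g i = {c..d}" "g i \<noteq> {}" by auto
    then show ?thesis by (intro exI[of _ c] exI[of _ "d - c"]) auto
  qed (auto simp: g0)
  then obtain c l where cl: "\<And>i. l i \<ge> 0" "\<And>i. g i \<subseteq> {c i..c i + l i}" "\<And>i. ennreal (l i) = emeasure lborel (interior (g i))"
    by metis
  have UD: "\<Union>D \<subseteq> (\<Union>i. g i)"
  proof
    fix x assume "x \<in> \<Union>D"
    then obtain K where K: "K \<in> D" "x \<in> K" by auto
    then have "g (to_nat_on D K) = K" using D(1) by (auto simp: g_def)
    then show "x \<in> (\<Union>i. g i)" using K by blast
  qed
  have disj: "disjoint_family (\<lambda>i. interior (g i))"
    unfolding disjoint_family_on_def
  proof (intro ballI impI)
    fix i j :: nat assume ij: "i \<noteq> j"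
    show "interior (g i) \<inter> interior (g j) = {}"
    proof (cases "i \<in> to_nat_on D ` D \<and> j \<in> to_nat_on D ` D")
      case True
      then obtain A B where AB: "A \<in> D" "i = to_nat_on D A" "B \<in> D" "j = to_nat_on D B" by auto
      then have "g i = A" "g j = B" using D(1) by (auto simp: g_def)
      then have "g i \<noteq> g j" using ij AB by auto
      then show ?thesis using D(3) g True by (auto simp: pairwise_def)
    qed (auto simp: g0)
  qed
  have "(\<Sum>i. ennreal (l i)) = emeasure lborel (\<Union>i. interior (g i))"
    unfolding cl(3) by (rule suminf_emeasure[OF _ disj]) auto
  also have "\<dots> = emeasure lebesgue (\<Union>i. interior (g i))" by (simp add: open_UN)
  also have "\<dots> \<le> emeasure lebesgue (\<Union>D)"
  proof (rule emeasure_mono)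
    show "(\<Union>i. interior (g i)) \<subseteq> \<Union>D" 
    proof
      fix x assume "x \<in> (\<Union>i. interior (g i))"
      then obtain i where i: "x \<in> g i" using interior_subset by blast
      then have "i \<in> to_nat_on D ` D" using g0[of i] by auto
      then show "x \<in> \<Union>D" using g i by blast
    qed
  qed (use D in auto)
  also have "\<dots> = ennreal (measure lebesgue (\<Union>D))" using emeasure_eq_measure2[OF D(5)] by simp
  also have "\<dots> \<le> ennreal (measure lebesgue T + e)" using D by (intro ennreal_leI) auto
  finally show ?thesis
  proof (rule that[of l c, rotated 2])
    show "l i \<ge> 0" for i by (rule cl(1))
    show "T \<subseteq> (\<Union>i. {c i..c i + l i})"
    proof
      fix x assume "x \<in> T"
      then obtain i where "x \<in> g i" using D(4) UD by blast
      then show "x \<in> (\<Union>i. {c i..c i + l i})" using cl(2)[of i] by blast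
    qed
  qed
next
  case False
  then have "T \<subseteq> {a}" using assms by force
  then show ?thesis using that[of "\<lambda>_. 0" "\<lambda>_. a"] assms by auto
qed

text \<open>Intervals that cover the angles almost optimally are cut into pieces shorter than \<open>\<eta>\<close>;
  their images are arcs whose diameter is at most the arc length, since chords are shorter than arcs.\<close>

lemma hausdorff1_circle_le:
  assumes "R > 0" and [measurable]: "S \<in> sets borel" and S: "S \<subseteq> sphere 0 R"
  shows "hausdorff1 S \<le> ennreal R * emeasure lborel (arc_angles R S)"
  unfolding hausdorff1_def
proof (rule SUP_least)
  fix \<eta> :: real assume "\<eta> \<in> {0<..}"
  then have \<eta>: "\<eta> > 0" by simp
  let ?T = "arc_angles R S"
  have T2: "?T \<subseteq> {-pi/2..3*pi/2}" by (auto simp: arc_angles_def)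
  have "bounded ?T" by (rule bounded_subset[OF bounded_closed_interval T2])
  then have "?T \<in> lmeasurable"
    using arc_angles_borel[OF assms(2), of R] by (intro bounded_set_imp_lmeasurable) auto
  note T = this T2
  have eT: "emeasure lborel ?T = ennreal (measure lebesgue ?T)"
    using emeasure_eq_measure2[OF T(1)] arc_angles_borel[OF assms(2), of R] by simp
  have "hausdorff1_pre \<eta> S \<le> ennreal (R * measure lebesgue ?T) + ennreal e" if e: "e > 0" for e
  proof -
    obtain c l where cl: "\<And>i. l i \<ge> 0" "?T \<subseteq> (\<Union>i. {c i..c i + l i})"
      "(\<Sum>i. ennreal (l i)) \<le> ennreal (measure lebesgue ?T + e / R)"
      by (rule interval_cover[OF T, of "e / R"]) (use e assms(1) in auto)
    have l_le: "l i \<le> measure lebesgue ?T + e / R" for i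
    proof -
      have "ennreal (l i) \<le> (\<Sum>i. ennreal (l i))" using sum_le_suminf[of "\<lambda>i. ennreal (l i)" "{i}"] by simp
      also note cl(3)
      finally show ?thesis using e assms(1) by (subst (asm) ennreal_le_iff) auto
    qed
    define N where "N = Suc (nat \<lceil>R * (measure lebesgue ?T + e / R) / \<eta>\<rceil>)"
    have "N > 0 \<and> real N \<ge> R * (measure lebesgue ?T + e / R) / \<eta>"
      unfolding N_def by linarith
    then have N: "real N \<ge> R * (measure lebesgue ?T + e / R) / \<eta>" "N > 0" by blast+
    \<comment> \<open>\<open>C n\<close> is the arc over the \<open>(n mod N)\<close>-th of the \<open>N\<close> equal parts of the interval with index \<open>n div N\<close>\<close>
    define C where "C n = (\<lambda>t. of_real R * cis t) ` {c (n div N) + real (n mod N) * (l (n div N) / N)..c (n div N) + (real (n mod N) + 1) * (l (n div N) / N)}" for n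
    have "norm (x - y) \<le> R * (l (n div N) / N)" if xy: "x \<in> C n" "y \<in> C n" for x y n
    proof -
      define h where "h = l (n div N) / N"
      obtain s t where st: "x = of_real R * cis s" "y = of_real R * cis t"
        "s \<in> {c (n div N) + real (n mod N) * h..c (n div N) + (real (n mod N) + 1) * h}"
        "t \<in> {c (n div N) + real (n mod N) * h..c (n div N) + (real (n mod N) + 1) * h}"
        using xy unfolding C_def h_def by blast
      then have "\<bar>s - t\<bar> \<le> h" by (auto simp: distrib_right abs_le_iff)
      note st = st(1,2) this[unfolded h_def]
      have "norm (x - y) = R * norm (cis s - cis t)" using st assms(1) by (simp add: right_diff_distrib[symmetric] norm_mult)
      also have "\<dots> \<le> R * (l (n div N) / N)" using norm_cis_diff_le[of s t] st assms(1) by (intro mult_left_mono) auto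
      finally show ?thesis .
    qed
    then have diam: "diameter (C n) \<le> R * (l (n div N) / N)" for n
      using cl(1) assms(1) by (intro diameter_le) auto
    have bd: "bounded (C n)" for n
      unfolding C_def by (intro compact_imp_bounded compact_continuous_image continuous_intros) auto
    have "hausdorff1_pre \<eta> S \<le> (\<Sum>n. ennreal (diameter (C n)))"
      unfolding hausdorff1_pre_def
    proof (rule INF_lower, safe)
      fix z assume "z \<in> S"
      then have "z \<in> sphere 0 R" using S by auto
      then obtain t0 where t0: "z = of_real R * cis t0"
        by (metis rcis_cmod_Arg mem_sphere_0 rcis_def)
      define t where "t = t0 - 2 * pi * of_int \<lfloor>(t0 + pi/2) / (2 * pi)\<rfloor>"
      have "cis t = cis t0" unfolding t_def by (simp add: cis_divide[symmetric] cis_multiple_2pi)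
      moreover have "t \<in> angles"
      proof -
        define k where "k = real_of_int \<lfloor>(t0 + pi/2) / (2 * pi)\<rfloor>"
        have "k \<le> (t0 + pi/2) / (2 * pi)" "(t0 + pi/2) / (2 * pi) < k + 1"
          unfolding k_def by linarith+
        then have "k * (2 * pi) \<le> t0 + pi/2" "t0 + pi/2 < (k + 1) * (2 * pi)"
          by (simp_all add: pos_le_divide_eq pos_divide_less_eq)
        then show ?thesis unfolding t_def k_def[symmetric] by (auto simp: algebra_simps)
      qed
      ultimately have "t \<in> ?T" using t0 \<open>z \<in> S\<close> by (auto simp: arc_angles_def)
      then obtain i where i: "c i \<le> t" "t \<le> c i + l i" using cl(2) by force
      have "\<exists>j<N. c i + real j * (l i / N) \<le> t \<and> t \<le> c i + (real j + 1) * (l i / N)"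
      proof (cases "l i = 0")
        case True then show ?thesis using i N by auto
      next
        case False
        define h where "h = l i / N"
        have h: "h > 0" "real N * h = l i"       proof -
          have "l i > 0" using False cl(1)[of i] by linarith
          then show "h > 0" "real N * h = l i" unfolding h_def using N(2) by (simp_all del: of_nat_Suc)
        qed
        show ?thesis
        proof (cases "t = c i + l i")
          case True
          have "real (N - 1) * h = l i - h" using N h by (simp add: of_nat_diff left_diff_distrib)
          moreover have "real (N - 1) + 1 = real N" using N by (simp add: of_nat_diff)
          ultimately have "c i + real (N - 1) * h \<le> t \<and> t \<le> c i + (real (N - 1) + 1) * h"
            using True h by simp
          then show ?thesis using N unfolding h_def[symmetric] by (intro exI[of _ "N - 1"]) simp
        next
          case neq: False
          define j where "j = nat \<lfloor>(t - c i) / h\<rfloor>"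
          have "(t - c i) / h \<ge> 0" using h i by auto
          then have j: "real j \<le> (t - c i) / h" "(t - c i) / h < real j + 1" unfolding j_def by linarith+
          have "(t - c i) / h < N" using neq i h by (simp add: divide_less_eq)
          then have "j < N" using j by linarith
          moreover have "real j * h \<le> t - c i" "t - c i \<le> (real j + 1) * h"
            using j h by (simp_all add: pos_le_divide_eq pos_divide_less_eq)
          ultimately show ?thesis unfolding h_def[symmetric] by (intro exI[of _ j]) simp
        qed
      qed
      then obtain j where j: "j < N" "c i + real j * (l i / N) \<le> t" "t \<le> c i + (real j + 1) * (l i / N)" by auto
      have "of_real R * cis t \<in> C (i * N + j)" using j unfolding C_def by auto
      then show "z \<in> (\<Union>i. C i)" using t0 \<open>cis t = cis t0\<close> by auto
    next
      fix n
      have "R * (l (n div N) / N) \<le> R * ((measure lebesgue ?T + e / R) / N)"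
        using l_le assms(1) by (intro mult_left_mono divide_right_mono) auto
      also have "\<dots> \<le> \<eta>" using N \<eta> by (simp add: field_simps)
      finally show "diameter (C n) \<le> \<eta>" using diam[of n] by linarith
    qed (rule bd)
    also have "\<dots> \<le> (\<Sum>n. ennreal (R * (l (n div N) / N)))"
      using diam by (intro suminf_le ennreal_leI) auto
    also have "\<dots> = (\<Sum>i. sum (\<lambda>n. ennreal (R * (l (n div N) / N))) {i * N ..< i * N + N})"
      by (rule sums_unique, rule sums_group) (auto intro: summable_sums N)
    also have "\<dots> = (\<Sum>i. ennreal R * ennreal (l i))"
    proof (rule suminf_cong)
      fix i
      have "sum (\<lambda>n. ennreal (R * (l (n div N) / N))) {i * N ..< i * N + N} = sum (\<lambda>n. ennreal (R * (l i / N))) {i * N ..< i * N + N}"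
        by (rule sum.cong) (auto simp: div_nat_eqI algebra_simps)
      also have "\<dots> = ennreal (real N * (R * (l i / N)))"
        using N cl(1) assms(1) by (subst ennreal_mult) (auto simp: ennreal_of_nat_eq_real_of_nat)
      also have "\<dots> = ennreal R * ennreal (l i)" using N cl(1) assms(1) by (simp add: ennreal_mult[symmetric])
      finally show "sum (\<lambda>n. ennreal (R * (l (n div N) / N))) {i * N ..< i * N + N} = ennreal R * ennreal (l i)" .
    qed
    also have "\<dots> = ennreal R * (\<Sum>i. ennreal (l i))" by (rule ennreal_suminf_cmult)
    also have "\<dots> \<le> ennreal R * ennreal (measure lebesgue ?T + e / R)" by (rule mult_left_mono[OF cl(3)]) simp
    also have "\<dots> = ennreal (R * measure lebesgue ?T) + ennreal e"
      using assms(1) e by (simp add: ennreal_mult[symmetric] ennreal_plus[symmetric] distrib_left del: ennreal_plus)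
    finally show ?thesis .
  qed
  then have "hausdorff1_pre \<eta> S \<le> ennreal (R * measure lebesgue ?T)"
    by (rule ennreal_le_epsilon)
  then show "hausdorff1_pre \<eta> S \<le> ennreal R * emeasure lborel ?T"
    using assms(1) by (simp add: eT ennreal_mult)
qed

definition circle_measure :: "real \<Rightarrow> complex measure" where
  "circle_measure R = distr (density lborel (\<lambda>t. ennreal (R * indicator angles t)))
     (restrict_space borel (sphere 0 R)) (\<lambda>t. of_real R * cis t)"

lemma circle_map_measurable:
  assumes "R > 0"
  shows "(\<lambda>t. of_real R * cis t) \<in> borel \<rightarrow>\<^sub>M restrict_space borel (sphere 0 R)"
  using assms by (intro measurable_restrict_space2) (auto simp: norm_mult)

text \<open>The two estimates above identify the outer measure on Borel subsets of the circle with the image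
  of Lebesgue measure, so that integration against it is integration in the angle.\<close>

lemma hausdorff1_on_circle:
  assumes "R > 0"
  shows "hausdorff1_on (sphere 0 R) = circle_measure R"
proof -
  let ?M = "circle_measure R"
  have s: "space ?M = sphere 0 R" "sets ?M = sets (restrict_space borel (sphere 0 R))"
    by (auto simp: circle_measure_def space_restrict_space)
  have eq: "hausdorff1 S = emeasure ?M S" if "S \<in> sets ?M" for S
  proof -
    have S: "S \<in> sets borel" "S \<subseteq> sphere 0 R"
      using that by (auto simp: s sets_restrict_space)
    note [measurable] = S(1)
    have "emeasure ?M S = emeasure (density lborel (\<lambda>t. ennreal (R * indicator angles t))) ((\<lambda>t. of_real R * cis t) -` S)"
      unfolding circle_measure_def using circle_map_measurable[OF assms] that s
      by (subst emeasure_distr) auto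
    also have "\<dots> = (\<integral>\<^sup>+t. ennreal (R * indicator angles t) * indicator ((\<lambda>t. of_real R * cis t) -` S) t \<partial>lborel)"
    proof (subst emeasure_density)
      show "(\<lambda>t. of_real R * cis t) -` S \<in> sets lborel"
        using measurable_sets_borel[of "\<lambda>t. of_real R * cis t" borel S] by simp
    qed auto
    also have "\<dots> = (\<integral>\<^sup>+t. ennreal R * indicator (arc_angles R S) t \<partial>lborel)"
      by (intro nn_integral_cong) (auto simp: indicator_def arc_angles_def)
    also have "\<dots> = ennreal R * emeasure lborel (arc_angles R S)"
      by (simp add: nn_integral_cmult)
    finally show ?thesis
      using hausdorff1_circle_ge[OF assms S(1)] hausdorff1_circle_le[OF assms S] by simp
  qed
  have "hausdorff1_on (sphere 0 R) = measure_of (space ?M) (sets ?M) hausdorff1"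
    by (simp add: hausdorff1_on_def s)
  also have "\<dots> = measure_of (space ?M) (sets ?M) (emeasure ?M)"
  proof (rule measure_of_eq)
    fix a assume "a \<in> sigma_sets (space ?M) (sets ?M)"
    then show "hausdorff1 a = emeasure ?M a" by (simp add: sets.sigma_sets_eq eq)
  qed (rule sets.space_closed)
  also have "\<dots> = ?M" by (rule measure_of_of_measure)
  finally show ?thesis .
qed

lemma circle_cont_borel:
  fixes f :: "complex \<Rightarrow> 'b::{banach, second_countable_topology}"
  assumes "R > 0" "continuous_on (sphere 0 R) f"
  shows "f \<in> borel_measurable (hausdorff1_on (sphere 0 R))"
  using borel_measurable_continuous_on_restrict[OF assms(2)] hausdorff1_on_circle[OF assms(1)]
  by (simp add: circle_measure_def)

lemma circle_integrable_iff:
  fixes f :: "complex \<Rightarrow> 'b::{banach, second_countable_topology}"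
  assumes "R > 0" "f \<in> borel_measurable (hausdorff1_on (sphere 0 R))"
  shows "integrable (hausdorff1_on (sphere 0 R)) f \<longleftrightarrow> integrable lborel (\<lambda>t. (R * indicator angles t) *\<^sub>R f (of_real R * cis t))"
    and "(\<integral>z. f z \<partial>hausdorff1_on (sphere 0 R)) = (\<integral>t. (R * indicator angles t) *\<^sub>R f (of_real R * cis t) \<partial>lborel)"
proof -
  have m: "(\<lambda>t. of_real R * cis t) \<in> density lborel (\<lambda>t. ennreal (R * indicator angles t)) \<rightarrow>\<^sub>M restrict_space borel (sphere 0 R)"
    using circle_map_measurable[OF assms(1)] by simp
  have f: "f \<in> borel_measurable (restrict_space borel (sphere 0 R))"
    using assms by (simp add: hausdorff1_on_circle circle_measure_def)
  have fm: "(\<lambda>t. f (of_real R * cis t)) \<in> borel_measurable borel"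
    using measurable_compose[OF circle_map_measurable[OF assms(1)] f] .
  show "integrable (hausdorff1_on (sphere 0 R)) f \<longleftrightarrow> integrable lborel (\<lambda>t. (R * indicator angles t) *\<^sub>R f (of_real R * cis t))"
    unfolding hausdorff1_on_circle[OF assms(1)] circle_measure_def
    using fm assms(1) by (subst integrable_distr_eq[OF m f], subst integrable_density) auto
  show "(\<integral>z. f z \<partial>hausdorff1_on (sphere 0 R)) = (\<integral>t. (R * indicator angles t) *\<^sub>R f (of_real R * cis t) \<partial>lborel)"
    unfolding hausdorff1_on_circle[OF assms(1)] circle_measure_def
    using fm assms(1) by (subst integral_distr[OF m f], subst integral_density) auto
qed

lemma finite_measure_circle:
  assumes "R > 0" shows "finite_measure (hausdorff1_on (sphere 0 R))"
proof -
  have "integrable (hausdorff1_on (sphere 0 R)) (\<lambda>z. 1::real)"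
    by (subst circle_integrable_iff[OF assms]) auto
  then show ?thesis by (auto intro!: finite_measureI simp: integrable_iff_bounded top.not_eq_extremum)
qed

section \<open>Differentiable functions and test functions\<close>

text \<open>The partial derivatives are parameters rather than derived from \<open>f\<close>, so that they can be given in closed form.\<close>

definition C1on :: "complex set \<Rightarrow> (complex \<Rightarrow> 'b::real_normed_vector) \<Rightarrow> (complex \<Rightarrow> 'b) \<Rightarrow> (complex \<Rightarrow> 'b) \<Rightarrow> bool" where
  "C1on U f fx fy \<longleftrightarrow>
     (\<forall>z\<in>U. (f has_derivative (\<lambda>h. Re h *\<^sub>R fx z + Im h *\<^sub>R fy z)) (at z)) \<and>
     continuous_on U fx \<and> continuous_on U fy"

definition C1c :: "complex set \<Rightarrow> (complex \<Rightarrow> 'b::real_normed_vector) \<Rightarrow> (complex \<Rightarrow> 'b) \<Rightarrow> (complex \<Rightarrow> 'b) \<Rightarrow> bool" where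
  "C1c K f fx fy \<longleftrightarrow> C1on UNIV f fx fy \<and> compact K \<and> (\<forall>z. z \<notin> K \<longrightarrow> f z = 0 \<and> fx z = 0 \<and> fy z = 0)"

lemma C1onD: "C1on U f fx fy \<Longrightarrow> z \<in> U \<Longrightarrow> (f has_derivative (\<lambda>h. Re h *\<^sub>R fx z + Im h *\<^sub>R fy z)) (at z)"
  by (simp add: C1on_def)

lemma C1on_continuous:
  assumes "C1on U f fx fy"
  shows "continuous_on U f" "continuous_on U fx" "continuous_on U fy"
  using assms unfolding C1on_def
  by (auto intro!: continuous_at_imp_continuous_on dest!: bspec has_derivative_continuous)

lemma C1on_subset: "C1on U f fx fy \<Longrightarrow> V \<subseteq> U \<Longrightarrow> C1on V f fx fy"
  unfolding C1on_def by (meson continuous_on_subset subsetD)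

lemma C1c_continuous:
  assumes "C1c K f fx fy"
  shows "continuous_on A f" "continuous_on A fx" "continuous_on A fy"
  using assms C1on_continuous[of UNIV f fx fy] unfolding C1c_def
  by (auto intro: continuous_on_subset)

lemma C1c_measurable:
  fixes f :: "complex \<Rightarrow> 'b::{real_normed_vector, second_countable_topology}"
  assumes "C1c K f fx fy"
  shows "f \<in> borel_measurable borel" "fx \<in> borel_measurable borel" "fy \<in> borel_measurable borel"
  using C1c_continuous[OF assms, of UNIV] by (auto intro: borel_measurable_continuous_onI)

lemma C1c_mult:
  fixes v :: "complex \<Rightarrow> 'b::real_normed_vector"
  assumes \<psi>: "C1c K \<psi> \<psi>x \<psi>y" and v: "C1on U v vx vy" and U: "open U" "K \<subseteq> U"
  shows "C1c K (\<lambda>z. \<psi> z *\<^sub>R v z) (\<lambda>z. \<psi>x z *\<^sub>R v z + \<psi> z *\<^sub>R vx z) (\<lambda>z. \<psi>y z *\<^sub>R v z + \<psi> z *\<^sub>R vy z)"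
proof -
  have K: "compact K" "closed K" and z: "\<And>z. z \<notin> K \<Longrightarrow> \<psi> z = 0" "\<And>z. z \<notin> K \<Longrightarrow> \<psi>x z = 0" "\<And>z. z \<notin> K \<Longrightarrow> \<psi>y z = 0"
    using \<psi> by (auto simp: C1c_def compact_imp_closed)
  have oK: "open (- K)" using K by (simp add: open_Compl)
  have U2: "UNIV = U \<union> (- K)" using U by auto
  have cont: "continuous_on UNIV (\<lambda>z. a z *\<^sub>R v z + \<psi> z *\<^sub>R b z)"
    if "continuous_on UNIV a" "continuous_on U b" "\<And>z. z \<notin> K \<Longrightarrow> a z = 0" for a :: "complex \<Rightarrow> real" and b
  proof -
    have "continuous_on U (\<lambda>z. a z *\<^sub>R v z + \<psi> z *\<^sub>R b z)"
      using that C1on_continuous[OF v] C1c_continuous(1)[OF \<psi>, of U]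
      by (intro continuous_intros) (auto intro: continuous_on_subset)
    moreover have "continuous_on (- K) (\<lambda>z. a z *\<^sub>R v z + \<psi> z *\<^sub>R b z) \<longleftrightarrow> continuous_on (- K) (\<lambda>z. 0 :: 'b)"
      by (rule continuous_on_cong) (use that z in auto)
    ultimately show ?thesis unfolding U2 by (intro continuous_on_open_Un U oK) auto
  qed
  have "((\<lambda>z. \<psi> z *\<^sub>R v z) has_derivative (\<lambda>h. Re h *\<^sub>R (\<psi>x z *\<^sub>R v z + \<psi> z *\<^sub>R vx z) + Im h *\<^sub>R (\<psi>y z *\<^sub>R v z + \<psi> z *\<^sub>R vy z))) (at z)" for z
  proof (cases "z \<in> K")
    case True
    then have "(\<psi> has_derivative (\<lambda>h. Re h *\<^sub>R \<psi>x z + Im h *\<^sub>R \<psi>y z)) (at z)"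
      "(v has_derivative (\<lambda>h. Re h *\<^sub>R vx z + Im h *\<^sub>R vy z)) (at z)"
      using \<psi> v U C1onD[of UNIV \<psi> \<psi>x \<psi>y z] C1onD[OF v, of z] unfolding C1c_def by blast+
    from has_derivative_scaleR[OF this] show ?thesis
      by (rule has_derivative_eq_rhs) (auto simp: algebra_simps)
  next
    case False
    have "((\<lambda>z. 0 :: 'b) has_derivative (\<lambda>h. 0)) (at z)" by simp
    then have "((\<lambda>z. \<psi> z *\<^sub>R v z) has_derivative (\<lambda>h. 0)) (at z)"
      by (rule has_derivative_transform_within_open[OF _ oK]) (use False z in auto)
    then show ?thesis using False z by simp
  qed
  then show ?thesis
    unfolding C1c_def C1on_def using K z cont[of \<psi>x vx] cont[of \<psi>y vy] C1c_continuous[OF \<psi>, of UNIV] C1on_continuous[OF v]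
    by auto
qed

lemma integrable_compact_support:
  fixes f :: "complex \<Rightarrow> 'b::{banach, second_countable_topology}"
  assumes "continuous_on UNIV f" "compact K" "\<And>z. z \<notin> K \<Longrightarrow> f z = 0"
  shows "integrable lborel f"
proof -
  have "integrable lborel (\<lambda>z. indicator K z *\<^sub>R f z)"
    by (rule borel_integrable_compact) (use assms in \<open>auto intro: continuous_on_subset\<close>)
  also have "(\<lambda>z. indicator K z *\<^sub>R f z) = f" using assms by (auto simp: indicator_def)
  finally show ?thesis .
qed

lemma bounded_compact_support:
  fixes f :: "complex \<Rightarrow> 'b::real_normed_vector"
  assumes "continuous_on UNIV f" "compact K" "\<And>z. z \<notin> K \<Longrightarrow> f z = 0"
  obtains B where "B > 0" "\<And>z. norm (f z) \<le> B"
proof -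
  have "bounded (f ` K)" using assms by (intro compact_imp_bounded compact_continuous_image) (auto intro: continuous_on_subset)
  then obtain B where B: "B > 0" "\<forall>x\<in>f ` K. norm x \<le> B" by (auto simp: bounded_pos)
  have "norm (f z) \<le> B" for z using B assms(3)[of z] by (cases "z \<in> K") auto
  then show ?thesis using that B by auto
qed

lemma uniform_compact_support:
  fixes f :: "complex \<Rightarrow> 'b::real_normed_vector"
  assumes "continuous_on UNIV f" "compact K" "\<And>z. z \<notin> K \<Longrightarrow> f z = 0" "e > 0"
  obtains d where "d > 0" "\<And>x y. norm (x - y) < d \<Longrightarrow> norm (f x - f y) < e"
proof -
  obtain R where R: "K \<subseteq> cball 0 R"
    using compact_imp_bounded[OF assms(2)] unfolding bounded_iff by (auto simp: subset_iff)
  have "uniformly_continuous_on (cball 0 (R + 1)) f"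
    using assms by (intro compact_uniformly_continuous) (auto intro: continuous_on_subset)
  then obtain d where d: "d > 0" "\<And>x y. x \<in> cball 0 (R+1) \<Longrightarrow> y \<in> cball 0 (R+1) \<Longrightarrow> dist y x < d \<Longrightarrow> dist (f y) (f x) < e"
    using assms(4) unfolding uniformly_continuous_on_def by metis
  show ?thesis
  proof (rule that[of "min d 1"])
    fix x y :: complex assume xy: "norm (x - y) < min d 1"
    have n: "norm y \<le> norm x + norm (x - y)" "norm x \<le> norm y + norm (x - y)"
      by (metis norm_minus_commute norm_triangle_sub)+
    show "norm (f x - f y) < e"
    proof (cases "x \<in> cball 0 R \<or> y \<in> cball 0 R")
      case True
      then have "x \<in> cball 0 (R+1)" "y \<in> cball 0 (R+1)" using xy n by auto
      then show ?thesis using d(2)[of y x] xy by (simp add: dist_norm)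
    next
      case False
      then have "f x = 0" "f y = 0" using assms(3) R by blast+
      then show ?thesis using assms(4) by simp
    qed
  qed (use d in auto)
qed

lemma C1c_integrable:
  fixes f :: "complex \<Rightarrow> 'b::{banach, second_countable_topology}"
  assumes "C1c K f fx fy"
  shows "integrable lborel f" "integrable lborel fx" "integrable lborel fy"
  using assms C1c_continuous[OF assms, of UNIV]
  by (auto intro!: integrable_compact_support[of _ K] simp: C1c_def)

lemma lborel_shift:
  fixes f :: "complex \<Rightarrow> 'b::{banach, second_countable_topology}"
  assumes [measurable]: "f \<in> borel_measurable borel"
  shows "(\<integral>z. f (z + c) \<partial>lborel) = (\<integral>z. f z \<partial>lborel)"
    and "integrable lborel (\<lambda>z. f (z + c)) \<longleftrightarrow> integrable lborel f"
proof -
  have l: "lborel = distr lborel borel (\<lambda>z. z + c)"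
  proof -
    have "(+) c = (\<lambda>z. z + c)" by (auto simp: add.commute)
    then show ?thesis using lborel_distr_plus[of c] by simp
  qed
  show "(\<integral>z. f (z + c) \<partial>lborel) = (\<integral>z. f z \<partial>lborel)"
    by (subst (2) l, subst integral_distr) auto
  show "integrable lborel (\<lambda>z. f (z + c)) \<longleftrightarrow> integrable lborel f"
    by (subst (2) l, subst integrable_distr_eq) auto
qed

lemma has_vector_derivative_imp_tendsto:
  assumes "(f has_vector_derivative f') (at x)"
  shows "((\<lambda>y. (1 / (y - x)) *\<^sub>R (f y - f x)) \<longlongrightarrow> f') (at x)"
proof -
  have "(f has_derivative (\<lambda>h. h *\<^sub>R f')) (at x)"
    using assms by (simp add: has_vector_derivative_def)
  then have "((\<lambda>y. norm (f y - f x - (y - x) *\<^sub>R f') / norm (y - x)) \<longlongrightarrow> 0) (at x)"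
    unfolding has_derivative_iff_norm by blast
  moreover have "norm (f y - f x - (y - x) *\<^sub>R f') / norm (y - x) = norm ((1 / (y - x)) *\<^sub>R (f y - f x) - f')" if "y \<noteq> x" for y
  proof -
    have "(1 / (y - x)) *\<^sub>R (f y - f x) - f' = (1 / (y - x)) *\<^sub>R (f y - f x - (y - x) *\<^sub>R f')"
      using that by (simp add: scaleR_diff_right)
    then show ?thesis by simp
  qed
  ultimately have "((\<lambda>y. norm ((1 / (y - x)) *\<^sub>R (f y - f x) - f')) \<longlongrightarrow> 0) (at x)"
    by (subst (asm) tendsto_cong[of _ "\<lambda>y. norm ((1 / (y - x)) *\<^sub>R (f y - f x) - f')"])
       (auto simp: eventually_at_filter)
  then show ?thesis by (simp add: tendsto_norm_zero_iff LIM_zero_iff)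
qed

text \<open>The translation \<open>z \<mapsto> z + t * c\<close> leaves \<open>\<integral>f\<close> unchanged, so the difference quotients have integral zero; they
  are bounded, supported in a fixed ball, and converge pointwise to the derivative.\<close>

lemma integral_partial_0:
  fixes f :: "complex \<Rightarrow> 'b::{banach, second_countable_topology}"
  assumes C: "C1c K f fx fy" and c: "c = 1 \<and> g = fx \<or> c = \<i> \<and> g = fy"
  shows "(\<integral>z. g z \<partial>lborel) = 0"
proof -
  have K: "compact K" "\<And>z. z \<notin> K \<Longrightarrow> f z = 0 \<and> g z = 0" using C c by (auto simp: C1c_def)
  have g: "continuous_on UNIV g" using C1c_continuous[OF C, of UNIV] c by auto
  note [measurable] = C1c_measurable[OF C]
  have [measurable]: "g \<in> borel_measurable borel" using c C1c_measurable[OF C] by auto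
  have nc: "norm c = 1" using c by auto
  obtain B where B: "B > 0" "\<And>z. norm (g z) \<le> B" using bounded_compact_support[OF g K(1)] K(2) by blast
  obtain R where R: "K \<subseteq> cball 0 R"
    using compact_imp_bounded[OF K(1)] unfolding bounded_iff by (auto simp: subset_iff)
  have der: "((\<lambda>s. f (z + of_real s * c)) has_vector_derivative g (z + of_real s * c)) (at s)" for z s
  proof -
    have "((\<lambda>s. z + of_real s * c) has_derivative (\<lambda>h. of_real h * c)) (at s)"
      by (auto intro!: derivative_eq_intros)
    moreover have "(f has_derivative (\<lambda>h. Re h *\<^sub>R fx (z + of_real s * c) + Im h *\<^sub>R fy (z + of_real s * c))) (at (z + of_real s * c))"
      using C unfolding C1c_def by (auto intro: C1onD)
    ultimately have "((\<lambda>s. f (z + of_real s * c)) has_derivative (\<lambda>h. Re (of_real h * c) *\<^sub>R fx (z + of_real s * c) + Im (of_real h * c) *\<^sub>R fy (z + of_real s * c))) (at s)"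
      by (rule has_derivative_compose)
    then show ?thesis
      unfolding has_vector_derivative_def by (rule has_derivative_eq_rhs) (use c in auto)
  qed
  define h where "h n = 1 / real (Suc n)" for n
  have h: "0 < h n" "h n \<le> 1" for n by (auto simp: h_def field_simps)
  define q where "q n z = (1 / h n) *\<^sub>R (f (z + of_real (h n) * c) - f z)" for n z
  have "(\<lambda>n. \<integral>z. q n z \<partial>lborel) \<longlonglongrightarrow> (\<integral>z. g z \<partial>lborel)"
  proof (rule integral_dominated_convergence[where w = "\<lambda>z. B * indicator (cball 0 (R + 1)) z"])
    show "integrable lborel (\<lambda>z. B * indicator (cball 0 (R + 1)) z :: real)"
      by (auto intro!: integrable_real_indicator emeasure_lborel_cball_finite)
    show "AE z in lborel. (\<lambda>n. q n z) \<longlonglongrightarrow> g z"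
    proof (rule AE_I2)
      fix z
      have "((\<lambda>t. (1 / (t - 0)) *\<^sub>R (f (z + of_real t * c) - f (z + of_real 0 * c))) \<longlongrightarrow> g (z + of_real 0 * c)) (at 0)"
        using der[of z 0, THEN has_vector_derivative_imp_tendsto] by simp
      moreover have "filterlim h (at 0) sequentially"
        unfolding filterlim_at h_def using LIMSEQ_Suc[OF lim_1_over_n] by (auto simp del: of_nat_Suc)
      ultimately have "((\<lambda>n. (1 / (h n - 0)) *\<^sub>R (f (z + of_real (h n) * c) - f (z + of_real 0 * c))) \<longlongrightarrow> g (z + of_real 0 * c)) sequentially"
        by (rule filterlim_compose)
      then show "(\<lambda>n. q n z) \<longlonglongrightarrow> g z" by (simp add: q_def)
    qed
    show "AE z in lborel. norm (q n z) \<le> B * indicator (cball 0 (R + 1)) z" for n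
    proof (rule AE_I2)
      fix z
      have bd: "norm (f (z + of_real (h n) * c) - f (z + of_real 0 * c)) \<le> B * norm (h n - 0)"
        by (rule differentiable_bound[of "{0..h n}" _ "\<lambda>s t. t *\<^sub>R g (z + of_real s * c)"])
           (use der h[of n] B in \<open>auto simp: has_vector_derivative_def has_derivative_at_withinI less_imp_le
              intro!: onorm_bound has_derivative_at_withinI mult_left_mono simp: mult.commute[of B]\<close>)
      show "norm (q n z) \<le> B * indicator (cball 0 (R + 1)) z"
      proof (cases "norm z \<le> R + 1")
        case True
        have "norm (q n z) = norm (f (z + of_real (h n) * c) - f z) / h n"
          using h[of n] by (simp add: q_def)
        also have "\<dots> \<le> B" using bd h[of n] by (simp add: divide_le_eq)
        finally show ?thesis using True by simp
      next
        case False
        have "norm z \<le> norm (z + of_real (h n) * c) + h n"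
          using norm_triangle_ineq4[of "z + of_real (h n) * c" "of_real (h n) * c"] h[of n] nc by (simp add: norm_mult)
        then have "z \<notin> K" "z + of_real (h n) * c \<notin> K" using False R h[of n] by auto
        then show ?thesis using K(2) False by (simp add: q_def)
      qed
    qed
  qed (auto simp: q_def)
  moreover have "(\<integral>z. q n z \<partial>lborel) = 0" for n
  proof -
    have [measurable]: "f \<in> borel_measurable borel" by (rule C1c_measurable(1)[OF C])
    have "integrable lborel (\<lambda>z. f (z + of_real (h n) * c))"
      using C1c_integrable(1)[OF C] lborel_shift(2)[of f "of_real (h n) * c"] by simp
    then have "(\<integral>z. f (z + of_real (h n) * c) - f z \<partial>lborel) = (\<integral>z. f (z + of_real (h n) * c) \<partial>lborel) - (\<integral>z. f z \<partial>lborel)"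
      by (rule Bochner_Integration.integral_diff[OF _ C1c_integrable(1)[OF C]])
    also have "\<dots> = 0" using lborel_shift(1)[of f "of_real (h n) * c"] by simp
    finally show ?thesis unfolding q_def by (subst integral_scaleR_right) simp
  qed
  ultimately show ?thesis by (simp add: LIMSEQ_const_iff)
qed

lemma C1_by_parts:
  fixes v :: "complex \<Rightarrow> 'b::{banach, second_countable_topology}"
  assumes \<psi>: "C1c K \<psi> \<psi>x \<psi>y" and v: "C1on U v vx vy" and U: "open U" "K \<subseteq> U"
  shows "(\<integral>z. \<psi>x z *\<^sub>R v z \<partial>lborel) = - (\<integral>z. \<psi> z *\<^sub>R vx z \<partial>lborel)"
    "(\<integral>z. \<psi>y z *\<^sub>R v z \<partial>lborel) = - (\<integral>z. \<psi> z *\<^sub>R vy z \<partial>lborel)"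
proof -
  note M = C1c_mult[OF assms]
  have z: "\<And>z. z \<notin> K \<Longrightarrow> \<psi> z = 0" "\<And>z. z \<notin> K \<Longrightarrow> \<psi>x z = 0" "\<And>z. z \<notin> K \<Longrightarrow> \<psi>y z = 0" and K: "compact K"
    using \<psi> by (auto simp: C1c_def)
  have int: "integrable lborel (\<lambda>z. a z *\<^sub>R b z)"
    if "continuous_on UNIV a" "continuous_on U b" "\<And>z. z \<notin> K \<Longrightarrow> a z = 0" for a :: "complex \<Rightarrow> real" and b :: "complex \<Rightarrow> 'b"
  proof -
    have "integrable lborel (\<lambda>z. indicator K z *\<^sub>R (a z *\<^sub>R b z))"
      by (rule borel_integrable_compact) (use that K U in \<open>auto intro!: continuous_intros intro: continuous_on_subset\<close>)
    also have "(\<lambda>z. indicator K z *\<^sub>R (a z *\<^sub>R b z)) = (\<lambda>z. a z *\<^sub>R b z)"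
      using that by (fastforce simp: indicator_def)
    finally show ?thesis .
  qed
  note i = int[OF C1c_continuous(1)[OF \<psi>] C1on_continuous(2)[OF v] z(1)] int[OF C1c_continuous(1)[OF \<psi>] C1on_continuous(3)[OF v] z(1)]
    int[OF C1c_continuous(2)[OF \<psi>] C1on_continuous(1)[OF v] z(2)] int[OF C1c_continuous(3)[OF \<psi>] C1on_continuous(1)[OF v] z(3)]
  have "(\<integral>z. \<psi>x z *\<^sub>R v z + \<psi> z *\<^sub>R vx z \<partial>lborel) = 0" "(\<integral>z. \<psi>y z *\<^sub>R v z + \<psi> z *\<^sub>R vy z \<partial>lborel) = 0"
    using integral_partial_0[OF M, of 1] integral_partial_0[OF M, of \<i>] by auto
  then show "(\<integral>z. \<psi>x z *\<^sub>R v z \<partial>lborel) = - (\<integral>z. \<psi> z *\<^sub>R vx z \<partial>lborel)"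
    "(\<integral>z. \<psi>y z *\<^sub>R v z \<partial>lborel) = - (\<integral>z. \<psi> z *\<^sub>R vy z \<partial>lborel)"
    using i by (simp_all add: eq_neg_iff_add_eq_0)
qed



lemma pderiv_dirI: "(f has_derivative D) (at z) \<Longrightarrow> pderiv_dir e f z = D e"
  unfolding pderiv_dir_def by (metis frechet_derivative_at)

lemma C1on_pderiv:
  assumes "\<forall>z. f differentiable at z" "continuous_on UNIV (pderiv_dir 1 f)" "continuous_on UNIV (pderiv_dir \<i> f)"
  shows "C1on UNIV f (pderiv_dir 1 f) (pderiv_dir \<i> f)"
proof -
  have "(f has_derivative (\<lambda>h. Re h *\<^sub>R pderiv_dir 1 f z + Im h *\<^sub>R pderiv_dir \<i> f z)) (at z)" for z
  proof -
    have D: "(f has_derivative frechet_derivative f (at z)) (at z)"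
      using assms(1) frechet_derivative_works by blast
    then have l: "linear (frechet_derivative f (at z))" by (rule has_derivative_linear)
    have "frechet_derivative f (at z) h = Re h *\<^sub>R pderiv_dir 1 f z + Im h *\<^sub>R pderiv_dir \<i> f z" for h
    proof -
      have "h = Re h *\<^sub>R 1 + Im h *\<^sub>R \<i>" by (simp add: complex_eq_iff)
      then have "frechet_derivative f (at z) h = frechet_derivative f (at z) (Re h *\<^sub>R 1 + Im h *\<^sub>R \<i>)" by simp
      also have "\<dots> = Re h *\<^sub>R pderiv_dir 1 f z + Im h *\<^sub>R pderiv_dir \<i> f z"
        by (simp only: linear_add[OF l] linear_scale[OF l] pderiv_dir_def)
      finally show ?thesis .
    qed
    then show ?thesis using D by (metis (no_types, lifting) has_derivative_eq_rhs ext)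
  qed
  then show ?thesis using assms by (simp add: C1on_def)
qed

lemma C1on_imp_pderiv:
  assumes "C1on UNIV f fx fy"
  shows "pderiv_dir 1 f = fx" "pderiv_dir \<i> f = fy" "f differentiable at z"
proof -
  have D: "(f has_derivative (\<lambda>h. Re h *\<^sub>R fx z + Im h *\<^sub>R fy z)) (at z)" for z
    using C1onD[OF assms] by simp
  show "pderiv_dir 1 f = fx" "pderiv_dir \<i> f = fy"
    using pderiv_dirI[OF D] by (auto intro!: ext)
  show "f differentiable at z" using D differentiable_def by blast
qed

lemma Ck_SucI:
  assumes "C1on UNIV f fx fy" "Ck k fx" "Ck k fy"
  shows "Ck (Suc k) f"
  using assms C1on_imp_pderiv[OF assms(1)] by simp

lemma Ck_imp_continuous: "Ck k f \<Longrightarrow> continuous_on UNIV f"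
proof (cases k)
  case (Suc m)
  assume "Ck k f"
  then show ?thesis using Suc
    by (auto intro!: continuous_at_imp_continuous_on simp: differentiable_imp_continuous_within)
qed simp

lemma Ck_SucD:
  assumes "Ck (Suc k) f"
  shows "C1on UNIV f (pderiv_dir 1 f) (pderiv_dir \<i> f)" "Ck k (pderiv_dir 1 f)" "Ck k (pderiv_dir \<i> f)"
  using assms by (auto intro!: C1on_pderiv Ck_imp_continuous)

lemma Ck_Suc_imp: "Ck (Suc k) f \<Longrightarrow> Ck k f"
proof (induction k arbitrary: f)
  case 0
  then show ?case using Ck_imp_continuous by fastforce
next
  case (Suc k)
  from Suc.prems have "Ck (Suc k) (pderiv_dir 1 f)" "Ck (Suc k) (pderiv_dir \<i> f)" by (auto simp only: Ck.simps)
  with Suc.IH have "Ck k (pderiv_dir 1 f)" "Ck k (pderiv_dir \<i> f)" by blast+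
  then show ?case by (rule Ck_SucI[OF Ck_SucD(1)[OF Suc.prems]])
qed

lemma Ck_const: "Ck k (\<lambda>z. c)"
proof (induction k arbitrary: c)
  case (Suc k)
  have "C1on UNIV (\<lambda>z. c) (\<lambda>z. 0) (\<lambda>z. 0)" by (simp add: C1on_def)
  then show ?case by (rule Ck_SucI[OF _ Suc.IH Suc.IH])
qed simp

lemma Ck_add: "Ck k f \<Longrightarrow> Ck k g \<Longrightarrow> Ck k (\<lambda>z. f z + g z)"
proof (induction k arbitrary: f g)
  case (Suc k)
  note D = Ck_SucD[OF Suc.prems(1)] Ck_SucD[OF Suc.prems(2)]
  have "C1on UNIV (\<lambda>z. f z + g z) (\<lambda>z. pderiv_dir 1 f z + pderiv_dir 1 g z) (\<lambda>z. pderiv_dir \<i> f z + pderiv_dir \<i> g z)"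
    using D(1,4) unfolding C1on_def
    by (auto intro!: continuous_intros has_derivative_eq_rhs[OF has_derivative_add] simp: algebra_simps)
  then show ?case by (rule Ck_SucI) (intro Suc.IH D)+
qed (auto intro: continuous_intros)

lemma C1on_mult:
  fixes f g :: "complex \<Rightarrow> real"
  assumes "C1on U f fx fy" "C1on U g gx gy"
  shows "C1on U (\<lambda>z. f z * g z) (\<lambda>z. fx z * g z + f z * gx z) (\<lambda>z. fy z * g z + f z * gy z)"
  using assms C1on_continuous[OF assms(1)] C1on_continuous[OF assms(2)] unfolding C1on_def
  by (auto intro!: continuous_intros has_derivative_eq_rhs[OF has_derivative_mult] simp: algebra_simps)

lemma Ck_mult: "Ck k f \<Longrightarrow> Ck k g \<Longrightarrow> Ck k (\<lambda>z. f z * g z)"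
proof (induction k arbitrary: f g)
  case (Suc k)
  note D = Ck_SucD[OF Suc.prems(1)] Ck_SucD[OF Suc.prems(2)] Suc.prems[THEN Ck_Suc_imp]
  show ?case
    by (rule Ck_SucI[OF C1on_mult[OF D(1,4)]]; intro Ck_add Suc.IH D)
qed (auto intro: continuous_intros)

lemma Ck_Re: "Ck k Re" and Ck_Im: "Ck k Im"
proof -
  have C: "C1on UNIV Re (\<lambda>z. 1) (\<lambda>z. 0)" "C1on UNIV Im (\<lambda>z. 0) (\<lambda>z. 1)"
    unfolding C1on_def by (auto intro!: derivative_eq_intros)
  show "Ck k Re" using Ck_Suc_imp[OF Ck_SucI[OF C(1) Ck_const Ck_const]] .
  show "Ck k Im" using Ck_Suc_imp[OF Ck_SucI[OF C(2) Ck_const Ck_const]] .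
qed

lemma Ck_affine:
  assumes "Ck k f" shows "Ck k (\<lambda>z. f (w + c *\<^sub>R z))"
  using assms
proof (induction k arbitrary: f)
  case 0
  then show ?case by (auto intro!: continuous_on_compose2[of UNIV f] continuous_intros)
next
  case (Suc k)
  note D = Ck_SucD[OF Suc.prems]
  have "C1on UNIV (\<lambda>z. f (w + c *\<^sub>R z)) (\<lambda>z. c * pderiv_dir 1 f (w + c *\<^sub>R z)) (\<lambda>z. c * pderiv_dir \<i> f (w + c *\<^sub>R z))"
    unfolding C1on_def
  proof (intro conjI ballI)
    fix z :: complex
    have "((\<lambda>z. w + c *\<^sub>R z) has_derivative (\<lambda>h. c *\<^sub>R h)) (at z)" by (auto intro!: derivative_eq_intros)
    from has_derivative_compose[OF this C1onD[OF D(1)]]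
    show "((\<lambda>z. f (w + c *\<^sub>R z)) has_derivative (\<lambda>h. Re h *\<^sub>R (c * pderiv_dir 1 f (w + c *\<^sub>R z)) + Im h *\<^sub>R (c * pderiv_dir \<i> f (w + c *\<^sub>R z)))) (at z)"
      by (auto simp: algebra_simps)
  qed (use C1on_continuous[OF D(1)] in \<open>auto intro!: continuous_intros continuous_on_compose2[of UNIV "pderiv_dir _ f"]\<close>)
  then show ?case by (rule Ck_SucI) (intro Ck_mult Ck_const Suc.IH D)+
qed

text \<open>The powers of \<open>t\<close> in the denominator make the family closed under differentiation, so smoothness
  of the bump function is an induction over the order with \<open>n\<close> arbitrary.\<close>

definition exp_flat :: "nat \<Rightarrow> real \<Rightarrow> real" where
  "exp_flat n t = (if t > 0 then exp (- 1 / t) / t ^ n else 0)"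

lemma exp_flat_nonneg: "exp_flat n t \<ge> 0" by (simp add: exp_flat_def)

text \<open>One term of the exponential series of \<open>1 / t\<close> suffices. The linear bound gives continuity at \<open>0\<close>, and
  together with \<open>exp_flat_shift\<close> a vanishing derivative there.\<close>

lemma exp_flat_le: "exp_flat n t \<le> fact (Suc n) * \<bar>t\<bar>"
proof (cases "t > 0")
  case True
  define E where "E = (fact (Suc n) :: real)"
  define P where "P = t * t ^ n"
  have EP: "E > 0" "P > 0" using True by (auto simp: E_def P_def)
  have "(1 / t) ^ Suc n / fact (Suc n) \<le> exp (1 / t)"
    using True sum_le_suminf[of "\<lambda>k. inverse (fact k) *\<^sub>R (1 / t) ^ k" "{Suc n}"] summable_exp_generic[of "1 / t"]
    by (auto simp: exp_def divide_inverse mult.commute)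
  then have "1 / P / E \<le> exp (1 / t)" by (simp add: P_def E_def power_one_over)
  then have "1 \<le> E * P * exp (1 / t)" using EP by (simp add: field_simps)
  then have "1 * exp (- 1 / t) \<le> (E * P * exp (1 / t)) * exp (- 1 / t)"
    by (rule mult_right_mono) simp
  also have "\<dots> = E * P * exp (1 / t + (- 1 / t))" by (simp only: exp_add mult.assoc)
  also have "\<dots> = E * t * t ^ n" by (simp add: P_def)
  finally show ?thesis using True by (simp add: exp_flat_def E_def divide_le_eq del: fact_Suc)
next
  case False
  have "0 \<le> fact (Suc n) * \<bar>t\<bar>" by (intro mult_nonneg_nonneg) (simp_all del: fact_Suc)
  then show ?thesis using False by (simp only: exp_flat_def if_False)
qed

lemma exp_flat_shift: "exp_flat n t = t * exp_flat (Suc n) t"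
  by (simp add: exp_flat_def)

lemma exp_flat_deriv:
  "(exp_flat n has_real_derivative (exp_flat (n + 2) t - real n * exp_flat (Suc n) t)) (at t)"
proof -
  consider "t > 0" | "t < 0" | "t = 0" by linarith
  then show ?thesis
  proof cases
    case 1
    define e where "e = exp (- 1 / t)"
    have "((\<lambda>t. exp (- 1 / t)) has_real_derivative e / t\<^sup>2) (at t)"
      unfolding e_def using 1 by (auto intro!: derivative_eq_intros simp: power2_eq_square)
    from DERIV_divide[OF this DERIV_pow]
    have "((\<lambda>t. exp (- 1 / t) / t ^ n) has_real_derivative (e / t\<^sup>2 * t ^ n - e * (real n * t ^ (n - Suc 0))) / (t ^ n * t ^ n)) (at t)"
      using 1 by (simp add: e_def)
    also have "(e / t\<^sup>2 * t ^ n - e * (real n * t ^ (n - Suc 0))) / (t ^ n * t ^ n) = exp_flat (n + 2) t - real n * exp_flat (Suc n) t"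
    proof (cases n)
      case (Suc m)
      define T where "T = t ^ m"
      have T: "T > 0" "t ^ n = t * T" "t ^ (n - Suc 0) = T" "t ^ (n + 2) = t * T * (t * t)" "t ^ Suc n = t * (t * T)"
        using 1 by (auto simp: T_def Suc)
      show ?thesis
        using 1 T(1) unfolding exp_flat_def T(2-) e_def[symmetric] power2_eq_square
        by (simp add: field_simps)
    qed (use 1 in \<open>simp add: exp_flat_def e_def power2_eq_square\<close>)
    finally have "((\<lambda>t. exp (- 1 / t) / t ^ n) has_real_derivative (exp_flat (n + 2) t - real n * exp_flat (Suc n) t)) (at t)" .
    then show ?thesis
      by (rule has_field_derivative_transform_within_open[of _ _ _ "{0<..}"]) (use 1 in \<open>auto simp: exp_flat_def\<close>)
  next
    case 2
    have "((\<lambda>t. 0) has_real_derivative 0) (at t)" by simp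
    then have "(exp_flat n has_real_derivative 0) (at t)"
      by (rule has_field_derivative_transform_within_open[of _ _ _ "{..<0}"]) (use 2 in \<open>auto simp: exp_flat_def\<close>)
    then show ?thesis using 2 by (simp add: exp_flat_def)
  next
    case 3
    have "((\<lambda>h. exp_flat n h / h) \<longlongrightarrow> 0) (at 0)"
    proof (rule Lim_null_comparison)
      show "\<forall>\<^sub>F h in at 0. norm (exp_flat n h / h) \<le> fact (Suc (Suc n)) * \<bar>h\<bar>"
        unfolding eventually_at_filter
      proof (intro always_eventually allI impI)
        fix h :: real assume "h \<noteq> 0"
        then have "exp_flat n h / h = exp_flat (Suc n) h" by (simp add: exp_flat_shift[of n h])
        then show "norm (exp_flat n h / h) \<le> fact (Suc (Suc n)) * \<bar>h\<bar>"
          using exp_flat_le[of "Suc n" h] exp_flat_nonneg[of "Suc n" h] by simp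
      qed
      show "((\<lambda>h. fact (Suc (Suc n)) * \<bar>h\<bar>) \<longlongrightarrow> 0) (at (0::real))"
        by (auto intro!: tendsto_eq_intros)
    qed
    then show ?thesis using 3 by (simp add: has_field_derivative_iff exp_flat_def)
  qed
qed

lemma C1on_compose_real:
  fixes F g :: "_ \<Rightarrow> real"
  assumes "\<And>t. (F has_real_derivative F' t) (at t)" "continuous_on UNIV F'" "C1on U g gx gy"
  shows "C1on U (\<lambda>z. F (g z)) (\<lambda>z. F' (g z) * gx z) (\<lambda>z. F' (g z) * gy z)"
  unfolding C1on_def
proof (intro conjI ballI)
  fix z assume "z \<in> U"
  have "(F has_derivative (\<lambda>h. F' (g z) * h)) (at (g z))" using assms(1) by (simp add: has_field_derivative_def)
  from has_derivative_compose[OF C1onD[OF assms(3) \<open>z \<in> U\<close>] this]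
  show "((\<lambda>z. F (g z)) has_derivative (\<lambda>h. Re h *\<^sub>R (F' (g z) * gx z) + Im h *\<^sub>R (F' (g z) * gy z))) (at z)"
    by (auto simp: algebra_simps)
qed (use C1on_continuous[OF assms(3)] assms(2) in \<open>auto intro!: continuous_intros continuous_on_compose2[of UNIV F']\<close>)

lemma exp_flat_continuous: "continuous_on A (exp_flat n)"
  by (meson DERIV_isCont continuous_at_imp_continuous_on exp_flat_deriv)

lemma C1on_exp_flat:
  assumes "C1on U g gx gy"
  shows "C1on U (\<lambda>z. exp_flat n (g z)) (\<lambda>z. (exp_flat (n + 2) (g z) - real n * exp_flat (Suc n) (g z)) * gx z)
    (\<lambda>z. (exp_flat (n + 2) (g z) - real n * exp_flat (Suc n) (g z)) * gy z)"
  by (rule C1on_compose_real[OF exp_flat_deriv _ assms]) (intro continuous_intros exp_flat_continuous)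

definition bump_arg :: "complex \<Rightarrow> real" where "bump_arg z = 1 - ((Re z)\<^sup>2 + (Im z)\<^sup>2)"

lemma bump_arg_norm: "bump_arg z = 1 - (norm z)\<^sup>2"
  by (simp add: bump_arg_def cmod_power2)

lemma C1on_bump_arg: "C1on UNIV bump_arg (\<lambda>z. - 2 * Re z) (\<lambda>z. - 2 * Im z)"
  unfolding C1on_def bump_arg_def
  by (auto intro!: derivative_eq_intros continuous_intros simp: algebra_simps)

lemma Ck_exp_flat_bump: "Ck k (\<lambda>z. exp_flat n (bump_arg z))"
proof (induction k arbitrary: n)
  case 0
  show ?case using C1on_continuous(1)[OF C1on_exp_flat[OF C1on_bump_arg]] by simp
next
  case (Suc k)
  have "Ck k (\<lambda>z. (exp_flat (n + 2) (bump_arg z) - real n * exp_flat (Suc n) (bump_arg z)) * (- 2 * g z))" if "Ck k g" for g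
  proof -
    have "Ck k (\<lambda>z. (exp_flat (n + 2) (bump_arg z) + (- real n) * exp_flat (Suc n) (bump_arg z)) * (- 2 * g z))"
      by (intro Ck_mult Ck_add Ck_const Suc.IH that)
    then show ?thesis by simp
  qed
  note H = this
  show ?case by (rule Ck_SucI[OF C1on_exp_flat[OF C1on_bump_arg] H[OF Ck_Re] H[OF Ck_Im]])
qed

section \<open>Square-integrable functions and mollification\<close>

definition sqint :: "(complex \<Rightarrow> 'b::euclidean_space) \<Rightarrow> bool" where
  "sqint F \<longleftrightarrow> F \<in> borel_measurable borel \<and> integrable lborel (\<lambda>z. (norm (F z))\<^sup>2)"

text \<open>The square of the \<open>L\<^sup>2\<close> norm over the plane; squares make sums and bounds free of square roots.\<close>

definition nsq :: "(complex \<Rightarrow> 'b::euclidean_space) \<Rightarrow> real" where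
  "nsq F = (\<integral>z. (norm (F z))\<^sup>2 \<partial>lborel)"

lemma sqint_meas[measurable_dest]: "sqint F \<Longrightarrow> F \<in> borel_measurable borel"
  by (simp add: sqint_def)

lemma nsq_nonneg: "nsq F \<ge> 0"
  by (simp add: nsq_def)

lemma norm_add_sq: "(norm (a + b))\<^sup>2 \<le> 2 * (norm a)\<^sup>2 + 2 * (norm (b::'b::real_normed_vector))\<^sup>2"
proof -
  have "(norm (a + b))\<^sup>2 \<le> (norm a + norm b)\<^sup>2" by (intro power_mono norm_triangle_ineq) auto
  also have "\<dots> \<le> 2 * (norm a)\<^sup>2 + 2 * (norm b)\<^sup>2"
    using sum_squares_bound[of "norm a" "norm b"] by (simp add: power2_sum)
  finally show ?thesis .
qed

lemma sqint_bound:
  assumes "sqint F" "G \<in> borel_measurable borel" "\<And>z. norm (G z) \<le> c * norm (F z)"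
  shows "sqint G" "nsq G \<le> c\<^sup>2 * nsq F"
proof -
  note [measurable] = assms(2)
  have le: "(norm (G z))\<^sup>2 \<le> c\<^sup>2 * (norm (F z))\<^sup>2" for z
    using power_mono[OF assms(3)[of z] norm_ge_zero, of 2] by (simp add: power_mult_distrib)
  have i: "integrable lborel (\<lambda>z. c\<^sup>2 * (norm (F z))\<^sup>2)" using assms(1) by (simp add: sqint_def)
  have i2: "integrable lborel (\<lambda>z. (norm (G z))\<^sup>2)"
    by (rule Bochner_Integration.integrable_bound[OF i]) (use le in auto)
  then show "sqint G" using assms by (simp add: sqint_def)
  have "nsq G \<le> (\<integral>z. c\<^sup>2 * (norm (F z))\<^sup>2 \<partial>lborel)" unfolding nsq_def by (intro integral_mono i i2 le)
  then show "nsq G \<le> c\<^sup>2 * nsq F" by (simp add: nsq_def)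
qed

lemma sqint_add:
  assumes "sqint F" "sqint G"
  shows "sqint (\<lambda>z. F z + G z)" "nsq (\<lambda>z. F z + G z) \<le> 2 * nsq F + 2 * nsq G"
proof -
  note [measurable] = sqint_meas[OF assms(1)] sqint_meas[OF assms(2)]
  have i: "integrable lborel (\<lambda>z. 2 * (norm (F z))\<^sup>2 + 2 * (norm (G z))\<^sup>2)" using assms by (simp add: sqint_def)
  have i2: "integrable lborel (\<lambda>z. (norm (F z + G z))\<^sup>2)"
    by (rule Bochner_Integration.integrable_bound[OF i]) (use norm_add_sq in auto)
  then show "sqint (\<lambda>z. F z + G z)" by (simp add: sqint_def)
  have "nsq (\<lambda>z. F z + G z) \<le> (\<integral>z. 2 * (norm (F z))\<^sup>2 + 2 * (norm (G z))\<^sup>2 \<partial>lborel)"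
    unfolding nsq_def by (intro integral_mono i i2 norm_add_sq)
  then show "nsq (\<lambda>z. F z + G z) \<le> 2 * nsq F + 2 * nsq G" using assms by (simp add: nsq_def sqint_def)
qed

lemma sqint_uminus: "sqint F \<Longrightarrow> sqint (\<lambda>z. - F z)" by (simp add: sqint_def)

lemma sqint_diff:
  assumes "sqint F" "sqint G"
  shows "sqint (\<lambda>z. F z - G z)" "nsq (\<lambda>z. F z - G z) \<le> 2 * nsq F + 2 * nsq G"
  using sqint_add[OF assms(1) sqint_uminus[OF assms(2)]] by (simp_all add: nsq_def)

lemma nsq_minus_commute: "nsq (\<lambda>z. F z - G z) = nsq (\<lambda>z. G z - F z)"
  by (simp add: nsq_def norm_minus_commute)

lemma sqint_continuous:
  fixes f :: "complex \<Rightarrow> 'b::euclidean_space"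
  assumes "continuous_on UNIV f" "compact K" "\<And>z. z \<notin> K \<Longrightarrow> f z = 0"
  shows "sqint f"
  unfolding sqint_def using assms
  by (auto intro!: integrable_compact_support[of _ K] continuous_intros borel_measurable_continuous_onI)

lemma integrable_norm_mult:
  fixes F :: "complex \<Rightarrow> 'b::euclidean_space" and G :: "complex \<Rightarrow> 'c::euclidean_space"
  assumes "sqint F" "sqint G"
  shows "integrable lborel (\<lambda>z. norm (F z) * norm (G z))"
proof -
  note [measurable] = sqint_meas[OF assms(1)] sqint_meas[OF assms(2)]
  have i: "integrable lborel (\<lambda>z. (norm (F z))\<^sup>2 + (norm (G z))\<^sup>2)" using assms by (simp add: sqint_def)
  show ?thesis
  proof (rule Bochner_Integration.integrable_bound[OF i])
    show "AE z in lborel. norm (norm (F z) * norm (G z)) \<le> norm ((norm (F z))\<^sup>2 + (norm (G z))\<^sup>2)"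
    proof (rule AE_I2)
      fix z
      show "norm (norm (F z) * norm (G z)) \<le> norm ((norm (F z))\<^sup>2 + (norm (G z))\<^sup>2)"
      proof -
        have "2 * (norm (F z) * norm (G z)) \<le> (norm (F z))\<^sup>2 + (norm (G z))\<^sup>2"
          using sum_squares_bound[of "norm (F z)" "norm (G z)"] by simp
        moreover have "0 \<le> norm (F z) * norm (G z)" by simp
        ultimately have "norm (F z) * norm (G z) \<le> (norm (F z))\<^sup>2 + (norm (G z))\<^sup>2" by linarith
        then show ?thesis by simp
      qed
    qed
  qed auto
qed

text \<open>The quadratic polynomial \<open>t \<mapsto> \<integral>(t |F| - |G|)\<^sup>2\<close> is nonnegative; evaluate it at its minimum.\<close>

lemma Cauchy_Schwarz_nsq:
  fixes F :: "complex \<Rightarrow> 'b::euclidean_space" and G :: "complex \<Rightarrow> 'c::euclidean_space"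
  assumes "sqint F" "sqint G"
  shows "(\<integral>z. norm (F z) * norm (G z) \<partial>lborel)\<^sup>2 \<le> nsq F * nsq G"
proof -
  define P where "P = (\<integral>z. norm (F z) * norm (G z) \<partial>lborel)"
  have q: "0 \<le> t\<^sup>2 * nsq F - 2 * t * P + nsq G" for t
  proof -
    have "0 \<le> (\<integral>z. (t * norm (F z) - norm (G z))\<^sup>2 \<partial>lborel)" by simp
    also have "\<dots> = (\<integral>z. t\<^sup>2 * (norm (F z))\<^sup>2 - 2 * t * (norm (F z) * norm (G z)) + (norm (G z))\<^sup>2 \<partial>lborel)"
      by (rule Bochner_Integration.integral_cong) (auto simp: power2_eq_square algebra_simps)
    also have "\<dots> = t\<^sup>2 * nsq F - 2 * t * P + nsq G"
      using assms integrable_norm_mult[OF assms] by (simp add: sqint_def nsq_def P_def)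
    finally show ?thesis .
  qed
  have P0: "P \<ge> 0" by (simp add: P_def)
  show ?thesis
  proof (cases "nsq F = 0")
    case True
    have "P = 0"
    proof (rule ccontr)
      assume "P \<noteq> 0"
      then have "P > 0" using P0 by simp
      then show False using q[of "(nsq G + 1) / (2 * P)"] True by simp
    qed
    then show ?thesis using True by (simp add: P_def)
  next
    case False
    then have F: "nsq F > 0" using nsq_nonneg[of F] by simp
    have "0 \<le> nsq F * ((P / nsq F)\<^sup>2 * nsq F - 2 * (P / nsq F) * P + nsq G)"
      using q[of "P / nsq F"] F by (intro mult_nonneg_nonneg) auto
    also have "\<dots> = nsq F * nsq G - P\<^sup>2"
    proof -
      have "f * ((P / f)\<^sup>2 * f - 2 * (P / f) * P + g) = f * g - P\<^sup>2" if "f > 0" for f g :: real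
        using that by (simp add: power2_eq_square field_simps)
      then show ?thesis using F by blast
    qed
    finally show ?thesis by (simp add: P_def)
  qed
qed

lemma norm_integral_mult_le:
  fixes F :: "complex \<Rightarrow> 'b::euclidean_space" and G :: "complex \<Rightarrow> 'c::euclidean_space" and H :: "complex \<Rightarrow> 'd::euclidean_space"
  assumes "sqint F" "sqint G" "H \<in> borel_measurable borel" "\<And>z. norm (H z) \<le> norm (F z) * norm (G z)"
  shows "integrable lborel H" "norm (\<integral>z. H z \<partial>lborel) \<le> sqrt (nsq F * nsq G)"
proof -
  show i: "integrable lborel H"
    by (rule Bochner_Integration.integrable_bound[OF integrable_norm_mult[OF assms(1,2)]]) (use assms in auto)
  have "norm (\<integral>z. H z \<partial>lborel) \<le> (\<integral>z. norm (F z) * norm (G z) \<partial>lborel)"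
    using i integrable_norm_mult[OF assms(1,2)] assms(4)
    by (intro order_trans[OF integral_norm_bound] integral_mono) auto
  also have "\<dots> \<le> sqrt (nsq F * nsq G)"
    using Cauchy_Schwarz_nsq[OF assms(1,2)] by (intro real_le_rsqrt) auto
  finally show "norm (\<integral>z. H z \<partial>lborel) \<le> sqrt (nsq F * nsq G)" .
qed

lemma integrable_indicator_cball: "integrable lborel (\<lambda>z::complex. c * indicator (cball 0 R) z :: real)"
  by (intro integrable_mult_right integrable_real_indicator emeasure_lborel_cball_finite) auto

lemma sqint_integrable:
  fixes F :: "complex \<Rightarrow> 'b::euclidean_space"
  assumes "sqint F" "bounded U" "\<And>z. z \<notin> U \<Longrightarrow> F z = 0"
  shows "integrable lborel F"
proof -
  obtain R where R: "U \<subseteq> cball 0 R"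
    using assms(2) unfolding bounded_iff by (auto simp: subset_iff)
  have s: "sqint (\<lambda>z. indicator (cball 0 R) z :: real)"
  proof -
    have "(\<lambda>z. (norm (indicator (cball 0 R) z :: real))\<^sup>2) = (\<lambda>z::complex. indicator (cball 0 R) z)"
      by (auto simp: indicator_def)
    then show ?thesis unfolding sqint_def using integrable_indicator_cball[of 1 R] by simp
  qed
  show ?thesis
  proof (rule norm_integral_mult_le(1)[OF s assms(1) sqint_meas[OF assms(1)]])
    show "norm (F z) \<le> norm (indicator (cball 0 R) z :: real) * norm (F z)" for z
    proof (cases "z \<in> cball 0 R")
      case False
      then have "z \<notin> U" using R by blast
      then show ?thesis using assms(3) by simp
    qed simp
  qed
qed

definition clip :: "real \<Rightarrow> 'b::euclidean_space \<Rightarrow> 'b" where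
  "clip M w = (1 / max 1 (norm w / M)) *\<^sub>R w"

lemma continuous_clip: "M > 0 \<Longrightarrow> continuous_on UNIV (clip M)"
  unfolding clip_def by (intro continuous_intros) auto

lemma norm_clip_le: "M > 0 \<Longrightarrow> norm (clip M w) \<le> M" "norm (clip M w) \<le> norm w"
proof -
  show "M > 0 \<Longrightarrow> norm (clip M w) \<le> M"
    by (auto simp: clip_def max_def field_simps)
  have "norm (clip M w) = (1 / max 1 (norm w / M)) * norm w" by (simp add: clip_def)
  also have "\<dots> \<le> norm w" by (intro mult_left_le_one_le) auto
  finally show "norm (clip M w) \<le> norm w" .
qed

lemma clip_eq: "M > 0 \<Longrightarrow> norm w \<le> M \<Longrightarrow> clip M w = w"
  by (simp add: clip_def max_def field_simps)

definition cutoff :: "real \<Rightarrow> complex \<Rightarrow> real" where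
  "cutoff M z = max 0 (min 1 (M + 1 - norm z))"

lemma cutoff_props:
  "0 \<le> cutoff M z" "cutoff M z \<le> 1" "norm z \<le> M \<Longrightarrow> cutoff M z = 1" "norm z > M + 1 \<Longrightarrow> cutoff M z = 0"
  "continuous_on A (cutoff M)"
  by (auto simp: cutoff_def[abs_def] intro!: continuous_intros)

lemma nsq_tendsto_dominated:
  fixes f :: "nat \<Rightarrow> complex \<Rightarrow> 'b::euclidean_space"
  assumes [measurable]: "\<And>n. f n \<in> borel_measurable borel"
    and lim: "AE z in lborel. (\<lambda>n. f n z) \<longlonglongrightarrow> 0"
    and bd: "\<And>n. AE z in lborel. norm (f n z) \<le> g z" and g: "integrable lborel (\<lambda>z. (g z)\<^sup>2)" and [measurable]: "g \<in> borel_measurable borel"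
  shows "(\<lambda>n. nsq (f n)) \<longlonglongrightarrow> 0" "sqint (f n)"
proof -
  have b2: "AE z in lborel. norm ((norm (f n z))\<^sup>2) \<le> (g z)\<^sup>2" for n
    using bd[of n] by eventually_elim (auto intro: power_mono)
  have "(\<lambda>n. \<integral>z. (norm (f n z))\<^sup>2 \<partial>lborel) \<longlonglongrightarrow> (\<integral>z. 0 \<partial>(lborel::complex measure))"
  proof (rule integral_dominated_convergence[OF _ _ g _ b2])
    show "AE z in lborel. (\<lambda>n. (norm (f n z))\<^sup>2) \<longlonglongrightarrow> 0"
      using lim by eventually_elim (auto intro!: tendsto_eq_intros)
  qed auto
  then show "(\<lambda>n. nsq (f n)) \<longlonglongrightarrow> 0" by (simp add: nsq_def)
  show "sqint (f n)" unfolding sqint_def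
    by (intro conjI Bochner_Integration.integrable_bound[OF g] assms) (use b2[of n] in auto)
qed

text \<open>First truncate in space and in size, which changes little by dominated convergence; then use that a
  Lebesgue measurable function is an almost everywhere limit of continuous functions. Truncating these in the same way keeps them continuous and dominated.\<close>

lemma sqint_dense:
  fixes F :: "complex \<Rightarrow> 'b::euclidean_space"
  assumes F: "sqint F" and e: "e > 0"
  obtains G R where "continuous_on UNIV G" "\<And>z. z \<notin> cball 0 R \<Longrightarrow> G z = 0" "nsq (\<lambda>z. F z - G z) < e"
proof -
  note [measurable] = sqint_meas[OF F]
  have cm[measurable]: "clip (real (Suc n)) \<in> borel_measurable borel" for n and x :: 'b
    by (intro borel_measurable_continuous_onI continuous_clip) auto
  have km[measurable]: "cutoff M \<in> borel_measurable borel" for M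
    by (intro borel_measurable_continuous_onI cutoff_props)
  define T where "T n z = cutoff (real (Suc n)) z *\<^sub>R clip (real (Suc n)) (F z)" for n z
  have [measurable]: "T n \<in> borel_measurable borel" for n
    unfolding T_def by (intro borel_measurable_scaleR km measurable_compose[OF _ cm]) auto
  have Tb: "norm (T n z) \<le> norm (F z)" for n z
  proof -
    have "norm (T n z) = cutoff (real (Suc n)) z * norm (clip (real (Suc n)) (F z))"
      by (simp add: T_def cutoff_props)
    also have "\<dots> \<le> 1 * norm (F z)"
      by (intro mult_mono cutoff_props norm_clip_le(2)) auto
    finally show ?thesis by simp
  qed
  have "(\<lambda>n. nsq (\<lambda>z. F z - T n z)) \<longlonglongrightarrow> 0"
  proof (rule nsq_tendsto_dominated(1))
    show "AE z in lborel. (\<lambda>n. F z - T n z) \<longlonglongrightarrow> 0"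
    proof (rule AE_I2)
      fix z
      obtain N :: nat where N: "norm z \<le> N" "norm (F z) \<le> N"
        by (metis max.bounded_iff real_arch_simple)
      have "\<forall>\<^sub>F n in sequentially. F z - T n z = 0"
        using eventually_ge_at_top[of N]
      proof eventually_elim
        case (elim n)
        then have "norm z \<le> real (Suc n)" "norm (F z) \<le> real (Suc n)" using N by linarith+
        then show ?case unfolding T_def by (subst cutoff_props(3), simp, subst clip_eq) auto
      qed
      then show "(\<lambda>n. F z - T n z) \<longlonglongrightarrow> 0" by (rule tendsto_eventually)
    qed
    show "AE z in lborel. norm (F z - T n z) \<le> 2 * norm (F z)" for n
      by (intro AE_I2 order_trans[OF norm_triangle_ineq4]) (use Tb[of n] in simp)
    show "integrable lborel (\<lambda>z. (2 * norm (F z))\<^sup>2)" using F by (simp add: sqint_def power_mult_distrib)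
  qed auto
  then have "\<forall>\<^sub>F n in sequentially. nsq (\<lambda>z. F z - T n z) < e / 4" using e by (intro order_tendstoD) auto
  then obtain m where m: "nsq (\<lambda>z. F z - T m z) < e / 4" by (auto simp: eventually_sequentially)
  define M where "M = real (Suc m)"
  have "F \<in> borel_measurable lebesgue" using sqint_meas[OF F] by (simp add: measurable_completion)
  then have "F measurable_on UNIV" by (rule lebesgue_measurable_imp_measurable_on) simp
  then obtain N g where N: "negligible N" and g: "\<And>n. continuous_on UNIV (g n)"
    "\<And>z. z \<notin> N \<Longrightarrow> (\<lambda>n. g n z) \<longlonglongrightarrow> F z" by (auto simp: measurable_on_def)
  define G where "G n z = cutoff M z *\<^sub>R clip M (g n z)" for n z
  have M: "M > 0" by (simp add: M_def)
  have cl: "continuous_on UNIV (\<lambda>z. clip M (g n z))" for n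
    by (rule continuous_on_compose2[OF continuous_clip[OF M] g(1)]) auto
  have Gc: "continuous_on UNIV (G n)" for n
    unfolding G_def by (intro continuous_intros cutoff_props cl)
  have [measurable]: "G n \<in> borel_measurable borel" for n by (intro borel_measurable_continuous_onI Gc)
  have G0: "G n z = 0" if "z \<notin> cball 0 (M + 1)" for n z using that by (simp add: G_def cutoff_props(4))
  have "(\<lambda>n. nsq (\<lambda>z. T m z - G n z)) \<longlonglongrightarrow> 0"
  proof (rule nsq_tendsto_dominated(1))
    have "AE z in lebesgue. z \<notin> N" using N by (intro AE_not_in) (simp add: negligible_iff_null_sets)
    then have "AE z in lborel. z \<notin> N" by (simp add: AE_completion_iff)
    then show "AE z in lborel. (\<lambda>n. T m z - G n z) \<longlonglongrightarrow> 0"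
    proof eventually_elim
      case (elim z)
      have "(\<lambda>n. clip M (g n z)) \<longlonglongrightarrow> clip M (F z)"
        using g(2)[OF elim] continuous_clip[OF M] by (intro continuous_on_tendsto_compose[of UNIV "clip M"]) auto
      then have "(\<lambda>n. T m z - G n z) \<longlonglongrightarrow> T m z - cutoff M z *\<^sub>R clip M (F z)"
        unfolding G_def by (intro tendsto_intros)
      then show ?case by (simp add: T_def M_def)
    qed
    show "AE z in lborel. norm (T m z - G n z) \<le> 2 * M * indicator (cball 0 (M + 1)) z" for n
    proof (rule AE_I2)
      fix z
      show "norm (T m z - G n z) \<le> 2 * M * indicator (cball 0 (M + 1)) z"
      proof (cases "z \<in> cball 0 (M + 1)")
        case True
        have "T m z - G n z = cutoff M z *\<^sub>R (clip M (F z) - clip M (g n z))"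
          by (simp add: T_def G_def M_def scaleR_diff_right)
        then have "norm (T m z - G n z) = cutoff M z * norm (clip M (F z) - clip M (g n z))"
          by (simp add: cutoff_props)
        also have "\<dots> \<le> 1 * (M + M)"
          using norm_clip_le(1)[OF M, of "F z"] norm_clip_le(1)[OF M, of "g n z"]
          by (intro mult_mono cutoff_props order_trans[OF norm_triangle_ineq4] add_mono) auto
        finally show ?thesis using True by simp
      next
        case False
        then show ?thesis using G0[OF False] by (simp add: T_def M_def cutoff_props(4))
      qed
    qed
    show "integrable lborel (\<lambda>z::complex. (2 * M * indicator (cball 0 (M + 1)) z)\<^sup>2)"
    proof -
      show ?thesis
        by (rule Bochner_Integration.integrable_cong[THEN iffD2, OF refl _ integrable_indicator_cball[of "(2 * M)\<^sup>2" "M + 1"]])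
           (auto simp: indicator_def)
    qed
    show "(\<lambda>z::complex. 2 * M * indicator (cball 0 (M + 1)) z) \<in> borel_measurable borel"
      by (intro borel_measurable_times borel_measurable_const borel_measurable_indicator) auto
  qed auto
  then have "\<forall>\<^sub>F n in sequentially. nsq (\<lambda>z. T m z - G n z) < e / 4" using e by (intro order_tendstoD) auto
  then obtain n where n: "nsq (\<lambda>z. T m z - G n z) < e / 4" by (auto simp: eventually_sequentially)
  have Ts: "sqint (T m)" by (rule sqint_bound(1)[OF F _, of _ 1]) (use Tb in auto)
  have Gs: "sqint (G n)" by (rule sqint_continuous[OF Gc compact_cball G0])
  have "nsq (\<lambda>z. (F z - T m z) + (T m z - G n z)) \<le> 2 * nsq (\<lambda>z. F z - T m z) + 2 * nsq (\<lambda>z. T m z - G n z)"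
    by (intro sqint_add sqint_diff F Ts Gs)
  then have "nsq (\<lambda>z. F z - G n z) < e" using m n by simp
  then show ?thesis using that[of "G n" "M + 1"] Gc G0 by blast
qed

definition conv :: "(complex \<Rightarrow> real) \<Rightarrow> (complex \<Rightarrow> 'b::euclidean_space) \<Rightarrow> complex \<Rightarrow> 'b" where
  "conv \<rho> F z = (\<integral>y. \<rho> (z - y) *\<^sub>R F y \<partial>lborel)"

lemma conv_integrable:
  fixes F :: "complex \<Rightarrow> 'b::euclidean_space"
  assumes "continuous_on UNIV \<rho>" "compact K" "\<And>z. z \<notin> K \<Longrightarrow> \<rho> z = 0" "integrable lborel F"
  shows "integrable lborel (\<lambda>y. \<rho> (z - y) *\<^sub>R F y)"
proof -
  obtain B where B: "B > 0" "\<And>z. norm (\<rho> z) \<le> B" using bounded_compact_support[OF assms(1-3)] by blast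
  have [measurable]: "\<rho> \<in> borel_measurable borel" "F \<in> borel_measurable borel"
    using assms by (auto intro: borel_measurable_continuous_onI)
  have "integrable lborel (\<lambda>y. B *\<^sub>R norm (F y))" using assms(4) by simp
  then show ?thesis
    by (rule Bochner_Integration.integrable_bound) (use B in \<open>auto intro!: mult_right_mono\<close>)
qed

lemma conv_continuous:
  fixes F :: "complex \<Rightarrow> 'b::euclidean_space"
  assumes \<rho>: "continuous_on UNIV \<rho>" "compact K" "\<And>z. z \<notin> K \<Longrightarrow> \<rho> z = 0" and F: "integrable lborel F"
  shows "continuous_on UNIV (conv \<rho> F)"
  unfolding continuous_on_iff
proof (intro ballI allI impI)
  fix z :: complex and e :: real assume e: "e > 0"
  define I where "I = (\<integral>y. norm (F y) \<partial>lborel)"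
  have I: "I \<ge> 0" by (simp add: I_def)
  obtain d where d: "d > 0" "\<And>x y. norm (x - y) < d \<Longrightarrow> norm (\<rho> x - \<rho> y) < e / (I + 1)"
    using uniform_compact_support[OF \<rho>, of "e / (I + 1)"] e I by auto
  show "\<exists>d>0. \<forall>z'\<in>UNIV. dist z' z < d \<longrightarrow> dist (conv \<rho> F z') (conv \<rho> F z) < e"
  proof (intro exI[of _ d] conjI d ballI impI)
    fix z' assume z': "dist z' z < d"
    have "conv \<rho> F z' - conv \<rho> F z = (\<integral>y. (\<rho> (z' - y) - \<rho> (z - y)) *\<^sub>R F y \<partial>lborel)"
      unfolding conv_def using conv_integrable[OF \<rho> F] by (simp add: scaleR_diff_left)
    also have "norm \<dots> \<le> (\<integral>y. e / (I + 1) * norm (F y) \<partial>lborel)"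
    proof (rule order_trans[OF integral_norm_bound integral_mono])
      show "integrable lborel (\<lambda>y. norm ((\<rho> (z' - y) - \<rho> (z - y)) *\<^sub>R F y))"
        unfolding scaleR_diff_left by (intro integrable_norm Bochner_Integration.integrable_diff conv_integrable[OF \<rho> F])
      show "norm ((\<rho> (z' - y) - \<rho> (z - y)) *\<^sub>R F y) \<le> e / (I + 1) * norm (F y)" for y
        unfolding norm_scaleR
        using d(2)[of "z' - y" "z - y"] z' by (intro mult_right_mono) (auto simp: dist_norm)
    qed (use F in simp)
    also have "\<dots> = e * (I / (I + 1))" by (simp add: I_def)
    also have "\<dots> < e * 1" using e I by (intro mult_strict_left_mono) auto
    finally show "dist (conv \<rho> F z') (conv \<rho> F z) < e" by (simp add: dist_norm)
  qed
qed

lemma C1c_linearization: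
  fixes \<rho> :: "complex \<Rightarrow> real"
  assumes \<rho>: "C1c K \<rho> \<rho>x \<rho>y" and e: "e > 0"
  obtains d where "d > 0" "\<And>a b. norm (b - a) < d \<Longrightarrow>
    norm (\<rho> b - \<rho> a - (Re (b - a) *\<^sub>R \<rho>x a + Im (b - a) *\<^sub>R \<rho>y a)) \<le> norm (b - a) * e"
proof -
  have K: "compact K" "\<And>z. z \<notin> K \<Longrightarrow> \<rho>x z = 0" "\<And>z. z \<notin> K \<Longrightarrow> \<rho>y z = 0" using \<rho> by (auto simp: C1c_def)
  obtain d1 where d1: "d1 > 0" "\<And>x y. norm (x - y) < d1 \<Longrightarrow> norm (\<rho>x x - \<rho>x y) < e / 2"
    using uniform_compact_support[OF C1c_continuous(2)[OF \<rho>] K(1,2), of "e / 2"] e by auto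
  obtain d2 where d2: "d2 > 0" "\<And>x y. norm (x - y) < d2 \<Longrightarrow> norm (\<rho>y x - \<rho>y y) < e / 2"
    using uniform_compact_support[OF C1c_continuous(3)[OF \<rho>] K(1,3), of "e / 2"] e by auto
  show ?thesis
  proof (rule that[of "min d1 d2"])
    fix a b :: complex assume ab: "norm (b - a) < min d1 d2"
    define L where "L x = (\<lambda>h. Re h *\<^sub>R \<rho>x x + Im h *\<^sub>R \<rho>y x)" for x
    have "norm (\<rho> b - \<rho> a - L a (b - a)) \<le> norm (b - a) * e"
    proof (rule differentiable_bound_linearization[where S = "ball a (min d1 d2)"])
      fix t :: real assume "t \<in> {0..1}"
      then have "t * norm (b - a) \<le> norm (b - a)" by (intro mult_left_le_one_le) auto
      then show "a + t *\<^sub>R (b - a) \<in> ball a (min d1 d2)" using ab \<open>t \<in> {0..1}\<close> by (simp add: dist_norm)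
    next
      fix x assume x: "x \<in> ball a (min d1 d2)"
      show "(\<rho> has_derivative L x) (at x within ball a (min d1 d2))"
        unfolding L_def
        by (rule has_derivative_at_withinI, rule C1onD[of UNIV]) (use \<rho> in \<open>simp_all add: C1c_def\<close>)
      show "onorm (L x - L a) \<le> e"
      proof (rule onorm_bound)
        fix h :: complex
        have "norm ((L x - L a) h) = \<bar>Re h * (\<rho>x x - \<rho>x a) + Im h * (\<rho>y x - \<rho>y a)\<bar>"
          by (simp add: L_def algebra_simps)
        also have "\<dots> \<le> \<bar>Re h\<bar> * \<bar>\<rho>x x - \<rho>x a\<bar> + \<bar>Im h\<bar> * \<bar>\<rho>y x - \<rho>y a\<bar>"
          by (metis abs_mult abs_triangle_ineq)
        also have "\<dots> \<le> norm h * (e / 2) + norm h * (e / 2)"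
          using d1(2)[of x a] d2(2)[of x a] x
          by (intro add_mono mult_mono abs_Re_le_cmod abs_Im_le_cmod) (auto simp: dist_norm norm_minus_commute)
        finally show "norm ((L x - L a) h) \<le> e * norm h" by (simp add: field_simps)
      qed (use e in simp)
    qed (use d1 d2 in auto)
    then show "norm (\<rho> b - \<rho> a - (Re (b - a) *\<^sub>R \<rho>x a + Im (b - a) *\<^sub>R \<rho>y a)) \<le> norm (b - a) * e"
      by (simp add: L_def)
  qed (use d1 d2 in auto)
qed

text \<open>Differentiation under the integral; the difference quotients of \<open>\<rho>\<close> converge uniformly by \<open>C1c_linearization\<close>.\<close>

lemma conv_C1on:
  fixes F :: "complex \<Rightarrow> 'b::euclidean_space"
  assumes \<rho>: "C1c K \<rho> \<rho>x \<rho>y" and F: "integrable lborel F"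
  shows "C1on UNIV (conv \<rho> F) (conv \<rho>x F) (conv \<rho>y F)"
  unfolding C1on_def
proof (intro conjI ballI)
  have K: "compact K" "\<And>z. z \<notin> K \<Longrightarrow> \<rho> z = 0" "\<And>z. z \<notin> K \<Longrightarrow> \<rho>x z = 0" "\<And>z. z \<notin> K \<Longrightarrow> \<rho>y z = 0"
    using \<rho> by (auto simp: C1c_def)
  note cc = C1c_continuous[OF \<rho>, of UNIV]
  show "continuous_on UNIV (conv \<rho>x F)" "continuous_on UNIV (conv \<rho>y F)"
    by (rule conv_continuous[OF cc(2) K(1) K(3) F], assumption)
       (rule conv_continuous[OF cc(3) K(1) K(4) F], assumption)
  note i = conv_integrable[OF cc(1) K(1) K(2) F] conv_integrable[OF cc(2) K(1) K(3) F] conv_integrable[OF cc(3) K(1) K(4) F]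
  fix z :: complex
  define I where "I = (\<integral>y. norm (F y) \<partial>lborel)"
  have I: "I \<ge> 0" by (simp add: I_def)
  show "(conv \<rho> F has_derivative (\<lambda>h. Re h *\<^sub>R conv \<rho>x F z + Im h *\<^sub>R conv \<rho>y F z)) (at z)"
    unfolding has_derivative_at_alt
  proof (intro conjI allI impI)
    show "bounded_linear (\<lambda>h. Re h *\<^sub>R conv \<rho>x F z + Im h *\<^sub>R conv \<rho>y F z)"
      by (intro bounded_linear_add bounded_linear_scaleR_const[OF bounded_linear_Re] bounded_linear_scaleR_const[OF bounded_linear_Im]
          bounded_linear_compose[OF bounded_linear_scaleR_left bounded_linear_Re] bounded_linear_compose[OF bounded_linear_scaleR_left bounded_linear_Im])
    fix e :: real assume e: "e > 0"
    obtain d where d: "d > 0" "\<And>a b. norm (b - a) < d \<Longrightarrow>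
      norm (\<rho> b - \<rho> a - (Re (b - a) *\<^sub>R \<rho>x a + Im (b - a) *\<^sub>R \<rho>y a)) \<le> norm (b - a) * (e / (I + 1))"
    proof -
      have "e / (I + 1) > 0" using e I by simp
      from C1c_linearization[OF \<rho> this] that show ?thesis by blast
    qed
    show "\<exists>d>0. \<forall>y. norm (y - z) < d \<longrightarrow> norm (conv \<rho> F y - conv \<rho> F z - (Re (y - z) *\<^sub>R conv \<rho>x F z + Im (y - z) *\<^sub>R conv \<rho>y F z)) \<le> e * norm (y - z)"
    proof (intro exI[of _ d] conjI d allI impI)
      fix y assume y: "norm (y - z) < d"
      let ?r = "\<lambda>w. \<rho> (y - w) - \<rho> (z - w) - (Re (y - z) *\<^sub>R \<rho>x (z - w) + Im (y - z) *\<^sub>R \<rho>y (z - w))"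
      have eq: "(\<lambda>w. ?r w *\<^sub>R F w) = (\<lambda>w. \<rho> (y - w) *\<^sub>R F w - \<rho> (z - w) *\<^sub>R F w - (Re (y - z) *\<^sub>R (\<rho>x (z - w) *\<^sub>R F w) + Im (y - z) *\<^sub>R (\<rho>y (z - w) *\<^sub>R F w)))"
        by (simp add: scaleR_diff_left scaleR_add_left)
      have ir: "integrable lborel (\<lambda>w. ?r w *\<^sub>R F w)"
        unfolding eq by (intro Bochner_Integration.integrable_diff Bochner_Integration.integrable_add integrable_scaleR_right i)
      have "has_bochner_integral lborel (\<lambda>w. ?r w *\<^sub>R F w) (conv \<rho> F y - conv \<rho> F z - (Re (y - z) *\<^sub>R conv \<rho>x F z + Im (y - z) *\<^sub>R conv \<rho>y F z))"
        unfolding conv_def eq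
        by (intro has_bochner_integral_diff has_bochner_integral_add has_bochner_integral_scaleR_right has_bochner_integral_integrable i)
      then have "conv \<rho> F y - conv \<rho> F z - (Re (y - z) *\<^sub>R conv \<rho>x F z + Im (y - z) *\<^sub>R conv \<rho>y F z) = (\<integral>w. ?r w *\<^sub>R F w \<partial>lborel)"
        by (rule has_bochner_integral_integral_eq[symmetric])
      also have "norm \<dots> \<le> (\<integral>w. norm (y - z) * (e / (I + 1)) * norm (F w) \<partial>lborel)"
      proof (rule order_trans[OF integral_norm_bound integral_mono])
        show "norm (?r w *\<^sub>R F w) \<le> norm (y - z) * (e / (I + 1)) * norm (F w)" for w
          unfolding norm_scaleR using d(2)[of "y - w" "z - w"] y by (intro mult_right_mono) auto
        show "integrable lborel (\<lambda>w. norm (?r w *\<^sub>R F w))" by (rule integrable_norm[OF ir])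
      qed (use F in auto)
      also have "\<dots> = norm (y - z) * e * (I / (I + 1))" by (simp add: I_def)
      also have "\<dots> \<le> norm (y - z) * e * 1" using e I by (intro mult_left_mono) auto
      finally show "norm (conv \<rho> F y - conv \<rho> F z - (Re (y - z) *\<^sub>R conv \<rho>x F z + Im (y - z) *\<^sub>R conv \<rho>y F z)) \<le> e * norm (y - z)"
        by (simp add: mult.commute)
    qed
  qed
qed

lemma C1c_of_Ck:
  assumes "\<And>k. Ck k f" "compact K" "\<And>z. z \<notin> K \<Longrightarrow> f z = 0"
  shows "C1c K f (pderiv_dir 1 f) (pderiv_dir \<i> f)"
proof -
  have C: "C1on UNIV f (pderiv_dir 1 f) (pderiv_dir \<i> f)" using Ck_SucD(1)[OF assms(1)[of "Suc 0"]] .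
  have "pderiv_dir e f z = 0" if "z \<notin> K" for z e
  proof -
    have "((\<lambda>z. 0 :: real) has_derivative (\<lambda>h. 0)) (at z)" by simp
    then have "(f has_derivative (\<lambda>h. 0)) (at z)"
      by (rule has_derivative_transform_within_open[of _ _ _ _ "- K"])
         (use assms that in \<open>auto simp: compact_imp_closed open_Compl\<close>)
    then show ?thesis by (simp add: pderiv_dirI)
  qed
  then show ?thesis using C assms by (simp add: C1c_def)
qed

lemma Ck_conv:
  fixes F :: "complex \<Rightarrow> real"
  assumes "\<And>k. Ck k \<rho>" "compact K" "\<And>z. z \<notin> K \<Longrightarrow> \<rho> z = 0" "integrable lborel F"
  shows "Ck k (conv \<rho> F)"
  using assms
proof (induction k arbitrary: \<rho>)
  case 0
  then show ?case using conv_continuous[OF Ck_imp_continuous[OF 0(1)] 0(2,3,4)] by simp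
next
  case (Suc k)
  note C = C1c_of_Ck[OF Suc.prems(1-3)]
  have "Ck j (pderiv_dir 1 \<rho>)" "Ck j (pderiv_dir \<i> \<rho>)" for j
    using Ck_SucD[OF Suc.prems(1)[of "Suc j"]] by auto
  then have "Ck k (conv (pderiv_dir 1 \<rho>) F)" "Ck k (conv (pderiv_dir \<i> \<rho>) F)"
    using C Suc.prems by (auto intro!: Suc.IH simp: C1c_def)
  then show ?case by (intro Ck_SucI[OF conv_C1on[OF C Suc.prems(4)]])
qed

definition moll :: "real \<Rightarrow> complex \<Rightarrow> real" where
  "moll \<eta> z = exp_flat 0 (bump_arg (0 + (1 / \<eta>) *\<^sub>R z)) * (1 / (\<integral>z. exp_flat 0 (bump_arg (0 + (1 / \<eta>) *\<^sub>R z)) \<partial>lborel))"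

lemma moll_zero: "\<eta> > 0 \<Longrightarrow> z \<notin> cball 0 \<eta> \<Longrightarrow> moll \<eta> z = 0"
proof -
  assume "\<eta> > 0" "z \<notin> cball 0 \<eta>"
  then have "norm ((1 / \<eta>) *\<^sub>R z) \<ge> 1" by (simp add: field_simps)
  then have "bump_arg ((1 / \<eta>) *\<^sub>R z) \<le> 0" by (simp add: bump_arg_norm power_mult_distrib del: norm_scaleR)
  then show ?thesis by (simp add: moll_def exp_flat_def)
qed

lemma moll_Ck: "Ck k (moll \<eta>)"
  unfolding moll_def by (intro Ck_mult Ck_const Ck_affine[of k "\<lambda>z. exp_flat 0 (bump_arg z)"] Ck_exp_flat_bump)

lemma moll_nonneg: "moll \<eta> z \<ge> 0"
  unfolding moll_def by (intro mult_nonneg_nonneg exp_flat_nonneg) (auto intro!: integral_nonneg_AE exp_flat_nonneg)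

lemma moll_integral:
  assumes "\<eta> > 0"
  shows "(\<integral>z. moll \<eta> z \<partial>lborel) = 1" "integrable lborel (moll \<eta>)"
proof -
  let ?f = "\<lambda>z. exp_flat 0 (bump_arg (0 + (1 / \<eta>) *\<^sub>R z))"
  have c: "continuous_on UNIV ?f"
    by (rule Ck_imp_continuous[of 0]) (intro Ck_affine[of 0 "\<lambda>z. exp_flat 0 (bump_arg z)"] Ck_exp_flat_bump)
  have z: "?f z = 0" if "z \<notin> cball 0 \<eta>" for z
  proof -
    have "norm ((1 / \<eta>) *\<^sub>R z) \<ge> 1" using that assms by (simp add: field_simps)
    then have "bump_arg ((1 / \<eta>) *\<^sub>R z) \<le> 0" by (simp add: bump_arg_norm power_mult_distrib del: norm_scaleR)
    then show ?thesis by (simp add: exp_flat_def)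
  qed
  have i: "integrable lborel ?f" by (rule integrable_compact_support[OF c compact_cball z])
  have "(\<integral>z. ?f z \<partial>lborel) \<noteq> 0"
  proof
    assume "(\<integral>z. ?f z \<partial>lborel) = 0"
    then have "AE z in lborel. ?f z = 0"
      using integral_nonneg_eq_0_iff_AE[OF i] exp_flat_nonneg by auto
    then have "AE z in lebesgue. z \<in> ?f -` {0}" by (auto simp: AE_completion_iff)
    moreover have "closed (?f -` {0})" using continuous_closed_vimage[of "{0}" ?f] c
      by (simp add: continuous_on_eq_continuous_at)
    ultimately have "0 \<in> ?f -` {0}" by (rule mem_closed_if_AE_lebesgue[rotated])
    then show False by (simp add: exp_flat_def bump_arg_def)
  qed
  then show "(\<integral>z. moll \<eta> z \<partial>lborel) = 1" unfolding moll_def using i by simp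
  show "integrable lborel (moll \<eta>)" unfolding moll_def using i by simp
qed

lemma moll_C1c:
  assumes "\<eta> > 0"
  shows "C1c (cball 0 \<eta>) (moll \<eta>) (pderiv_dir 1 (moll \<eta>)) (pderiv_dir \<i> (moll \<eta>))"
  by (rule C1c_of_Ck[OF moll_Ck compact_cball moll_zero[OF assms]])

lemma moll_continuous: "continuous_on A (moll \<eta>)"
  by (rule continuous_on_subset[OF Ck_imp_continuous[OF moll_Ck]]) auto

lemma moll_measurable[measurable]: "moll \<eta> \<in> borel_measurable borel"
  by (intro borel_measurable_continuous_onI moll_continuous)

lemma lborel_reflect:
  fixes f :: "complex \<Rightarrow> 'b::{banach, second_countable_topology}"
  assumes [measurable]: "f \<in> borel_measurable borel"
  shows "(\<integral>y. f (z - y) \<partial>lborel) = (\<integral>y. f y \<partial>lborel)" "integrable lborel (\<lambda>y. f (z - y)) \<longleftrightarrow> integrable lborel f"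
proof -
  have "(\<integral>y. f (z - y) \<partial>lborel) = (\<integral>y. f (z + y) \<partial>lborel)"
    by (subst (1) lborel_uminus_complex[symmetric], subst integral_distr) auto
  then show "(\<integral>y. f (z - y) \<partial>lborel) = (\<integral>y. f y \<partial>lborel)"
    using lborel_shift(1)[of f z] by (simp add: add.commute)
  have "integrable lborel (\<lambda>y. f (z - y)) \<longleftrightarrow> integrable lborel (\<lambda>y. f (z + y))"
    by (subst (1) lborel_uminus_complex[symmetric], subst integrable_distr_eq) auto
  then show "integrable lborel (\<lambda>y. f (z - y)) \<longleftrightarrow> integrable lborel f"
    using lborel_shift(2)[of f z] by (simp add: add.commute)
qed

lemma moll_shift_integral:
  assumes "\<eta> > 0"
  shows "(\<integral>y. moll \<eta> (z - y) \<partial>lborel) = 1" "integrable lborel (\<lambda>y. moll \<eta> (z - y))"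
  using lborel_reflect[OF moll_measurable, of \<eta> z] moll_integral[OF assms] by auto

lemma moll_conv_integrable:
  fixes F :: "complex \<Rightarrow> 'b::euclidean_space"
  assumes "\<eta> > 0" "integrable lborel F"
  shows "integrable lborel (\<lambda>y. moll \<eta> (z - y) *\<^sub>R F y)"
  by (rule conv_integrable[OF moll_continuous compact_cball moll_zero[OF assms(1)] assms(2)])

lemma conv_moll_continuous:
  fixes F :: "complex \<Rightarrow> 'b::euclidean_space"
  assumes "\<eta> > 0" "integrable lborel F"
  shows "continuous_on UNIV (conv (moll \<eta>) F)"
  by (rule conv_continuous[OF moll_continuous compact_cball moll_zero[OF assms(1)] assms(2)])

lemma conv_moll_diff:
  fixes F :: "complex \<Rightarrow> 'b::euclidean_space"
  assumes "\<eta> > 0" "integrable lborel F" "integrable lborel G"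
  shows "conv (moll \<eta>) (\<lambda>z. F z - G z) z = conv (moll \<eta>) F z - conv (moll \<eta>) G z"
  unfolding conv_def scaleR_diff_right
  by (rule Bochner_Integration.integral_diff; rule moll_conv_integrable[OF assms(1)]; fact)

text \<open>Young's inequality for convolution with a probability density: by Jensen the squared norm of the
  average is at most the average of the squared norm.\<close>

lemma conv_moll_nsq_le:
  fixes F :: "complex \<Rightarrow> 'b::euclidean_space"
  assumes \<eta>: "\<eta> > 0" and F: "sqint F" and iF: "integrable lborel F"
  shows "sqint (conv (moll \<eta>) F)" "nsq (conv (moll \<eta>) F) \<le> nsq F"
proof -
  note [measurable] = sqint_meas[OF F]
  have [measurable]: "conv (moll \<eta>) F \<in> borel_measurable borel"
    by (intro borel_measurable_continuous_onI conv_moll_continuous \<eta> iF)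
  have i2: "integrable lborel (\<lambda>y. (norm (F y))\<^sup>2)" using F by (simp add: sqint_def)
  have i3: "integrable lborel (\<lambda>y. moll \<eta> (z - y) *\<^sub>R (norm (F y))\<^sup>2)" for z
    by (rule moll_conv_integrable[OF \<eta> i2])
  have i4: "integrable lborel (\<lambda>y. moll \<eta> (z - y) *\<^sub>R norm (F y))" for z
    by (rule moll_conv_integrable[OF \<eta> integrable_norm[OF iF]])
  have jensen: "(norm (conv (moll \<eta>) F z))\<^sup>2 \<le> (\<integral>y. moll \<eta> (z - y) * (norm (F y))\<^sup>2 \<partial>lborel)" for z
  proof -
    define m where "m = norm (conv (moll \<eta>) F z)"
    have m: "m \<le> (\<integral>y. moll \<eta> (z - y) * norm (F y) \<partial>lborel)"
      unfolding m_def conv_def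
      by (rule order_trans[OF integral_norm_bound]) (simp add: moll_nonneg)
    have "0 \<le> (\<integral>y. moll \<eta> (z - y) * (norm (F y) - m)\<^sup>2 \<partial>lborel)"
      by (intro integral_nonneg_AE) (auto simp: moll_nonneg)
    also have "\<dots> = (\<integral>y. moll \<eta> (z - y) * (norm (F y))\<^sup>2 - 2 * m * (moll \<eta> (z - y) * norm (F y)) + m\<^sup>2 * moll \<eta> (z - y) \<partial>lborel)"
      by (rule Bochner_Integration.integral_cong) (auto simp: power2_eq_square algebra_simps)
    also have "\<dots> = (\<integral>y. moll \<eta> (z - y) * (norm (F y))\<^sup>2 \<partial>lborel) - 2 * m * (\<integral>y. moll \<eta> (z - y) * norm (F y) \<partial>lborel) + m\<^sup>2"
      using i3[of z] i4[of z] moll_shift_integral[OF \<eta>, of z] by simp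
    finally have "2 * m * (\<integral>y. moll \<eta> (z - y) * norm (F y) \<partial>lborel) - m\<^sup>2 \<le> (\<integral>y. moll \<eta> (z - y) * (norm (F y))\<^sup>2 \<partial>lborel)"
      by simp
    moreover have "2 * m * m \<le> 2 * m * (\<integral>y. moll \<eta> (z - y) * norm (F y) \<partial>lborel)"
      by (rule mult_left_mono[OF m]) (simp add: m_def)
    ultimately show ?thesis by (simp add: m_def power2_eq_square)
  qed
  have "(\<integral>\<^sup>+z. ennreal ((norm (conv (moll \<eta>) F z))\<^sup>2) \<partial>lborel) \<le> (\<integral>\<^sup>+z. \<integral>\<^sup>+y. ennreal (moll \<eta> (z - y) * (norm (F y))\<^sup>2) \<partial>lborel \<partial>lborel)"
  proof (rule nn_integral_mono)
    fix z
    have "ennreal ((norm (conv (moll \<eta>) F z))\<^sup>2) \<le> ennreal (\<integral>y. moll \<eta> (z - y) * (norm (F y))\<^sup>2 \<partial>lborel)"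
      by (rule ennreal_leI[OF jensen])
    also have "\<dots> = (\<integral>\<^sup>+y. ennreal (moll \<eta> (z - y) * (norm (F y))\<^sup>2) \<partial>lborel)"
      using i3[of z] by (intro nn_integral_eq_integral[symmetric]) (auto simp: moll_nonneg)
    finally show "ennreal ((norm (conv (moll \<eta>) F z))\<^sup>2) \<le> (\<integral>\<^sup>+y. ennreal (moll \<eta> (z - y) * (norm (F y))\<^sup>2) \<partial>lborel)" .
  qed
  also have "\<dots> = (\<integral>\<^sup>+y. \<integral>\<^sup>+z. ennreal (moll \<eta> (z - y) * (norm (F y))\<^sup>2) \<partial>lborel \<partial>lborel)"
    by (rule lborel_pair.Fubini') measurable
  also have "\<dots> = (\<integral>\<^sup>+y. ennreal ((norm (F y))\<^sup>2) \<partial>lborel)"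
  proof (rule nn_integral_cong)
    fix y
    have "(\<integral>z. moll \<eta> (z - y) * (norm (F y))\<^sup>2 \<partial>lborel) = (norm (F y))\<^sup>2"
      using lborel_shift(1)[of "moll \<eta>" "- y"] moll_integral[OF \<eta>] by simp
    moreover have "integrable lborel (\<lambda>z. moll \<eta> (z - y) * (norm (F y))\<^sup>2)"
      using lborel_shift(2)[of "moll \<eta>" "- y"] moll_integral[OF \<eta>] by simp
    ultimately show "(\<integral>\<^sup>+z. ennreal (moll \<eta> (z - y) * (norm (F y))\<^sup>2) \<partial>lborel) = ennreal ((norm (F y))\<^sup>2)"
      by (subst nn_integral_eq_integral) (auto simp: moll_nonneg)
  qed
  also have "\<dots> = ennreal (nsq F)" unfolding nsq_def by (rule nn_integral_eq_integral[OF i2]) auto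
  finally have le: "(\<integral>\<^sup>+z. ennreal ((norm (conv (moll \<eta>) F z))\<^sup>2) \<partial>lborel) \<le> ennreal (nsq F)" .
  have i5: "integrable lborel (\<lambda>z. (norm (conv (moll \<eta>) F z))\<^sup>2)"
    by (rule integrableI_bounded) (use le in \<open>auto simp: le_less_trans\<close>)
  then show "sqint (conv (moll \<eta>) F)" by (simp add: sqint_def)
  have "ennreal (nsq (conv (moll \<eta>) F)) \<le> ennreal (nsq F)"
    unfolding nsq_def[of "conv _ _"] using le by (subst nn_integral_eq_integral[OF i5, symmetric]) auto
  then show "nsq (conv (moll \<eta>) F) \<le> nsq F" by (simp add: nsq_nonneg)
qed

lemma conv_moll_continuous_close:
  fixes G :: "complex \<Rightarrow> 'b::euclidean_space"
  assumes G: "continuous_on UNIV G" "\<And>z. z \<notin> cball 0 R \<Longrightarrow> G z = 0" and e: "e > 0"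
  obtains \<eta>0 where "\<eta>0 > 0" "\<And>\<eta>. 0 < \<eta> \<Longrightarrow> \<eta> < \<eta>0 \<Longrightarrow> nsq (\<lambda>z. conv (moll \<eta>) G z - G z) \<le> e"
proof -
  define V where "V = measure lborel (cball (0::complex) (R + 1))"
  have V: "V \<ge> 0" by (simp add: V_def)
  define s where "s = sqrt (e / (V + 1))"
  have s: "s > 0" "s\<^sup>2 = e / (V + 1)" using e V by (auto simp: s_def)
  obtain d where d: "d > 0" "\<And>x y. norm (x - y) < d \<Longrightarrow> norm (G x - G y) < s"
    using uniform_compact_support[OF G(1) compact_cball G(2) s(1)] by blast
  have iG: "integrable lborel G" by (rule integrable_compact_support[OF G(1) compact_cball G(2)])
  show ?thesis
  proof (rule that[of "min d 1"])
    fix \<eta> :: real assume \<eta>: "0 < \<eta>" "\<eta> < min d 1"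
    have bd: "norm (conv (moll \<eta>) G z - G z) \<le> s" for z
    proof -
      have i: "integrable lborel (\<lambda>y. moll \<eta> (z - y) *\<^sub>R (G y - G z))"
        unfolding scaleR_diff_right
        by (intro Bochner_Integration.integrable_diff moll_conv_integrable \<eta> iG integrable_scaleR_left moll_shift_integral)
      have "conv (moll \<eta>) G z - G z = (\<integral>y. moll \<eta> (z - y) *\<^sub>R G y \<partial>lborel) - (\<integral>y. moll \<eta> (z - y) *\<^sub>R G z \<partial>lborel)"
        using moll_shift_integral[OF \<eta>(1), of z] by (simp add: conv_def)
      also have "\<dots> = (\<integral>y. moll \<eta> (z - y) *\<^sub>R (G y - G z) \<partial>lborel)"
        unfolding scaleR_diff_right
        by (intro Bochner_Integration.integral_diff[symmetric] moll_conv_integrable \<eta> iG integrable_scaleR_left moll_shift_integral)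
      also have "norm \<dots> \<le> (\<integral>y. moll \<eta> (z - y) * s \<partial>lborel)"
      proof (rule order_trans[OF integral_norm_bound integral_mono])
        show "integrable lborel (\<lambda>y. norm (moll \<eta> (z - y) *\<^sub>R (G y - G z)))" by (rule integrable_norm[OF i])
        show "integrable lborel (\<lambda>y. moll \<eta> (z - y) * s)" using moll_shift_integral[OF \<eta>(1)] by simp
        show "norm (moll \<eta> (z - y) *\<^sub>R (G y - G z)) \<le> moll \<eta> (z - y) * s" for y
        proof (cases "z - y \<in> cball 0 \<eta>")
          case True
          then have "norm (y - z) < d" using \<eta> by (auto simp: norm_minus_commute)
          then show ?thesis using d(2)[of y z] by (auto simp: moll_nonneg intro!: mult_left_mono)
        next
          case False
          then show ?thesis using moll_zero[OF \<eta>(1) False] by simp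
        qed
      qed
      also have "\<dots> = s" using moll_shift_integral[OF \<eta>(1), of z] by simp
      finally show ?thesis .
    qed
    have z0: "conv (moll \<eta>) G z - G z = 0" if "z \<notin> cball 0 (R + 1)" for z
    proof -
      have "moll \<eta> (z - y) *\<^sub>R G y = 0" for y
      proof (cases "y \<in> cball 0 R")
        case True
        have "norm z \<le> norm (z - y) + norm y" by (metis diff_add_cancel norm_triangle_ineq)
        then have "z - y \<notin> cball 0 \<eta>" using True that \<eta> by auto
        then show ?thesis using moll_zero[OF \<eta>(1)] by simp
      qed (simp add: G(2))
      moreover have "z \<notin> cball 0 R" using that by auto
      moreover from calculation(1) have "(\<lambda>y. moll \<eta> (z - y) *\<^sub>R G y) = (\<lambda>y. 0)" by (rule ext)
      ultimately show ?thesis using G(2) unfolding conv_def by (simp only: Bochner_Integration.integral_zero) simp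
    qed
    have c: "continuous_on UNIV (\<lambda>z. conv (moll \<eta>) G z - G z)"
      by (intro continuous_intros conv_moll_continuous \<eta> iG G)
    have "nsq (\<lambda>z. conv (moll \<eta>) G z - G z) \<le> (\<integral>z. s\<^sup>2 * indicator (cball 0 (R + 1)) (z::complex) \<partial>lborel)"
      unfolding nsq_def
    proof (rule integral_mono)
      show "integrable lborel (\<lambda>z. (norm (conv (moll \<eta>) G z - G z))\<^sup>2)"
        using sqint_continuous[OF c compact_cball[of 0 "R + 1"] z0] unfolding sqint_def by blast
      show "integrable lborel (\<lambda>z. s\<^sup>2 * indicator (cball 0 (R + 1)) (z::complex))" by (rule integrable_indicator_cball)
      show "(norm (conv (moll \<eta>) G z - G z))\<^sup>2 \<le> s\<^sup>2 * indicator (cball 0 (R + 1)) z" for z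
        using bd[of z] z0[of z] by (cases "z \<in> cball 0 (R + 1)") (auto intro: power_mono simp del: mem_cball)
    qed
    also have "\<dots> = s\<^sup>2 * V" by (simp add: V_def)
    also have "\<dots> = e * (V / (V + 1))" unfolding s(2) by simp
    also have "\<dots> \<le> e * 1" using e V by (intro mult_left_mono) auto
    finally show "nsq (\<lambda>z. conv (moll \<eta>) G z - G z) \<le> e" by simp
  qed (use d in auto)
qed

text \<open>For continuous functions with compact support the convergence is uniform; the general case follows by
  density, since mollification does not increase the \<open>L\<^sup>2\<close> norm.\<close>

lemma conv_moll_L2:
  fixes F :: "complex \<Rightarrow> 'b::euclidean_space"
  assumes F: "sqint F" and iF: "integrable lborel F" and e: "e > 0"
  obtains \<eta>0 where "\<eta>0 > 0" "\<And>\<eta>. 0 < \<eta> \<Longrightarrow> \<eta> < \<eta>0 \<Longrightarrow> nsq (\<lambda>z. conv (moll \<eta>) F z - F z) < e"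
proof -
  obtain G R where G: "continuous_on UNIV G" "\<And>z. z \<notin> cball 0 R \<Longrightarrow> G z = 0" "nsq (\<lambda>z. F z - G z) < e / 16"
    using sqint_dense[OF F, of "e / 16"] e by auto
  obtain \<eta>0 where \<eta>0: "\<eta>0 > 0" "\<And>\<eta>. 0 < \<eta> \<Longrightarrow> \<eta> < \<eta>0 \<Longrightarrow> nsq (\<lambda>z. conv (moll \<eta>) G z - G z) \<le> e / 16"
    using conv_moll_continuous_close[of G R "e / 16"] G(1,2) e by (metis divide_pos_pos zero_less_numeral)
  have sG: "sqint G" and iG: "integrable lborel G"
    by (rule sqint_continuous[OF G(1) compact_cball G(2)] integrable_compact_support[OF G(1) compact_cball G(2)]; assumption)+
  show ?thesis
  proof (rule that[OF \<eta>0(1)])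
    fix \<eta> assume \<eta>: "0 < \<eta>" "\<eta> < \<eta>0"
    have iD: "integrable lborel (\<lambda>z. F z - G z)" using iF iG by simp
    have sD: "sqint (\<lambda>z. F z - G z)" by (rule sqint_diff(1)[OF F sG])
    note A = conv_moll_nsq_le[OF \<eta>(1) sD iD]
    note cG = conv_moll_nsq_le[OF \<eta>(1) sG iG]
    note B = sqint_diff(1)[OF cG(1) sG]
    note C = sqint_diff(1)[OF sG F]
    note D = sqint_add[OF B C]
    have eq: "conv (moll \<eta>) F z - F z = conv (moll \<eta>) (\<lambda>z. F z - G z) z + ((conv (moll \<eta>) G z - G z) + (G z - F z))" for z
      by (simp add: conv_moll_diff[OF \<eta>(1) iF iG])
    have "nsq (\<lambda>z. conv (moll \<eta>) F z - F z) \<le> 2 * nsq (conv (moll \<eta>) (\<lambda>z. F z - G z)) + 2 * nsq (\<lambda>z. (conv (moll \<eta>) G z - G z) + (G z - F z))"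
      unfolding eq by (rule sqint_add(2)[OF A(1) D(1)])
    also have "\<dots> \<le> 2 * nsq (\<lambda>z. F z - G z) + 2 * (2 * nsq (\<lambda>z. conv (moll \<eta>) G z - G z) + 2 * nsq (\<lambda>z. G z - F z))"
      by (intro add_mono mult_left_mono A(2) D(2)) auto
    also have "\<dots> < e" using G(3) \<eta>0(2)[OF \<eta>] nsq_minus_commute[of F G] e by simp
    finally show "nsq (\<lambda>z. conv (moll \<eta>) F z - F z) < e" .
  qed
qed

text \<open>A fixed null sequence of mollification radii, since the arguments below pass to subsequences.\<close>

definition etas :: "nat \<Rightarrow> real" where "etas n = 1 / real (Suc n)"

lemma etas_pos: "etas n > 0" by (simp add: etas_def)

lemma etas_less: "e > 0 \<Longrightarrow> \<forall>\<^sub>F n in sequentially. etas n < e"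
  unfolding etas_def using LIMSEQ_Suc[OF lim_1_over_n] by (rule order_tendstoD)

lemma conv_moll_L2_seq:
  fixes F :: "complex \<Rightarrow> 'b::euclidean_space"
  assumes F: "sqint F" and iF: "integrable lborel F"
  shows "(\<lambda>n. nsq (\<lambda>z. conv (moll (etas n)) F z - F z)) \<longlonglongrightarrow> 0"
proof (rule order_tendstoI)
  fix e :: real assume "0 < e"
  then obtain \<eta>0 where \<eta>0: "\<eta>0 > 0" "\<And>\<eta>. 0 < \<eta> \<Longrightarrow> \<eta> < \<eta>0 \<Longrightarrow> nsq (\<lambda>z. conv (moll \<eta>) F z - F z) < e"
    using conv_moll_L2[OF F iF] by blast
  show "\<forall>\<^sub>F n in sequentially. nsq (\<lambda>z. conv (moll (etas n)) F z - F z) < e"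
    using etas_less[OF \<eta>0(1)] by eventually_elim (auto intro: \<eta>0 etas_pos)
next
  fix e :: real assume "e < 0"
  then show "\<forall>\<^sub>F n in sequentially. e < nsq (\<lambda>z. conv (moll (etas n)) F z - F z)"
    by (auto intro!: always_eventually less_le_trans[OF _ nsq_nonneg])
qed

text \<open>Pointwise convergence is needed where an \<open>L\<^sup>2\<close> limit is composed with a nonlinear map.\<close>

lemma nsq_AE_subseq:
  fixes f :: "nat \<Rightarrow> complex \<Rightarrow> 'b::euclidean_space"
  assumes f: "\<And>n. sqint (f n)" and lim: "(\<lambda>n. nsq (f n)) \<longlonglongrightarrow> 0"
  obtains r :: "nat \<Rightarrow> nat" where "strict_mono r" "AE z in lborel. (\<lambda>n. f (r n) z) \<longlonglongrightarrow> 0"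
proof -
  have "\<exists>r::nat \<Rightarrow> nat. strict_mono r \<and> (AE z in lborel. (\<lambda>n. (norm (f (r n) z))\<^sup>2) \<longlonglongrightarrow> 0)"
    by (rule tendsto_L1_AE_subseq[of _ "\<lambda>n z. (norm (f n z))\<^sup>2"]) (use f lim in \<open>auto simp: sqint_def nsq_def\<close>)
  then obtain r :: "nat \<Rightarrow> nat" where r: "strict_mono r" "AE z in lborel. (\<lambda>n. (norm (f (r n) z))\<^sup>2) \<longlonglongrightarrow> 0" by blast
  have "AE z in lborel. (\<lambda>n. f (r n) z) \<longlonglongrightarrow> 0"
    using r(2)
  proof eventually_elim
    case (elim z)
    then have "(\<lambda>n. sqrt ((norm (f (r n) z))\<^sup>2)) \<longlonglongrightarrow> sqrt 0" by (intro tendsto_real_sqrt)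
    then show ?case by (simp add: tendsto_norm_zero_iff)
  qed
  then show ?thesis using that r by blast
qed

section \<open>Sobolev functions\<close>

text \<open>An \<open>H\<^sup>1\<close> function on \<open>U\<close> with its two weak derivatives, all Borel and extended by zero, so that
  every integral is over the plane. Testing with \<open>C\<^sup>1\<close> rather than smooth functions loses nothing
  (test functions can be mollified) and allows products with cutoffs and with mollified functions as test functions.\<close>

definition wk :: "complex set \<Rightarrow> (complex \<Rightarrow> complex) \<Rightarrow> (complex \<Rightarrow> complex) \<Rightarrow> (complex \<Rightarrow> complex) \<Rightarrow> bool" where
  "wk U u p q \<longleftrightarrow> sqint u \<and> sqint p \<and> sqint q \<and> (\<forall>z. z \<notin> U \<longrightarrow> u z = 0 \<and> p z = 0 \<and> q z = 0) \<and>
    (\<forall>K \<psi> \<psi>x \<psi>y. C1c K \<psi> \<psi>x \<psi>y \<and> K \<subseteq> U \<longrightarrow>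
       (\<integral>z. \<psi>x z *\<^sub>R u z \<partial>lborel) = - (\<integral>z. \<psi> z *\<^sub>R p z \<partial>lborel) \<and>
       (\<integral>z. \<psi>y z *\<^sub>R u z \<partial>lborel) = - (\<integral>z. \<psi> z *\<^sub>R q z \<partial>lborel))"

lemma C1c_reflect:
  assumes "C1c K \<rho> \<rho>x \<rho>y"
  shows "C1c ((\<lambda>k. z - k) ` K) (\<lambda>y. \<rho> (z - y)) (\<lambda>y. - \<rho>x (z - y)) (\<lambda>y. - \<rho>y (z - y))"
proof -
  have D: "(\<rho> has_derivative (\<lambda>h. Re h *\<^sub>R \<rho>x w + Im h *\<^sub>R \<rho>y w)) (at w)" for w
    using assms by (auto simp: C1c_def intro: C1onD)
  have "((\<lambda>y. \<rho> (z - y)) has_derivative (\<lambda>h. Re h *\<^sub>R (- \<rho>x (z - y)) + Im h *\<^sub>R (- \<rho>y (z - y)))) (at y)" for y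
  proof -
    have "((\<lambda>y. z - y) has_derivative (\<lambda>h. - h)) (at y)" by (auto intro!: derivative_eq_intros)
    from has_derivative_compose[OF this D] show ?thesis by simp
  qed
  moreover have "w \<notin> (\<lambda>k. z - k) ` K \<Longrightarrow> z - w \<notin> K" for w by (metis diff_diff_eq2 diff_add_cancel image_eqI add_diff_cancel_left' diff_diff_add)
  moreover have "compact ((\<lambda>k. z - k) ` K)"
    using assms by (intro compact_continuous_image continuous_intros) (auto simp: C1c_def)
  ultimately show ?thesis
    using assms C1c_continuous[OF assms, of UNIV] unfolding C1c_def C1on_def
    by (auto intro!: continuous_intros continuous_on_compose2[of UNIV \<rho>x] continuous_on_compose2[of UNIV \<rho>y])
qed

lemma conv_deriv_C1c:
  fixes \<psi> :: "complex \<Rightarrow> real"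
  assumes \<rho>: "C1c L \<rho> \<rho>x \<rho>y" and \<psi>: "C1c K \<psi> \<psi>x \<psi>y"
  shows "conv \<rho>x \<psi> z = conv \<rho> \<psi>x z" "conv \<rho>y \<psi> z = conv \<rho> \<psi>y z"
proof -
  have R: "C1on UNIV (\<lambda>y. \<rho> (z - y)) (\<lambda>y. - \<rho>x (z - y)) (\<lambda>y. - \<rho>y (z - y))"
    using C1c_reflect[OF \<rho>, of z] by (simp add: C1c_def)
  show "conv \<rho>x \<psi> z = conv \<rho> \<psi>x z" "conv \<rho>y \<psi> z = conv \<rho> \<psi>y z"
    using C1_by_parts[OF \<psi> R] by (simp_all add: conv_def mult.commute)
qed

text \<open>Near a point whose \<open>\<eta>\<close>-neighbourhood lies in \<open>U\<close> the kernel itself is a test function for the weak derivative.\<close>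

lemma conv_wk:
  assumes \<rho>: "C1c (cball 0 \<eta>) \<rho> \<rho>x \<rho>y" and u: "wk U u p q" and z: "cball z \<eta> \<subseteq> U"
  shows "conv \<rho>x u z = conv \<rho> p z" "conv \<rho>y u z = conv \<rho> q z"
proof -
  note R = C1c_reflect[OF \<rho>, of z]
  have "(\<lambda>k. z - k) ` cball 0 \<eta> \<subseteq> U" using z by (auto simp: dist_norm)
  then have "(\<integral>y. (- \<rho>x (z - y)) *\<^sub>R u y \<partial>lborel) = - (\<integral>y. \<rho> (z - y) *\<^sub>R p y \<partial>lborel)"
    "(\<integral>y. (- \<rho>y (z - y)) *\<^sub>R u y \<partial>lborel) = - (\<integral>y. \<rho> (z - y) *\<^sub>R q y \<partial>lborel)"
    using u R unfolding wk_def by blast+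
  then show "conv \<rho>x u z = conv \<rho> p z" "conv \<rho>y u z = conv \<rho> q z" by (simp_all add: conv_def)
qed

text \<open>A mollified \<open>C\<^sup>1\<close> function is smooth, and its support stays in \<open>A\<close> for small radii.\<close>

lemma test_conv:
  assumes \<psi>: "C1c K \<psi> \<psi>x \<psi>y" and A: "open A" "K \<subseteq> A"
  obtains \<eta>0 where "\<eta>0 > 0" "\<And>\<eta>. 0 < \<eta> \<Longrightarrow> \<eta> < \<eta>0 \<Longrightarrow> conv (moll \<eta>) \<psi> \<in> test_functions A"
proof -
  have K: "compact K" "\<And>z. z \<notin> K \<Longrightarrow> \<psi> z = 0" using \<psi> by (auto simp: C1c_def)
  obtain \<eta>0 where \<eta>0: "\<eta>0 > 0" "(\<Union>x\<in>K. cball x \<eta>0) \<subseteq> A"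
    using compact_subset_open_imp_cball_epsilon_subset[OF K(1) A] by blast
  show ?thesis
  proof (rule that[OF \<eta>0(1)])
    fix \<eta> assume \<eta>: "0 < \<eta>" "\<eta> < \<eta>0"
    define L where "L = {x + y | x y. x \<in> K \<and> y \<in> cball 0 \<eta>}"
    have L: "compact L" unfolding L_def by (intro compact_sums K compact_cball)
    have "L \<subseteq> A"
    proof
      fix w assume "w \<in> L"
      then obtain x y where "w = x + y" "x \<in> K" "norm y \<le> \<eta>" by (auto simp: L_def)
      then have "w \<in> cball x \<eta>0" using \<eta> by (simp add: dist_norm)
      then show "w \<in> A" using \<eta>0(2) \<open>x \<in> K\<close> by blast
    qed
    have sub: "{z. conv (moll \<eta>) \<psi> z \<noteq> 0} \<subseteq> L"
    proof (rule ccontr)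
      assume "\<not> {z. conv (moll \<eta>) \<psi> z \<noteq> 0} \<subseteq> L"
      then obtain z where z: "conv (moll \<eta>) \<psi> z \<noteq> 0" "z \<notin> L" by auto
      have "moll \<eta> (z - y) *\<^sub>R \<psi> y = 0" for y
      proof (cases "y \<in> K")
        case True
        have "z - y \<notin> cball 0 \<eta>"
        proof
          assume "z - y \<in> cball 0 \<eta>"
          then have "y + (z - y) \<in> L" using True unfolding L_def by blast
          then show False using z by simp
        qed
        then show ?thesis using moll_zero[OF \<eta>(1)] by simp
      qed (simp add: K)
      then have "(\<lambda>y. moll \<eta> (z - y) *\<^sub>R \<psi> y) = (\<lambda>y. 0)" by (rule ext)
      then show False using z unfolding conv_def by (simp only: Bochner_Integration.integral_zero)
    qed
    have "closure {z. conv (moll \<eta>) \<psi> z \<noteq> 0} \<subseteq> L"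
      using L sub by (simp add: closure_minimal compact_imp_closed)
    moreover have "Ck k (conv (moll \<eta>) \<psi>)" for k
      by (rule Ck_conv[OF moll_Ck compact_cball moll_zero[OF \<eta>(1)] C1c_integrable(1)[OF \<psi>]])
    ultimately show "conv (moll \<eta>) \<psi> \<in> test_functions A"
      using \<open>L \<subseteq> A\<close> L unfolding test_functions_def
      using bounded_subset[OF compact_imp_bounded[OF L] \<open>{z. conv (moll \<eta>) \<psi> z \<noteq> 0} \<subseteq> L\<close>] by auto
  qed
qed

lemma C1c_test:
  assumes "\<phi> \<in> test_functions U"
  obtains K where "K \<subseteq> U" "C1c K \<phi> (pderiv_dir 1 \<phi>) (pderiv_dir \<i> \<phi>)"
proof -
  let ?K = "closure {z. \<phi> z \<noteq> 0}"
  have "\<And>k. Ck k \<phi>" "compact ?K" "?K \<subseteq> U" using assms by (auto simp: test_functions_def)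
  moreover have "\<phi> z = 0" if "z \<notin> ?K" for z using that closure_subset[of "{z. \<phi> z \<noteq> 0}"] by auto
  ultimately show ?thesis using that[of ?K] C1c_of_Ck[of \<phi> ?K] by blast
qed

text \<open>Functions measurable for the completed measure are replaced by Borel ones, which compose and mollify well.\<close>

lemma L2_borel_rep:
  assumes f: "f \<in> L2 (lebesgue_on A)" and A: "A \<in> sets borel"
  obtains F where "sqint F" "\<And>z. z \<notin> A \<Longrightarrow> F z = 0" "AE z in lebesgue_on A. f z = F z"
proof -
  have Al: "A \<in> sets lebesgue" using A by simp
  define f' where "f' z = (if z \<in> A then f z else 0)" for z
  have m: "f' \<in> borel_measurable lebesgue"
    unfolding f'_def using f Al by (intro borel_measurable_if_I) (auto simp: L2_def)
  have "(\<lambda>z. Re (f' z)) \<in> borel_measurable (completion lborel)" "(\<lambda>z. Im (f' z)) \<in> borel_measurable (completion lborel)"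
    using m by (auto intro: borel_measurable_Re borel_measurable_Im)
  then obtain a b where ab: "a \<in> borel_measurable lborel" "AE z in lborel. Re (f' z) = a z"
    "b \<in> borel_measurable lborel" "AE z in lborel. Im (f' z) = b z"
    using completion_ex_borel_measurable_real by metis
  note [measurable] = A
  have [measurable]: "a \<in> borel_measurable borel" "b \<in> borel_measurable borel" using ab by auto
  define F where "F z = (if z \<in> A then Complex (a z) (b z) else 0)" for z
  have Fm[measurable]: "F \<in> borel_measurable borel" unfolding F_def by measurable
  have ae: "AE z in lborel. f' z = F z"
    using ab(2,4) by eventually_elim (auto simp: f'_def F_def complex_eq_iff)
  have aeA: "AE z in lebesgue_on A. f z = F z"
    using ae Al by (subst AE_restrict_space_iff) (auto simp: AE_completion_iff f'_def elim!: eventually_mono)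
  have "integrable (lebesgue_on A) (\<lambda>z. (cmod (f z))\<^sup>2)" using f by (simp add: L2_def)
  then have "integrable lebesgue (\<lambda>z. if z \<in> A then (cmod (f z))\<^sup>2 else 0)"
    using Lebesgue_Measure.integrable_restrict_UNIV[OF Al, of "\<lambda>z. (cmod (f z))\<^sup>2"] by simp
  then have "integrable lebesgue (\<lambda>z. (cmod (F z))\<^sup>2)"
    by (rule integrable_cong_AE_imp)
       (use ae in \<open>auto simp: AE_completion_iff f'_def measurable_completion elim!: eventually_mono\<close>)
  then have "integrable lborel (\<lambda>z. (cmod (F z))\<^sup>2)" by (simp add: integrable_completion)
  then have "sqint F" by (simp add: sqint_def)
  then show ?thesis using that[of F] aeA by (auto simp: F_def)
qed

lemma lebesgue_on_rep:
  fixes h H :: "complex \<Rightarrow> 'b::euclidean_space"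
  assumes A: "A \<in> sets borel" and H: "H \<in> borel_measurable borel" "\<And>z. z \<notin> A \<Longrightarrow> H z = 0"
    and ae: "AE z in lebesgue_on A. h z = H z"
  shows "h \<in> borel_measurable (lebesgue_on A)"
    "integrable (lebesgue_on A) h \<longleftrightarrow> integrable lborel H"
    "(\<integral>z. h z \<partial>lebesgue_on A) = (\<integral>z. H z \<partial>lborel)"
proof -
  have Al: "A \<in> sets lebesgue" using A by simp
  have ae': "AE z in lebesgue. H z = (if z \<in> A then h z else 0)"
    using ae Al H(2) by (subst (asm) AE_restrict_space_iff) (auto elim!: eventually_mono)
  have Hl: "H \<in> borel_measurable lebesgue" using H(1) by (simp add: measurable_completion)
  have hl: "(\<lambda>z. if z \<in> A then h z else 0) \<in> borel_measurable lebesgue"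
    by (rule borel_measurable_AE[OF Hl ae'])
  then show "h \<in> borel_measurable (lebesgue_on A)" by (rule borel_measurable_if_D)
  have "integrable (lebesgue_on A) h \<longleftrightarrow> integrable lebesgue H"
    unfolding Lebesgue_Measure.integrable_restrict_UNIV[OF Al, symmetric] using ae' by (intro integrable_cong_AE hl Hl) auto
  then show "integrable (lebesgue_on A) h \<longleftrightarrow> integrable lborel H" using H(1) by (simp add: integrable_completion)
  have "(\<integral>z. h z \<partial>lebesgue_on A) = (\<integral>z. H z \<partial>lebesgue)"
    unfolding Lebesgue_Measure.integral_restrict_UNIV[OF Al, symmetric] using ae' by (intro integral_cong_AE hl Hl) auto
  then show "(\<integral>z. h z \<partial>lebesgue_on A) = (\<integral>z. H z \<partial>lborel)" using H(1) by (simp add: integral_completion)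
qed

lemma L2_norm_rep:
  assumes A: "A \<in> sets borel" and H: "sqint H" "\<And>z. z \<notin> A \<Longrightarrow> H z = 0"
    and ae: "AE z in lebesgue_on A. h z = H z"
  shows "h \<in> L2 (lebesgue_on A)" "(L2_norm (lebesgue_on A) h)\<^sup>2 = nsq H"
proof -
  note m = sqint_meas[OF H(1)]
  have ae2: "AE z in lebesgue_on A. (cmod (h z))\<^sup>2 = (cmod (H z))\<^sup>2" using ae by auto
  have m2: "(\<lambda>z. (cmod (H z))\<^sup>2) \<in> borel_measurable borel" using m by measurable
  note R = lebesgue_on_rep[OF A m2 _ ae2]
  show "h \<in> L2 (lebesgue_on A)"
    using lebesgue_on_rep(1)[OF A m H(2) ae] R(2) H by (auto simp: L2_def sqint_def)
  show "(L2_norm (lebesgue_on A) h)\<^sup>2 = nsq H"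
    using R(3) H(2) by (simp add: L2_norm_def nsq_def)
qed

lemma C1c_sqint:
  fixes \<psi> :: "complex \<Rightarrow> 'b::euclidean_space"
  assumes "C1c K \<psi> \<psi>x \<psi>y" shows "sqint \<psi>" "sqint \<psi>x" "sqint \<psi>y"
proof -
  have K: "compact K" "\<And>z. z \<notin> K \<Longrightarrow> \<psi> z = 0" "\<And>z. z \<notin> K \<Longrightarrow> \<psi>x z = 0" "\<And>z. z \<notin> K \<Longrightarrow> \<psi>y z = 0"
    using assms by (auto simp: C1c_def)
  show "sqint \<psi>" by (rule sqint_continuous[OF C1c_continuous(1)[OF assms] K(1) K(2)])
  show "sqint \<psi>x" by (rule sqint_continuous[OF C1c_continuous(2)[OF assms] K(1) K(3)])
  show "sqint \<psi>y" by (rule sqint_continuous[OF C1c_continuous(3)[OF assms] K(1) K(4)])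
qed

lemma tendsto_integral_scaleR:
  fixes a :: "nat \<Rightarrow> complex \<Rightarrow> real" and F :: "complex \<Rightarrow> complex"
  assumes a: "\<And>n. sqint (a n)" "sqint b" and lim: "(\<lambda>n. nsq (\<lambda>z. a n z - b z)) \<longlonglongrightarrow> 0" and F: "sqint F"
  shows "(\<lambda>n. \<integral>z. a n z *\<^sub>R F z \<partial>lborel) \<longlonglongrightarrow> (\<integral>z. b z *\<^sub>R F z \<partial>lborel)"
proof (rule Lim_transform2[OF tendsto_const])
  note [measurable] = sqint_meas[OF a(1)] sqint_meas[OF a(2)] sqint_meas[OF F]
  have i: "integrable lborel (\<lambda>z. c z *\<^sub>R F z)" if "sqint c" for c :: "complex \<Rightarrow> real"
    by (rule norm_integral_mult_le(1)[OF that F]) (use sqint_meas[OF that] in auto)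
  show "(\<lambda>n. (\<integral>z. b z *\<^sub>R F z \<partial>lborel) - (\<integral>z. a n z *\<^sub>R F z \<partial>lborel)) \<longlonglongrightarrow> 0"
  proof (rule Lim_null_comparison)
    show "\<forall>\<^sub>F n in sequentially. norm ((\<integral>z. b z *\<^sub>R F z \<partial>lborel) - (\<integral>z. a n z *\<^sub>R F z \<partial>lborel)) \<le> sqrt (nsq (\<lambda>z. a n z - b z) * nsq F)"
    proof (intro always_eventually allI)
      fix n
      have "(\<integral>z. b z *\<^sub>R F z \<partial>lborel) - (\<integral>z. a n z *\<^sub>R F z \<partial>lborel) = (\<integral>z. (b z - a n z) *\<^sub>R F z \<partial>lborel)"
        unfolding scaleR_diff_left by (intro Bochner_Integration.integral_diff[symmetric] i a)
      then show "norm ((\<integral>z. b z *\<^sub>R F z \<partial>lborel) - (\<integral>z. a n z *\<^sub>R F z \<partial>lborel)) \<le> sqrt (nsq (\<lambda>z. a n z - b z) * nsq F)"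
        using norm_integral_mult_le(2)[OF sqint_diff(1)[OF a(2) a(1)[of n]] F, of "\<lambda>z. (b z - a n z) *\<^sub>R F z"]
        by (simp add: nsq_minus_commute[of b])
    qed
    show "(\<lambda>n. sqrt (nsq (\<lambda>z. a n z - b z) * nsq F)) \<longlonglongrightarrow> 0"
      using tendsto_real_sqrt[OF tendsto_mult[OF lim tendsto_const[of "nsq F"]]] by simp
  qed
qed

text \<open>Mollify the \<open>C\<^sup>1\<close> test function: mollification commutes with its derivatives, and both sides converge in \<open>L\<^sup>2\<close>.\<close>

lemma is_weak_deriv_C1c:
  assumes e: "e = 1 \<and> \<psi>e = \<psi>x \<or> e = \<i> \<and> \<psi>e = \<psi>y"
    and w: "is_weak_deriv A e u w" and A: "open A"
    and U: "sqint U" "\<And>z. z \<notin> A \<Longrightarrow> U z = 0" "AE z in lebesgue_on A. u z = U z"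
    and W: "sqint W" "\<And>z. z \<notin> A \<Longrightarrow> W z = 0" "AE z in lebesgue_on A. w z = W z"
    and \<psi>: "C1c K \<psi> \<psi>x \<psi>y" "K \<subseteq> A"
  shows "(\<integral>z. \<psi>e z *\<^sub>R U z \<partial>lborel) = - (\<integral>z. \<psi> z *\<^sub>R W z \<partial>lborel)"
proof -
  have Ab: "A \<in> sets borel" using A by simp
  note [measurable] = sqint_meas[OF U(1)] sqint_meas[OF W(1)]
  obtain \<eta>0 where \<eta>0: "\<eta>0 > 0" "\<And>\<eta>. 0 < \<eta> \<Longrightarrow> \<eta> < \<eta>0 \<Longrightarrow> conv (moll \<eta>) \<psi> \<in> test_functions A"
    using test_conv[OF \<psi>(1) A \<psi>(2)] by blast
  have s\<psi>: "sqint \<psi>e" "integrable lborel \<psi>e" using C1c_sqint[OF \<psi>(1)] C1c_integrable[OF \<psi>(1)] e by auto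
  have eq: "(\<integral>z. conv (moll (etas n)) \<psi>e z *\<^sub>R U z \<partial>lborel) = - (\<integral>z. conv (moll (etas n)) \<psi> z *\<^sub>R W z \<partial>lborel)" if n: "etas n < \<eta>0" for n
  proof -
    let ?\<phi> = "conv (moll (etas n)) \<psi>"
    have t: "?\<phi> \<in> test_functions A" by (rule \<eta>0(2)[OF etas_pos n])
    have "C1on UNIV ?\<phi> (conv (pderiv_dir 1 (moll (etas n))) \<psi>) (conv (pderiv_dir \<i> (moll (etas n))) \<psi>)"
      by (rule conv_C1on[OF moll_C1c[OF etas_pos] C1c_integrable(1)[OF \<psi>(1)]])
    then have pd: "pderiv_dir e ?\<phi> = conv (moll (etas n)) \<psi>e"
      using C1on_imp_pderiv(1,2) conv_deriv_C1c[OF moll_C1c[OF etas_pos] \<psi>(1)] e by (metis ext)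
    have [measurable]: "conv (moll (etas n)) \<psi>e \<in> borel_measurable borel" "?\<phi> \<in> borel_measurable borel"
      by (intro borel_measurable_continuous_onI conv_moll_continuous etas_pos s\<psi> C1c_integrable(1)[OF \<psi>(1)])+
    have "(\<integral>z. pderiv_dir e ?\<phi> z *\<^sub>R u z \<partial>lebesgue_on A) = (\<integral>z. conv (moll (etas n)) \<psi>e z *\<^sub>R U z \<partial>lborel)"
      unfolding pd by (rule lebesgue_on_rep(3)[OF Ab]) (use U in auto)
    moreover have "(\<integral>z. ?\<phi> z *\<^sub>R w z \<partial>lebesgue_on A) = (\<integral>z. ?\<phi> z *\<^sub>R W z \<partial>lborel)"
      by (rule lebesgue_on_rep(3)[OF Ab]) (use W in auto)
    ultimately show ?thesis using w t by (simp add: is_weak_deriv_def)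
  qed
  have "(\<lambda>n. \<integral>z. conv (moll (etas n)) \<psi>e z *\<^sub>R U z \<partial>lborel) \<longlonglongrightarrow> (\<integral>z. \<psi>e z *\<^sub>R U z \<partial>lborel)"
    by (intro tendsto_integral_scaleR conv_moll_L2_seq conv_moll_nsq_le(1) etas_pos s\<psi> U)
  moreover have "(\<lambda>n. \<integral>z. conv (moll (etas n)) \<psi> z *\<^sub>R W z \<partial>lborel) \<longlonglongrightarrow> (\<integral>z. \<psi> z *\<^sub>R W z \<partial>lborel)"
    by (intro tendsto_integral_scaleR conv_moll_L2_seq conv_moll_nsq_le(1) etas_pos W C1c_sqint[OF \<psi>(1)] C1c_integrable[OF \<psi>(1)])
  then have "(\<lambda>n. - (\<integral>z. conv (moll (etas n)) \<psi> z *\<^sub>R W z \<partial>lborel)) \<longlonglongrightarrow> - (\<integral>z. \<psi> z *\<^sub>R W z \<partial>lborel)"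
    by (rule tendsto_minus)
  then have "(\<lambda>n. \<integral>z. conv (moll (etas n)) \<psi>e z *\<^sub>R U z \<partial>lborel) \<longlonglongrightarrow> - (\<integral>z. \<psi> z *\<^sub>R W z \<partial>lborel)"
    by (rule Lim_transform_eventually) (use etas_less[OF \<eta>0(1)] eq in \<open>auto elim!: eventually_mono\<close>)
  ultimately show ?thesis by (rule LIMSEQ_unique)
qed

text \<open>Passage from an element of \<open>H\<^sup>1\<close>, defined up to null sets of the completed measure, to Borel representatives.\<close>

lemma H1_rep:
  assumes A: "open A" and u: "u \<in> sobolev_H1 A"
  obtains U P Q where "wk A U P Q" "AE z in lebesgue_on A. u z = U z"
    "AE z in lebesgue_on A. wderiv A 1 u z = P z" "AE z in lebesgue_on A. wderiv A \<i> u z = Q z"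
proof -
  have Ab: "A \<in> sets borel" using A by simp
  have w: "is_weak_deriv A 1 u (wderiv A 1 u)" "is_weak_deriv A \<i> u (wderiv A \<i> u)"
  proof -
    have "\<exists>w. is_weak_deriv A 1 u w" "\<exists>w. is_weak_deriv A \<i> u w" using u unfolding sobolev_H1_def by blast+
    from this[THEN someI_ex] show "is_weak_deriv A 1 u (wderiv A 1 u)" "is_weak_deriv A \<i> u (wderiv A \<i> u)"
      unfolding wderiv_def .
  qed
  have l: "u \<in> L2 (lebesgue_on A)" "wderiv A 1 u \<in> L2 (lebesgue_on A)" "wderiv A \<i> u \<in> L2 (lebesgue_on A)"
    using u w by (auto simp: sobolev_H1_def is_weak_deriv_def)
  obtain U where U: "sqint U" "\<And>z. z \<notin> A \<Longrightarrow> U z = 0" "AE z in lebesgue_on A. u z = U z"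
    using L2_borel_rep[OF l(1) Ab] by blast
  obtain P where P: "sqint P" "\<And>z. z \<notin> A \<Longrightarrow> P z = 0" "AE z in lebesgue_on A. wderiv A 1 u z = P z"
    using L2_borel_rep[OF l(2) Ab] by blast
  obtain Q where Q: "sqint Q" "\<And>z. z \<notin> A \<Longrightarrow> Q z = 0" "AE z in lebesgue_on A. wderiv A \<i> u z = Q z"
    using L2_borel_rep[OF l(3) Ab] by blast
  have "wk A U P Q"
    unfolding wk_def
  proof (intro conjI allI impI)
    fix K and \<psi> \<psi>x \<psi>y :: "complex \<Rightarrow> real" assume \<psi>: "C1c K \<psi> \<psi>x \<psi>y \<and> K \<subseteq> A"
    show "(\<integral>z. \<psi>x z *\<^sub>R U z \<partial>lborel) = - (\<integral>z. \<psi> z *\<^sub>R P z \<partial>lborel)"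
      by (rule is_weak_deriv_C1c[OF _ w(1) A U P]) (use \<psi> in auto)
    show "(\<integral>z. \<psi>y z *\<^sub>R U z \<partial>lborel) = - (\<integral>z. \<psi> z *\<^sub>R Q z \<partial>lborel)"
      by (rule is_weak_deriv_C1c[OF _ w(2) A U Q]) (use \<psi> in auto)
  qed (use U P Q in auto)
  then show ?thesis using that U P Q by blast
qed

lemma wk_is_weak_deriv:
  assumes A: "open A" and wk: "wk A U P Q" and ae: "AE z in lebesgue_on A. u z = U z"
  shows "is_weak_deriv A 1 u P" "is_weak_deriv A \<i> u Q" "u \<in> sobolev_H1 A"
proof -
  have Ab: "A \<in> sets borel" using A by simp
  have s: "sqint U" "sqint P" "sqint Q" "\<And>z. z \<notin> A \<Longrightarrow> U z = 0" "\<And>z. z \<notin> A \<Longrightarrow> P z = 0" "\<And>z. z \<notin> A \<Longrightarrow> Q z = 0"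
    using wk by (auto simp: wk_def)
  note [measurable] = sqint_meas[OF s(1)] sqint_meas[OF s(2)] sqint_meas[OF s(3)]
  have "(\<integral>z. pderiv_dir 1 \<phi> z *\<^sub>R u z \<partial>lebesgue_on A) = - (\<integral>z. \<phi> z *\<^sub>R P z \<partial>lebesgue_on A) \<and>
    (\<integral>z. pderiv_dir \<i> \<phi> z *\<^sub>R u z \<partial>lebesgue_on A) = - (\<integral>z. \<phi> z *\<^sub>R Q z \<partial>lebesgue_on A)"
    if t: "\<phi> \<in> test_functions A" for \<phi>
  proof -
    obtain K where K: "K \<subseteq> A" "C1c K \<phi> (pderiv_dir 1 \<phi>) (pderiv_dir \<i> \<phi>)" using C1c_test[OF t] by blast
    note [measurable] = C1c_measurable[OF K(2)]
    have "(\<integral>z. pderiv_dir 1 \<phi> z *\<^sub>R u z \<partial>lebesgue_on A) = (\<integral>z. pderiv_dir 1 \<phi> z *\<^sub>R U z \<partial>lborel)"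
      "(\<integral>z. pderiv_dir \<i> \<phi> z *\<^sub>R u z \<partial>lebesgue_on A) = (\<integral>z. pderiv_dir \<i> \<phi> z *\<^sub>R U z \<partial>lborel)"
      "(\<integral>z. \<phi> z *\<^sub>R P z \<partial>lebesgue_on A) = (\<integral>z. \<phi> z *\<^sub>R P z \<partial>lborel)"
      "(\<integral>z. \<phi> z *\<^sub>R Q z \<partial>lebesgue_on A) = (\<integral>z. \<phi> z *\<^sub>R Q z \<partial>lborel)"
      by (rule lebesgue_on_rep(3)[OF Ab]; use s ae in auto)+
    then show ?thesis using wk K by (simp add: wk_def)
  qed
  moreover have "P \<in> L2 (lebesgue_on A)" "Q \<in> L2 (lebesgue_on A)" "u \<in> L2 (lebesgue_on A)"
    by (rule L2_norm_rep(1)[OF Ab]; use s ae in auto)+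
  ultimately show "is_weak_deriv A 1 u P" "is_weak_deriv A \<i> u Q" "u \<in> sobolev_H1 A"
    by (auto simp: is_weak_deriv_def sobolev_H1_def)
qed

text \<open>The mollifications vanish in the interior as soon as the radius is small, and a subsequence converges
  to \<open>D\<close> almost everywhere.\<close>

lemma weak_zero:
  fixes D :: "complex \<Rightarrow> complex"
  assumes A: "open A" "bounded A" and D: "sqint D" "\<And>z. z \<notin> A \<Longrightarrow> D z = 0"
    and z: "\<And>K \<psi> \<psi>x \<psi>y. C1c K \<psi> \<psi>x \<psi>y \<Longrightarrow> K \<subseteq> A \<Longrightarrow> (\<integral>z. \<psi> z *\<^sub>R D z \<partial>lborel) = 0"
  shows "AE z in lborel. D z = 0"
proof -
  have iD: "integrable lborel D" by (rule sqint_integrable[OF D(1) A(2) D(2)])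
  have sc: "sqint (\<lambda>z. conv (moll (etas n)) D z - D z)" for n
    by (intro sqint_diff conv_moll_nsq_le(1) etas_pos D iD)
  obtain r :: "nat \<Rightarrow> nat" where r: "strict_mono r" "AE z in lborel. (\<lambda>n. conv (moll (etas (r n))) D z - D z) \<longlonglongrightarrow> 0"
    using nsq_AE_subseq[OF sc conv_moll_L2_seq[OF D(1) iD]] by blast
  from r(2) show ?thesis
  proof eventually_elim
    case (elim z)
    show "D z = 0"
    proof (cases "z \<in> A")
      case True
      then obtain e where e: "e > 0" "cball z e \<subseteq> A" using A(1) open_contains_cball by blast
      have "\<forall>\<^sub>F n in sequentially. etas (r n) < e"
        using eventually_subseq[OF r(1) etas_less[OF e(1)]] .
      then have "\<forall>\<^sub>F n in sequentially. conv (moll (etas (r n))) D z - D z = - D z"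
      proof eventually_elim
        case (elim n)
        have "(\<lambda>k. z - k) ` cball 0 (etas (r n)) \<subseteq> A" using e elim by (auto simp: dist_norm subset_iff)
        then have "conv (moll (etas (r n))) D z = 0"
          unfolding conv_def by (rule z[OF C1c_reflect[OF moll_C1c[OF etas_pos]]])
        then show ?case by simp
      qed
      then have "(\<lambda>n. - D z) \<longlonglongrightarrow> 0" using elim by (rule Lim_transform_eventually[rotated])
      then show ?thesis by (simp add: LIMSEQ_const_iff)
    qed (use D in auto)
  qed
qed

text \<open>The choice made by \<open>wderiv\<close> agrees almost everywhere with any weak derivative at hand.\<close>

lemma wk_unique:
  assumes A: "open A" "bounded A" and wk: "wk A U P Q" and ae: "AE z in lebesgue_on A. u z = U z"
  shows "AE z in lebesgue_on A. wderiv A 1 u z = P z" "AE z in lebesgue_on A. wderiv A \<i> u z = Q z"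
proof -
  have Al: "A \<inter> space lebesgue \<in> sets lebesgue" using A by simp
  obtain U' P' Q' where R: "wk A U' P' Q'" "AE z in lebesgue_on A. u z = U' z"
    "AE z in lebesgue_on A. wderiv A 1 u z = P' z" "AE z in lebesgue_on A. wderiv A \<i> u z = Q' z"
    using H1_rep[OF A(1) wk_is_weak_deriv(3)[OF A(1) wk ae]] by blast
  have s: "sqint U" "sqint P" "sqint Q" "\<And>z. z \<notin> A \<Longrightarrow> U z = 0" "\<And>z. z \<notin> A \<Longrightarrow> P z = 0" "\<And>z. z \<notin> A \<Longrightarrow> Q z = 0"
    using wk by (auto simp: wk_def)
  have s': "sqint U'" "sqint P'" "sqint Q'" "\<And>z. z \<notin> A \<Longrightarrow> U' z = 0" "\<And>z. z \<notin> A \<Longrightarrow> P' z = 0" "\<And>z. z \<notin> A \<Longrightarrow> Q' z = 0"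
    using R by (auto simp: wk_def)
  note [measurable] = sqint_meas[OF s(1)] sqint_meas[OF s'(1)]
  have "AE z in lebesgue_on A. U z = U' z" using ae R(2) by eventually_elim auto
  then have UU: "AE z in lborel. U z = U' z"
    using s(4) s'(4) Al by (subst (asm) AE_restrict_space_iff) (auto simp: AE_completion_iff elim!: eventually_mono)
  have eq: "(\<integral>z. f z *\<^sub>R U z \<partial>lborel) = (\<integral>z. f z *\<^sub>R U' z \<partial>lborel)" if [measurable]: "f \<in> borel_measurable borel" for f :: "complex \<Rightarrow> real"
    by (rule integral_cong_AE) (use UU in auto)
  have i: "integrable lborel (\<lambda>z. f z *\<^sub>R F z)" if "sqint f" "sqint F" for f :: "complex \<Rightarrow> real" and F :: "complex \<Rightarrow> complex"
    by (rule norm_integral_mult_le(1)[OF that]) (use sqint_meas[OF that(1)] sqint_meas[OF that(2)] in auto)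
  have PP: "AE z in lborel. P z - P' z = 0"
  proof (rule weak_zero[OF A sqint_diff(1)[OF s(2) s'(2)]])
    fix K and \<psi> \<psi>x \<psi>y :: "complex \<Rightarrow> real" assume \<psi>: "C1c K \<psi> \<psi>x \<psi>y" "K \<subseteq> A"
    then have "(\<integral>z. \<psi> z *\<^sub>R P z \<partial>lborel) = (\<integral>z. \<psi> z *\<^sub>R P' z \<partial>lborel)"
    proof -
      have "(\<integral>z. \<psi>x z *\<^sub>R U z \<partial>lborel) = - (\<integral>z. \<psi> z *\<^sub>R P z \<partial>lborel)"
        "(\<integral>z. \<psi>x z *\<^sub>R U' z \<partial>lborel) = - (\<integral>z. \<psi> z *\<^sub>R P' z \<partial>lborel)"
        using wk R(1) \<psi> unfolding wk_def by blast+
      then show ?thesis using eq[OF C1c_measurable(2)[OF \<psi>(1)]] by simp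
    qed
    then show "(\<integral>z. \<psi> z *\<^sub>R (P z - P' z) \<partial>lborel) = 0"
      using i[OF C1c_sqint(1)[OF \<psi>(1)] s(2)] i[OF C1c_sqint(1)[OF \<psi>(1)] s'(2)] by (simp add: scaleR_diff_right)
  qed (use s s' in auto)
  have QQ: "AE z in lborel. Q z - Q' z = 0"
  proof (rule weak_zero[OF A sqint_diff(1)[OF s(3) s'(3)]])
    fix K and \<psi> \<psi>x \<psi>y :: "complex \<Rightarrow> real" assume \<psi>: "C1c K \<psi> \<psi>x \<psi>y" "K \<subseteq> A"
    then have "(\<integral>z. \<psi> z *\<^sub>R Q z \<partial>lborel) = (\<integral>z. \<psi> z *\<^sub>R Q' z \<partial>lborel)"
    proof -
      have "(\<integral>z. \<psi>y z *\<^sub>R U z \<partial>lborel) = - (\<integral>z. \<psi> z *\<^sub>R Q z \<partial>lborel)"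
        "(\<integral>z. \<psi>y z *\<^sub>R U' z \<partial>lborel) = - (\<integral>z. \<psi> z *\<^sub>R Q' z \<partial>lborel)"
        using wk R(1) \<psi> unfolding wk_def by blast+
      then show ?thesis using eq[OF C1c_measurable(3)[OF \<psi>(1)]] by simp
    qed
    then show "(\<integral>z. \<psi> z *\<^sub>R (Q z - Q' z) \<partial>lborel) = 0"
      using i[OF C1c_sqint(1)[OF \<psi>(1)] s(3)] i[OF C1c_sqint(1)[OF \<psi>(1)] s'(3)] by (simp add: scaleR_diff_right)
  qed (use s s' in auto)
  have lift: "AE z in lebesgue_on A. f z = g z" if "AE z in lborel. f z - g z = 0" for f g :: "complex \<Rightarrow> complex"
    using that Al by (subst AE_restrict_space_iff) (auto simp: AE_completion_iff elim!: eventually_mono)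
  show "AE z in lebesgue_on A. wderiv A 1 u z = P z"
    using R(3) lift[OF PP] by eventually_elim auto
  show "AE z in lebesgue_on A. wderiv A \<i> u z = Q z"
    using R(4) lift[OF QQ] by eventually_elim auto
qed

lemma wk_C1on:
  assumes A: "open A" "bounded A" and v: "C1on A v vx vy"
    and B: "\<And>z. z \<in> A \<Longrightarrow> norm (v z) \<le> B" "\<And>z. z \<in> A \<Longrightarrow> norm (vx z) \<le> B" "\<And>z. z \<in> A \<Longrightarrow> norm (vy z) \<le> B"
  shows "wk A (\<lambda>z. if z \<in> A then v z else 0) (\<lambda>z. if z \<in> A then vx z else 0) (\<lambda>z. if z \<in> A then vy z else 0)"
proof -
  obtain R where R: "A \<subseteq> cball 0 R" using A(2) unfolding bounded_iff by (auto simp: subset_iff)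
  have sq: "sqint (\<lambda>z. if z \<in> A then f z else 0)" if c: "continuous_on A f" and b: "\<And>z. z \<in> A \<Longrightarrow> norm (f z) \<le> B" for f :: "complex \<Rightarrow> complex"
    unfolding sqint_def
  proof
    have m[measurable]: "(\<lambda>z. if z \<in> A then f z else 0) \<in> borel_measurable borel"
      using borel_measurable_continuous_on_indicator[of A f] c A
      by (simp add: indicator_scaleR_eq_if)
    then show "(\<lambda>z. if z \<in> A then f z else 0) \<in> borel_measurable borel" .
    show "integrable lborel (\<lambda>z. (cmod (if z \<in> A then f z else 0))\<^sup>2)"
    proof (rule Bochner_Integration.integrable_bound[OF integrable_indicator_cball[of "B\<^sup>2" R]])
      show "AE z in lborel. norm ((cmod (if z \<in> A then f z else 0))\<^sup>2) \<le> norm (B\<^sup>2 * indicator (cball 0 R) z :: real)"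
      proof (rule AE_I2)
        fix z
        show "norm ((cmod (if z \<in> A then f z else 0))\<^sup>2) \<le> norm (B\<^sup>2 * indicator (cball 0 R) z :: real)"
        proof (cases "z \<in> A")
          case True
          then have "z \<in> cball 0 R" using R by blast
          then show ?thesis using True b[OF True] by (auto intro: power_mono)
        qed simp
      qed
    qed auto
  qed
  have rest: "(\<lambda>z. a z *\<^sub>R (if z \<in> A then f z else 0)) = (\<lambda>z. a z *\<^sub>R f z)"
    if "\<And>z. z \<notin> K \<Longrightarrow> a z = 0" "K \<subseteq> A" for a :: "complex \<Rightarrow> real" and f :: "complex \<Rightarrow> complex" and K
  proof (rule ext)
    fix z
    show "a z *\<^sub>R (if z \<in> A then f z else 0) = a z *\<^sub>R f z"
      using that(1)[of z] that(2) by (cases "z \<in> A") auto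
  qed
  show ?thesis
    unfolding wk_def
  proof (intro conjI allI impI)
    fix K and \<psi> \<psi>x \<psi>y :: "complex \<Rightarrow> real" assume \<psi>: "C1c K \<psi> \<psi>x \<psi>y \<and> K \<subseteq> A"
    then have z: "\<And>z. z \<notin> K \<Longrightarrow> \<psi> z = 0" "\<And>z. z \<notin> K \<Longrightarrow> \<psi>x z = 0" "\<And>z. z \<notin> K \<Longrightarrow> \<psi>y z = 0" "K \<subseteq> A"
      by (auto simp: C1c_def)
    note P = C1_by_parts[OF conjunct1[OF \<psi>] v A(1) z(4)]
    have r: "(\<lambda>z. \<psi>x z *\<^sub>R (if z \<in> A then v z else 0)) = (\<lambda>z. \<psi>x z *\<^sub>R v z)"
      "(\<lambda>z. \<psi> z *\<^sub>R (if z \<in> A then vx z else 0)) = (\<lambda>z. \<psi> z *\<^sub>R vx z)"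
      "(\<lambda>z. \<psi>y z *\<^sub>R (if z \<in> A then v z else 0)) = (\<lambda>z. \<psi>y z *\<^sub>R v z)"
      "(\<lambda>z. \<psi> z *\<^sub>R (if z \<in> A then vy z else 0)) = (\<lambda>z. \<psi> z *\<^sub>R vy z)"
      by (rule rest[OF _ z(4)], erule z)+
    show "(\<integral>z. \<psi>x z *\<^sub>R (if z \<in> A then v z else 0) \<partial>lborel) = - (\<integral>z. \<psi> z *\<^sub>R (if z \<in> A then vx z else 0) \<partial>lborel)"
      unfolding r by (rule P(1))
    show "(\<integral>z. \<psi>y z *\<^sub>R (if z \<in> A then v z else 0) \<partial>lborel) = - (\<integral>z. \<psi> z *\<^sub>R (if z \<in> A then vy z else 0) \<partial>lborel)"
      unfolding r by (rule P(2))
  qed (use sq C1on_continuous[OF v] B in auto)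
qed

lemma wkD:
  assumes "wk U u p q"
  shows "sqint u" "sqint p" "sqint q" "\<And>z. z \<notin> U \<Longrightarrow> u z = 0" "\<And>z. z \<notin> U \<Longrightarrow> p z = 0" "\<And>z. z \<notin> U \<Longrightarrow> q z = 0"
    "C1c K \<psi> \<psi>x \<psi>y \<Longrightarrow> K \<subseteq> U \<Longrightarrow> (\<integral>z. \<psi>x z *\<^sub>R u z \<partial>lborel) = - (\<integral>z. \<psi> z *\<^sub>R p z \<partial>lborel)"
    "C1c K \<psi> \<psi>x \<psi>y \<Longrightarrow> K \<subseteq> U \<Longrightarrow> (\<integral>z. \<psi>y z *\<^sub>R u z \<partial>lborel) = - (\<integral>z. \<psi> z *\<^sub>R q z \<partial>lborel)"
  using assms unfolding wk_def by blast+

lemma wk_AE_cong: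
  assumes w: "wk U u p q" and u': "u' \<in> borel_measurable borel" "\<And>z. z \<notin> U \<Longrightarrow> u' z = 0"
    and ae: "AE z in lborel. u z = u' z"
  shows "wk U u' p q"
proof -
  note [measurable] = u'(1) sqint_meas[OF wkD(1)[OF w]]
  have "integrable lborel (\<lambda>z. (cmod (u' z))\<^sup>2)"
    by (rule integrable_cong_AE_imp[of _ "\<lambda>z. (cmod (u z))\<^sup>2"]) (use wkD(1)[OF w] ae in \<open>auto simp: sqint_def elim!: eventually_mono\<close>)
  then have s: "sqint u'" by (simp add: sqint_def)
  have "(\<integral>z. f z *\<^sub>R u z \<partial>lborel) = (\<integral>z. f z *\<^sub>R u' z \<partial>lborel)" if [measurable]: "f \<in> borel_measurable borel" for f :: "complex \<Rightarrow> real"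
    by (rule integral_cong_AE) (use ae in \<open>auto elim!: eventually_mono\<close>)
  note eq = this
  show ?thesis
    unfolding wk_def
  proof (intro conjI allI impI)
    fix K and \<psi> \<psi>x \<psi>y :: "complex \<Rightarrow> real" assume \<psi>: "C1c K \<psi> \<psi>x \<psi>y \<and> K \<subseteq> U"
    note m = C1c_measurable[OF conjunct1[OF \<psi>]]
    show "(\<integral>z. \<psi>x z *\<^sub>R u' z \<partial>lborel) = - (\<integral>z. \<psi> z *\<^sub>R p z \<partial>lborel)"
      unfolding eq[OF m(2), symmetric] by (rule wkD(7)[OF w conjunct1[OF \<psi>] conjunct2[OF \<psi>]])
    show "(\<integral>z. \<psi>y z *\<^sub>R u' z \<partial>lborel) = - (\<integral>z. \<psi> z *\<^sub>R q z \<partial>lborel)"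
      unfolding eq[OF m(3), symmetric] by (rule wkD(8)[OF w conjunct1[OF \<psi>] conjunct2[OF \<psi>]])
  qed (use s u' wkD[OF w] in auto)
qed

lemma wk_diff:
  assumes "wk U u p q" "wk U u' p' q'"
  shows "wk U (\<lambda>z. u z - u' z) (\<lambda>z. p z - p' z) (\<lambda>z. q z - q' z)"
proof -
  have i: "integrable lborel (\<lambda>z. f z *\<^sub>R F z)" if "sqint f" "sqint F" for f :: "complex \<Rightarrow> real" and F :: "complex \<Rightarrow> complex"
    by (rule norm_integral_mult_le(1)[OF that]) (use sqint_meas[OF that(1)] sqint_meas[OF that(2)] in auto)
  have d: "(\<integral>z. f z *\<^sub>R (F z - G z) \<partial>lborel) = (\<integral>z. f z *\<^sub>R F z \<partial>lborel) - (\<integral>z. f z *\<^sub>R G z \<partial>lborel)"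
    if "sqint f" "sqint F" "sqint G" for f :: "complex \<Rightarrow> real" and F G :: "complex \<Rightarrow> complex"
    unfolding scaleR_diff_right by (intro Bochner_Integration.integral_diff i that)
  show ?thesis
    unfolding wk_def
  proof (intro conjI allI impI)
    fix K and \<psi> \<psi>x \<psi>y :: "complex \<Rightarrow> real" assume \<psi>: "C1c K \<psi> \<psi>x \<psi>y \<and> K \<subseteq> U"
    note s = C1c_sqint[OF conjunct1[OF \<psi>]]
    show "(\<integral>z. \<psi>x z *\<^sub>R (u z - u' z) \<partial>lborel) = - (\<integral>z. \<psi> z *\<^sub>R (p z - p' z) \<partial>lborel)"
      using wkD(7)[OF assms(1), of K \<psi> \<psi>x \<psi>y] wkD(7)[OF assms(2), of K \<psi> \<psi>x \<psi>y] \<psi>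
      by (simp only: d[OF s(2) wkD(1)[OF assms(1)] wkD(1)[OF assms(2)]] d[OF s(1) wkD(2)[OF assms(1)] wkD(2)[OF assms(2)]]) simp
    show "(\<integral>z. \<psi>y z *\<^sub>R (u z - u' z) \<partial>lborel) = - (\<integral>z. \<psi> z *\<^sub>R (q z - q' z) \<partial>lborel)"
      using wkD(8)[OF assms(1), of K \<psi> \<psi>x \<psi>y] wkD(8)[OF assms(2), of K \<psi> \<psi>x \<psi>y] \<psi>
      by (simp only: d[OF s(3) wkD(1)[OF assms(1)] wkD(1)[OF assms(2)]] d[OF s(1) wkD(3)[OF assms(1)] wkD(3)[OF assms(2)]]) simp
  qed (use wkD[OF assms(1)] wkD[OF assms(2)] in \<open>auto intro: sqint_diff\<close>)
qed

section \<open>Curl of the current and the chain rule\<close>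

text \<open>Symmetry of the second derivatives, read off from their closed form.\<close>

lemma moll_mixed: "pderiv_dir \<i> (pderiv_dir 1 (moll \<eta>)) = pderiv_dir 1 (pderiv_dir \<i> (moll \<eta>))"
proof -
  define s where "s = 1 / \<eta>"
  define g where "g z = bump_arg (0 + s *\<^sub>R z)" for z
  define c where "c = 1 / (\<integral>z. exp_flat 0 (g z) \<partial>lborel)"
  define e where "e = - 2 * s\<^sup>2"
  have g: "C1on UNIV g (\<lambda>z. e * Re z) (\<lambda>z. e * Im z)"
    unfolding C1on_def g_def bump_arg_def e_def
    by (auto intro!: derivative_eq_intros continuous_intros simp: algebra_simps power2_eq_square)
  have m: "moll \<eta> = (\<lambda>z. exp_flat 0 (g z) * c)" by (simp add: moll_def g_def c_def s_def fun_eq_iff)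
  have C: "C1on UNIV (\<lambda>z. c) (\<lambda>z. 0) (\<lambda>z. 0)" by (simp add: C1on_def)
  have X: "C1on UNIV (\<lambda>z. e * Re z * c) (\<lambda>z. e * c) (\<lambda>z. 0)" "C1on UNIV (\<lambda>z. e * Im z * c) (\<lambda>z. 0) (\<lambda>z. e * c)"
    unfolding C1on_def by (auto intro!: derivative_eq_intros)
  have E: "C1on UNIV (\<lambda>z. exp_flat 2 (g z)) (\<lambda>z. (exp_flat 4 (g z) - 2 * exp_flat 3 (g z)) * (e * Re z)) (\<lambda>z. (exp_flat 4 (g z) - 2 * exp_flat 3 (g z)) * (e * Im z))"
    using C1on_exp_flat[OF g, of 2] by (simp add: numeral_eq_Suc)
  have "C1on UNIV (moll \<eta>) (\<lambda>z. exp_flat 2 (g z) * (e * Re z * c)) (\<lambda>z. exp_flat 2 (g z) * (e * Im z * c))"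
    using C1on_mult[OF C1on_exp_flat[OF g, of 0] C] unfolding m by (simp add: numeral_eq_Suc mult.assoc)
  note A = C1on_imp_pderiv(1,2)[OF this]
  show ?thesis
    unfolding A C1on_imp_pderiv(2)[OF C1on_mult[OF E X(1)]] C1on_imp_pderiv(1)[OF C1on_mult[OF E X(2)]]
    by (simp add: fun_eq_iff algebra_simps)
qed

abbreviation "msm n \<equiv> moll (etas n)"
abbreviation "msmx n \<equiv> pderiv_dir 1 (moll (etas n))"
abbreviation "msmy n \<equiv> pderiv_dir \<i> (moll (etas n))"

lemma pderiv_C1c:
  assumes "\<And>k. Ck k \<rho>" "C1c K \<rho> (pderiv_dir 1 \<rho>) (pderiv_dir \<i> \<rho>)"
  shows "C1c K (pderiv_dir 1 \<rho>) (pderiv_dir 1 (pderiv_dir 1 \<rho>)) (pderiv_dir \<i> (pderiv_dir 1 \<rho>))"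
    "C1c K (pderiv_dir \<i> \<rho>) (pderiv_dir 1 (pderiv_dir \<i> \<rho>)) (pderiv_dir \<i> (pderiv_dir \<i> \<rho>))"
proof -
  have K: "compact K" "\<And>z. z \<notin> K \<Longrightarrow> pderiv_dir 1 \<rho> z = 0" "\<And>z. z \<notin> K \<Longrightarrow> pderiv_dir \<i> \<rho> z = 0"
    using assms(2) by (auto simp: C1c_def)
  show "C1c K (pderiv_dir 1 \<rho>) (pderiv_dir 1 (pderiv_dir 1 \<rho>)) (pderiv_dir \<i> (pderiv_dir 1 \<rho>))"
    by (rule C1c_of_Ck[OF Ck_SucD(2)[OF assms(1)] K(1) K(2)])
  show "C1c K (pderiv_dir \<i> \<rho>) (pderiv_dir 1 (pderiv_dir \<i> \<rho>)) (pderiv_dir \<i> (pderiv_dir \<i> \<rho>))"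
    by (rule C1c_of_Ck[OF Ck_SucD(3)[OF assms(1)] K(1) K(3)])
qed

lemma smooth_wk:
  assumes U: "bounded U" and w: "wk U u p q"
  shows "C1on UNIV (conv (msm n) u) (conv (msmx n) u) (conv (msmy n) u)"
    "C1on UNIV (conv (msmx n) u) (conv (pderiv_dir 1 (msmx n)) u) (conv (pderiv_dir \<i> (msmx n)) u)"
    "C1on UNIV (conv (msmy n) u) (conv (pderiv_dir \<i> (msmx n)) u) (conv (pderiv_dir \<i> (msmy n)) u)"
proof -
  have i: "integrable lborel u" by (rule sqint_integrable[OF wkD(1)[OF w] U wkD(4)[OF w]])
  note P = pderiv_C1c[OF moll_Ck moll_C1c[OF etas_pos]]
  show "C1on UNIV (conv (msm n) u) (conv (msmx n) u) (conv (msmy n) u)"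
    by (rule conv_C1on[OF moll_C1c[OF etas_pos] i])
  show "C1on UNIV (conv (msmx n) u) (conv (pderiv_dir 1 (msmx n)) u) (conv (pderiv_dir \<i> (msmx n)) u)"
    by (rule conv_C1on[OF P(1) i])
  show "C1on UNIV (conv (msmy n) u) (conv (pderiv_dir \<i> (msmx n)) u) (conv (pderiv_dir \<i> (msmy n)) u)"
    using conv_C1on[OF P(2) i] by (simp add: moll_mixed)
qed

text \<open>Away from the boundary of \<open>U\<close> the derivative of the mollification is the mollification of the weak derivative.\<close>

lemma smooth_wk_deriv:
  assumes w: "wk U u p q" and K: "compact K" "open U" "K \<subseteq> U"
  shows "\<forall>\<^sub>F n in sequentially. \<forall>z\<in>K. conv (msmx n) u z = conv (msm n) p z \<and> conv (msmy n) u z = conv (msm n) q z"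
proof -
  obtain e where e: "e > 0" "(\<Union>x\<in>K. cball x e) \<subseteq> U"
    using compact_subset_open_imp_cball_epsilon_subset[OF K] by blast
  from etas_less[OF e(1)] show ?thesis
  proof eventually_elim
    case (elim n)
    show ?case
    proof
      fix z assume "z \<in> K"
      then have "cball z (etas n) \<subseteq> U" using e elim by (force simp: subset_iff)
      then show "conv (msmx n) u z = conv (msm n) p z \<and> conv (msmy n) u z = conv (msm n) q z"
        using conv_wk[OF moll_C1c[OF etas_pos] w] by blast
    qed
  qed
qed

lemma smooth_L2:
  assumes U: "bounded U" and w: "wk U u p q"
  shows "sqint (conv (msm n) u)" "sqint (conv (msm n) p)" "sqint (conv (msm n) q)"
    "(\<lambda>n. nsq (\<lambda>z. conv (msm n) u z - u z)) \<longlonglongrightarrow> 0"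
    "(\<lambda>n. nsq (\<lambda>z. conv (msm n) p z - p z)) \<longlonglongrightarrow> 0"
    "(\<lambda>n. nsq (\<lambda>z. conv (msm n) q z - q z)) \<longlonglongrightarrow> 0"
proof -
  note i = sqint_integrable[OF wkD(1)[OF w] U wkD(4)[OF w]] sqint_integrable[OF wkD(2)[OF w] U wkD(5)[OF w]]
    sqint_integrable[OF wkD(3)[OF w] U wkD(6)[OF w]]
  show "sqint (conv (msm n) u)" by (rule conv_moll_nsq_le(1)[OF etas_pos wkD(1)[OF w] i(1)])
  show "sqint (conv (msm n) p)" by (rule conv_moll_nsq_le(1)[OF etas_pos wkD(2)[OF w] i(2)])
  show "sqint (conv (msm n) q)" by (rule conv_moll_nsq_le(1)[OF etas_pos wkD(3)[OF w] i(3)])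
  show "(\<lambda>n. nsq (\<lambda>z. conv (msm n) u z - u z)) \<longlonglongrightarrow> 0" by (rule conv_moll_L2_seq[OF wkD(1)[OF w] i(1)])
  show "(\<lambda>n. nsq (\<lambda>z. conv (msm n) p z - p z)) \<longlonglongrightarrow> 0" by (rule conv_moll_L2_seq[OF wkD(2)[OF w] i(2)])
  show "(\<lambda>n. nsq (\<lambda>z. conv (msm n) q z - q z)) \<longlonglongrightarrow> 0" by (rule conv_moll_L2_seq[OF wkD(3)[OF w] i(3)])
qed

lemma wedge_eq: "wedge a b = Re a * Im b - Im a * Re b"
  by (simp add: wedge_def Re_divide Im_divide field_simps power2_eq_square)

lemma wedge_le: "\<bar>wedge a b\<bar> \<le> norm a * norm b"
proof -
  have "wedge a b = Im (cnj a * b)" by (simp add: wedge_eq)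
  also have "\<bar>\<dots>\<bar> \<le> norm (cnj a * b)" by (rule abs_Im_le_cmod)
  finally show ?thesis by (simp add: norm_mult)
qed

lemma wedge_linear:
  "wedge (a + b) c = wedge a c + wedge b c" "wedge a (b + c) = wedge a b + wedge a c"
  "wedge (a - b) c = wedge a c - wedge b c" "wedge a (b - c) = wedge a b - wedge a c"
  "wedge (r *\<^sub>R a) b = r * wedge a b" "wedge a (r *\<^sub>R b) = r * wedge a b" "wedge b a = - wedge a b" "wedge 0 a = 0" "wedge a 0 = 0"
  by (simp_all add: wedge_eq algebra_simps)

lemma wedge_measurable[measurable (raw)]:
  assumes [measurable]: "f \<in> borel_measurable M" "g \<in> borel_measurable M"
  shows "(\<lambda>z. wedge (f z) (g z)) \<in> borel_measurable M"
  unfolding wedge_eq by measurable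

lemma wedge_integrable:
  assumes "sqint a" "sqint b"
  shows "integrable lborel (\<lambda>z. wedge (a z) (b z))" "\<bar>\<integral>z. wedge (a z) (b z) \<partial>lborel\<bar> \<le> sqrt (nsq a * nsq b)"
  using norm_integral_mult_le[OF assms, of "\<lambda>z. wedge (a z) (b z)"] wedge_le sqint_meas[OF assms(1)] sqint_meas[OF assms(2)]
  by auto

lemma wedge_tendsto:
  assumes a: "sqint a" and b: "\<And>n. sqint (b n)" "sqint c" and lim: "(\<lambda>n. nsq (\<lambda>z. b n z - c z)) \<longlonglongrightarrow> 0"
  shows "(\<lambda>n. \<integral>z. wedge (a z) (b n z) \<partial>lborel) \<longlonglongrightarrow> (\<integral>z. wedge (a z) (c z) \<partial>lborel)"
proof (rule Lim_transform2[OF tendsto_const])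
  show "(\<lambda>n. (\<integral>z. wedge (a z) (c z) \<partial>lborel) - (\<integral>z. wedge (a z) (b n z) \<partial>lborel)) \<longlonglongrightarrow> 0"
  proof (rule Lim_null_comparison)
    show "\<forall>\<^sub>F n in sequentially. norm ((\<integral>z. wedge (a z) (c z) \<partial>lborel) - (\<integral>z. wedge (a z) (b n z) \<partial>lborel)) \<le> sqrt (nsq a * nsq (\<lambda>z. b n z - c z))"
    proof (intro always_eventually allI)
      fix n
      have "(\<integral>z. wedge (a z) (c z) \<partial>lborel) - (\<integral>z. wedge (a z) (b n z) \<partial>lborel) = (\<integral>z. wedge (a z) (c z - b n z) \<partial>lborel)"
        unfolding wedge_linear(4) by (intro Bochner_Integration.integral_diff[symmetric] wedge_integrable a b)
      then show "norm ((\<integral>z. wedge (a z) (c z) \<partial>lborel) - (\<integral>z. wedge (a z) (b n z) \<partial>lborel)) \<le> sqrt (nsq a * nsq (\<lambda>z. b n z - c z))"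
        using wedge_integrable(2)[OF a sqint_diff(1)[OF b(2) b(1)[of n]]] by (simp add: nsq_minus_commute[of c])
    qed
    show "(\<lambda>n. sqrt (nsq a * nsq (\<lambda>z. b n z - c z))) \<longlonglongrightarrow> 0"
      using tendsto_real_sqrt[OF tendsto_mult[OF tendsto_const[of "nsq a"] lim]] by simp
  qed
qed

lemma wk_wedge_test:
  fixes f :: "complex \<Rightarrow> complex"
  assumes w: "wk U u p q" and f: "C1c K f fx fy" "K \<subseteq> U"
  shows "(\<integral>z. wedge (u z) (fx z) \<partial>lborel) = - (\<integral>z. wedge (p z) (f z) \<partial>lborel)"
    "(\<integral>z. wedge (u z) (fy z) \<partial>lborel) = - (\<integral>z. wedge (q z) (f z) \<partial>lborel)"
proof -
  have D: "(f has_derivative (\<lambda>h. Re h *\<^sub>R fx z + Im h *\<^sub>R fy z)) (at z)" for z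
    using f by (auto simp: C1c_def intro: C1onD)
  have re: "C1c K (\<lambda>z. Re (f z)) (\<lambda>z. Re (fx z)) (\<lambda>z. Re (fy z))"
    and im: "C1c K (\<lambda>z. Im (f z)) (\<lambda>z. Im (fx z)) (\<lambda>z. Im (fy z))"
    using f(1) C1c_continuous[OF f(1), of UNIV] has_derivative_Re[OF D] has_derivative_Im[OF D]
    unfolding C1c_def C1on_def by (auto intro!: continuous_intros)
  have i: "integrable lborel (\<lambda>z. g z *\<^sub>R F z)" if "sqint g" "sqint F" for g :: "complex \<Rightarrow> real" and F :: "complex \<Rightarrow> complex"
    by (rule norm_integral_mult_le(1)[OF that]) (use sqint_meas[OF that(1)] sqint_meas[OF that(2)] in auto)
  have split: "(\<integral>z. wedge (F z) (h z) \<partial>lborel) = Re (\<integral>z. Im (h z) *\<^sub>R F z \<partial>lborel) - Im (\<integral>z. Re (h z) *\<^sub>R F z \<partial>lborel)"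
    if F: "sqint F" and h: "sqint (\<lambda>z. Re (h z))" "sqint (\<lambda>z. Im (h z))" for F h :: "complex \<Rightarrow> complex"
  proof -
    have "(\<integral>z. wedge (F z) (h z) \<partial>lborel) = (\<integral>z. Re (Im (h z) *\<^sub>R F z) - Im (Re (h z) *\<^sub>R F z) \<partial>lborel)"
      by (simp add: wedge_eq mult.commute)
    also have "\<dots> = (\<integral>z. Re (Im (h z) *\<^sub>R F z) \<partial>lborel) - (\<integral>z. Im (Re (h z) *\<^sub>R F z) \<partial>lborel)"
      by (intro Bochner_Integration.integral_diff integrable_Re integrable_Im i F h)
    also have "\<dots> = Re (\<integral>z. Im (h z) *\<^sub>R F z \<partial>lborel) - Im (\<integral>z. Re (h z) *\<^sub>R F z \<partial>lborel)"
      using integral_Re[OF i[OF h(2) F]] integral_Im[OF i[OF h(1) F]] by simp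
    finally show ?thesis .
  qed
  note s = C1c_sqint[OF re] C1c_sqint[OF im]
  show "(\<integral>z. wedge (u z) (fx z) \<partial>lborel) = - (\<integral>z. wedge (p z) (f z) \<partial>lborel)"
    unfolding split[OF wkD(1)[OF w] s(2,5)] split[OF wkD(2)[OF w] s(1,4)]
    by (simp only: wkD(7)[OF w re f(2)] wkD(7)[OF w im f(2)]) simp
  show "(\<integral>z. wedge (u z) (fy z) \<partial>lborel) = - (\<integral>z. wedge (q z) (f z) \<partial>lborel)"
    unfolding split[OF wkD(1)[OF w] s(3,6)] split[OF wkD(3)[OF w] s(1,4)]
    by (simp only: wkD(8)[OF w re f(2)] wkD(8)[OF w im f(2)]) simp
qed

text \<open>The vorticity is the curl of the current. For the mollified function the identity is two
  integrations by parts in which the mixed second derivatives cancel. Here only one factor is mollified at a time,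
  with the other one kept as the weak derivative; every term is then linear in the mollified function, and \<open>L\<^sup>2\<close> convergence is enough for the limit.\<close>

lemma wedge_identity:
  assumes U: "open U" "bounded U" and w: "wk U u p q" and \<phi>: "C1c K \<phi> \<phi>x \<phi>y" "K \<subseteq> U"
  shows "(\<integral>z. 2 * wedge (p z) (q z) * \<phi> z \<partial>lborel)
    = - (\<integral>z. \<phi>x z * wedge (u z) (q z) - \<phi>y z * wedge (u z) (p z) \<partial>lborel)"
proof -
  have z0: "\<And>z. z \<notin> K \<Longrightarrow> \<phi> z = 0" "\<And>z. z \<notin> K \<Longrightarrow> \<phi>x z = 0" "\<And>z. z \<notin> K \<Longrightarrow> \<phi>y z = 0" and K: "compact K"
    using \<phi> by (auto simp: C1c_def)
  note S = smooth_wk[OF U(2) w] and L = smooth_L2[OF U(2) w] and W = wkD[OF w]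
  obtain B1 where B1: "\<And>z. norm (\<phi> z) \<le> B1" using bounded_compact_support[OF C1c_continuous(1)[OF \<phi>(1)] K z0(1)] by blast
  obtain B2 where B2: "\<And>z. norm (\<phi>x z) \<le> B2" using bounded_compact_support[OF C1c_continuous(2)[OF \<phi>(1)] K z0(2)] by blast
  obtain B3 where B3: "\<And>z. norm (\<phi>y z) \<le> B3" using bounded_compact_support[OF C1c_continuous(3)[OF \<phi>(1)] K z0(3)] by blast
  note [measurable] = C1c_measurable[OF \<phi>(1)] sqint_meas[OF W(1)] sqint_meas[OF W(2)] sqint_meas[OF W(3)]
  have sm: "sqint (\<lambda>z. g z *\<^sub>R F z)" "nsq (\<lambda>z. g z *\<^sub>R F z) \<le> B\<^sup>2 * nsq F"
    if "\<And>z. norm (g z) \<le> B" "g \<in> borel_measurable borel" "sqint F" for g :: "complex \<Rightarrow> real" and F :: "complex \<Rightarrow> complex" and B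
    by (rule sqint_bound[OF that(3), of _ B]; use that sqint_meas[OF that(3)] in \<open>auto intro: mult_right_mono\<close>)+
  have lim: "(\<lambda>n. \<integral>z. wedge (a z) (g z *\<^sub>R b n z) \<partial>lborel) \<longlonglongrightarrow> (\<integral>z. wedge (a z) (g z *\<^sub>R c z) \<partial>lborel)"
    if g: "\<And>z. norm (g z) \<le> B" "g \<in> borel_measurable borel" and a: "sqint a" and b: "\<And>n. sqint (b n)" "sqint c" "(\<lambda>n. nsq (\<lambda>z. b n z - c z)) \<longlonglongrightarrow> 0"
    for g :: "complex \<Rightarrow> real" and B and a c :: "complex \<Rightarrow> complex" and b
  proof (rule wedge_tendsto[OF a sm(1)[OF g b(1)] sm(1)[OF g b(2)]])
    show "(\<lambda>n. nsq (\<lambda>z. g z *\<^sub>R b n z - g z *\<^sub>R c z)) \<longlonglongrightarrow> 0"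
    proof (rule tendsto_sandwich[OF _ _ tendsto_const])
      show "\<forall>\<^sub>F n in sequentially. nsq (\<lambda>z. g z *\<^sub>R b n z - g z *\<^sub>R c z) \<le> B\<^sup>2 * nsq (\<lambda>z. b n z - c z)"
        unfolding scaleR_diff_right[symmetric] by (intro always_eventually allI sm(2)[OF g] sqint_diff b)
      show "(\<lambda>n. B\<^sup>2 * nsq (\<lambda>z. b n z - c z)) \<longlonglongrightarrow> 0" using tendsto_mult[OF tendsto_const b(3), of "B\<^sup>2"] by simp
    qed (simp add: nsq_nonneg)
  qed
  define l where "l n = (\<integral>z. wedge (p z) (\<phi> z *\<^sub>R conv (msm n) q z) \<partial>lborel) - (\<integral>z. wedge (q z) (\<phi> z *\<^sub>R conv (msm n) p z) \<partial>lborel)" for n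
  define r where "r n = (\<integral>z. wedge (u z) (\<phi>y z *\<^sub>R conv (msm n) p z) \<partial>lborel) - (\<integral>z. wedge (u z) (\<phi>x z *\<^sub>R conv (msm n) q z) \<partial>lborel)" for n
  have EV: "\<forall>\<^sub>F n in sequentially. l n = r n"
    using smooth_wk_deriv[OF w K U(1) \<phi>(2)]
  proof eventually_elim
    case (elim n)
    define vx where "vx = conv (msmx n) u"
    define vy where "vy = conv (msmy n) u"
    define vxy where "vxy = conv (pderiv_dir \<i> (msmx n)) u"
    note Cx = C1c_mult[OF \<phi>(1) S(2)[of n, folded vx_def vxy_def] open_UNIV subset_UNIV]
    note Cy = C1c_mult[OF \<phi>(1) S(3)[of n, folded vy_def vxy_def] open_UNIV subset_UNIV]
    have eqs: "g z *\<^sub>R conv (msm n) p z = g z *\<^sub>R vx z" "g z *\<^sub>R conv (msm n) q z = g z *\<^sub>R vy z"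
      if "\<And>z. z \<notin> K \<Longrightarrow> g z = 0" for g :: "complex \<Rightarrow> real" and z
      using that[of z] elim by (cases "z \<in> K"; simp add: vx_def vy_def)+
    have sq: "sqint (\<lambda>z. \<phi> z *\<^sub>R vxy z)" "sqint (\<lambda>z. \<phi>x z *\<^sub>R vy z)" "sqint (\<lambda>z. \<phi>y z *\<^sub>R vx z)"
      using C1on_continuous[OF S(2)[of n]] C1on_continuous[OF S(3)[of n]] C1c_continuous[OF \<phi>(1), of UNIV] z0
      by (auto intro!: sqint_continuous[OF _ K] continuous_intros simp: vx_def vy_def vxy_def)
    have "(\<integral>z. wedge (u z) (\<phi>x z *\<^sub>R vy z) \<partial>lborel) + (\<integral>z. wedge (u z) (\<phi> z *\<^sub>R vxy z) \<partial>lborel) = - (\<integral>z. wedge (p z) (\<phi> z *\<^sub>R vy z) \<partial>lborel)"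
      using wk_wedge_test(1)[OF w Cy \<phi>(2)] wedge_integrable(1)[OF W(1) sq(2)] wedge_integrable(1)[OF W(1) sq(1)]
      by (simp only: wedge_linear(2)) simp
    moreover have "(\<integral>z. wedge (u z) (\<phi>y z *\<^sub>R vx z) \<partial>lborel) + (\<integral>z. wedge (u z) (\<phi> z *\<^sub>R vxy z) \<partial>lborel) = - (\<integral>z. wedge (q z) (\<phi> z *\<^sub>R vx z) \<partial>lborel)"
      using wk_wedge_test(2)[OF w Cx \<phi>(2)] wedge_integrable(1)[OF W(1) sq(3)] wedge_integrable(1)[OF W(1) sq(1)]
      by (simp only: wedge_linear(2)) simp
    moreover have E1: "\<phi> z *\<^sub>R conv (msm n) p z = \<phi> z *\<^sub>R vx z" "\<phi>y z *\<^sub>R conv (msm n) p z = \<phi>y z *\<^sub>R vx z" for z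
      by (rule eqs(1), erule z0)+
    moreover have E2: "\<phi> z *\<^sub>R conv (msm n) q z = \<phi> z *\<^sub>R vy z" "\<phi>x z *\<^sub>R conv (msm n) q z = \<phi>x z *\<^sub>R vy z" for z
      by (rule eqs(2), erule z0)+
    ultimately show ?case
      unfolding l_def r_def E1 E2 by linarith
  qed
  have T1: "l \<longlonglongrightarrow> (\<integral>z. wedge (p z) (\<phi> z *\<^sub>R q z) \<partial>lborel) - (\<integral>z. wedge (q z) (\<phi> z *\<^sub>R p z) \<partial>lborel)"
    unfolding l_def by (intro tendsto_diff lim[OF B1] W L) auto
  have T2: "r \<longlonglongrightarrow> (\<integral>z. wedge (u z) (\<phi>y z *\<^sub>R p z) \<partial>lborel) - (\<integral>z. wedge (u z) (\<phi>x z *\<^sub>R q z) \<partial>lborel)"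
    unfolding r_def by (intro tendsto_diff lim[OF B3] lim[OF B2] W L) auto
  have eq: "(\<integral>z. wedge (p z) (\<phi> z *\<^sub>R q z) \<partial>lborel) - (\<integral>z. wedge (q z) (\<phi> z *\<^sub>R p z) \<partial>lborel)
    = (\<integral>z. wedge (u z) (\<phi>y z *\<^sub>R p z) \<partial>lborel) - (\<integral>z. wedge (u z) (\<phi>x z *\<^sub>R q z) \<partial>lborel)"
    by (rule LIMSEQ_unique[OF Lim_transform_eventually[OF T1 EV] T2])
  have I: "integrable lborel (\<lambda>z. wedge (p z) (\<phi> z *\<^sub>R q z))" "integrable lborel (\<lambda>z. wedge (q z) (\<phi> z *\<^sub>R p z))"
    "integrable lborel (\<lambda>z. wedge (u z) (\<phi>y z *\<^sub>R p z))" "integrable lborel (\<lambda>z. wedge (u z) (\<phi>x z *\<^sub>R q z))"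
    by (intro wedge_integrable W sm(1)[OF B1] sm(1)[OF B2] sm(1)[OF B3]; measurable)+
  have "(\<integral>z. 2 * wedge (p z) (q z) * \<phi> z \<partial>lborel) = (\<integral>z. wedge (p z) (\<phi> z *\<^sub>R q z) - wedge (q z) (\<phi> z *\<^sub>R p z) \<partial>lborel)"
    by (rule Bochner_Integration.integral_cong) (auto simp: wedge_eq algebra_simps)
  also have "\<dots> = (\<integral>z. wedge (u z) (\<phi>y z *\<^sub>R p z) \<partial>lborel) - (\<integral>z. wedge (u z) (\<phi>x z *\<^sub>R q z) \<partial>lborel)"
    using I eq by simp
  also have "\<dots> = (\<integral>z. wedge (u z) (\<phi>y z *\<^sub>R p z) - wedge (u z) (\<phi>x z *\<^sub>R q z) \<partial>lborel)" using I by simp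
  also have "\<dots> = (\<integral>z. - (\<phi>x z * wedge (u z) (q z) - \<phi>y z * wedge (u z) (p z)) \<partial>lborel)"
    by (rule Bochner_Integration.integral_cong) (auto simp: wedge_linear(6))
  finally show ?thesis by (simp only: Bochner_Integration.integral_minus)
qed

lemma tendsto_integral_scaleR_right:
  fixes g :: "complex \<Rightarrow> real" and b :: "complex \<Rightarrow> complex"
  assumes g: "sqint g" and a: "\<And>n. sqint (a n)" "sqint b" "(\<lambda>n. nsq (\<lambda>z. a n z - b z)) \<longlonglongrightarrow> 0"
  shows "(\<lambda>n. \<integral>z. g z *\<^sub>R a n z \<partial>lborel) \<longlonglongrightarrow> (\<integral>z. g z *\<^sub>R b z \<partial>lborel)"
proof (rule Lim_transform2[OF tendsto_const])
  have i: "integrable lborel (\<lambda>z. g z *\<^sub>R F z)" if "sqint F" for F :: "complex \<Rightarrow> complex"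
    by (rule norm_integral_mult_le(1)[OF g that]) (use sqint_meas[OF g] sqint_meas[OF that] in auto)
  show "(\<lambda>n. (\<integral>z. g z *\<^sub>R b z \<partial>lborel) - (\<integral>z. g z *\<^sub>R a n z \<partial>lborel)) \<longlonglongrightarrow> 0"
  proof (rule Lim_null_comparison)
    show "\<forall>\<^sub>F n in sequentially. norm ((\<integral>z. g z *\<^sub>R b z \<partial>lborel) - (\<integral>z. g z *\<^sub>R a n z \<partial>lborel)) \<le> sqrt (nsq g * nsq (\<lambda>z. a n z - b z))"
    proof (intro always_eventually allI)
      fix n
      have d: "sqint (\<lambda>z. b z - a n z)" by (intro sqint_diff a)
      have "(\<integral>z. g z *\<^sub>R b z \<partial>lborel) - (\<integral>z. g z *\<^sub>R a n z \<partial>lborel) = (\<integral>z. g z *\<^sub>R (b z - a n z) \<partial>lborel)"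
        unfolding scaleR_diff_right by (intro Bochner_Integration.integral_diff[symmetric] i a)
      then show "norm ((\<integral>z. g z *\<^sub>R b z \<partial>lborel) - (\<integral>z. g z *\<^sub>R a n z \<partial>lborel)) \<le> sqrt (nsq g * nsq (\<lambda>z. a n z - b z))"
        using norm_integral_mult_le(2)[OF g d, of "\<lambda>z. g z *\<^sub>R (b z - a n z)"] sqint_meas[OF g] sqint_meas[OF d]
        by (simp add: nsq_minus_commute[of b])
    qed
    show "(\<lambda>n. sqrt (nsq g * nsq (\<lambda>z. a n z - b z))) \<longlonglongrightarrow> 0"
      using tendsto_real_sqrt[OF tendsto_mult[OF tendsto_const[of "nsq g"] a(3)]] by simp
  qed
qed

text \<open>The bound on the derivative makes composition with \<open>P\<close> act on \<open>H\<^sup>1\<close> without increasing the Dirichlet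
  energy, and \<open>P 0 = 0\<close> keeps the extension by zero.\<close>

locale contraction_C1 =
  fixes P :: "complex \<Rightarrow> complex" and DP :: "complex \<Rightarrow> complex \<Rightarrow> complex"
  assumes deriv: "(P has_derivative DP y) (at y)"
    and cont: "continuous_on UNIV (\<lambda>y. DP y w)"
    and le: "norm (DP y w) \<le> norm w"
    and zero: "P 0 = 0"
begin

lemma lipschitz: "norm (P a - P b) \<le> norm (a - b)"
proof -
  have "norm (P a - P b) \<le> 1 * norm (a - b)"
    by (rule differentiable_bound[of UNIV P DP]) (use deriv le in \<open>auto intro!: has_derivative_at_withinI onorm_bound\<close>)
  then show ?thesis by simp
qed

lemma norm_le: "norm (P a) \<le> norm a"
  using lipschitz[of a 0] zero by simp

lemma linear: "linear (DP y)"
  using deriv by (rule has_derivative_linear)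

lemma DP_eq: "DP y w = Re w *\<^sub>R DP y 1 + Im w *\<^sub>R DP y \<i>"
proof -
  have "w = Re w *\<^sub>R 1 + Im w *\<^sub>R \<i>" by (simp add: complex_eq_iff)
  then have "DP y w = DP y (Re w *\<^sub>R 1 + Im w *\<^sub>R \<i>)" by simp
  also have "\<dots> = Re w *\<^sub>R DP y 1 + Im w *\<^sub>R DP y \<i>" by (simp only: linear_add[OF linear] linear_scale[OF linear])
  finally show ?thesis .
qed

lemma P_cont: "continuous_on UNIV P"
  using deriv has_derivative_continuous by (blast intro: continuous_at_imp_continuous_on)

lemma measurable_P[measurable]: "P \<in> borel_measurable borel"
  by (intro borel_measurable_continuous_onI P_cont)

lemma measurable_DP:
  assumes [measurable]: "u \<in> borel_measurable borel" "p \<in> borel_measurable borel"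
  shows "(\<lambda>z. DP (u z) (p z)) \<in> borel_measurable borel"
proof -
  have [measurable]: "(\<lambda>y. DP y 1) \<in> borel_measurable borel" "(\<lambda>y. DP y \<i>) \<in> borel_measurable borel"
    by (intro borel_measurable_continuous_onI cont)+
  show ?thesis by (subst DP_eq) measurable
qed

lemma sqint_P: "sqint u \<Longrightarrow> sqint (\<lambda>z. P (u z))"
  by (rule sqint_bound(1)[of u _ 1]) (auto simp: norm_le intro: sqint_meas)

lemma sqint_DP: "sqint u \<Longrightarrow> sqint p \<Longrightarrow> sqint (\<lambda>z. DP (u z) (p z))"
  by (rule sqint_bound(1)[of p _ 1]) (auto simp: le intro: sqint_meas measurable_DP)

text \<open>Split off the difference \<open>p n - q\<close>, which \<open>DP\<close> does not enlarge; what remains has a fixed argument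
  \<open>q\<close> and tends to zero by dominated convergence.\<close>

lemma DP_tendsto:
  assumes u: "\<And>n. sqint (u n)" "sqint v" "AE z in lborel. (\<lambda>n. u n z) \<longlonglongrightarrow> v z"
    and p: "\<And>n. sqint (p n)" "sqint q" "(\<lambda>n. nsq (\<lambda>z. p n z - q z)) \<longlonglongrightarrow> 0"
  shows "(\<lambda>n. nsq (\<lambda>z. DP (u n z) (p n z) - DP (v z) (q z))) \<longlonglongrightarrow> 0"
proof -
  have A: "(\<lambda>n. nsq (\<lambda>z. DP (u n z) (q z) - DP (v z) (q z))) \<longlonglongrightarrow> 0"
  proof (rule nsq_tendsto_dominated(1))
    show "(\<lambda>z. DP (u n z) (q z) - DP (v z) (q z)) \<in> borel_measurable borel" for n
      by (intro borel_measurable_diff measurable_DP sqint_meas u p)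
    show "AE z in lborel. (\<lambda>n. DP (u n z) (q z) - DP (v z) (q z)) \<longlonglongrightarrow> 0"
      using u(3)
    proof eventually_elim
      case (elim z)
      have "(\<lambda>n. DP (u n z) (q z)) \<longlonglongrightarrow> DP (v z) (q z)"
        using elim cont[of "q z"] by (intro continuous_on_tendsto_compose[of UNIV "\<lambda>y. DP y (q z)"]) auto
      then show ?case by (simp add: LIM_zero)
    qed
    show "AE z in lborel. norm (DP (u n z) (q z) - DP (v z) (q z)) \<le> 2 * norm (q z)" for n
      using le by (intro AE_I2 order_trans[OF norm_triangle_ineq4]) (metis add_mono mult_2)
    show "integrable lborel (\<lambda>z. (2 * norm (q z))\<^sup>2)" using p(2) by (simp add: sqint_def power_mult_distrib)
    show "(\<lambda>z. 2 * norm (q z)) \<in> borel_measurable borel" using sqint_meas[OF p(2)] by measurable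
  qed
  show ?thesis
  proof (rule tendsto_sandwich[OF _ _ tendsto_const])
    show "\<forall>\<^sub>F n in sequentially. nsq (\<lambda>z. DP (u n z) (p n z) - DP (v z) (q z))
      \<le> 2 * nsq (\<lambda>z. p n z - q z) + 2 * nsq (\<lambda>z. DP (u n z) (q z) - DP (v z) (q z))"
    proof (intro always_eventually allI)
      fix n
      have pq: "sqint (\<lambda>z. p n z - q z)" by (intro sqint_diff p)
      have eq: "DP (u n z) (p n z) - DP (v z) (q z) = DP (u n z) (p n z - q z) + (DP (u n z) (q z) - DP (v z) (q z))" for z
        by (simp add: linear_diff[OF linear])
      have "nsq (\<lambda>z. DP (u n z) (p n z) - DP (v z) (q z)) \<le> 2 * nsq (\<lambda>z. DP (u n z) (p n z - q z)) + 2 * nsq (\<lambda>z. DP (u n z) (q z) - DP (v z) (q z))"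
        unfolding eq by (intro sqint_add(2) sqint_DP sqint_diff(1) u p pq)
      moreover have "nsq (\<lambda>z. DP (u n z) (p n z - q z)) \<le> nsq (\<lambda>z. p n z - q z)"
        using sqint_bound(2)[OF pq measurable_DP[OF sqint_meas[OF u(1)[of n]] sqint_meas[OF pq]], of 1] le by simp
      ultimately show "nsq (\<lambda>z. DP (u n z) (p n z) - DP (v z) (q z))
        \<le> 2 * nsq (\<lambda>z. p n z - q z) + 2 * nsq (\<lambda>z. DP (u n z) (q z) - DP (v z) (q z))" by linarith
    qed
    show "(\<lambda>n. 2 * nsq (\<lambda>z. p n z - q z) + 2 * nsq (\<lambda>z. DP (u n z) (q z) - DP (v z) (q z))) \<longlonglongrightarrow> 0"
      using tendsto_add[OF tendsto_mult[OF tendsto_const p(3), of 2] tendsto_mult[OF tendsto_const A, of 2]] by simp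
  qed (simp add: nsq_nonneg)
qed

lemma C1on_P:
  assumes v: "C1on UNIV v vx vy"
  shows "C1on UNIV (\<lambda>z. P (v z)) (\<lambda>z. DP (v z) (vx z)) (\<lambda>z. DP (v z) (vy z))"
  unfolding C1on_def
proof (intro conjI ballI)
  have c: "continuous_on UNIV (\<lambda>z. DP (v z) (w z))" if "continuous_on UNIV w" for w
    by (subst DP_eq) (intro continuous_intros that continuous_on_compose2[OF cont C1on_continuous(1)[OF v]]; simp)
  show "continuous_on UNIV (\<lambda>z. DP (v z) (vx z))" "continuous_on UNIV (\<lambda>z. DP (v z) (vy z))"
    by (intro c C1on_continuous[OF v])+
  fix z :: complex
  from has_derivative_compose[OF C1onD[OF v UNIV_I] deriv]
  show "((\<lambda>z. P (v z)) has_derivative (\<lambda>h. Re h *\<^sub>R DP (v z) (vx z) + Im h *\<^sub>R DP (v z) (vy z))) (at z)"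
    by (simp add: linear_add[OF linear] linear_scale[OF linear])
qed

text \<open>Apply the classical chain rule to the mollifications and pass to the limit along a subsequence that
  converges almost everywhere.\<close>

lemma chain_wk:
  assumes U: "open U" "bounded U" and w: "wk U u p q"
  shows "wk U (\<lambda>z. P (u z)) (\<lambda>z. DP (u z) (p z)) (\<lambda>z. DP (u z) (q z))"
  unfolding wk_def
proof (intro conjI allI impI)
  note W = wkD[OF w] and L = smooth_L2[OF U(2) w]
  show "sqint (\<lambda>z. P (u z))" "sqint (\<lambda>z. DP (u z) (p z))" "sqint (\<lambda>z. DP (u z) (q z))"
    by (intro sqint_P sqint_DP W)+
  fix z assume "z \<notin> U"
  then show "P (u z) = 0" "DP (u z) (p z) = 0" "DP (u z) (q z) = 0"
    using W zero linear_0[OF linear] by auto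
next
  note W = wkD[OF w] and L = smooth_L2[OF U(2) w]
  fix K and \<psi> \<psi>x \<psi>y :: "complex \<Rightarrow> real" assume \<psi>: "C1c K \<psi> \<psi>x \<psi>y \<and> K \<subseteq> U"
  then have z0: "\<And>z. z \<notin> K \<Longrightarrow> \<psi> z = 0" and K: "compact K" by (auto simp: C1c_def)
  note s\<psi> = C1c_sqint[OF conjunct1[OF \<psi>]]
  obtain r :: "nat \<Rightarrow> nat" where r: "strict_mono r" "AE z in lborel. (\<lambda>n. conv (msm (r n)) u z - u z) \<longlonglongrightarrow> 0"
    using nsq_AE_subseq[OF sqint_diff(1)[OF L(1) W(1)] L(4)] by blast
  have ae: "AE z in lborel. (\<lambda>n. conv (msm (r n)) u z) \<longlonglongrightarrow> u z"
    using r(2) by eventually_elim (simp add: LIM_zero_iff)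
  note bil = tendsto_integral_scaleR_right
  have Pu: "(\<lambda>n. nsq (\<lambda>z. P (conv (msm (r n)) u z) - P (u z))) \<longlonglongrightarrow> 0"
  proof (rule tendsto_sandwich[OF _ _ tendsto_const])
    show "\<forall>\<^sub>F n in sequentially. nsq (\<lambda>z. P (conv (msm (r n)) u z) - P (u z)) \<le> nsq (\<lambda>z. conv (msm (r n)) u z - u z)"
    proof (intro always_eventually allI)
      fix n
      show "nsq (\<lambda>z. P (conv (msm (r n)) u z) - P (u z)) \<le> nsq (\<lambda>z. conv (msm (r n)) u z - u z)"
        using sqint_bound(2)[where c = 1, OF sqint_diff(1)[OF L(1)[of "r n"] W(1)] sqint_meas[OF sqint_diff(1)[OF sqint_P[OF L(1)[of "r n"]] sqint_P[OF W(1)]]]] lipschitz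
        by simp
    qed
    show "(\<lambda>n. nsq (\<lambda>z. conv (msm (r n)) u z - u z)) \<longlonglongrightarrow> 0"
      using LIMSEQ_subseq_LIMSEQ[OF L(4) r(1)] by (simp add: o_def)
  qed (simp add: nsq_nonneg)
  have main: "(\<integral>z. \<psi>e z *\<^sub>R P (u z) \<partial>lborel) = - (\<integral>z. \<psi> z *\<^sub>R DP (u z) (pe z) \<partial>lborel)"
    if e: "\<psi>e = \<psi>x \<and> pe = p \<and> \<mu> = msmx \<or> \<psi>e = \<psi>y \<and> pe = q \<and> \<mu> = msmy" for \<psi>e pe \<mu>
  proof -
    have pe: "sqint pe" "\<And>n. sqint (conv (msm n) pe)" "(\<lambda>n. nsq (\<lambda>z. conv (msm n) pe z - pe z)) \<longlonglongrightarrow> 0" "sqint \<psi>e"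
      using e W L s\<psi> by auto
    have pr: "(\<lambda>n. nsq (\<lambda>z. conv (msm (r n)) pe z - pe z)) \<longlonglongrightarrow> 0"
      using LIMSEQ_subseq_LIMSEQ[OF pe(3) r(1)] by (simp add: o_def)
    have T1: "(\<lambda>n. \<integral>z. \<psi>e z *\<^sub>R P (conv (msm (r n)) u z) \<partial>lborel) \<longlonglongrightarrow> (\<integral>z. \<psi>e z *\<^sub>R P (u z) \<partial>lborel)"
      by (intro bil pe sqint_P L W Pu)
    have T2: "(\<lambda>n. - (\<integral>z. \<psi> z *\<^sub>R DP (conv (msm (r n)) u z) (conv (msm (r n)) pe z) \<partial>lborel)) \<longlonglongrightarrow> - (\<integral>z. \<psi> z *\<^sub>R DP (u z) (pe z) \<partial>lborel)"
      by (intro tendsto_minus bil s\<psi> sqint_DP L W pe DP_tendsto ae pr)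
    have EV: "\<forall>\<^sub>F n in sequentially. (\<integral>z. \<psi>e z *\<^sub>R P (conv (msm (r n)) u z) \<partial>lborel) = - (\<integral>z. \<psi> z *\<^sub>R DP (conv (msm (r n)) u z) (conv (msm (r n)) pe z) \<partial>lborel)"
      using eventually_subseq[OF r(1) smooth_wk_deriv[OF w K U(1) conjunct2[OF \<psi>]]]
    proof eventually_elim
      case (elim n)
      have "(\<integral>z. \<psi>e z *\<^sub>R P (conv (msm (r n)) u z) \<partial>lborel) = - (\<integral>z. \<psi> z *\<^sub>R DP (conv (msm (r n)) u z) (conv (\<mu> (r n)) u z) \<partial>lborel)"
        using C1_by_parts[OF conjunct1[OF \<psi>] C1on_P[OF smooth_wk(1)[OF U(2) w, of "r n"]] open_UNIV subset_UNIV] e by auto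
      also have "(\<lambda>z. \<psi> z *\<^sub>R DP (conv (msm (r n)) u z) (conv (\<mu> (r n)) u z)) = (\<lambda>z. \<psi> z *\<^sub>R DP (conv (msm (r n)) u z) (conv (msm (r n)) pe z))"
      proof (rule ext)
        fix z
        show "\<psi> z *\<^sub>R DP (conv (msm (r n)) u z) (conv (\<mu> (r n)) u z) = \<psi> z *\<^sub>R DP (conv (msm (r n)) u z) (conv (msm (r n)) pe z)"
          using z0[of z] elim e by (cases "z \<in> K") auto
      qed
      finally show ?case .
    qed
    show ?thesis by (rule LIMSEQ_unique[OF Lim_transform_eventually[OF T1 EV] T2])
  qed
  show "(\<integral>z. \<psi>x z *\<^sub>R P (u z) \<partial>lborel) = - (\<integral>z. \<psi> z *\<^sub>R DP (u z) (p z) \<partial>lborel)" by (rule main[of _ _ msmx]) simp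
  show "(\<integral>z. \<psi>y z *\<^sub>R P (u z) \<partial>lborel) = - (\<integral>z. \<psi> z *\<^sub>R DP (u z) (q z) \<partial>lborel)" by (rule main[of _ _ msmy]) simp
qed

end

section \<open>Extension by zero across a circle\<close>

text \<open>A \<open>C\<^sup>1\<close> replacement for the positive part, from which cutoffs with explicit derivatives are built.\<close>

definition pos2 :: "real \<Rightarrow> real" where "pos2 x = (max 0 x)\<^sup>2"

lemma pos2_deriv: "(pos2 has_real_derivative 2 * max 0 x) (at x)"
proof -
  consider "x > 0" | "x < 0" | "x = 0" by linarith
  then show ?thesis
  proof cases
    case 1
    have "((\<lambda>x. x\<^sup>2) has_real_derivative 2 * max 0 x) (at x)" using 1 by (auto intro!: derivative_eq_intros)
    then show ?thesis
      by (rule has_field_derivative_transform_within_open[of _ _ _ "{0<..}"]) (use 1 in \<open>auto simp: pos2_def\<close>)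
  next
    case 2
    have "((\<lambda>x. 0) has_real_derivative 2 * max 0 x) (at x)" using 2 by auto
    then show ?thesis
      by (rule has_field_derivative_transform_within_open[of _ _ _ "{..<0}"]) (use 2 in \<open>auto simp: pos2_def\<close>)
  next
    case 3
    have "((\<lambda>h. pos2 h / h) \<longlongrightarrow> 0) (at 0)"
    proof (rule Lim_null_comparison)
      show "\<forall>\<^sub>F h in at 0. norm (pos2 h / h) \<le> \<bar>h\<bar>"
        unfolding eventually_at_filter
        by (intro always_eventually) (auto simp: pos2_def max_def power2_eq_square)
      show "((\<lambda>h. \<bar>h\<bar>) \<longlongrightarrow> 0) (at (0::real))" by (auto intro!: tendsto_eq_intros)
    qed
    then show ?thesis using 3 by (simp add: has_field_derivative_iff pos2_def)
  qed
qed

text \<open>The second derivative is \<open>4\<close> on \<open>(0, 1/2)\<close> and \<open>-4\<close> on \<open>(1/2, 1)\<close>, which is what makes it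
  a \<open>C\<^sup>1\<close> step from \<open>0\<close> to \<open>1\<close>.\<close>

definition smoothstep :: "real \<Rightarrow> real" where
  "smoothstep x = 2 * pos2 x - 4 * pos2 (x - 1 / 2) + 2 * pos2 (x - 1)"

definition smoothstep' :: "real \<Rightarrow> real" where
  "smoothstep' x = 4 * max 0 x - 8 * max 0 (x - 1 / 2) + 4 * max 0 (x - 1)"

lemma smoothstep_deriv: "(smoothstep has_real_derivative smoothstep' x) (at x)"
proof -
  have "((\<lambda>x. pos2 (x - c)) has_real_derivative 2 * max 0 (x - c)) (at x)" for c
  proof -
    have "((\<lambda>x. x - c) has_real_derivative 1) (at x)" by (auto intro!: derivative_eq_intros)
    from DERIV_chain'[OF this pos2_deriv] show ?thesis by simp
  qed
  note D = this[of "1/2"] this[of 1] pos2_deriv[of x]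
  show ?thesis unfolding smoothstep_def smoothstep'_def
    using D by (auto intro!: derivative_eq_intros)
qed

lemma smoothstep_0: "x \<le> 0 \<Longrightarrow> smoothstep x = 0" "x \<le> 0 \<Longrightarrow> smoothstep' x = 0"
  by (simp_all add: smoothstep_def smoothstep'_def pos2_def)

lemma smoothstep_1: "x \<ge> 1 \<Longrightarrow> smoothstep x = 1" "x \<ge> 1 \<Longrightarrow> smoothstep' x = 0"
  by (simp_all add: smoothstep_def smoothstep'_def pos2_def power2_eq_square algebra_simps)

lemma smoothstep'_bound: "\<bar>smoothstep' x\<bar> \<le> 2"
  by (auto simp: smoothstep'_def max_def)

lemma smoothstep_bound: "0 \<le> smoothstep x" "smoothstep x \<le> 1"
proof -
  consider "x \<le> 0" | "0 < x" "x \<le> 1/2" | "1/2 < x" "x < 1" | "x \<ge> 1" by linarith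
  then have "0 \<le> smoothstep x \<and> smoothstep x \<le> 1"
  proof cases
    case 2
    have "x\<^sup>2 \<le> (1/2)\<^sup>2" using 2 by (intro power_mono) auto
    then show ?thesis using 2 by (simp add: smoothstep_def pos2_def power2_eq_square)
  next
    case 3
    have eq: "smoothstep x = 1 - 2 * (1 - x)\<^sup>2"
      using 3 by (simp add: smoothstep_def pos2_def power2_eq_square algebra_simps)
    have "(1 - x)\<^sup>2 \<le> (1/2)\<^sup>2" using 3 by (intro power_mono) auto
    then show ?thesis unfolding eq by (simp add: power2_eq_square)
  qed (simp_all add: smoothstep_0 smoothstep_1)
  then show "0 \<le> smoothstep x" "smoothstep x \<le> 1" by auto
qed

lemma C1on_norm_sq: "C1on UNIV (\<lambda>z. k * (c - (norm z)\<^sup>2) - 1) (\<lambda>z. - 2 * k * Re z) (\<lambda>z. - 2 * k * Im z)"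
  unfolding C1on_def cmod_power2
  by (auto intro!: derivative_eq_intros continuous_intros simp: algebra_simps)

text \<open>A radial cutoff that vanishes near the circle of radius \<open>R\<close> and outside it, and increases to \<open>1\<close> inside across the layer
  where \<open>R\<^sup>2 - (norm z)\<^sup>2\<close> lies between \<open>1 / k\<close> and \<open>2 / k\<close>. Working with the square of the
  radius keeps it differentiable at the origin and gives the layer an area independent of \<open>R\<close>.\<close>

definition rcut :: "real \<Rightarrow> real \<Rightarrow> complex \<Rightarrow> real" where
  "rcut R k z = smoothstep (k * (R\<^sup>2 - (norm z)\<^sup>2) - 1)"

definition rcutx :: "real \<Rightarrow> real \<Rightarrow> complex \<Rightarrow> real" where
  "rcutx R k z = smoothstep' (k * (R\<^sup>2 - (norm z)\<^sup>2) - 1) * (- 2 * k * Re z)"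

definition rcuty :: "real \<Rightarrow> real \<Rightarrow> complex \<Rightarrow> real" where
  "rcuty R k z = smoothstep' (k * (R\<^sup>2 - (norm z)\<^sup>2) - 1) * (- 2 * k * Im z)"

lemma C1on_rcut: "C1on UNIV (rcut R k) (rcutx R k) (rcuty R k)"
  unfolding rcut_def[abs_def] rcutx_def[abs_def] rcuty_def[abs_def]
  by (rule C1on_compose_real[OF smoothstep_deriv _ C1on_norm_sq])
     (auto simp: smoothstep'_def intro!: continuous_intros)

text \<open>With the cutoff, a test function that crosses the outer circle becomes one supported in the annulus.\<close>

lemma rcut_C1c:
  fixes \<psi> :: "complex \<Rightarrow> real"
  assumes \<psi>: "C1c K \<psi> \<psi>x \<psi>y" and K: "K \<subseteq> annulus R1 S" and R: "0 < R" and k: "k > 0"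
  shows "C1c (K \<inter> {z. (norm z)\<^sup>2 \<le> R\<^sup>2 - 1 / k}) (\<lambda>z. \<psi> z * rcut R k z)
    (\<lambda>z. \<psi>x z * rcut R k z + \<psi> z * rcutx R k z) (\<lambda>z. \<psi>y z * rcut R k z + \<psi> z * rcuty R k z)"
    and "K \<inter> {z. (norm z)\<^sup>2 \<le> R\<^sup>2 - 1 / k} \<subseteq> annulus R1 R"
proof -
  have M: "C1c K (\<lambda>z. \<psi> z * rcut R k z)
    (\<lambda>z. \<psi>x z * rcut R k z + \<psi> z * rcutx R k z) (\<lambda>z. \<psi>y z * rcut R k z + \<psi> z * rcuty R k z)"
    using C1c_mult[OF \<psi> C1on_rcut[of R k] open_UNIV subset_UNIV] by simp
  have out: "rcut R k z = 0 \<and> rcutx R k z = 0 \<and> rcuty R k z = 0" if "\<not> (norm z)\<^sup>2 \<le> R\<^sup>2 - 1 / k" for z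
  proof -
    have "k * (R\<^sup>2 - (norm z)\<^sup>2) \<le> k * (1 / k)" using that k by (intro mult_left_mono) auto
    then have "k * (R\<^sup>2 - (norm z)\<^sup>2) - 1 \<le> 0" using k by simp
    then show ?thesis by (simp add: rcut_def rcutx_def rcuty_def smoothstep_0)
  qed
  have "closed {z::complex. (norm z)\<^sup>2 \<le> R\<^sup>2 - 1 / k}" by (intro closed_Collect_le continuous_intros)
  moreover have "compact K" using \<psi> by (simp add: C1c_def)
  ultimately have "compact (K \<inter> {z. (norm z)\<^sup>2 \<le> R\<^sup>2 - 1 / k})" by (rule compact_Int_closed[rotated])
  moreover have "\<psi> z * rcut R k z = 0 \<and> \<psi>x z * rcut R k z + \<psi> z * rcutx R k z = 0 \<and> \<psi>y z * rcut R k z + \<psi> z * rcuty R k z = 0"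
    if "z \<notin> K \<inter> {z. (norm z)\<^sup>2 \<le> R\<^sup>2 - 1 / k}" for z
    using that out[of z] \<psi> by (cases "z \<in> K") (auto simp: C1c_def)
  ultimately show "C1c (K \<inter> {z. (norm z)\<^sup>2 \<le> R\<^sup>2 - 1 / k}) (\<lambda>z. \<psi> z * rcut R k z)
    (\<lambda>z. \<psi>x z * rcut R k z + \<psi> z * rcutx R k z) (\<lambda>z. \<psi>y z * rcut R k z + \<psi> z * rcuty R k z)"
    using M unfolding C1c_def by blast
  show "K \<inter> {z. (norm z)\<^sup>2 \<le> R\<^sup>2 - 1 / k} \<subseteq> annulus R1 R"
  proof
    fix z assume z: "z \<in> K \<inter> {z. (norm z)\<^sup>2 \<le> R\<^sup>2 - 1 / k}"
    have "1 / k > 0" using k by simp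
    moreover have "(norm z)\<^sup>2 \<le> R\<^sup>2 - 1 / k" using z by blast
    ultimately have "(norm z)\<^sup>2 < R\<^sup>2" by linarith
    then have "norm z < R" using R by (auto intro: power_less_imp_less_base)
    then show "z \<in> annulus R1 R" using z K by (auto simp: annulus_def)
  qed
qed

lemma closure_annulus:
  assumes "0 < R1" "R1 < R2"
  shows "closure (annulus R1 R2) \<subseteq> cball 0 R2" "sphere 0 R2 \<subseteq> closure (annulus R1 R2)"
    "compact (closure (annulus R1 R2))"
proof -
  show *: "closure (annulus R1 R2) \<subseteq> cball 0 R2" by (rule closure_minimal) (auto simp: annulus_def)
  then show "compact (closure (annulus R1 R2))" by (metis bounded_cball bounded_subset closed_closure compact_eq_bounded_closed)
  show "sphere 0 R2 \<subseteq> closure (annulus R1 R2)"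
  proof
    fix z :: complex assume z: "z \<in> sphere 0 R2"
    show "z \<in> closure (annulus R1 R2)"
      unfolding closure_approachable
    proof (intro allI impI)
      fix e :: real assume e: "e > 0"
      define r where "r = max ((R1 + R2) / 2) (R2 - e / 2)"
      have "(R1 + R2) / 2 \<le> r" "R2 - e / 2 \<le> r" by (simp_all add: r_def)
      moreover have "r < R2" using assms e by (simp add: r_def)
      moreover have "R1 < (R1 + R2) / 2" "R2 - e / 2 > R2 - e" using assms e by (auto simp: field_simps)
      ultimately have r: "R1 < r" "r < R2" "R2 - r < e" by auto
      have "norm (of_real (r / R2) * z) = r" using z r assms by (simp add: norm_mult norm_divide)
      moreover have "dist (of_real (r / R2) * z) z = R2 - r"
      proof -
        have "of_real (r / R2) * z - z = of_real (r / R2 - 1) * z" by (simp add: algebra_simps)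
        then have "dist (of_real (r / R2) * z) z = \<bar>r / R2 - 1\<bar> * R2" using z by (simp add: dist_norm norm_mult del: of_real_diff)
        also have "\<dots> = R2 - r" using r assms by (simp add: abs_if field_simps)
        finally show ?thesis .
      qed
      ultimately show "\<exists>y\<in>annulus R1 R2. dist y z < e"
        using r by (intro bexI[of _ "of_real (r / R2) * z"]) (auto simp: annulus_def)
    qed
  qed
qed

lemma annulus_open: "open (annulus R1 R2)" and annulus_bounded: "bounded (annulus R1 R2)"
  by (auto simp: annulus_def intro: bounded_subset[OF bounded_ball])

lemma annulus_iff: "z \<in> annulus r R \<longleftrightarrow> r < norm z \<and> norm z < R"
  by (auto simp: annulus_def)

text \<open>The mass of a thin layer below the circle is controlled by the values on the circle: by uniform continuity they
  change by at most \<open>\<omega>\<close> across the layer, and each ray carries the mass \<open>1 / (2 * k)\<close>.\<close>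

lemma layer_estimate:
  fixes f :: "complex \<Rightarrow> complex"
  assumes R: "0 < R1" "R1 < R2" and F: "continuous_on (closure (annulus R1 R2)) F" and \<omega>: "\<omega> > 0"
    and f: "f \<in> borel_measurable borel" "\<forall>z\<in>annulus R1 R2. f z = F z"
  defines "I \<equiv> (\<integral>t. indicator angles t * norm (F (of_real R2 * cis t)) \<partial>lborel)"
  shows "\<forall>\<^sub>F k::nat in sequentially.
    (\<integral>\<^sup>+z. ennreal (norm (f z)) * indicator {z. 1 / k \<le> R2\<^sup>2 - (norm z)\<^sup>2 \<and> R2\<^sup>2 - (norm z)\<^sup>2 \<le> 2 / k} z \<partial>lborel)
      \<le> ennreal ((I + 2 * pi * \<omega>) / (2 * k))"
proof -
  note [measurable] = f(1)
  have "uniformly_continuous_on (closure (annulus R1 R2)) F"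
    by (intro compact_uniformly_continuous F closure_annulus R)
  then obtain e where e: "e > 0" "\<And>x y. x \<in> closure (annulus R1 R2) \<Longrightarrow> y \<in> closure (annulus R1 R2) \<Longrightarrow> dist y x < e \<Longrightarrow> dist (F y) (F x) < \<omega>"
    using \<omega> unfolding uniformly_continuous_on_def by metis
  have mF: "(\<lambda>t. F (of_real R2 * cis t)) \<in> borel_measurable borel"
    using R closure_annulus(2)[OF R]
    by (intro borel_measurable_continuous_onI continuous_on_compose2[OF F] continuous_intros) (auto simp: norm_mult)
  note [measurable] = mF
  have iF: "integrable lborel (\<lambda>t. indicator angles t * norm (F (of_real R2 * cis t)))"
  proof -
    have "integrable lborel (\<lambda>t. indicator {-pi/2..3*pi/2} t *\<^sub>R norm (F (of_real R2 * cis t)))"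
      using R closure_annulus(2)[OF R]
      by (intro borel_integrable_compact continuous_on_norm continuous_on_compose2[OF F] continuous_intros) (auto simp: norm_mult)
    then show ?thesis
      by (rule Bochner_Integration.integrable_bound) (auto simp: indicator_def)
  qed
  have "R2\<^sup>2 - R1\<^sup>2 > 0" using R by (simp add: power_strict_mono)
  then have "\<forall>\<^sub>F k::nat in sequentially. 2 / real k < R2\<^sup>2 - R1\<^sup>2"
    using order_tendstoD(2)[OF lim_const_over_n[of "2::real"]] by simp
  moreover have "e * R2 > 0" using e R by simp
  then have "\<forall>\<^sub>F k::nat in sequentially. 2 / real k < e * R2"
    using order_tendstoD(2)[OF lim_const_over_n[of "2::real"]] by simp
  ultimately show ?thesis using eventually_gt_at_top[of 0]
  proof eventually_elim
    case (elim k)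
    then have k: "real k > 0" by simp
    define L where "L = {z::complex. 1 / k \<le> R2\<^sup>2 - (norm z)\<^sup>2 \<and> R2\<^sup>2 - (norm z)\<^sup>2 \<le> 2 / k}"
    have [measurable]: "L \<in> sets borel" unfolding L_def by measurable
    define r1 where "r1 = sqrt (R2\<^sup>2 - 2 / k)"
    define r2 where "r2 = sqrt (R2\<^sup>2 - 1 / k)"
    have pos: "R2\<^sup>2 - 2 / k > R1\<^sup>2" using elim by simp
    then have pos': "R2\<^sup>2 - 2 / k > 0" by (smt (verit) zero_le_power2)
    have kk: "1 / real k \<le> 2 / real k" using k by (simp add: divide_right_mono)
    have rr: "r1\<^sup>2 = R2\<^sup>2 - 2 / k" "r2\<^sup>2 = R2\<^sup>2 - 1 / k" "0 < r1" "r1 \<le> r2"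
      using pos' kk by (auto simp: r1_def r2_def)
    have inL: "r1 \<le> r \<and> r \<le> r2 \<and> rcis r t \<in> annulus R1 R2 \<and> norm (F (rcis r t)) \<le> norm (F (of_real R2 * cis t)) + \<omega>"
      if r: "r > 0" "rcis r t \<in> L" for r t
    proof -
      have n: "norm (rcis r t) = r" using r by simp
      have L: "r\<^sup>2 \<le> r2\<^sup>2" "r1\<^sup>2 \<le> r\<^sup>2" using r(2) rr n by (auto simp: L_def)
      have a: "r1 \<le> r" "r \<le> r2"
        by (rule power2_le_imp_le[OF L(2)], use r in simp) (rule power2_le_imp_le[OF L(1)], use rr in simp)
      have "R1\<^sup>2 < r\<^sup>2" using L rr pos by linarith
      then have R1r: "R1 < r" using r by (auto intro: power_less_imp_less_base)
      have "1 / real k > 0" using k by simp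
      then have "r\<^sup>2 < R2\<^sup>2" using L rr by linarith
      then have rR2: "r < R2" using R by (auto intro: power_less_imp_less_base)
      have A: "rcis r t \<in> annulus R1 R2" using R1r rR2 n by (simp add: annulus_iff)
      have "(R2 - r) * R2 \<le> (R2 - r) * (R2 + r)" using r rR2 by (intro mult_left_mono) auto
      also have "\<dots> = R2\<^sup>2 - r\<^sup>2" by (simp add: power2_eq_square algebra_simps)
      also have "\<dots> \<le> 2 / k" using L rr by linarith
      also have "\<dots> < e * R2" using elim by simp
      finally have "R2 - r < e" using R by simp
      moreover have "dist (rcis r t) (of_real R2 * cis t) = R2 - r"
      proof -
        have "rcis r t - of_real R2 * cis t = of_real (r - R2) * cis t" by (simp add: rcis_def algebra_simps)
        then show ?thesis using rR2 by (simp add: dist_norm norm_mult del: of_real_diff)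
      qed
      moreover have "of_real R2 * cis t \<in> closure (annulus R1 R2)" using closure_annulus(2)[OF R] R by (auto simp: norm_mult)
      ultimately have "dist (F (rcis r t)) (F (of_real R2 * cis t)) < \<omega>"
        using A closure_subset by (intro e(2)) auto
      then have "norm (F (rcis r t)) \<le> norm (F (of_real R2 * cis t)) + \<omega>"
        using norm_triangle_sub[of "F (rcis r t)" "F (of_real R2 * cis t)"] by (simp add: dist_norm)
      then show ?thesis using a A by simp
    qed
    have "(\<integral>\<^sup>+z. ennreal (norm (f z)) * indicator L z \<partial>lborel)
      = (\<integral>\<^sup>+t. indicator angles t * (\<integral>\<^sup>+r. ennreal r * indicator {0<..} r * (ennreal (norm (f (rcis r t))) * indicator L (rcis r t)) \<partial>lborel) \<partial>lborel)"
      by (rule nn_integral_polar) measurable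
    also have "\<dots> \<le> (\<integral>\<^sup>+t. indicator angles t * (ennreal (norm (F (of_real R2 * cis t)) + \<omega>) * ennreal (1 / (2 * k))) \<partial>lborel)"
    proof (intro nn_integral_mono mult_left_mono)
      fix t
      have "(\<integral>\<^sup>+r. ennreal r * indicator {0<..} r * (ennreal (norm (f (rcis r t))) * indicator L (rcis r t)) \<partial>lborel)
        \<le> (\<integral>\<^sup>+r. ennreal (norm (F (of_real R2 * cis t)) + \<omega>) * (ennreal r * indicator {r1..r2} r) \<partial>lborel)"
      proof (rule nn_integral_mono)
        fix r
        show "ennreal r * indicator {0<..} r * (ennreal (norm (f (rcis r t))) * indicator L (rcis r t))
          \<le> ennreal (norm (F (of_real R2 * cis t)) + \<omega>) * (ennreal r * indicator {r1..r2} r)"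
        proof (cases "r > 0 \<and> rcis r t \<in> L")
          case True
          then show ?thesis using inL[of r t] bspec[OF f(2), of "rcis r t"]
            by (auto simp: mult.commute[of _ "ennreal r"] mult.commute[of _ "of_real R2"] intro!: mult_left_mono ennreal_leI)
        qed (auto simp: indicator_def)
      qed
      also have "\<dots> = ennreal (norm (F (of_real R2 * cis t)) + \<omega>) * (\<integral>\<^sup>+r. ennreal r * indicator {r1..r2} r \<partial>lborel)"
        by (rule nn_integral_cmult) measurable
      also have "(\<integral>\<^sup>+r. ennreal r * indicator {r1..r2} r \<partial>lborel) = ennreal (r2\<^sup>2 / 2 - r1\<^sup>2 / 2)"
        by (rule nn_integral_FTC_Icc) (use rr in \<open>auto intro!: derivative_eq_intros\<close>)
      also have "r2\<^sup>2 / 2 - r1\<^sup>2 / 2 = 1 / (2 * k)" unfolding rr using k by (simp add: field_simps)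
      finally show "(\<integral>\<^sup>+r. ennreal r * indicator {0<..} r * (ennreal (norm (f (rcis r t))) * indicator L (rcis r t)) \<partial>lborel)
        \<le> ennreal (norm (F (of_real R2 * cis t)) + \<omega>) * ennreal (1 / (2 * k))" .
    qed auto
    also have "\<dots> = (\<integral>\<^sup>+t. ennreal (1 / (2 * k)) * ennreal (indicator angles t * norm (F (of_real R2 * cis t)) + \<omega> * indicator angles t) \<partial>lborel)"
      using \<omega> by (intro nn_integral_cong) (auto simp: indicator_def mult.commute)
    also have "\<dots> = ennreal (1 / (2 * k)) * (\<integral>\<^sup>+t. ennreal (indicator angles t * norm (F (of_real R2 * cis t)) + \<omega> * indicator angles t) \<partial>lborel)"
      by (rule nn_integral_cmult) measurable
    also have "(\<integral>\<^sup>+t. ennreal (indicator angles t * norm (F (of_real R2 * cis t)) + \<omega> * indicator angles t) \<partial>lborel)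
      = ennreal (\<integral>t. indicator angles t * norm (F (of_real R2 * cis t)) + \<omega> * indicator angles t \<partial>lborel)"
    proof (rule nn_integral_eq_integral)
      show "integrable lborel (\<lambda>t. indicator angles t * norm (F (of_real R2 * cis t)) + \<omega> * indicator angles t)"
        using iF by (intro Bochner_Integration.integrable_add) auto
    qed (use \<omega> in \<open>auto simp: indicator_def\<close>)
    also have "(\<integral>t. indicator angles t * norm (F (of_real R2 * cis t)) + \<omega> * indicator angles t \<partial>lborel) = I + \<omega> * (2 * pi)"
      using iF by (simp add: I_def)
    also have "ennreal (1 / (2 * k)) * ennreal (I + \<omega> * (2 * pi)) = ennreal ((I + 2 * pi * \<omega>) / (2 * k))"
      using k \<omega> by (subst ennreal_mult[symmetric]) (auto simp: I_def intro!: add_nonneg_nonneg simp: mult.commute mult.left_commute)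
    finally show ?case unfolding L_def by simp
  qed
qed

text \<open>Test with \<open>\<psi>\<close> times the cutoff. The derivative of the cutoff is of size \<open>k\<close>
  on a layer of area of order \<open>1 / k\<close>, so the defect in the integration by parts is bounded by the boundary values alone.\<close>

lemma boundary_estimate:
  fixes \<psi> :: "complex \<Rightarrow> real"
  assumes R: "0 < R1" "R1 < R2" and F: "continuous_on (closure (annulus R1 R2)) F"
    and w: "wk (annulus R1 R2) (\<lambda>z. if z \<in> annulus R1 R2 then F z else 0) p q"
    and \<psi>: "C1c K \<psi> \<psi>x \<psi>y" "K \<subseteq> annulus R1 S" and M: "\<And>z. \<bar>\<psi> z\<bar> \<le> M"
    and e: "\<psi>e = \<psi>x \<and> pe = p \<and> \<chi>e = rcutx \<or> \<psi>e = \<psi>y \<and> pe = q \<and> \<chi>e = rcuty"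
  defines "I \<equiv> (\<integral>t. indicator angles t * norm (F (of_real R2 * cis t)) \<partial>lborel)"
  defines "f \<equiv> (\<lambda>z. if z \<in> annulus R1 R2 then F z else 0)"
  shows "norm ((\<integral>z. \<psi>e z *\<^sub>R f z \<partial>lborel) + (\<integral>z. \<psi> z *\<^sub>R pe z \<partial>lborel)) \<le> 2 * M * R2 * I"
proof -
  note W = wkD[OF w[folded f_def]]
  note [measurable] = sqint_meas[OF W(1)]
  have pe: "sqint pe" "\<And>z. z \<notin> annulus R1 R2 \<Longrightarrow> pe z = 0" and s\<psi>: "sqint \<psi>e" "sqint \<psi>"
    using e W C1c_sqint[OF \<psi>(1)] by auto
  note [measurable] = sqint_meas[OF pe(1)] sqint_meas[OF s\<psi>(1)] sqint_meas[OF s\<psi>(2)]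
  have rm: "rcut R2 k \<in> borel_measurable borel" "\<chi>e R2 k \<in> borel_measurable borel" for k
    using C1on_continuous[OF C1on_rcut] e by (auto intro!: borel_measurable_continuous_onI)
  note [measurable] = rm
  have fF: "\<forall>z\<in>annulus R1 R2. f z = F z" by (simp add: f_def)
  have M0: "M \<ge> 0" using M[of 0] by linarith
  have I0: "I \<ge> 0" unfolding I_def by (intro integral_nonneg_AE) auto
  have i: "integrable lborel (\<lambda>z. g z *\<^sub>R G z)" if "sqint g" "sqint G" for g :: "complex \<Rightarrow> real" and G :: "complex \<Rightarrow> complex"
    by (rule norm_integral_mult_le(1)[OF that]) (use sqint_meas[OF that(1)] sqint_meas[OF that(2)] in auto)
  have sc: "sqint (\<lambda>z. g z * rcut R2 k z)" if "sqint g" for g k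
    by (rule sqint_bound(1)[OF that, of _ 1])
       (use sqint_meas[OF that] rm(1)[of k] smoothstep_bound in
         \<open>auto simp: abs_mult mult_left_le rcut_def intro: borel_measurable_times[OF sqint_meas[OF that] rm(1)[of k, unfolded rcut_def[abs_def]]]\<close>)
  have lim: "(\<lambda>k. \<integral>z. (g z * rcut R2 (real k) z) *\<^sub>R G z \<partial>lborel) \<longlonglongrightarrow> (\<integral>z. g z *\<^sub>R G z \<partial>lborel)"
    if g: "sqint g" and G: "sqint G" "\<And>z. z \<notin> annulus R1 R2 \<Longrightarrow> G z = 0" for g :: "complex \<Rightarrow> real" and G :: "complex \<Rightarrow> complex"
  proof (rule integral_dominated_convergence[where w = "\<lambda>z. norm (g z) * norm (G z)"])
    note [measurable] = sqint_meas[OF g] sqint_meas[OF G(1)]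
    show "integrable lborel (\<lambda>z. norm (g z) * norm (G z))" by (rule integrable_norm_mult[OF g G(1)])
    show "AE z in lborel. norm ((g z * rcut R2 (real k) z) *\<^sub>R G z) \<le> norm (g z) * norm (G z)" for k
      using smoothstep_bound by (intro AE_I2) (auto simp: rcut_def abs_mult intro!: mult_right_mono mult_left_le)
    show "AE z in lborel. (\<lambda>k. (g z * rcut R2 (real k) z) *\<^sub>R G z) \<longlonglongrightarrow> g z *\<^sub>R G z"
    proof (rule AE_I2)
      fix z
      show "(\<lambda>k. (g z * rcut R2 (real k) z) *\<^sub>R G z) \<longlonglongrightarrow> g z *\<^sub>R G z"
      proof (cases "z \<in> annulus R1 R2")
        case True
        then have p: "R2\<^sup>2 - (norm z)\<^sup>2 > 0" by (simp add: annulus_iff power_strict_mono)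
        then have "\<forall>\<^sub>F k::nat in sequentially. 2 / real k < R2\<^sup>2 - (norm z)\<^sup>2"
          using order_tendstoD(2)[OF lim_const_over_n[of "2::real"]] by simp
        then have "\<forall>\<^sub>F k::nat in sequentially. real k * (R2\<^sup>2 - (norm z)\<^sup>2) - 1 \<ge> 1"
          using eventually_gt_at_top[of 0] by eventually_elim (simp add: divide_less_eq mult.commute)
        then have "\<forall>\<^sub>F k in sequentially. (g z * rcut R2 (real k) z) *\<^sub>R G z = g z *\<^sub>R G z"
          by eventually_elim (simp add: rcut_def smoothstep_1)
        then show ?thesis by (rule tendsto_eventually)
      qed (simp add: G)
    qed
    show "(\<lambda>z. g z *\<^sub>R G z) \<in> borel_measurable lborel" "(\<lambda>z. (g z * rcut R2 (real k) z) *\<^sub>R G z) \<in> borel_measurable lborel" for k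
      by measurable
  qed
  have sx: "sqint (\<lambda>z. \<psi> z * \<chi>e R2 k z)" for k
  proof -
    have "continuous_on UNIV (\<lambda>z. \<psi> z * \<chi>e R2 k z)"
      using C1c_continuous[OF \<psi>(1), of UNIV] C1on_continuous[OF C1on_rcut] e by (auto intro!: continuous_intros)
    moreover have "compact K" "\<And>z. z \<notin> K \<Longrightarrow> \<psi> z = 0" using \<psi> by (auto simp: C1c_def)
    ultimately show ?thesis by (intro sqint_continuous[of _ K]) auto
  qed
  have id: "(\<integral>z. (\<psi>e z * rcut R2 k z) *\<^sub>R f z \<partial>lborel) + (\<integral>z. (\<psi> z * rcut R2 k z) *\<^sub>R pe z \<partial>lborel)
      = - (\<integral>z. (\<psi> z * \<chi>e R2 k z) *\<^sub>R f z \<partial>lborel)" if k: "k > 0" for k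
  proof -
    have R2: "0 < R2" using R by simp
    have "(\<integral>z. (\<psi>e z * rcut R2 k z + \<psi> z * \<chi>e R2 k z) *\<^sub>R f z \<partial>lborel) = - (\<integral>z. (\<psi> z * rcut R2 k z) *\<^sub>R pe z \<partial>lborel)"
      using W(7)[OF rcut_C1c[OF \<psi> R2 k]] W(8)[OF rcut_C1c[OF \<psi> R2 k]] e by auto
    moreover have "(\<integral>z. (\<psi>e z * rcut R2 k z + \<psi> z * \<chi>e R2 k z) *\<^sub>R f z \<partial>lborel)
      = (\<integral>z. (\<psi>e z * rcut R2 k z) *\<^sub>R f z \<partial>lborel) + (\<integral>z. (\<psi> z * \<chi>e R2 k z) *\<^sub>R f z \<partial>lborel)"
      unfolding scaleR_add_left by (intro Bochner_Integration.integral_add i sc sx s\<psi> W)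
    ultimately show ?thesis by (simp add: algebra_simps eq_neg_iff_add_eq_0)
  qed
  have bound: "\<forall>\<^sub>F k in sequentially. norm (\<integral>z. (\<psi> z * \<chi>e R2 (real k) z) *\<^sub>R f z \<partial>lborel) \<le> 2 * M * R2 * (I + 2 * pi * \<omega>)"
    if \<omega>: "\<omega> > 0" for \<omega>
    using layer_estimate[OF R F \<omega> sqint_meas[OF W(1)] fF, folded I_def] eventually_gt_at_top[of 0]
  proof eventually_elim
    case (elim k)
    then have k: "real k > 0" by simp
    let ?L = "{z. 1 / k \<le> R2\<^sup>2 - (norm z)\<^sup>2 \<and> R2\<^sup>2 - (norm z)\<^sup>2 \<le> 2 / k}"
    have le: "ennreal (norm ((\<psi> z * \<chi>e R2 (real k) z) *\<^sub>R f z)) \<le> ennreal (4 * M * k * R2) * (ennreal (norm (f z)) * indicator ?L z)" for z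
    proof (cases "z \<in> annulus R1 R2 \<and> z \<in> ?L")
      case True
      then have n: "norm z \<le> R2" by (simp add: annulus_iff)
      have c: "\<bar>\<chi>e R2 (real k) z\<bar> \<le> 2 * (2 * k * R2)"
      proof -
        have "\<bar>smoothstep' x * (- 2 * real k * y)\<bar> \<le> 2 * (2 * k * R2)" if "\<bar>y\<bar> \<le> norm z" for x y
        proof -
          have "\<bar>smoothstep' x * (- 2 * real k * y)\<bar> = \<bar>smoothstep' x\<bar> * (2 * real k * \<bar>y\<bar>)" by (simp add: abs_mult)
          also have "\<dots> \<le> 2 * (2 * k * R2)"
            using smoothstep'_bound[of x] that n by (intro mult_mono) auto
          finally show ?thesis .
        qed
        then show ?thesis using e abs_Re_le_cmod[of z] abs_Im_le_cmod[of z] by (auto simp: rcutx_def rcuty_def)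
      qed
      have "\<bar>\<psi> z\<bar> * \<bar>\<chi>e R2 (real k) z\<bar> \<le> M * (2 * (2 * k * R2))" using M[of z] c M0 by (intro mult_mono) auto
      then have "norm ((\<psi> z * \<chi>e R2 (real k) z) *\<^sub>R f z) \<le> (4 * M * k * R2) * norm (f z)"
      proof -
        have "norm ((\<psi> z * \<chi>e R2 (real k) z) *\<^sub>R f z) = (\<bar>\<psi> z\<bar> * \<bar>\<chi>e R2 (real k) z\<bar>) * norm (f z)" by (simp add: abs_mult)
        also have "\<dots> \<le> (M * (2 * (2 * k * R2))) * norm (f z)"
          by (rule mult_right_mono[OF \<open>\<bar>\<psi> z\<bar> * \<bar>\<chi>e R2 (real k) z\<bar> \<le> M * (2 * (2 * k * R2))\<close>]) simp
        finally show ?thesis by (simp add: ac_simps)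
      qed
      then show ?thesis using True M0 R by (simp add: ennreal_mult[symmetric] ennreal_leI)
    next
      case False
      have zz: "(\<psi> z * \<chi>e R2 (real k) z) *\<^sub>R f z = 0"
      proof (cases "z \<in> annulus R1 R2")
        case True
        then have "z \<notin> ?L" using False by simp
        then have "R2\<^sup>2 - (norm z)\<^sup>2 < 1 / k \<or> R2\<^sup>2 - (norm z)\<^sup>2 > 2 / k" by auto
        then have "k * (R2\<^sup>2 - (norm z)\<^sup>2) - 1 \<le> 0 \<or> k * (R2\<^sup>2 - (norm z)\<^sup>2) - 1 \<ge> 1"
          using k by (auto simp: field_simps)
        then have "smoothstep' (k * (R2\<^sup>2 - (norm z)\<^sup>2) - 1) = 0" using smoothstep_0(2) smoothstep_1(2) by blast
        then show ?thesis using e by (auto simp: rcutx_def rcuty_def)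
      qed (simp add: f_def)
      show ?thesis unfolding zz by simp
    qed
    have "ennreal (norm (\<integral>z. (\<psi> z * \<chi>e R2 (real k) z) *\<^sub>R f z \<partial>lborel)) \<le> (\<integral>\<^sup>+z. ennreal (norm ((\<psi> z * \<chi>e R2 (real k) z) *\<^sub>R f z)) \<partial>lborel)"
      by (rule integral_norm_bound_ennreal[OF i[OF sx W(1)]])
    also have "\<dots> \<le> (\<integral>\<^sup>+z. ennreal (4 * M * k * R2) * (ennreal (norm (f z)) * indicator ?L z) \<partial>lborel)"
      by (intro nn_integral_mono le)
    also have "\<dots> = ennreal (4 * M * k * R2) * (\<integral>\<^sup>+z. ennreal (norm (f z)) * indicator ?L z \<partial>lborel)"
      by (rule nn_integral_cmult) measurable
    also have "\<dots> \<le> ennreal (4 * M * k * R2) * ennreal ((I + 2 * pi * \<omega>) / (2 * k))"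
      by (rule mult_left_mono) (use elim in \<open>auto simp: f_def\<close>)
    also have "\<dots> = ennreal (4 * M * k * R2 * ((I + 2 * pi * \<omega>) / (2 * k)))"
      by (rule ennreal_mult[symmetric]) (use M0 R I0 \<omega> k in simp_all)
    also have "4 * M * k * R2 * ((I + 2 * pi * \<omega>) / (2 * k)) = 2 * M * R2 * (I + 2 * pi * \<omega>)"
      using k by (simp add: field_simps)
    finally show ?case using M0 R I0 \<omega> by (subst (asm) ennreal_le_iff) auto
  qed
  have tends: "(\<lambda>k. norm ((\<integral>z. (\<psi>e z * rcut R2 (real k) z) *\<^sub>R f z \<partial>lborel) + (\<integral>z. (\<psi> z * rcut R2 (real k) z) *\<^sub>R pe z \<partial>lborel)))
    \<longlonglongrightarrow> norm ((\<integral>z. \<psi>e z *\<^sub>R f z \<partial>lborel) + (\<integral>z. \<psi> z *\<^sub>R pe z \<partial>lborel))"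
    by (intro tendsto_norm tendsto_add lim s\<psi> W pe)
  have "norm ((\<integral>z. \<psi>e z *\<^sub>R f z \<partial>lborel) + (\<integral>z. \<psi> z *\<^sub>R pe z \<partial>lborel)) \<le> 2 * M * R2 * I + \<epsilon>" if \<epsilon>: "\<epsilon> > 0" for \<epsilon>
  proof -
    define \<omega> where "\<omega> = \<epsilon> / (4 * pi * (M * R2 + 1))"
    have MR: "M * R2 \<ge> 0" using M0 R by simp
    have \<omega>: "\<omega> > 0" using \<epsilon> MR by (simp add: \<omega>_def add_nonneg_pos)
    have ne: "4 * pi * (M * R2 + 1) \<noteq> 0" using MR by simp
    have "2 * M * R2 * (2 * pi * \<omega>) \<le> 4 * pi * (M * R2 + 1) * \<omega>" using \<omega> by (simp add: algebra_simps)
    also have "\<dots> = \<epsilon>"     proof -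
      have "c * (\<epsilon> / c) = \<epsilon>" if "c \<noteq> 0" for c :: real using that by simp
      from this[OF ne] show ?thesis unfolding \<omega>_def .
    qed
    finally have w: "2 * M * R2 * (I + 2 * pi * \<omega>) \<le> 2 * M * R2 * I + \<epsilon>" by (simp add: distrib_left)
    have "\<forall>\<^sub>F k in sequentially. norm ((\<integral>z. (\<psi>e z * rcut R2 (real k) z) *\<^sub>R f z \<partial>lborel) + (\<integral>z. (\<psi> z * rcut R2 (real k) z) *\<^sub>R pe z \<partial>lborel)) \<le> 2 * M * R2 * I + \<epsilon>"
      using bound[OF \<omega>] eventually_gt_at_top[of 0]
      by eventually_elim (use id w in auto)
    then show ?thesis by (intro tendsto_upperbound[OF tends]) auto
  qed
  then show ?thesis by (rule field_le_epsilon)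
qed

text \<open>A function with zero trace on the outer circle stays weakly differentiable when extended by zero:
  the boundary defect of the approximating functions is controlled by their \<open>L\<^sup>1\<close> norm on the circle.\<close>

lemma zero_trace_extension:
  assumes R: "0 < R1" "R1 < R2" "R2 \<le> S" and w: "wk (annulus R1 R2) f p q"
    and F: "\<And>n::nat. continuous_on (closure (annulus R1 R2)) (F n)"
    and wn: "\<And>n. wk (annulus R1 R2) (\<lambda>z. if z \<in> annulus R1 R2 then F n z else 0) (pn n) (qn n)"
    and lf: "(\<lambda>n. nsq (\<lambda>z. (if z \<in> annulus R1 R2 then F n z else 0) - f z)) \<longlonglongrightarrow> 0"
    and lp: "(\<lambda>n. nsq (\<lambda>z. pn n z - p z)) \<longlonglongrightarrow> 0" and lq: "(\<lambda>n. nsq (\<lambda>z. qn n z - q z)) \<longlonglongrightarrow> 0"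
    and tr: "(\<lambda>n. \<integral>t. indicator angles t * norm (F n (of_real R2 * cis t)) \<partial>lborel) \<longlonglongrightarrow> 0"
  shows "wk (annulus R1 S) f p q"
proof -
  note W = wkD[OF w] and Wn = wkD[OF wn]
  have tl: "(\<lambda>n. \<integral>z. g z *\<^sub>R a n z \<partial>lborel) \<longlonglongrightarrow> (\<integral>z. g z *\<^sub>R b z \<partial>lborel)"
    if g: "sqint g" and a: "\<And>n. sqint (a n)" "sqint b" "(\<lambda>n. nsq (\<lambda>z. a n z - b z)) \<longlonglongrightarrow> 0"
    for g :: "complex \<Rightarrow> real" and a and b :: "complex \<Rightarrow> complex"
    by (rule tendsto_integral_scaleR_right[OF g a])
  show ?thesis
    unfolding wk_def
  proof (intro conjI allI impI)
    fix z assume "z \<notin> annulus R1 S"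
    then have "z \<notin> annulus R1 R2" using R by (auto simp: annulus_iff)
    then show "f z = 0" "p z = 0" "q z = 0" using W by auto
  next
    fix K and \<psi> \<psi>x \<psi>y :: "complex \<Rightarrow> real" assume "C1c K \<psi> \<psi>x \<psi>y \<and> K \<subseteq> annulus R1 S"
    then have \<psi>: "C1c K \<psi> \<psi>x \<psi>y" "K \<subseteq> annulus R1 S" by auto
    have "compact K" "\<And>z. z \<notin> K \<Longrightarrow> \<psi> z = 0" using \<psi> by (auto simp: C1c_def)
    then obtain M where M: "\<And>z. \<bar>\<psi> z\<bar> \<le> M"
      using bounded_compact_support[OF C1c_continuous(1)[OF \<psi>(1)]] by (metis real_norm_def)
    have main: "(\<integral>z. \<psi>e z *\<^sub>R f z \<partial>lborel) = - (\<integral>z. \<psi> z *\<^sub>R pe z \<partial>lborel)"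
      if e: "\<psi>e = \<psi>x \<and> pe = p \<and> pen = pn \<and> \<chi>e = rcutx \<or> \<psi>e = \<psi>y \<and> pe = q \<and> pen = qn \<and> \<chi>e = rcuty" for \<psi>e pe pen \<chi>e
    proof -
      have s: "sqint \<psi>e" "sqint \<psi>" "sqint pe" "\<And>n. sqint (pen n)" "(\<lambda>n. nsq (\<lambda>z. pen n z - pe z)) \<longlonglongrightarrow> 0"
        using e C1c_sqint[OF \<psi>(1)] W Wn lp lq by auto
      have T: "(\<lambda>n. (\<integral>z. \<psi>e z *\<^sub>R (if z \<in> annulus R1 R2 then F n z else 0) \<partial>lborel) + (\<integral>z. \<psi> z *\<^sub>R pen n z \<partial>lborel))
        \<longlonglongrightarrow> (\<integral>z. \<psi>e z *\<^sub>R f z \<partial>lborel) + (\<integral>z. \<psi> z *\<^sub>R pe z \<partial>lborel)"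
        by (intro tendsto_add tl s W Wn lf)
      moreover have "(\<lambda>n. (\<integral>z. \<psi>e z *\<^sub>R (if z \<in> annulus R1 R2 then F n z else 0) \<partial>lborel) + (\<integral>z. \<psi> z *\<^sub>R pen n z \<partial>lborel)) \<longlonglongrightarrow> 0"
      proof (rule Lim_null_comparison)
        show "\<forall>\<^sub>F n in sequentially. norm ((\<integral>z. \<psi>e z *\<^sub>R (if z \<in> annulus R1 R2 then F n z else 0) \<partial>lborel) + (\<integral>z. \<psi> z *\<^sub>R pen n z \<partial>lborel))
          \<le> 2 * M * R2 * (\<integral>t. indicator angles t * norm (F n (of_real R2 * cis t)) \<partial>lborel)"
        proof (intro always_eventually allI)
          fix n
          show "norm ((\<integral>z. \<psi>e z *\<^sub>R (if z \<in> annulus R1 R2 then F n z else 0) \<partial>lborel) + (\<integral>z. \<psi> z *\<^sub>R pen n z \<partial>lborel))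
            \<le> 2 * M * R2 * (\<integral>t. indicator angles t * norm (F n (of_real R2 * cis t)) \<partial>lborel)"
            by (rule boundary_estimate[OF R(1,2) F wn \<psi> M, of _ _ _ \<chi>e]) (use e in auto)
        qed
        show "(\<lambda>n. 2 * M * R2 * (\<integral>t. indicator angles t * norm (F n (of_real R2 * cis t)) \<partial>lborel)) \<longlonglongrightarrow> 0"
          using tendsto_mult[OF tendsto_const tr, of "2 * M * R2"] by simp
      qed
      ultimately have "(\<integral>z. \<psi>e z *\<^sub>R f z \<partial>lborel) + (\<integral>z. \<psi> z *\<^sub>R pe z \<partial>lborel) = 0" by (rule LIMSEQ_unique)
      then show ?thesis by (simp add: eq_neg_iff_add_eq_0)
    qed
    show "(\<integral>z. \<psi>x z *\<^sub>R f z \<partial>lborel) = - (\<integral>z. \<psi> z *\<^sub>R p z \<partial>lborel)" by (rule main[of _ _ pn rcutx]) simp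
    show "(\<integral>z. \<psi>y z *\<^sub>R f z \<partial>lborel) = - (\<integral>z. \<psi> z *\<^sub>R q z \<partial>lborel)" by (rule main[of _ _ qn rcuty]) simp
  qed (use W in auto)
qed

text \<open>The integrand is the radial derivative of \<open>\<phi>\<close> divided by the radius; the Jacobian cancels
  the division, and along each ray the fundamental theorem of calculus leaves the value on the circle.\<close>

lemma radial_integral:
  fixes \<phi> :: "complex \<Rightarrow> real"
  assumes \<phi>: "C1c K \<phi> \<phi>x \<phi>y" and R: "R > 0"
  shows "integrable lborel (\<lambda>z. indicator {z. R < norm z} z * ((\<phi>x z * Re z + \<phi>y z * Im z) / (norm z)\<^sup>2))" (is "integrable lborel ?G")
    and "(\<integral>z. indicator {z. R < norm z} z * ((\<phi>x z * Re z + \<phi>y z * Im z) / (norm z)\<^sup>2) \<partial>lborel)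
    = - (\<integral>t. indicator angles t * \<phi> (of_real R * cis t) \<partial>lborel)"
proof -
  note [measurable] = C1c_measurable[OF \<phi>]
  have K: "compact K" "\<And>z. z \<notin> K \<Longrightarrow> \<phi> z = 0" "\<And>z. z \<notin> K \<Longrightarrow> \<phi>x z = 0" "\<And>z. z \<notin> K \<Longrightarrow> \<phi>y z = 0"
    using \<phi> by (auto simp: C1c_def)
  obtain R0 where R0: "K \<subseteq> cball 0 R0" using compact_imp_bounded[OF K(1)] unfolding bounded_iff by (auto simp: subset_iff)
  define R' where "R' = max R R0 + 1"
  have R': "R \<le> R'" "\<And>z. R' \<le> norm z \<Longrightarrow> z \<notin> K" using R0 by (auto simp: R'_def)
  show "integrable lborel ?G"
  proof (rule Bochner_Integration.integrable_bound)
    show "integrable lborel (\<lambda>z. (1 / R) * (\<bar>\<phi>x z\<bar> + \<bar>\<phi>y z\<bar>))" using C1c_integrable[OF \<phi>] by simp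
    show "AE z in lborel. norm (?G z) \<le> norm ((1 / R) * (\<bar>\<phi>x z\<bar> + \<bar>\<phi>y z\<bar>))"
    proof (rule AE_I2)
      fix z
      show "norm (?G z) \<le> norm ((1 / R) * (\<bar>\<phi>x z\<bar> + \<bar>\<phi>y z\<bar>))"
      proof (cases "R < norm z")
        case True
        have n: "norm z > 0" using True R by linarith
        have "\<bar>\<phi>x z * Re z + \<phi>y z * Im z\<bar> \<le> \<bar>\<phi>x z\<bar> * \<bar>Re z\<bar> + \<bar>\<phi>y z\<bar> * \<bar>Im z\<bar>" by (metis abs_mult abs_triangle_ineq)
        also have "\<dots> \<le> \<bar>\<phi>x z\<bar> * norm z + \<bar>\<phi>y z\<bar> * norm z" by (intro add_mono mult_left_mono abs_Re_le_cmod abs_Im_le_cmod) auto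
        finally have "\<bar>\<phi>x z * Re z + \<phi>y z * Im z\<bar> / (norm z)\<^sup>2 \<le> (\<bar>\<phi>x z\<bar> + \<bar>\<phi>y z\<bar>) * norm z / (norm z)\<^sup>2"
          by (intro divide_right_mono) (auto simp: distrib_right)
        also have "\<dots> = (\<bar>\<phi>x z\<bar> + \<bar>\<phi>y z\<bar>) / norm z" using n by (simp add: power2_eq_square)
        also have "\<dots> \<le> (\<bar>\<phi>x z\<bar> + \<bar>\<phi>y z\<bar>) / R" using True R n by (intro divide_left_mono mult_pos_pos) auto
        finally show ?thesis using True R by simp
      qed simp
    qed
  qed measurable
  then have "(\<integral>z. ?G z \<partial>lborel) = (\<integral>t. indicator angles t *\<^sub>R (\<integral>r. (indicator {0<..} r * r) *\<^sub>R ?G (rcis r t) \<partial>lborel) \<partial>lborel)"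
    by (rule integral_polar)
  also have "\<dots> = (\<integral>t. - (indicator angles t * \<phi> (of_real R * cis t)) \<partial>lborel)"
  proof (rule Bochner_Integration.integral_cong[OF refl])
    fix t
    let ?g = "\<lambda>r. cos t * \<phi>x (rcis r t) + sin t * \<phi>y (rcis r t)"
    have "(\<integral>r. (indicator {0<..} r * r) *\<^sub>R ?G (rcis r t) \<partial>lborel) = (\<integral>r. indicator {R..R'} r *\<^sub>R ?g r \<partial>lborel)"
    proof (rule integral_cong_AE)
      have "AE r in lborel. r \<noteq> R" by (rule AE_lborel_singleton)
      then show "AE r in lborel. (indicator {0<..} r * r) *\<^sub>R ?G (rcis r t) = indicator {R..R'} r *\<^sub>R ?g r"
      proof eventually_elim
        fix r assume r: "r \<noteq> R"
        show "(indicator {0<..} r * r) *\<^sub>R ?G (rcis r t) = indicator {R..R'} r *\<^sub>R ?g r"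
        proof (cases "r > R")
          case True
          then have r0: "r > 0" using R by simp
          have "?g r = 0" if "r > R'"
            using K(3,4) R'(2)[of "rcis r t"] that r0 by simp
          have "r * ((\<phi>x (rcis r t) * (r * cos t) + \<phi>y (rcis r t) * (r * sin t)) / r\<^sup>2) = ?g r"
            using r0 by (simp add: field_simps power2_eq_square)
          moreover have "(indicator {0<..} r * r) *\<^sub>R ?G (rcis r t) = r * ((\<phi>x (rcis r t) * (r * cos t) + \<phi>y (rcis r t) * (r * sin t)) / r\<^sup>2)"
            using True r0 by simp
          moreover have "indicator {R..R'} r *\<^sub>R ?g r = ?g r"
            using True \<open>r > R' \<Longrightarrow> ?g r = 0\<close> by (cases "r > R'") auto
          ultimately show ?thesis by simp
        qed (use r R in \<open>auto simp: indicator_def\<close>)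
      qed
    qed measurable
    also have "\<dots> = \<phi> (rcis R' t) - \<phi> (rcis R t)"
    proof (rule has_bochner_integral_integral_eq, rule has_bochner_integral_FTC_Icc[OF R'(1)])
      fix r
      have "((\<lambda>r. rcis r t) has_derivative (\<lambda>h. rcis h t)) (at r)" unfolding rcis_def by (auto intro!: derivative_eq_intros)
      moreover have "(\<phi> has_derivative (\<lambda>h. Re h *\<^sub>R \<phi>x (rcis r t) + Im h *\<^sub>R \<phi>y (rcis r t))) (at (rcis r t))"
        by (rule C1onD[of UNIV]) (use \<phi> in \<open>auto simp: C1c_def\<close>)
      ultimately have "((\<lambda>r. \<phi> (rcis r t)) has_derivative (\<lambda>h. Re (rcis h t) *\<^sub>R \<phi>x (rcis r t) + Im (rcis h t) *\<^sub>R \<phi>y (rcis r t))) (at r)"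
        by (rule has_derivative_compose)
      then have "((\<lambda>r. \<phi> (rcis r t)) has_vector_derivative ?g r) (at r)"
        unfolding has_vector_derivative_def by (rule has_derivative_eq_rhs) (auto simp: algebra_simps)
      then show "((\<lambda>r. \<phi> (rcis r t)) has_vector_derivative ?g r) (at r within {R..R'})"
        by (rule has_vector_derivative_at_within)
    next
      show "continuous_on {R..R'} ?g"
        unfolding rcis_def
        by (intro continuous_intros continuous_on_compose2[OF C1c_continuous(2)[OF \<phi>, of UNIV]] continuous_on_compose2[OF C1c_continuous(3)[OF \<phi>, of UNIV]]) auto
    qed
    also have "\<phi> (rcis R' t) = 0" using K(2) R'(2)[of "rcis R' t"] R' R by simp
    finally show "indicator angles t *\<^sub>R (\<integral>r. (indicator {0<..} r * r) *\<^sub>R ?G (rcis r t) \<partial>lborel) = - (indicator angles t * \<phi> (of_real R * cis t))"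
      by (simp add: rcis_def)
  qed
  finally show "(\<integral>z. ?G z \<partial>lborel) = - (\<integral>t. indicator angles t * \<phi> (of_real R * cis t) \<partial>lborel)" by simp
qed

section \<open>Upper bound for the minimal energy\<close>

lemma wk_zero: "wk A (\<lambda>z. 0) (\<lambda>z. 0) (\<lambda>z. 0)"
  by (auto simp: wk_def sqint_def)

lemma sobolev_H1_norm_zero:
  assumes A: "open A" "bounded A" and "\<And>z. z \<in> A \<Longrightarrow> f z = 0"
  shows "sobolev_H1_norm A f = 0"
proof -
  have Ab: "A \<in> sets borel" using A by simp
  have ae: "AE z in lebesgue_on A. f z = 0" using assms(3) by (intro AE_I2) auto
  note u = wk_unique[OF A wk_zero ae]
  have z: "(L2_norm (lebesgue_on A) h)\<^sup>2 = 0" if "AE z in lebesgue_on A. h z = 0" for h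
    using L2_norm_rep(2)[OF Ab, of "\<lambda>z. 0" h] that by (simp add: sqint_def nsq_def)
  show ?thesis unfolding sobolev_H1_norm_def using z[OF ae] z[OF u(1)] z[OF u(2)] by simp
qed

lemma L2_circle:
  assumes R: "R > 0" and f: "continuous_on (sphere 0 R) f" and g: "\<And>z. z \<in> sphere 0 R \<Longrightarrow> g z = f z"
  shows "g \<in> L2 (hausdorff1_on (sphere 0 R))"
proof -
  let ?M = "hausdorff1_on (sphere 0 R)"
  have sp: "space ?M = sphere 0 R" by (simp add: hausdorff1_on_circle[OF R] circle_measure_def space_restrict_space)
  interpret finite_measure ?M by (rule finite_measure_circle[OF R])
  have fm: "f \<in> borel_measurable ?M" by (rule circle_cont_borel[OF R f])
  have gm: "g \<in> borel_measurable ?M" using fm by (subst measurable_cong[of _ _ f]) (auto simp: sp g)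
  obtain B where B: "\<And>z. z \<in> sphere 0 R \<Longrightarrow> norm (f z) \<le> B"
    using compact_imp_bounded[OF compact_continuous_image[OF f compact_sphere]] unfolding bounded_iff by blast
  have "integrable ?M (\<lambda>z. (cmod (g z))\<^sup>2)"
    by (rule integrable_const_bound[where B = "B\<^sup>2"])
       (use gm B g in \<open>auto simp: sp intro!: AE_I2 power_mono borel_measurable_power borel_measurable_norm measurable_compose[OF gm]\<close>)
  then show ?thesis using gm by (simp add: L2_def)
qed

text \<open>A function that is continuous up to the boundary approximates itself.\<close>

lemma has_trace_self:
  assumes A: "open A" "bounded A" and w: "wk A (\<lambda>z. if z \<in> A then F z else 0) p q" and c: "continuous_on (closure A) F"
    and R: "R > 0" and cs: "continuous_on (sphere 0 R) F" and g: "\<And>z. z \<in> sphere 0 R \<Longrightarrow> g z = F z"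
  shows "has_trace A (sphere 0 R) F g"
  unfolding has_trace_def
proof (intro exI[of _ "\<lambda>n. F"] conjI allI c)
  have "AE z in lebesgue_on A. F z = (if z \<in> A then F z else 0)" by (intro AE_I2) auto
  then show "F \<in> sobolev_H1 A" by (rule wk_is_weak_deriv(3)[OF A(1) w])
  show "(\<lambda>n. sobolev_H1_norm A (\<lambda>z. F z - F z)) \<longlonglongrightarrow> 0"
    using sobolev_H1_norm_zero[OF A, of "\<lambda>z. F z - F z"] by simp
  have sp: "space (hausdorff1_on (sphere 0 R)) = sphere 0 R" by (simp add: hausdorff1_on_circle[OF R] circle_measure_def space_restrict_space)
  have "(\<integral>z. (cmod (F z - g z))\<^sup>2 \<partial>hausdorff1_on (sphere 0 R)) = (\<integral>z. 0 \<partial>hausdorff1_on (sphere 0 R))"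
    by (rule Bochner_Integration.integral_cong) (auto simp: sp g)
  then show "tendsto_L2 (hausdorff1_on (sphere 0 R)) (\<lambda>n. F) g sequentially"
    using L2_circle[OF R cs, of F] L2_circle[OF R cs, of g] g by (simp add: tendsto_L2_def L2_norm_def)
qed

lemma C1on_scaleR:
  fixes g :: "complex \<Rightarrow> real" and v :: "complex \<Rightarrow> complex"
  assumes "C1on U g gx gy" "C1on U v vx vy"
  shows "C1on U (\<lambda>z. g z *\<^sub>R v z) (\<lambda>z. gx z *\<^sub>R v z + g z *\<^sub>R vx z) (\<lambda>z. gy z *\<^sub>R v z + g z *\<^sub>R vy z)"
  using assms C1on_continuous[OF assms(1)] C1on_continuous[OF assms(2)] unfolding C1on_def
  by (auto intro!: continuous_intros has_derivative_eq_rhs[OF has_derivative_scaleR] simp: algebra_simps)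

lemma C1on_norm: "C1on (- {0}) norm (\<lambda>z. Re z / norm z) (\<lambda>z. Im z / norm z)"
  unfolding C1on_def
proof (intro conjI ballI)
  fix z :: complex assume "z \<in> - {0}"
  then have "(norm has_derivative (\<lambda>h. h \<bullet> sgn z)) (at z)" by (auto intro: has_derivative_norm)
  then show "(norm has_derivative (\<lambda>h. Re h *\<^sub>R (Re z / norm z) + Im h *\<^sub>R (Im z / norm z))) (at z)"
    by (rule has_derivative_eq_rhs) (auto simp: inner_complex_def sgn_div_norm divide_inverse mult.commute)
qed (auto intro!: continuous_intros)

text \<open>A form of \<open>e\<^sup>i\<^sup>n\<^sup>\<theta>\<close> that is visibly smooth away from the origin, where \<open>Arg\<close> jumps.\<close>

definition phase :: "nat \<Rightarrow> complex \<Rightarrow> complex" where "phase n z = sgn z ^ n"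

lemma sgn_deriv:
  fixes z :: complex
  assumes "z \<noteq> 0"
  shows "(sgn has_derivative (\<lambda>w. sgn z * \<i> * of_real (Im (cnj z * w) / (norm z)\<^sup>2))) (at z)"
proof -
  have n: "norm z \<noteq> 0" using assms by simp
  have "((\<lambda>z. inverse (norm z) *\<^sub>R z) has_derivative
      (\<lambda>w. inverse (norm z) *\<^sub>R w + (- (inverse (norm z) * (w \<bullet> sgn z) * inverse (norm z))) *\<^sub>R z)) (at z)"
    by (rule has_derivative_scaleR[OF Deriv.has_derivative_inverse[OF n has_derivative_norm[OF assms]] has_derivative_ident])
  moreover have "inverse (norm z) *\<^sub>R w + (- (inverse (norm z) * (w \<bullet> sgn z) * inverse (norm z))) *\<^sub>R z
     = sgn z * \<i> * of_real (Im (cnj z * w) / (norm z)\<^sup>2)" for w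
  proof -
    define k where "k = inverse (norm z)"
    have kk: "k * k * (Re z * Re z + Im z * Im z) = 1"
    proof -
      have "Re z * Re z + Im z * Im z = (norm z)\<^sup>2" unfolding cmod_power2 by (simp add: power2_eq_square)
      then show ?thesis using n by (simp add: k_def power2_eq_square field_simps)
    qed
    have sg: "sgn z = k *\<^sub>R z" by (simp add: sgn_div_norm k_def)
    have n2: "x / (norm z)\<^sup>2 = k * k * x" for x by (simp add: k_def divide_inverse power2_eq_square)
    have "k * Re w - k * (k * (Re w * Re z + Im w * Im z)) * k * Re z = - (k * Im z * (k * k * (Re z * Im w - Im z * Re w)))"
      "k * Im w - k * (k * (Re w * Re z + Im w * Im z)) * k * Im z = k * Re z * (k * k * (Re z * Im w - Im z * Re w))"
      using kk by algebra+
    then show ?thesis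
      unfolding k_def[symmetric] sg n2
      by (simp add: complex_eq_iff inner_complex_def distrib_left mult.assoc mult.left_commute)
  qed
  ultimately show ?thesis by (simp add: sgn_div_norm[abs_def])
qed

lemma C1on_phase:
  "C1on (- {0}) (phase n) (\<lambda>z. phase n z * \<i> * of_real (- real n * Im z / (norm z)\<^sup>2)) (\<lambda>z. phase n z * \<i> * of_real (real n * Re z / (norm z)\<^sup>2))"
proof -
  have D: "(phase n has_derivative (\<lambda>w. phase n z * \<i> * of_real (real n * Im (cnj z * w) / (norm z)\<^sup>2))) (at z)" if "z \<noteq> 0" for z
  proof (cases n)
    case 0
    then show ?thesis by (simp add: phase_def[abs_def])
  next
    case (Suc m)
    show ?thesis
      unfolding phase_def[abs_def]
      by (rule has_derivative_eq_rhs[OF has_derivative_power[OF sgn_deriv[OF that]]]) (auto simp: Suc algebra_simps)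
  qed
  have c: "continuous_on (- {0}) (phase n)"
    by (intro continuous_at_imp_continuous_on ballI has_derivative_continuous[OF D]) simp
  show ?thesis
    unfolding C1on_def
  proof (intro conjI ballI)
    fix z :: complex assume "z \<in> - {0}"
    then have "z \<noteq> 0" by simp
    from D[OF this] show "(phase n has_derivative (\<lambda>h. Re h *\<^sub>R (phase n z * \<i> * of_real (- real n * Im z / (norm z)\<^sup>2)) + Im h *\<^sub>R (phase n z * \<i> * of_real (real n * Re z / (norm z)\<^sup>2)))) (at z)"
      by (rule has_derivative_eq_rhs) (auto simp: scaleR_conv_of_real divide_inverse algebra_simps)
  qed (intro continuous_intros c; auto)+
qed

lemma norm_phase: "z \<noteq> 0 \<Longrightarrow> norm (phase n z) = 1"
  by (simp add: phase_def norm_power norm_sgn)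

lemma norm_phase_deriv:
  assumes "z \<noteq> 0"
  shows "norm (phase n z * \<i> * of_real (- real n * Im z / (norm z)\<^sup>2)) \<le> real n / norm z"
    "norm (phase n z * \<i> * of_real (real n * Re z / (norm z)\<^sup>2)) \<le> real n / norm z"
proof -
  have n: "norm z > 0" using assms by simp
  have "real n * x / (norm z)\<^sup>2 \<le> real n / norm z" if "x \<le> norm z" for x
  proof -
    have "real n * x / (norm z)\<^sup>2 \<le> real n * norm z / (norm z)\<^sup>2" by (intro divide_right_mono mult_left_mono that) auto
    also have "\<dots> = real n / norm z" using n by (simp add: power2_eq_square)
    finally show ?thesis .
  qed
  then show "norm (phase n z * \<i> * of_real (- real n * Im z / (norm z)\<^sup>2)) \<le> real n / norm z"
    "norm (phase n z * \<i> * of_real (real n * Re z / (norm z)\<^sup>2)) \<le> real n / norm z"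
    using abs_Re_le_cmod[of z] abs_Im_le_cmod[of z]
    by (auto simp: norm_mult norm_phase[OF assms] abs_mult simp del: of_real_divide of_real_mult of_real_minus)
qed

lemma phase_rcis: "r > 0 \<Longrightarrow> phase n (rcis r t) = cis (real n * t)"
proof -
  assume "r > 0"
  then have "sgn (rcis r t) = cis t" by (simp add: sgn_div_norm rcis_def norm_mult scaleR_conv_of_real mult.assoc[symmetric])
  then show ?thesis unfolding phase_def by (simp only: Complex.DeMoivre)
qed

lemma phase_Arg: "z \<noteq> 0 \<Longrightarrow> phase n z = cis (real n * Arg z)"
proof -
  assume "z \<noteq> 0"
  from cis_Arg[OF this, symmetric] show ?thesis unfolding phase_def by (simp only: Complex.DeMoivre)
qed

text \<open>A smooth substitute for \<open>y / norm y\<close>: it fixes the unit circle, and its zero at the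
  origin has a core of radius \<open>\<eta>\<close>.\<close>

definition soft_normalize :: "real \<Rightarrow> complex \<Rightarrow> complex" where
  "soft_normalize \<eta> y = (sqrt (1 + \<eta>\<^sup>2) / sqrt ((norm y)\<^sup>2 + \<eta>\<^sup>2)) *\<^sub>R y"

definition soft_normalize_deriv :: "real \<Rightarrow> complex \<Rightarrow> complex \<Rightarrow> complex" where
  "soft_normalize_deriv \<eta> y w = sqrt (1 + \<eta>\<^sup>2) *\<^sub>R ((1 / sqrt ((norm y)\<^sup>2 + \<eta>\<^sup>2)) *\<^sub>R w - ((y \<bullet> w) / (sqrt ((norm y)\<^sup>2 + \<eta>\<^sup>2))^3) *\<^sub>R y)"

lemma soft_normalize_has_derivative:
  assumes "\<eta> > 0"
  shows "(soft_normalize \<eta> has_derivative soft_normalize_deriv \<eta> y) (at y)"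
proof -
  define Y where "Y = y \<bullet> y + \<eta>\<^sup>2"
  have Y: "Y > 0" using assms by (simp add: Y_def add_nonneg_pos)
  have D0: "((\<lambda>y. y \<bullet> y + \<eta>\<^sup>2) has_derivative (\<lambda>w. 2 * (y \<bullet> w))) (at y)"
    by (rule has_derivative_eq_rhs[OF has_derivative_add[OF has_derivative_inner[OF has_derivative_ident has_derivative_ident] has_derivative_const]])
       (auto simp: inner_commute)
  have "(sqrt has_derivative (*) (inverse (sqrt Y) / 2)) (at (y \<bullet> y + \<eta>\<^sup>2))"
    using DERIV_real_sqrt[OF Y] unfolding has_field_derivative_def Y_def .
  note D = has_derivative_compose[OF D0 this]
  have ne: "sqrt (y \<bullet> y + \<eta>\<^sup>2) \<noteq> 0" using Y unfolding Y_def by simp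
  note E = has_derivative_scaleR_right[OF has_derivative_scaleR[OF Deriv.has_derivative_inverse[OF ne D] has_derivative_ident], of "sqrt (1 + \<eta>\<^sup>2)", folded Y_def]
  have fe: "soft_normalize \<eta> = (\<lambda>y. sqrt (1 + \<eta>\<^sup>2) *\<^sub>R (inverse (sqrt (y \<bullet> y + \<eta>\<^sup>2)) *\<^sub>R y))"
    by (rule ext) (simp add: soft_normalize_def power2_norm_eq_inner divide_inverse)
  show ?thesis
    unfolding fe
  proof (rule has_derivative_eq_rhs[OF E], rule ext)
    fix w
    have Yn: "(norm y)\<^sup>2 + \<eta>\<^sup>2 = Y" by (simp add: Y_def power2_norm_eq_inner)
    define \<rho> where "\<rho> = sqrt Y"
    show "sqrt (1 + \<eta>\<^sup>2) *\<^sub>R (inverse (sqrt Y) *\<^sub>R w + - (inverse (sqrt Y) * (inverse (sqrt Y) / 2 * (2 * (y \<bullet> w))) * inverse (sqrt Y)) *\<^sub>R y) = soft_normalize_deriv \<eta> y w"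
    proof -
      have \<rho>: "\<rho> > 0" using Y by (simp add: \<rho>_def)
      have c: "inverse \<rho> * (inverse \<rho> / 2 * (2 * t)) * inverse \<rho> = t / \<rho>^3" for t
        using \<rho> by (simp add: field_simps power3_eq_cube)
      show ?thesis unfolding soft_normalize_deriv_def Yn \<rho>_def[symmetric] c
        by (simp add: inverse_eq_divide)
    qed
  qed
qed

lemma soft_normalize_deriv_bound:
  assumes "\<eta> > 0"
  shows "(norm (soft_normalize_deriv \<eta> y w))\<^sup>2 \<le> 4 * (1 + \<eta>\<^sup>2) * (norm w)\<^sup>2 / ((norm y)\<^sup>2 + \<eta>\<^sup>2)"
proof -
  define \<rho> where "\<rho> = sqrt ((norm y)\<^sup>2 + \<eta>\<^sup>2)"
  have p: "(norm y)\<^sup>2 + \<eta>\<^sup>2 > 0" using assms by (simp add: add_nonneg_pos)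
  then have \<rho>: "\<rho> > 0" "\<rho>\<^sup>2 = (norm y)\<^sup>2 + \<eta>\<^sup>2" by (auto simp: \<rho>_def)
  have y: "norm y \<le> \<rho>" unfolding \<rho>_def by (rule real_le_rsqrt) simp
  have "norm ((y \<bullet> w / \<rho>^3) *\<^sub>R y) \<le> norm w / \<rho>"
  proof -
    have "norm ((y \<bullet> w / \<rho>^3) *\<^sub>R y) = \<bar>y \<bullet> w\<bar> * norm y / \<rho>^3" using \<rho> by simp
    also have "\<dots> \<le> (norm y * norm w) * norm y / \<rho>^3"
      using \<rho> Cauchy_Schwarz_ineq2[of y w] by (intro divide_right_mono mult_right_mono) auto
    also have "\<dots> \<le> (\<rho> * norm w) * \<rho> / \<rho>^3" using \<rho> y by (intro divide_right_mono mult_mono) auto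
    also have "\<dots> = norm w / \<rho>" using \<rho> by (simp add: power3_eq_cube)
    finally show ?thesis .
  qed
  then have "norm ((1 / \<rho>) *\<^sub>R w - ((y \<bullet> w) / \<rho>^3) *\<^sub>R y) \<le> norm w / \<rho> + norm w / \<rho>"
    using \<rho> by (intro order_trans[OF norm_triangle_ineq4] add_mono) auto
  then have "norm (soft_normalize_deriv \<eta> y w) \<le> sqrt (1 + \<eta>\<^sup>2) * (2 * norm w / \<rho>)"
    unfolding soft_normalize_deriv_def \<rho>_def[symmetric] norm_scaleR by (intro mult_mono) auto
  then have "(norm (soft_normalize_deriv \<eta> y w))\<^sup>2 \<le> (sqrt (1 + \<eta>\<^sup>2) * (2 * norm w / \<rho>))\<^sup>2" by (intro power_mono) auto
  also have "\<dots> = 4 * (1 + \<eta>\<^sup>2) * (norm w)\<^sup>2 / \<rho>\<^sup>2" by (simp add: power_mult_distrib power_divide)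
  finally show ?thesis by (simp add: \<rho>)
qed

lemma soft_normalize_norm:
  assumes "\<eta> > 0"
  shows "norm y = 1 \<Longrightarrow> soft_normalize \<eta> y = y"
    and "norm y \<le> 1 \<Longrightarrow> norm (soft_normalize \<eta> y) \<le> 1"
    and "norm y \<le> 1 \<Longrightarrow> (1 - (norm (soft_normalize \<eta> y))\<^sup>2)\<^sup>2 \<le> \<eta>\<^sup>2 / ((norm y)\<^sup>2 + \<eta>\<^sup>2)"
proof -
  have p: "(norm y)\<^sup>2 + \<eta>\<^sup>2 > 0" using assms by (simp add: add_nonneg_pos)
  have s1: "sqrt (1 + \<eta>\<^sup>2) > 0" by (simp add: add_pos_nonneg)
  then show "norm y = 1 \<Longrightarrow> soft_normalize \<eta> y = y" by (simp add: soft_normalize_def)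
  have n: "(norm (soft_normalize \<eta> y))\<^sup>2 = (1 + \<eta>\<^sup>2) * (norm y)\<^sup>2 / ((norm y)\<^sup>2 + \<eta>\<^sup>2)"
    using p by (simp add: soft_normalize_def power_mult_distrib power_divide add_nonneg_nonneg)
  assume y: "norm y \<le> 1"
  then have y2: "(norm y)\<^sup>2 \<le> 1" by (simp add: power_le_one)
  have d: "1 - (norm (soft_normalize \<eta> y))\<^sup>2 = \<eta>\<^sup>2 * (1 - (norm y)\<^sup>2) / ((norm y)\<^sup>2 + \<eta>\<^sup>2)"
  proof -
    have "1 - (1 + e) * Y / (Y + e) = e * (1 - Y) / (Y + e)" if "Y + e > 0" for Y e :: real
      using that by (simp add: divide_simps) (simp add: algebra_simps)
    from this[OF p] show ?thesis unfolding n .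
  qed
  have d0: "0 \<le> 1 - (norm (soft_normalize \<eta> y))\<^sup>2" unfolding d using p y2 by auto
  then show "norm (soft_normalize \<eta> y) \<le> 1" by (metis diff_ge_0_iff_ge norm_ge_zero one_power2 power2_le_imp_le zero_le_one)
  have le: "1 - (norm (soft_normalize \<eta> y))\<^sup>2 \<le> \<eta>\<^sup>2 / ((norm y)\<^sup>2 + \<eta>\<^sup>2)"
    unfolding d using p y2 by (intro divide_right_mono mult_left_le) auto
  have "\<eta>\<^sup>2 / ((norm y)\<^sup>2 + \<eta>\<^sup>2) \<le> 1" using p by (simp add: divide_le_eq)
  then have "(1 - (norm (soft_normalize \<eta> y))\<^sup>2) * (1 - (norm (soft_normalize \<eta> y))\<^sup>2) \<le> \<eta>\<^sup>2 / ((norm y)\<^sup>2 + \<eta>\<^sup>2) * 1"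
    using le d0 p by (intro mult_mono) auto
  then show "(1 - (norm (soft_normalize \<eta> y))\<^sup>2)\<^sup>2 \<le> \<eta>\<^sup>2 / ((norm y)\<^sup>2 + \<eta>\<^sup>2)" by (simp add: power2_eq_square)
qed

lemma nn_integral_periods:
  fixes f :: "real \<Rightarrow> ennreal"
  assumes [measurable]: "f \<in> borel_measurable borel" and per: "\<And>s. f (s + 2 * pi) = f s"
  shows "(\<integral>\<^sup>+s. indicator {0..<2 * pi * real n} s * f s \<partial>lborel) = of_nat n * (\<integral>\<^sup>+s. indicator {0..<2 * pi} s * f s \<partial>lborel)"
proof (induction n)
  case (Suc n)
  have "f (2 * pi * real n + s) = f s" for s
  proof (induction n)
    case (Suc n)
    then show ?case using per[of "2 * pi * real n + s"] by (simp add: algebra_simps)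
  qed simp
  note p = this
  have "(\<integral>\<^sup>+s. indicator {0..<2 * pi * real (Suc n)} s * f s \<partial>lborel)
    = (\<integral>\<^sup>+s. indicator {0..<2 * pi * real n} s * f s + indicator {2 * pi * real n..<2 * pi * real n + 2 * pi} s * f s \<partial>lborel)"
  proof (rule nn_integral_cong)
    fix s
    define a where "a = 2 * pi * real n"
    have a: "0 \<le> a" "2 * pi * real (Suc n) = a + 2 * pi" by (simp_all add: a_def algebra_simps)
    show "indicator {0..<2 * pi * real (Suc n)} s * f s
      = indicator {0..<2 * pi * real n} s * f s + indicator {2 * pi * real n..<2 * pi * real n + 2 * pi} s * f s"
    proof -
      have "s < a \<Longrightarrow> s < a + 2 * pi" using pi_gt_zero by linarith
      then show ?thesis unfolding a(2) a_def[symmetric] using a(1) by (auto simp: indicator_def)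
    qed
  qed
  also have "\<dots> = (\<integral>\<^sup>+s. indicator {0..<2 * pi * real n} s * f s \<partial>lborel) + (\<integral>\<^sup>+s. indicator {2 * pi * real n..<2 * pi * real n + 2 * pi} s * f s \<partial>lborel)"
    by (rule nn_integral_add) measurable
  also have "(\<integral>\<^sup>+s. indicator {2 * pi * real n..<2 * pi * real n + 2 * pi} s * f s \<partial>lborel) = (\<integral>\<^sup>+s. indicator {0..<2 * pi} s * f s \<partial>lborel)"
    by (subst nn_integral_real_affine[where c = 1 and t = "2 * pi * real n"])
       (auto simp: p indicator_def intro!: nn_integral_cong)
  finally show ?case using Suc by (simp add: distrib_right add.commute)
qed simp

lemma sin_ge_half:
  assumes "0 \<le> x" "x \<le> pi / 2"
  shows "x / 2 \<le> sin x"
proof (cases "x \<le> pi / 3")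
  case True
  have "sin 0 - 0 / 2 \<le> sin x - x / 2"
  proof (rule DERIV_nonneg_imp_nondecreasing[OF assms(1)])
    fix y assume y: "0 \<le> y" "y \<le> x"
    have "cos (pi / 3) \<le> cos y" using y True by (intro cos_monotone_0_pi_le) auto
    then show "\<exists>d. ((\<lambda>x. sin x - x / 2) has_real_derivative d) (at y) \<and> 0 \<le> d"
      by (intro exI[of _ "cos y - 1 / 2"]) (auto intro!: derivative_eq_intros simp: cos_60)
  qed
  then show ?thesis by simp
next
  case False
  have "sin (pi / 3) \<le> sin x" using False assms by (intro sin_monotone_2pi_le) auto
  moreover have "8 / 5 \<le> sqrt 3" by (rule real_le_rsqrt) (simp add: power2_eq_square)
  moreover have "pi < 32 / 10" using pi_approx by simp
  ultimately show ?thesis using assms unfolding sin_60 by linarith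
qed

text \<open>Over one full turn of the phase the cosine has a simple zero, so the integrand is comparable to
  \<open>1 / (s\<^sup>2 + p\<^sup>2)\<close>. The \<open>n\<close> turns of length \<open>2 * pi / n\<close> contribute equally, hence the bound does not depend on \<open>n\<close>.\<close>

lemma angular_integral_le:
  assumes p: "p > 0" and n: "n > 0"
  shows "(\<integral>\<^sup>+t. indicator angles t * ennreal (1 / ((cos (real n * (t + pi / 2) / 2))\<^sup>2 + p\<^sup>2)) \<partial>lborel) \<le> ennreal (4 * pi / p)"
proof -
  define f where "f s = ennreal (1 / ((cos (s / 2))\<^sup>2 + p\<^sup>2))" for s
  have [measurable]: "f \<in> borel_measurable borel" unfolding f_def by measurable
  have per: "f (s + 2 * pi) = f s" for s
    by (simp add: f_def add_divide_distrib cos_add)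
  have "(\<integral>\<^sup>+t. indicator angles t * ennreal (1 / ((cos (real n * (t + pi / 2) / 2))\<^sup>2 + p\<^sup>2)) \<partial>lborel)
    = ennreal (1 / n) * (\<integral>\<^sup>+s. indicator {0..<2 * pi * real n} s * f s \<partial>lborel)"
    using n by (subst nn_integral_real_affine[where c = "1 / real n" and t = "- pi / 2"])
       (auto simp: f_def indicator_def field_simps intro!: arg_cong[where f = "(*) _"] nn_integral_cong)
  also have "\<dots> = ennreal (1 / n) * (of_nat n * (\<integral>\<^sup>+s. indicator {0..<2 * pi} s * f s \<partial>lborel))"
    by (subst nn_integral_periods) (auto simp: per)
  also have "\<dots> = (\<integral>\<^sup>+s. indicator {0..<2 * pi} s * f s \<partial>lborel)"
    using n by (simp add: mult.assoc[symmetric] ennreal_of_nat_eq_real_of_nat ennreal_mult[symmetric])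
  also have "\<dots> \<le> (\<integral>\<^sup>+s. ennreal (1 / (((s - pi) / 4)\<^sup>2 + p\<^sup>2)) * indicator {0..2 * pi} s \<partial>lborel)"
  proof (rule nn_integral_mono)
    fix s
    show "indicator {0..<2 * pi} s * f s \<le> ennreal (1 / (((s - pi) / 4)\<^sup>2 + p\<^sup>2)) * indicator {0..2 * pi} s"
    proof (cases "s \<in> {0..<2 * pi}")
      case True
      define x where "x = (s - pi) / 2"
      have "\<bar>x\<bar> \<le> pi / 2" using True by (auto simp: x_def abs_le_iff)
      then have "\<bar>x\<bar> / 2 \<le> sin \<bar>x\<bar>" by (intro sin_ge_half) auto
      moreover have "cos (s / 2) = - sin x" by (simp add: x_def sin_cos_eq[of "(s - pi)/2"] diff_divide_distrib sin_diff)
      then have "(cos (s / 2))\<^sup>2 = (sin \<bar>x\<bar>)\<^sup>2" by (simp add: abs_if)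
      moreover have "((s - pi) / 4)\<^sup>2 = (\<bar>x\<bar> / 2)\<^sup>2" by (simp add: x_def power_divide)
      ultimately have "((s - pi) / 4)\<^sup>2 \<le> (cos (s / 2))\<^sup>2" by (simp only:) (intro power_mono, auto)
      then have "1 / ((cos (s / 2))\<^sup>2 + p\<^sup>2) \<le> 1 / (((s - pi) / 4)\<^sup>2 + p\<^sup>2)"
        using p by (intro divide_left_mono mult_pos_pos) (auto simp: add_nonneg_pos)
      then show ?thesis using True by (simp add: f_def ennreal_leI)
    qed simp
  qed
  also have "\<dots> = ennreal ((4 / p) * arctan ((2 * pi - pi) / (4 * p)) - (4 / p) * arctan ((0 - pi) / (4 * p)))"
  proof (rule nn_integral_FTC_Icc)
    fix s :: real
    have q: "1 + ((s - pi) / (4 * p))\<^sup>2 > 0" by (simp add: add_pos_nonneg)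
    have "((\<lambda>s. (4 / p) * arctan ((s - pi) / (4 * p))) has_real_derivative (4 / p) * (inverse (1 + ((s - pi) / (4 * p))\<^sup>2) * (1 / (4 * p)))) (at s)"
      using p by (auto intro!: derivative_eq_intros)
    also have "(4 / p) * (inverse (1 + ((s - pi) / (4 * p))\<^sup>2) * (1 / (4 * p))) = 1 / (p\<^sup>2 * (1 + ((s - pi) / (4 * p))\<^sup>2))"
    proof -
      have "(4 / p) * (inverse X * (1 / (4 * p))) = 1 / (p\<^sup>2 * X)" if "X > 0" for X
        using p that by (simp add: field_simps power2_eq_square)
      from this[OF q] show ?thesis .
    qed
    also have "p\<^sup>2 * (1 + ((s - pi) / (4 * p))\<^sup>2) = ((s - pi) / 4)\<^sup>2 + p\<^sup>2"
      using p by (simp add: power_divide power_mult_distrib distrib_left)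
    finally show "((\<lambda>s. (4 / p) * arctan ((s - pi) / (4 * p))) has_real_derivative 1 / (((s - pi) / 4)\<^sup>2 + p\<^sup>2)) (at s)" .
  qed auto
  also have "\<dots> \<le> ennreal (4 * pi / p)"
  proof (rule ennreal_leI)
    have "(4 / p) * (arctan ((2 * pi - pi) / (4 * p)) - arctan ((0 - pi) / (4 * p))) \<le> (4 / p) * pi"
      using p arctan_ubound[of "(2 * pi - pi) / (4 * p)"] arctan_lbound[of "(0 - pi) / (4 * p)"] by (intro mult_left_mono) auto
    then show "(4 / p) * arctan ((2 * pi - pi) / (4 * p)) - (4 / p) * arctan ((0 - pi) / (4 * p)) \<le> 4 * pi / p"
      by (simp add: right_diff_distrib power2_eq_square)
  qed
  finally show ?thesis .
qed

text \<open>This integral is the only source of the logarithm in the energy bound.\<close>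

lemma radial_log_integral:
  assumes \<epsilon>: "0 < \<epsilon>" "\<epsilon> < 1"
  shows "(\<integral>\<^sup>+x. ennreal (1 / (\<bar>1 - x\<bar> + \<epsilon>)) * indicator {0..2} x \<partial>lborel) \<le> ennreal (2 * (1 + \<bar>ln \<epsilon>\<bar>))"
proof -
  have l: "ln (1 + \<epsilon>) - ln \<epsilon> \<le> 1 + \<bar>ln \<epsilon>\<bar>"
    using \<epsilon> ln_add_one_self_le_self[of \<epsilon>] by (simp add: abs_if)
  have "(\<integral>\<^sup>+x. ennreal (1 / (\<bar>1 - x\<bar> + \<epsilon>)) * indicator {0..2} x \<partial>lborel)
    \<le> (\<integral>\<^sup>+x. ennreal (1 / (1 - x + \<epsilon>)) * indicator {0..1} x + ennreal (1 / (x - 1 + \<epsilon>)) * indicator {1..2} x \<partial>lborel)"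
    by (intro nn_integral_mono) (auto simp: indicator_def)
  also have "\<dots> = (\<integral>\<^sup>+x. ennreal (1 / (1 - x + \<epsilon>)) * indicator {0..1} x \<partial>lborel) + (\<integral>\<^sup>+x. ennreal (1 / (x - 1 + \<epsilon>)) * indicator {1..2} x \<partial>lborel)"
    by (rule nn_integral_add) measurable
  also have "(\<integral>\<^sup>+x. ennreal (1 / (1 - x + \<epsilon>)) * indicator {0..1} x \<partial>lborel) = ennreal (- ln (1 - 1 + \<epsilon>) - - ln (1 - 0 + \<epsilon>))"
    by (rule nn_integral_FTC_Icc) (use \<epsilon> in \<open>auto intro!: derivative_eq_intros\<close>)
  also have "(\<integral>\<^sup>+x. ennreal (1 / (x - 1 + \<epsilon>)) * indicator {1..2} x \<partial>lborel) = ennreal (ln (2 - 1 + \<epsilon>) - ln (1 - 1 + \<epsilon>))"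
    by (rule nn_integral_FTC_Icc) (use \<epsilon> in \<open>auto intro!: derivative_eq_intros\<close>)
  also have "ennreal (- ln (1 - 1 + \<epsilon>) - - ln (1 - 0 + \<epsilon>)) + ennreal (ln (2 - 1 + \<epsilon>) - ln (1 - 1 + \<epsilon>)) \<le> ennreal (1 + \<bar>ln \<epsilon>\<bar>) + ennreal (1 + \<bar>ln \<epsilon>\<bar>)"
    using l by (intro add_mono ennreal_leI) auto
  also have "\<dots> = ennreal (2 * (1 + \<bar>ln \<epsilon>\<bar>))" by (subst ennreal_plus[symmetric]) auto
  finally show ?thesis .
qed

lemma nn_integral_lebesgue_on_rep:
  assumes A: "A \<in> sets borel" and H[measurable]: "H \<in> borel_measurable borel" and ae: "AE z in lebesgue_on A. h z = (H z :: ennreal)"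
  shows "(\<integral>\<^sup>+z. h z \<partial>lebesgue_on A) = (\<integral>\<^sup>+z. H z * indicator A z \<partial>lborel)"
proof -
  note [measurable] = A
  have "(\<integral>\<^sup>+z. h z \<partial>lebesgue_on A) = (\<integral>\<^sup>+z. H z \<partial>lebesgue_on A)" by (rule nn_integral_cong_AE[OF ae])
  also have "\<dots> = (\<integral>\<^sup>+z. H z * indicator A z \<partial>lebesgue)" using A by (subst nn_integral_restrict_space) auto
  also have "\<dots> = (\<integral>\<^sup>+z. H z * indicator A z \<partial>lborel)" by (rule nn_integral_completion)
  finally show ?thesis .
qed

text \<open>The energy computed from Borel representatives.\<close>

lemma GL_energy_wk:
  assumes A: "open A" "bounded A" and w: "wk A U P Q" and ae: "AE z in lebesgue_on A. u z = U z"
  shows "GL_energy \<epsilon> A u = ennreal (1 / 2) * (\<integral>\<^sup>+z. ennreal ((cmod (P z))\<^sup>2 + (cmod (Q z))\<^sup>2) * indicator A z \<partial>lborel)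
     + ennreal (1 / (4 * \<epsilon>\<^sup>2)) * (\<integral>\<^sup>+z. ennreal ((1 - (cmod (U z))\<^sup>2)\<^sup>2) * indicator A z \<partial>lborel)"
proof -
  have Ab: "A \<in> sets borel" using A by simp
  note [measurable] = sqint_meas[OF wkD(1)[OF w]] sqint_meas[OF wkD(2)[OF w]] sqint_meas[OF wkD(3)[OF w]]
  note D = wk_unique[OF A w ae]
  have "(\<integral>\<^sup>+z. ennreal ((cmod (wderiv A 1 u z))\<^sup>2 + (cmod (wderiv A \<i> u z))\<^sup>2) \<partial>lebesgue_on A)
    = (\<integral>\<^sup>+z. ennreal ((cmod (P z))\<^sup>2 + (cmod (Q z))\<^sup>2) * indicator A z \<partial>lborel)"
    by (rule nn_integral_lebesgue_on_rep[OF Ab]) (measurable, use D in eventually_elim, simp)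
  moreover have "(\<integral>\<^sup>+z. ennreal ((1 - (cmod (u z))\<^sup>2)\<^sup>2) \<partial>lebesgue_on A) = (\<integral>\<^sup>+z. ennreal ((1 - (cmod (U z))\<^sup>2)\<^sup>2) * indicator A z \<partial>lborel)"
    by (rule nn_integral_lebesgue_on_rep[OF Ab]) (measurable, use ae in eventually_elim, simp)
  ultimately show ?thesis by (simp add: GL_energy_def)
qed

text \<open>The coordinate across the boundary layer: \<open>1\<close> on the outer circle and \<open>0\<close> at distance
  \<open>(R2 - R1) / n\<close> from it, a width comparable to the distance between neighbouring zeros.\<close>

definition lq :: "real \<Rightarrow> real \<Rightarrow> nat \<Rightarrow> real \<Rightarrow> real" where
  "lq R1 R2 n r = 1 - (real n / (R2 - R1)) * (R2 - r)"

text \<open>The value of the boundary datum at the angle \<open>- pi / 2\<close>, where the range of angles begins.\<close>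

definition inner_phase :: "nat \<Rightarrow> complex" where "inner_phase n = cis (- (real n * pi / 2))"

definition cmpG :: "real \<Rightarrow> real \<Rightarrow> nat \<Rightarrow> complex \<Rightarrow> real" where "cmpG R1 R2 n z = pos2 (lq R1 R2 n (norm z))"

text \<open>The straight-line homotopy, across the layer, from the boundary datum to a constant of modulus one. It has degree
  \<open>n\<close> outside and \<open>0\<close> inside, and vanishes at exactly \<open>n\<close> points, one per turn of the phase.\<close>

definition cmpH :: "real \<Rightarrow> real \<Rightarrow> nat \<Rightarrow> complex \<Rightarrow> complex" where
  "cmpH R1 R2 n z = inner_phase n + cmpG R1 R2 n z *\<^sub>R (phase n z - inner_phase n)"

text \<open>Common form of the two partial derivatives of \<open>cmpH\<close>: \<open>a\<close> is the coordinate in question and \<open>b\<close> the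
  corresponding partial derivative of \<open>phase n\<close>.\<close>

definition cmpHd :: "real \<Rightarrow> real \<Rightarrow> nat \<Rightarrow> real \<Rightarrow> complex \<Rightarrow> complex \<Rightarrow> complex" where
  "cmpHd R1 R2 n a b z = (2 * max 0 (lq R1 R2 n (norm z)) * (real n / (R2 - R1) * (a / norm z))) *\<^sub>R (phase n z - inner_phase n) + cmpG R1 R2 n z *\<^sub>R b"

definition cmpHx where "cmpHx R1 R2 n z = cmpHd R1 R2 n (Re z) (phase n z * \<i> * of_real (- real n * Im z / (norm z)\<^sup>2)) z"
definition cmpHy where "cmpHy R1 R2 n z = cmpHd R1 R2 n (Im z) (phase n z * \<i> * of_real (real n * Re z / (norm z)\<^sup>2)) z"

lemma norm_inner_phase [simp]: "norm (inner_phase n) = 1"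
  by (simp add: inner_phase_def)

lemma C1on_cmpH: "C1on (- {0}) (cmpH R1 R2 n) (cmpHx R1 R2 n) (cmpHy R1 R2 n)"
proof -
  have l: "C1on (- {0}) (\<lambda>z. lq R1 R2 n (norm z)) (\<lambda>z. real n / (R2 - R1) * (Re z / norm z)) (\<lambda>z. real n / (R2 - R1) * (Im z / norm z))"
  proof -
    have "C1on (- {0}) (\<lambda>z::complex. 1 - c * (R2 - norm z)) (\<lambda>z. c * (Re z / norm z)) (\<lambda>z. c * (Im z / norm z))" for c
      by (rule C1on_compose_real[of "\<lambda>t. 1 - c * (R2 - t)" "\<lambda>_. c", OF _ _ C1on_norm])
         (auto intro!: derivative_eq_intros)
    then show ?thesis unfolding lq_def .
  qed
  have G: "C1on (- {0}) (cmpG R1 R2 n) (\<lambda>z. 2 * max 0 (lq R1 R2 n (norm z)) * (real n / (R2 - R1) * (Re z / norm z)))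
     (\<lambda>z. 2 * max 0 (lq R1 R2 n (norm z)) * (real n / (R2 - R1) * (Im z / norm z)))"
    unfolding cmpG_def[abs_def]
    by (rule C1on_compose_real[OF pos2_deriv _ l]) (intro continuous_intros)
  have P: "C1on (- {0}) (\<lambda>z. phase n z - inner_phase n) (\<lambda>z. phase n z * \<i> * of_real (- real n * Im z / (norm z)\<^sup>2)) (\<lambda>z. phase n z * \<i> * of_real (real n * Re z / (norm z)\<^sup>2))"
    using C1on_phase[of n] unfolding C1on_def by (auto intro!: has_derivative_eq_rhs[OF has_derivative_diff[OF _ has_derivative_const]])
  have "C1on (- {0}) (\<lambda>z. cmpG R1 R2 n z *\<^sub>R (phase n z - inner_phase n)) (cmpHx R1 R2 n) (cmpHy R1 R2 n)"
    using C1on_scaleR[OF G P] unfolding cmpHx_def[abs_def] cmpHy_def[abs_def] cmpHd_def .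
  then show ?thesis
    unfolding C1on_def cmpH_def[abs_def] by (auto intro!: has_derivative_eq_rhs[OF has_derivative_add[OF has_derivative_const]])
qed

lemma cmp_facts:
  assumes R: "0 < R1" "R1 < R2" and n: "n > 0" and z: "z \<in> annulus R1 R2"
  shows "0 \<le> cmpG R1 R2 n z" "cmpG R1 R2 n z \<le> 1" "norm (cmpH R1 R2 n z) \<le> 1"
    "norm (cmpHx R1 R2 n z) \<le> real n * (4 / (R2 - R1) + 1 / R1)" "norm (cmpHy R1 R2 n z) \<le> real n * (4 / (R2 - R1) + 1 / R1)"
    "lq R1 R2 n (norm z) \<le> 0 \<Longrightarrow> cmpH R1 R2 n z = inner_phase n \<and> cmpHx R1 R2 n z = 0 \<and> cmpHy R1 R2 n z = 0"
proof -
  have z': "R1 < norm z" "norm z < R2" "norm z > 0" "z \<noteq> 0" using z R by (auto simp: annulus_iff)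
  have "real n / (R2 - R1) * (R2 - norm z) \<ge> 0" using R z' by simp
  then have q: "0 \<le> max 0 (lq R1 R2 n (norm z))" "max 0 (lq R1 R2 n (norm z)) \<le> 1" by (auto simp: lq_def)
  show G: "0 \<le> cmpG R1 R2 n z" "cmpG R1 R2 n z \<le> 1" using q by (auto simp: cmpG_def pos2_def power_le_one)
  have "cmpH R1 R2 n z = (1 - cmpG R1 R2 n z) *\<^sub>R inner_phase n + cmpG R1 R2 n z *\<^sub>R phase n z"
    by (simp add: cmpH_def algebra_simps)
  also have "norm \<dots> \<le> (1 - cmpG R1 R2 n z) * 1 + cmpG R1 R2 n z * 1"
    using G norm_phase[OF z'(4), of n] by (intro order_trans[OF norm_triangle_ineq]) simp
  finally show "norm (cmpH R1 R2 n z) \<le> 1" by simp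
  have pw: "norm (phase n z - inner_phase n) \<le> 2"
    using norm_triangle_ineq4[of "phase n z" "inner_phase n"] norm_phase[OF z'(4), of n] by simp
  have d: "norm (cmpHd R1 R2 n a b z) \<le> real n * (4 / (R2 - R1) + 1 / R1)" if a: "\<bar>a\<bar> \<le> norm z" and b: "norm b \<le> real n / norm z" for a b
  proof -
    have "\<bar>a\<bar> / norm z \<le> 1" using a z' by simp
    then have "\<bar>2 * max 0 (lq R1 R2 n (norm z)) * (real n / (R2 - R1) * (a / norm z))\<bar> \<le> 2 * 1 * (real n / (R2 - R1) * 1)"
      unfolding abs_mult using q R by (intro mult_mono) (auto simp: abs_mult)
    then have 1: "norm ((2 * max 0 (lq R1 R2 n (norm z)) * (real n / (R2 - R1) * (a / norm z))) *\<^sub>R (phase n z - inner_phase n)) \<le> (2 * 1 * (real n / (R2 - R1) * 1)) * 2"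
      unfolding norm_scaleR using pw R by (intro mult_mono) auto
    have "norm (cmpG R1 R2 n z *\<^sub>R b) \<le> 1 * (real n / norm z)" unfolding norm_scaleR using G b by (intro mult_mono) auto
    also have "\<dots> \<le> real n / R1" using z' R by (simp add: frac_le)
    finally have "norm (cmpHd R1 R2 n a b z) \<le> (2 * 1 * (real n / (R2 - R1) * 1)) * 2 + real n / R1"
      unfolding cmpHd_def by (intro order_trans[OF norm_triangle_ineq] add_mono 1)
    then show ?thesis by (simp add: distrib_left mult.commute)
  qed
  show "norm (cmpHx R1 R2 n z) \<le> real n * (4 / (R2 - R1) + 1 / R1)"
    unfolding cmpHx_def by (intro d abs_Re_le_cmod norm_phase_deriv z')
  show "norm (cmpHy R1 R2 n z) \<le> real n * (4 / (R2 - R1) + 1 / R1)"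
    unfolding cmpHy_def by (intro d abs_Im_le_cmod norm_phase_deriv z')
  show "lq R1 R2 n (norm z) \<le> 0 \<Longrightarrow> cmpH R1 R2 n z = inner_phase n \<and> cmpHx R1 R2 n z = 0 \<and> cmpHy R1 R2 n z = 0"
    by (simp add: cmpH_def cmpHx_def cmpHy_def cmpHd_def cmpG_def pos2_def)
qed

text \<open>Quantitative form of the zeros being simple: the modulus is bounded below by the distances
  to the zero in the angular and in the radial variable separately. The zeros lie at \<open>pos2 (lq R1 R2 n r) = 1 / 2\<close>,
  hence the factor \<open>sqrt 2\<close>.\<close>

lemma cmpH_lower:
  assumes R: "0 < R1" "R1 < R2" and n: "n > 0" and z: "rcis r t \<in> annulus R1 R2" "r > 0" and q: "lq R1 R2 n r > 0" and \<epsilon>: "\<epsilon> > 0"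
  shows "((cos (real n * (t + pi / 2) / 2))\<^sup>2 + ((\<bar>1 - sqrt 2 * lq R1 R2 n r\<bar> + \<epsilon>) / 2)\<^sup>2) / 2 \<le> (norm (cmpH R1 R2 n (rcis r t)))\<^sup>2 + \<epsilon>\<^sup>2"
proof -
  define G where "G = cmpG R1 R2 n (rcis r t)"
  define s where "s = real n * (t + pi / 2)"
  define \<kappa> where "\<kappa> = (cos (s / 2))\<^sup>2"
  \<comment> \<open>the squared modulus is \<open>1 - (1 - \<kappa>) * (1 - m)\<close>, at least the mean of \<open>\<kappa>\<close> and \<open>m\<close>\<close>
  define m where "m = (1 - 2 * G)\<^sup>2"
  define x where "x = lq R1 R2 n r"
  have G: "0 \<le> G" "G \<le> 1" "G = x\<^sup>2" using cmp_facts(1,2)[OF R n z(1)] z(2) q by (auto simp: G_def cmpG_def pos2_def x_def)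
  have x: "x > 0" using q by (simp add: x_def)
  have \<kappa>: "0 \<le> \<kappa>" "\<kappa> \<le> 1" using abs_square_le_1[of "cos (s / 2)"] by (auto simp: \<kappa>_def)
  have m: "0 \<le> m" "m \<le> 1" using G abs_square_le_1[of "1 - 2 * G"] by (auto simp: m_def)
  have ph: "phase n (rcis r t) = inner_phase n * cis s"
    using z(2) by (simp add: phase_rcis inner_phase_def cis_mult s_def algebra_simps)
  have "cmpH R1 R2 n (rcis r t) = inner_phase n * (of_real (1 - G) + of_real G * cis s)"
    by (simp add: cmpH_def G_def[symmetric] ph scaleR_conv_of_real algebra_simps)
  then have "(norm (cmpH R1 R2 n (rcis r t)))\<^sup>2 = (1 - G + G * cos s)\<^sup>2 + (G * sin s)\<^sup>2"
    by (simp add: norm_mult cmod_power2 del: of_real_diff)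
  also have "\<dots> = 1 - 2 * G * (1 - G) * (1 - cos s)"
  proof -
    have "(sin s)\<^sup>2 = 1 - (cos s)\<^sup>2" by (simp add: sin_squared_eq)
    then have "(G * sin s)\<^sup>2 = G\<^sup>2 * (1 - (cos s)\<^sup>2)" by (simp add: power_mult_distrib)
    then show ?thesis by (simp add: power2_eq_square algebra_simps)
  qed
  also have "cos s = 2 * \<kappa> - 1" using cos_double_cos[of "s / 2"] by (simp add: \<kappa>_def)
  also have "1 - 2 * G * (1 - G) * (1 - (2 * \<kappa> - 1)) = \<kappa> + m - m * \<kappa>"
    by (simp add: m_def power2_eq_square algebra_simps)
  also have "\<dots> \<ge> (\<kappa> + m) / 2"
    using mult_left_le_one_le[of \<kappa> m] mult_left_le_one_le[of m \<kappa>] \<kappa> m by (simp add: mult.commute)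
  finally have H: "(\<kappa> + m) / 2 \<le> (norm (cmpH R1 R2 n (rcis r t)))\<^sup>2" .
  have "m = ((1 - sqrt 2 * x) * (1 + sqrt 2 * x))\<^sup>2"
    unfolding m_def G(3) by (simp add: power2_eq_square algebra_simps)
  also have "\<dots> = (1 - sqrt 2 * x)\<^sup>2 * (1 + sqrt 2 * x)\<^sup>2" by (rule power_mult_distrib)
  also have "\<dots> \<ge> (1 - sqrt 2 * x)\<^sup>2 * 1"
  proof (rule mult_left_mono[OF _ zero_le_power2])
    have "sqrt 2 * x \<ge> 0" using x by simp
    then show "1 \<le> (1 + sqrt 2 * x)\<^sup>2" by (intro one_le_power) linarith
  qed
  finally have m2: "m \<ge> (\<bar>1 - sqrt 2 * x\<bar>)\<^sup>2" by simp
  have "((\<bar>1 - sqrt 2 * x\<bar> + \<epsilon>) / 2)\<^sup>2 \<le> (\<bar>1 - sqrt 2 * x\<bar>)\<^sup>2 + \<epsilon>\<^sup>2"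
    using norm_add_sq[of "\<bar>1 - sqrt 2 * x\<bar>" \<epsilon>] \<epsilon> by (simp add: power_divide abs_of_nonneg) (smt (verit) zero_le_power2)
  also have "\<dots> \<le> m + 2 * \<epsilon>\<^sup>2" using m2 zero_le_power2[of \<epsilon>] by linarith
  finally show ?thesis using H unfolding \<kappa>_def s_def x_def by simp
qed

text \<open>The competitor is the soft normalisation of \<open>cmpH\<close>, with \<open>n\<close> vortices next to the outer
  circle. Its energy density is at most a multiple of \<open>n\<^sup>2\<close> divided by \<open>(norm (cmpH R1 R2 n z))\<^sup>2 + \<epsilon>\<^sup>2\<close> in the layer and zero elsewhere. Integrating first in the angle and then
  across the layer, of width of order \<open>1 / n\<close>, gives order \<open>n\<close> times a logarithm.\<close>

lemma comparison_map:
  assumes R: "0 < R1" "R1 < R2"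
  obtains C where "C > 0" "\<And>n \<epsilon>. n > 0 \<Longrightarrow> 0 < \<epsilon> \<Longrightarrow> \<epsilon> < 1 \<Longrightarrow>
    \<exists>v \<in> GL_admissible R1 R2 n. GL_energy \<epsilon> (annulus R1 R2) v \<le> ennreal (C * real n * (1 + \<bar>ln \<epsilon>\<bar>))"
proof -
  define c0 where "c0 = 4 / (R2 - R1) + 1 / R1"
  have c0: "c0 > 0" using R by (auto simp: c0_def intro: add_pos_pos)
  define C1 where "C1 = 8 * c0\<^sup>2 + 1 / 4"
  have C1: "C1 > 0" using c0 by (auto simp: C1_def intro: add_nonneg_pos)
  define C where "C = 32 * pi * R2 * (R2 - R1) * C1"
  let ?A = "annulus R1 R2"
  have A: "open ?A" "bounded ?A" by (rule annulus_open annulus_bounded)+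
  show ?thesis
  proof (rule that)
    show "C > 0" using R C1 by (simp add: C_def)
    fix n :: nat and \<epsilon> :: real assume n: "n > 0" and \<epsilon>: "0 < \<epsilon>" "\<epsilon> < 1"
    let ?H = "cmpH R1 R2 n" and ?q = "\<lambda>r. lq R1 R2 n r"
    define F where "F z = soft_normalize \<epsilon> (?H z)" for z
    define Fx where "Fx z = soft_normalize_deriv \<epsilon> (?H z) (cmpHx R1 R2 n z)" for z
    define Fy where "Fy z = soft_normalize_deriv \<epsilon> (?H z) (cmpHy R1 R2 n z)" for z
    have sp: "(norm y)\<^sup>2 + \<epsilon>\<^sup>2 > 0" for y :: complex using \<epsilon> by (simp add: add_nonneg_pos)
    have CF: "C1on (- {0}) F Fx Fy"
      unfolding C1on_def
    proof (intro conjI ballI)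
      have c: "continuous_on (- {0}) (\<lambda>z. soft_normalize_deriv \<epsilon> (?H z) (h z))" if "continuous_on (- {0}) h" for h
        unfolding soft_normalize_deriv_def using sp
        by (intro continuous_intros C1on_continuous(1)[OF C1on_cmpH] that) (auto simp: less_imp_neq[symmetric])
      show "continuous_on (- {0}) Fx" "continuous_on (- {0}) Fy"
        unfolding Fx_def[abs_def] Fy_def[abs_def] by (intro c C1on_continuous[OF C1on_cmpH])+
      fix z :: complex assume z: "z \<in> - {0}"
      have l: "linear (soft_normalize_deriv \<epsilon> (?H z))"
        by (rule has_derivative_linear[OF soft_normalize_has_derivative[OF \<epsilon>(1)]])
      from has_derivative_compose[OF C1onD[OF C1on_cmpH[of R1 R2 n] z] soft_normalize_has_derivative[OF \<epsilon>(1)]]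
      show "(F has_derivative (\<lambda>h. Re h *\<^sub>R Fx z + Im h *\<^sub>R Fy z)) (at z)"
        unfolding F_def[abs_def] Fx_def Fy_def by (simp add: linear_add[OF l] linear_scale[OF l])
    qed
    have A0: "?A \<subseteq> - {0}" using R by (auto simp: annulus_iff)
    note CA = C1on_subset[OF CF A0]
    have e2: "1 + \<epsilon>\<^sup>2 \<le> 2" using \<epsilon> by (simp add: power_le_one)
    have Fd: "(norm (soft_normalize_deriv \<epsilon> (?H z) h))\<^sup>2 \<le> 8 * (real n * c0)\<^sup>2 / ((norm (?H z))\<^sup>2 + \<epsilon>\<^sup>2)"
      if "norm h \<le> real n * c0" for h z
    proof -
      have "(norm (soft_normalize_deriv \<epsilon> (?H z) h))\<^sup>2 \<le> 4 * (1 + \<epsilon>\<^sup>2) * (norm h)\<^sup>2 / ((norm (?H z))\<^sup>2 + \<epsilon>\<^sup>2)"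
        by (rule soft_normalize_deriv_bound[OF \<epsilon>(1)])
      also have "\<dots> \<le> 4 * 2 * (real n * c0)\<^sup>2 / ((norm (?H z))\<^sup>2 + \<epsilon>\<^sup>2)"
        using e2 that by (intro divide_right_mono mult_mono power_mono) auto
      finally show ?thesis by simp
    qed
    have Fxy: "(norm (Fx z))\<^sup>2 \<le> 8 * (real n * c0)\<^sup>2 / ((norm (?H z))\<^sup>2 + \<epsilon>\<^sup>2)" "(norm (Fy z))\<^sup>2 \<le> 8 * (real n * c0)\<^sup>2 / ((norm (?H z))\<^sup>2 + \<epsilon>\<^sup>2)"
      if "z \<in> ?A" for z
      unfolding Fx_def Fy_def using cmp_facts(4,5)[OF R n that] by (simp_all only: c0_def[symmetric] Fd)
    define B where "B = max 1 (sqrt (8 * (real n * c0)\<^sup>2 / \<epsilon>\<^sup>2))"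
    have bnd: "norm (F z) \<le> B \<and> norm (Fx z) \<le> B \<and> norm (Fy z) \<le> B" if z: "z \<in> ?A" for z
    proof -
      have "8 * (real n * c0)\<^sup>2 / ((norm (?H z))\<^sup>2 + \<epsilon>\<^sup>2) \<le> 8 * (real n * c0)\<^sup>2 / \<epsilon>\<^sup>2"
        using \<epsilon> sp[of "?H z"] by (intro divide_left_mono mult_pos_pos) auto
      then have "norm (Fx z) \<le> sqrt (8 * (real n * c0)\<^sup>2 / \<epsilon>\<^sup>2)" "norm (Fy z) \<le> sqrt (8 * (real n * c0)\<^sup>2 / \<epsilon>\<^sup>2)"
        using Fxy[OF z] by (auto intro!: real_le_rsqrt)
      moreover have "norm (F z) \<le> 1" unfolding F_def by (rule soft_normalize_norm(2)[OF \<epsilon>(1) cmp_facts(3)[OF R n z]])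
      ultimately show ?thesis by (auto simp: B_def)
    qed
    have w: "wk ?A (\<lambda>z. if z \<in> ?A then F z else 0) (\<lambda>z. if z \<in> ?A then Fx z else 0) (\<lambda>z. if z \<in> ?A then Fy z else 0)"
      by (rule wk_C1on[OF A CA, of B]) (use bnd in auto)
    have Fc: "continuous_on (- {0}) F" by (rule C1on_continuous(1)[OF CF])
    have clA: "closure ?A \<subseteq> - {0}"
    proof -
      have "closure ?A \<subseteq> {z. R1 \<le> norm z}"
        by (rule closure_minimal) (auto simp: annulus_iff intro!: closed_Collect_le continuous_intros)
      then show ?thesis using R by auto
    qed
    have Fcl: "continuous_on (closure ?A) F" by (rule continuous_on_subset[OF Fc clA])
    have Fs: "continuous_on (sphere 0 r) F" if "r > 0" for r using that by (intro continuous_on_subset[OF Fc]) auto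
    have ae: "AE z in lebesgue_on ?A. F z = (if z \<in> ?A then F z else 0)" by (intro AE_I2) auto
    have F2: "F z = cis (real n * Arg z)" if "z \<in> sphere 0 R2" for z
    proof -
      have z: "norm z = R2" "z \<noteq> 0" using that R by auto
      then have "?H z = phase n z" by (simp add: cmpH_def cmpG_def lq_def pos2_def)
      then show ?thesis using norm_phase[OF z(2)] phase_Arg[OF z(2)] soft_normalize_norm(1)[OF \<epsilon>(1)] by (simp add: F_def)
    qed
    have F1: "norm (F z) = 1" if "norm z = R1" for z
    proof -
      have "lq R1 R2 n (norm z) \<le> 0" using that R n by (simp add: lq_def)
      then have "?H z = inner_phase n" by (simp add: cmpH_def cmpG_def pos2_def)
      then show ?thesis using soft_normalize_norm(1)[OF \<epsilon>(1), of "inner_phase n"] by (simp add: F_def)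
    qed
    have adm: "F \<in> GL_admissible R1 R2 n"
    proof -
      have "has_trace ?A (sphere 0 R2) F (\<lambda>z. cis (real n * Arg z))"
        by (rule has_trace_self[OF A w Fcl _ Fs]) (use R F2 in auto)
      moreover have "has_trace ?A (sphere 0 R1) F F"
        by (rule has_trace_self[OF A w Fcl R(1) Fs[OF R(1)]]) auto
      moreover have "AE z in hausdorff1_on (sphere 0 R1). cmod (F z) = 1"
        using F1 by (intro AE_I2) (auto simp: hausdorff1_on_circle[OF R(1)] circle_measure_def space_restrict_space)
      ultimately show ?thesis using wk_is_weak_deriv(3)[OF A(1) w ae] unfolding GL_admissible_def by blast
    qed
    define D where "D z = (norm (Fx z))\<^sup>2 / 2 + (norm (Fy z))\<^sup>2 / 2 + (1 - (norm (F z))\<^sup>2)\<^sup>2 / (4 * \<epsilon>\<^sup>2)" for z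
    have Dm: "(\<lambda>z. if z \<in> ?A then D z else 0) \<in> borel_measurable borel"
    proof -
      have "continuous_on ?A D"
        unfolding D_def[abs_def] using \<epsilon> by (intro continuous_intros C1on_continuous[OF CA]) auto
      then have "(\<lambda>z. indicator ?A z *\<^sub>R D z) \<in> borel_measurable borel"
        using A by (intro borel_measurable_continuous_on_indicator) auto
      also have "(\<lambda>z. indicator ?A z *\<^sub>R D z) = (\<lambda>z. if z \<in> ?A then D z else 0)" by (auto simp: fun_eq_iff)
      finally show ?thesis .
    qed
    have Db: "D z \<le> real n ^ 2 * C1 / ((norm (?H z))\<^sup>2 + \<epsilon>\<^sup>2)" if z: "z \<in> ?A" for z
    proof -
      have p: "(1 - (norm (F z))\<^sup>2)\<^sup>2 \<le> \<epsilon>\<^sup>2 / ((norm (?H z))\<^sup>2 + \<epsilon>\<^sup>2)"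
        unfolding F_def by (rule soft_normalize_norm(3)[OF \<epsilon>(1) cmp_facts(3)[OF R n z]])
      have "(1 - (norm (F z))\<^sup>2)\<^sup>2 / (4 * \<epsilon>\<^sup>2) \<le> (\<epsilon>\<^sup>2 / ((norm (?H z))\<^sup>2 + \<epsilon>\<^sup>2)) / (4 * \<epsilon>\<^sup>2)"
        using p by (intro divide_right_mono) auto
      also have "\<dots> = (1 / 4) / ((norm (?H z))\<^sup>2 + \<epsilon>\<^sup>2)" using \<epsilon> by simp
      also have "\<dots> \<le> (real n ^ 2 * (1 / 4)) / ((norm (?H z))\<^sup>2 + \<epsilon>\<^sup>2)"
        using n by (intro divide_right_mono) auto
      finally have "D z \<le> 4 * (real n * c0)\<^sup>2 / ((norm (?H z))\<^sup>2 + \<epsilon>\<^sup>2) + 4 * (real n * c0)\<^sup>2 / ((norm (?H z))\<^sup>2 + \<epsilon>\<^sup>2) + (real n ^ 2 * (1 / 4)) / ((norm (?H z))\<^sup>2 + \<epsilon>\<^sup>2)"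
        unfolding D_def using Fxy[OF z] by (intro add_mono) auto
      also have "\<dots> = real n ^ 2 * C1 / ((norm (?H z))\<^sup>2 + \<epsilon>\<^sup>2)"
        unfolding add_divide_distrib[symmetric]
        by (rule arg_cong[where f = "\<lambda>a. a / _"]) (simp add: C1_def power_mult_distrib algebra_simps)
      finally show ?thesis .
    qed
    have D0: "D z = 0" if z: "z \<in> ?A" "?q (norm z) \<le> 0" for z
    proof -
      have l: "linear (soft_normalize_deriv \<epsilon> (?H z))"
        by (rule has_derivative_linear[OF soft_normalize_has_derivative[OF \<epsilon>(1)]])
      have "F z = inner_phase n" "Fx z = 0" "Fy z = 0"
        using cmp_facts(6)[OF R n z] soft_normalize_norm(1)[OF \<epsilon>(1), of "inner_phase n"] linear_0[OF l]
        by (auto simp: F_def Fx_def Fy_def)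
      then show ?thesis by (simp add: D_def)
    qed
    \<comment> \<open>the radial distance to the zeros, regularised at scale \<open>\<epsilon>\<close>\<close>
    define p where "p r = (\<bar>1 - sqrt 2 * ?q r\<bar> + \<epsilon>) / 2" for r
    have p: "p r > 0" for r using \<epsilon> by (simp add: p_def add_nonneg_pos)
    \<comment> \<open>vanishes exactly at the angles of the zeros\<close>
    define \<kappa> where "\<kappa> t = (cos (real n * (t + pi / 2) / 2))\<^sup>2" for t
    \<comment> \<open>the inner edge of the layer, inside which the competitor is constant\<close>
    define r1 where "r1 = R2 - (R2 - R1) / n"
    have qpos: "?q r > 0 \<longleftrightarrow> r > r1" for r
      using R n by (simp add: lq_def r1_def field_simps)
    have pm[measurable]: "p \<in> borel_measurable borel" "\<kappa> \<in> borel_measurable borel"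
      unfolding p_def[abs_def] \<kappa>_def[abs_def] lq_def by measurable
    have "GL_energy \<epsilon> ?A F = (\<integral>\<^sup>+z. ennreal (if z \<in> ?A then D z else 0) \<partial>lborel)"
    proof -
      note [measurable] = sqint_meas[OF wkD(1)[OF w]] sqint_meas[OF wkD(2)[OF w]] sqint_meas[OF wkD(3)[OF w]]
      have [measurable]: "?A \<in> sets borel" using A by simp
      let ?U = "\<lambda>z. if z \<in> ?A then F z else 0" and ?P = "\<lambda>z. if z \<in> ?A then Fx z else 0" and ?Q = "\<lambda>z. if z \<in> ?A then Fy z else 0"
      have "GL_energy \<epsilon> ?A F = (\<integral>\<^sup>+z. ennreal (1 / 2) * (ennreal ((cmod (?P z))\<^sup>2 + (cmod (?Q z))\<^sup>2) * indicator ?A z)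
          + ennreal (1 / (4 * \<epsilon>\<^sup>2)) * (ennreal ((1 - (cmod (?U z))\<^sup>2)\<^sup>2) * indicator ?A z) \<partial>lborel)"
        unfolding GL_energy_wk[OF A w ae]
        by (subst nn_integral_add) (measurable, subst (1 2) nn_integral_cmult, measurable)
      also have "\<dots> = (\<integral>\<^sup>+z. ennreal (if z \<in> ?A then D z else 0) \<partial>lborel)"
      proof (rule nn_integral_cong)
        fix z
        show "ennreal (1 / 2) * (ennreal ((cmod (?P z))\<^sup>2 + (cmod (?Q z))\<^sup>2) * indicator ?A z)
          + ennreal (1 / (4 * \<epsilon>\<^sup>2)) * (ennreal ((1 - (cmod (?U z))\<^sup>2)\<^sup>2) * indicator ?A z) = ennreal (if z \<in> ?A then D z else 0)"
        proof (cases "z \<in> ?A")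
          case True
          have "ennreal (1 / 2) * ennreal ((cmod (Fx z))\<^sup>2 + (cmod (Fy z))\<^sup>2) + ennreal (1 / (4 * \<epsilon>\<^sup>2)) * ennreal ((1 - (cmod (F z))\<^sup>2)\<^sup>2)
            = ennreal (1 / 2 * ((cmod (Fx z))\<^sup>2 + (cmod (Fy z))\<^sup>2) + 1 / (4 * \<epsilon>\<^sup>2) * (1 - (cmod (F z))\<^sup>2)\<^sup>2)"
            by (subst (1 2) ennreal_mult[symmetric], simp, simp, simp, simp, subst ennreal_plus[symmetric]) auto
          then show ?thesis using True by (simp add: D_def add_divide_distrib)
        qed simp
      qed
      finally show ?thesis .
    qed
    also have "\<dots> = (\<integral>\<^sup>+t. indicator angles t * (\<integral>\<^sup>+r. ennreal r * indicator {0<..} r * ennreal (if rcis r t \<in> ?A then D (rcis r t) else 0) \<partial>lborel) \<partial>lborel)"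
      by (rule nn_integral_polar) (use Dm in measurable)
    also have "\<dots> \<le> (\<integral>\<^sup>+t. (\<integral>\<^sup>+r. ennreal (2 * R2 * real n ^ 2 * C1) * indicator {r1<..<R2} r * (indicator angles t * ennreal (1 / (\<kappa> t + (p r)\<^sup>2))) \<partial>lborel) \<partial>lborel)"
    proof (rule nn_integral_mono)
      fix t
      have [measurable]: "(\<lambda>r. if rcis r t \<in> ?A then D (rcis r t) else 0) \<in> borel_measurable borel"
        using measurable_compose[OF _ Dm, of "\<lambda>r. rcis r t" borel] by simp
      have "indicator angles t * (\<integral>\<^sup>+r. ennreal r * indicator {0<..} r * ennreal (if rcis r t \<in> ?A then D (rcis r t) else 0) \<partial>lborel)
        = (\<integral>\<^sup>+r. indicator angles t * (ennreal r * indicator {0<..} r * ennreal (if rcis r t \<in> ?A then D (rcis r t) else 0)) \<partial>lborel)"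
        by (rule nn_integral_cmult[symmetric]) measurable
      also have "\<dots> \<le> (\<integral>\<^sup>+r. ennreal (2 * R2 * real n ^ 2 * C1) * indicator {r1<..<R2} r * (indicator angles t * ennreal (1 / (\<kappa> t + (p r)\<^sup>2))) \<partial>lborel)"
      proof (rule nn_integral_mono)
        fix r
        show "indicator angles t * (ennreal r * indicator {0<..} r * ennreal (if rcis r t \<in> ?A then D (rcis r t) else 0))
          \<le> ennreal (2 * R2 * real n ^ 2 * C1) * indicator {r1<..<R2} r * (indicator angles t * ennreal (1 / (\<kappa> t + (p r)\<^sup>2)))"
        proof (cases "r > 0 \<and> rcis r t \<in> ?A \<and> ?q r > 0 \<and> t \<in> angles")
          case True
          then have r: "r > 0" "rcis r t \<in> ?A" "?q r > 0" by auto
          have rR: "r < R2" using r by (simp add: annulus_iff)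
          have kp: "\<kappa> t + (p r)\<^sup>2 > 0" using p[of r] by (simp add: \<kappa>_def add_nonneg_pos)
          have low: "(\<kappa> t + (p r)\<^sup>2) / 2 \<le> (norm (?H (rcis r t)))\<^sup>2 + \<epsilon>\<^sup>2"
            unfolding \<kappa>_def p_def by (rule cmpH_lower[OF R n r(2,1,3) \<epsilon>(1)])
          have "D (rcis r t) \<le> real n ^ 2 * C1 / ((\<kappa> t + (p r)\<^sup>2) / 2)"
            using low kp C1 by (intro order_trans[OF Db[OF r(2)]] divide_left_mono mult_pos_pos sp) auto
          then have "r * D (rcis r t) \<le> R2 * (real n ^ 2 * C1 / ((\<kappa> t + (p r)\<^sup>2) / 2))"
            using r rR by (intro mult_mono) (auto simp: D_def)
          also have "\<dots> = 2 * R2 * real n ^ 2 * C1 * (1 / (\<kappa> t + (p r)\<^sup>2))" by simp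
          finally have "ennreal (r * D (rcis r t)) \<le> ennreal (2 * R2 * real n ^ 2 * C1 * (1 / (\<kappa> t + (p r)\<^sup>2)))" by (rule ennreal_leI)
          then have "ennreal r * ennreal (D (rcis r t)) \<le> ennreal (2 * R2 * real n ^ 2 * C1) * ennreal (1 / (\<kappa> t + (p r)\<^sup>2))"
            using r R C1 kp by (subst (asm) (1 2) ennreal_mult) (auto simp: D_def)
          then show ?thesis using True qpos[of r] rR by simp
        next
          case False
          have "rcis r t \<in> ?A \<Longrightarrow> r > 0 \<Longrightarrow> \<not> ?q r > 0 \<Longrightarrow> D (rcis r t) = 0"
            by (rule D0) auto
          then have "indicator angles t * (ennreal r * indicator {0<..} r * ennreal (if rcis r t \<in> ?A then D (rcis r t) else 0)) = 0"
            using False by (auto simp: indicator_def)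
          then show ?thesis by (simp only: zero_le)
        qed
      qed
      finally show "indicator angles t * (\<integral>\<^sup>+r. ennreal r * indicator {0<..} r * ennreal (if rcis r t \<in> ?A then D (rcis r t) else 0) \<partial>lborel)
        \<le> (\<integral>\<^sup>+r. ennreal (2 * R2 * real n ^ 2 * C1) * indicator {r1<..<R2} r * (indicator angles t * ennreal (1 / (\<kappa> t + (p r)\<^sup>2))) \<partial>lborel)" .
    qed
    also have "\<dots> = (\<integral>\<^sup>+r. (\<integral>\<^sup>+t. ennreal (2 * R2 * real n ^ 2 * C1) * indicator {r1<..<R2} r * (indicator angles t * ennreal (1 / (\<kappa> t + (p r)\<^sup>2))) \<partial>lborel) \<partial>lborel)"
      by (rule lborel_pair.Fubini') measurable
    also have "\<dots> \<le> (\<integral>\<^sup>+r. ennreal (2 * R2 * real n ^ 2 * C1) * indicator {r1<..<R2} r * ennreal (4 * pi / p r) \<partial>lborel)"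
    proof (rule nn_integral_mono)
      fix r
      have "(\<integral>\<^sup>+t. ennreal (2 * R2 * real n ^ 2 * C1) * indicator {r1<..<R2} r * (indicator angles t * ennreal (1 / (\<kappa> t + (p r)\<^sup>2))) \<partial>lborel)
        = ennreal (2 * R2 * real n ^ 2 * C1) * indicator {r1<..<R2} r * (\<integral>\<^sup>+t. indicator angles t * ennreal (1 / (\<kappa> t + (p r)\<^sup>2)) \<partial>lborel)"
        by (rule nn_integral_cmult) measurable
      also have "\<dots> \<le> ennreal (2 * R2 * real n ^ 2 * C1) * indicator {r1<..<R2} r * ennreal (4 * pi / p r)"
        unfolding \<kappa>_def by (intro mult_left_mono angular_integral_le p n) auto
      finally show "(\<integral>\<^sup>+t. ennreal (2 * R2 * real n ^ 2 * C1) * indicator {r1<..<R2} r * (indicator angles t * ennreal (1 / (\<kappa> t + (p r)\<^sup>2))) \<partial>lborel)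
        \<le> ennreal (2 * R2 * real n ^ 2 * C1) * indicator {r1<..<R2} r * ennreal (4 * pi / p r)" .
    qed
    also have "\<dots> = ennreal ((R2 - R1) / (n * sqrt 2)) * (\<integral>\<^sup>+x. ennreal (2 * R2 * real n ^ 2 * C1) * indicator {r1<..<R2} (r1 + (R2 - R1) / (n * sqrt 2) * x) * ennreal (4 * pi / p (r1 + (R2 - R1) / (n * sqrt 2) * x)) \<partial>lborel)"
      using R n by (subst nn_integral_real_affine[where c = "(R2 - R1) / (n * sqrt 2)" and t = r1]) auto
    also have "\<dots> \<le> ennreal ((R2 - R1) / n) * (\<integral>\<^sup>+x. ennreal (16 * pi * R2 * real n ^ 2 * C1) * (ennreal (1 / (\<bar>1 - x\<bar> + \<epsilon>)) * indicator {0..2} x) \<partial>lborel)"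
    proof (rule mult_mono[OF ennreal_leI nn_integral_mono])
      show "(R2 - R1) / (n * sqrt 2) \<le> (R2 - R1) / n" using R n by (intro divide_left_mono) auto
      fix x :: real
      define r where "r = r1 + (R2 - R1) / (n * sqrt 2) * x"
      have qx: "?q r = x / sqrt 2" using R n by (simp add: lq_def r_def r1_def field_simps)
      then have px: "4 * pi / p r = 8 * pi * (1 / (\<bar>1 - x\<bar> + \<epsilon>))" by (simp add: p_def)
      show "ennreal (2 * R2 * real n ^ 2 * C1) * indicator {r1<..<R2} (r1 + (R2 - R1) / (n * sqrt 2) * x) * ennreal (4 * pi / p (r1 + (R2 - R1) / (n * sqrt 2) * x))
        \<le> ennreal (16 * pi * R2 * real n ^ 2 * C1) * (ennreal (1 / (\<bar>1 - x\<bar> + \<epsilon>)) * indicator {0..2} x)"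
      proof (cases "r \<in> {r1<..<R2}")
        case True
        have "?q r > 0" using True qpos by simp
        then have x0: "x > 0" unfolding qx by (simp add: zero_less_divide_iff)
        have "?q r < 1" using True R n by (simp add: lq_def)
        then have "x < sqrt 2" unfolding qx by simp
        also have "sqrt 2 \<le> 2" by (rule real_le_lsqrt) auto
        finally have x2: "x \<in> {0..2}" using x0 by simp
        have "ennreal (2 * R2 * real n ^ 2 * C1) * ennreal (4 * pi / p r) = ennreal (16 * pi * R2 * real n ^ 2 * C1) * ennreal (1 / (\<bar>1 - x\<bar> + \<epsilon>))"
          unfolding px using R C1 \<epsilon> by (subst (1 2) ennreal_mult[symmetric]) auto
        then show ?thesis using True x2 unfolding r_def[symmetric] by simp
      qed (simp add: r_def)
    qed auto
    also have "\<dots> = ennreal ((R2 - R1) / n) * (ennreal (16 * pi * R2 * real n ^ 2 * C1) * (\<integral>\<^sup>+x. ennreal (1 / (\<bar>1 - x\<bar> + \<epsilon>)) * indicator {0..2} x \<partial>lborel))"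
      by (subst nn_integral_cmult) auto
    also have "\<dots> \<le> ennreal ((R2 - R1) / n) * (ennreal (16 * pi * R2 * real n ^ 2 * C1) * ennreal (2 * (1 + \<bar>ln \<epsilon>\<bar>)))"
      by (intro mult_left_mono radial_log_integral \<epsilon>) auto
    also have "\<dots> = ennreal (C * real n * (1 + \<bar>ln \<epsilon>\<bar>))"
    proof -
      have e1: "(R2 - R1) / n * (16 * pi * R2 * real n ^ 2 * C1 * (2 * (1 + \<bar>ln \<epsilon>\<bar>))) = C * real n * (1 + \<bar>ln \<epsilon>\<bar>)"
        using n by (simp add: C_def power2_eq_square)
      have e2: "ennreal a * (ennreal b * ennreal c) = ennreal (a * (b * c))" if "0 \<le> a" "0 \<le> b" "0 \<le> c" for a b c
        using that by (simp add: ennreal_mult)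
      show ?thesis unfolding e1[symmetric] by (rule e2) (use R C1 in auto)
    qed
    finally show "\<exists>v \<in> GL_admissible R1 R2 n. GL_energy \<epsilon> ?A v \<le> ennreal (C * real n * (1 + \<bar>ln \<epsilon>\<bar>))"
      using adm by blast
  qed
qed

section \<open>Traces under composition\<close>

lemma sobolev_H1_norm_rep:
  assumes A: "open A" "bounded A" and w: "wk A U P Q" and ae: "AE z in lebesgue_on A. u z = U z"
  shows "(sobolev_H1_norm A u)\<^sup>2 = nsq U + nsq P + nsq Q"
proof -
  have Ab: "A \<in> sets borel" using A by simp
  note W = wkD[OF w] and D = wk_unique[OF A w ae]
  have "(L2_norm (lebesgue_on A) u)\<^sup>2 = nsq U" by (rule L2_norm_rep(2)[OF Ab W(1) _ ae]) (rule W)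
  moreover have "(L2_norm (lebesgue_on A) (wderiv A 1 u))\<^sup>2 = nsq P" by (rule L2_norm_rep(2)[OF Ab W(2) _ D(1)]) (rule W)
  moreover have "(L2_norm (lebesgue_on A) (wderiv A \<i> u))\<^sup>2 = nsq Q" by (rule L2_norm_rep(2)[OF Ab W(3) _ D(2)]) (rule W)
  ultimately show ?thesis by (simp add: sobolev_H1_norm_def nsq_nonneg)
qed

lemma AE_lborel_of_lebesgue_on:
  assumes A: "A \<in> sets borel" and ae: "AE z in lebesgue_on A. Q z" and off: "\<And>z. z \<notin> A \<Longrightarrow> Q z"
  shows "AE z in lborel. Q z"
proof -
  have "A \<inter> space lebesgue \<in> sets lebesgue" using A by simp
  then show ?thesis using ae off by (subst (asm) AE_restrict_space_iff) (auto simp: AE_completion_iff elim!: eventually_mono)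
qed

text \<open>The approximating functions in the definition of the trace, restricted to \<open>A\<close>, serve as their own representatives.\<close>

lemma has_trace_approx:
  assumes A: "open A" "bounded A" and w: "wk A U P Q" and ae: "AE z in lebesgue_on A. u z = U z" and tr: "has_trace A \<Gamma> u g"
  shows "\<exists>F pn qn. (\<forall>n::nat. continuous_on (closure A) (F n)) \<and>
    (\<forall>n. wk A (\<lambda>z. if z \<in> A then F n z else 0) (pn n) (qn n)) \<and>
    (\<lambda>n. nsq (\<lambda>z. (if z \<in> A then F n z else 0) - U z)) \<longlonglongrightarrow> 0 \<and>
    (\<lambda>n. nsq (\<lambda>z. pn n z - P z)) \<longlonglongrightarrow> 0 \<and> (\<lambda>n. nsq (\<lambda>z. qn n z - Q z)) \<longlonglongrightarrow> 0 \<and>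
    tendsto_L2 (hausdorff1_on \<Gamma>) F g sequentially"
proof -
  have Ab: "A \<in> sets borel" using A by simp
  obtain F where F: "\<And>n::nat. F n \<in> sobolev_H1 A" "\<And>n. continuous_on (closure A) (F n)"
    "(\<lambda>n. sobolev_H1_norm A (\<lambda>z. F n z - u z)) \<longlonglongrightarrow> 0" "tendsto_L2 (hausdorff1_on \<Gamma>) F g sequentially"
    using tr unfolding has_trace_def by blast
  have "\<exists>p q. wk A (\<lambda>z. if z \<in> A then F n z else 0) p q" for n
  proof -
    obtain V p q where V: "wk A V p q" "AE z in lebesgue_on A. F n z = V z" by (rule H1_rep[OF A(1) F(1)[of n]])
    have "continuous_on A (F n)" by (rule continuous_on_subset[OF F(2) closure_subset])
    then have "(\<lambda>z. indicator A z *\<^sub>R F n z) \<in> borel_measurable borel"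
      using A by (intro borel_measurable_continuous_on_indicator) auto
    also have "(\<lambda>z. indicator A z *\<^sub>R F n z) = (\<lambda>z. if z \<in> A then F n z else 0)" by (auto simp: fun_eq_iff)
    finally have m: "(\<lambda>z. if z \<in> A then F n z else 0) \<in> borel_measurable borel" .
    have "AE z in lborel. V z = (if z \<in> A then F n z else 0)"
      by (rule AE_lborel_of_lebesgue_on[OF Ab]) (use V wkD(4)[OF V(1)] Ab in \<open>auto simp: AE_restrict_space_iff elim!: eventually_mono\<close>)
    from wk_AE_cong[OF V(1) m _ this] show ?thesis by auto
  qed
  then obtain pn qn where W: "\<And>n. wk A (\<lambda>z. if z \<in> A then F n z else 0) (pn n) (qn n)" by metis
  have eq: "(sobolev_H1_norm A (\<lambda>z. F n z - u z))\<^sup>2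
     = nsq (\<lambda>z. (if z \<in> A then F n z else 0) - U z) + nsq (\<lambda>z. pn n z - P z) + nsq (\<lambda>z. qn n z - Q z)" for n
    by (rule sobolev_H1_norm_rep[OF A wk_diff[OF W[of n] w]]) (use ae Ab in \<open>auto simp: AE_restrict_space_iff elim!: eventually_mono\<close>)
  have lim: "(\<lambda>n. nsq (\<lambda>z. (if z \<in> A then F n z else 0) - U z) + nsq (\<lambda>z. pn n z - P z) + nsq (\<lambda>z. qn n z - Q z)) \<longlonglongrightarrow> 0"
    using tendsto_power[OF F(3), of 2] unfolding eq by simp
  have sq: "g \<longlonglongrightarrow> 0" if "\<And>n. 0 \<le> g n" "\<And>n. g n \<le> nsq (\<lambda>z. (if z \<in> A then F n z else 0) - U z) + nsq (\<lambda>z. pn n z - P z) + nsq (\<lambda>z. qn n z - Q z)"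
    for g :: "nat \<Rightarrow> real"
    by (rule tendsto_sandwich[OF _ _ tendsto_const lim]) (use that in auto)
  have "(\<lambda>n. nsq (\<lambda>z. (if z \<in> A then F n z else 0) - U z)) \<longlonglongrightarrow> 0" "(\<lambda>n. nsq (\<lambda>z. pn n z - P z)) \<longlonglongrightarrow> 0" "(\<lambda>n. nsq (\<lambda>z. qn n z - Q z)) \<longlonglongrightarrow> 0"
    by (rule sq; auto simp: nsq_nonneg add_nonneg_nonneg)+
  then show ?thesis using F(2,4) W by blast
qed

context contraction_C1
begin

lemma tendsto_L2_P:
  assumes "tendsto_L2 M f g sequentially" and r: "strict_mono (r::nat \<Rightarrow> nat)"
  shows "tendsto_L2 M (\<lambda>n z. P (f (r n) z)) (\<lambda>z. P (g z)) sequentially"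
proof -
  have f: "\<forall>\<^sub>F n in sequentially. f (r n) \<in> L2 M" "g \<in> L2 M" "(\<lambda>n. L2_norm M (\<lambda>z. f (r n) z - g z)) \<longlonglongrightarrow> 0"
    using assms eventually_compose_filterlim[OF _ filterlim_subseq[OF r], of "\<lambda>n. f n \<in> L2 M"] LIMSEQ_subseq_LIMSEQ[OF _ r]
    unfolding tendsto_L2_def o_def by blast+
  have L2_P: "(\<lambda>z. P (h z)) \<in> L2 M" if "h \<in> L2 M" for h
  proof -
    have [measurable]: "h \<in> borel_measurable M" and i: "integrable M (\<lambda>z. (cmod (h z))\<^sup>2)" using that by (auto simp: L2_def)
    have "integrable M (\<lambda>z. (cmod (P (h z)))\<^sup>2)"
      by (rule Bochner_Integration.integrable_bound[OF i]) (auto intro!: AE_I2 power_mono norm_le)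
    then show ?thesis by (simp add: L2_def)
  qed
  have le: "L2_norm M (\<lambda>z. P (h z) - P (g z)) \<le> L2_norm M (\<lambda>z. h z - g z)" if h: "h \<in> L2 M" for h
  proof -
    have [measurable]: "h \<in> borel_measurable M" "g \<in> borel_measurable M" and i: "integrable M (\<lambda>z. 2 * (cmod (h z))\<^sup>2 + 2 * (cmod (g z))\<^sup>2)"
      using h f(2) by (auto simp: L2_def)
    have b: "(cmod (h z - g z))\<^sup>2 \<le> 2 * (cmod (h z))\<^sup>2 + 2 * (cmod (g z))\<^sup>2" for z
      using norm_add_sq[of "h z" "- g z"] by simp
    have i1: "integrable M (\<lambda>z. (cmod (h z - g z))\<^sup>2)"
      by (rule Bochner_Integration.integrable_bound[OF i]) (use b in auto)
    have l: "(cmod (P (h z) - P (g z)))\<^sup>2 \<le> (cmod (h z - g z))\<^sup>2" for z by (intro power_mono lipschitz) auto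
    have i2: "integrable M (\<lambda>z. (cmod (P (h z) - P (g z)))\<^sup>2)"
      by (rule Bochner_Integration.integrable_bound[OF i1]) (use l in auto)
    show ?thesis unfolding L2_norm_def by (intro real_sqrt_le_mono integral_mono i1 i2 l)
  qed
  have "(\<lambda>n. L2_norm M (\<lambda>z. P (f (r n) z) - P (g z))) \<longlonglongrightarrow> 0"
    by (rule tendsto_sandwich[OF _ _ tendsto_const f(3)])
       (use f(1) le in \<open>auto simp: L2_norm_def elim!: eventually_mono\<close>)
  then show ?thesis using f(1,2) L2_P unfolding tendsto_L2_def by (auto elim!: eventually_mono)
qed

lemma nsq_P_le:
  assumes "sqint f" "sqint g"
  shows "nsq (\<lambda>z. P (f z) - P (g z)) \<le> nsq (\<lambda>z. f z - g z)"
  using sqint_bound(2)[where c = 1, OF sqint_diff(1)[OF assms] sqint_meas[OF sqint_diff(1)[OF sqint_P[OF assms(1)] sqint_P[OF assms(2)]]]] lipschitz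
  by simp

lemma sobolev_H1_P:
  assumes A: "open A" "bounded A" and w: "wk A U p q" and ae: "AE z in lebesgue_on A. u z = U z"
  shows "(\<lambda>z. P (u z)) \<in> sobolev_H1 A"
  by (rule wk_is_weak_deriv(3)[OF A(1) chain_wk[OF A w]]) (use ae in \<open>auto elim!: eventually_mono\<close>)

text \<open>Compose the approximating functions with \<open>P\<close>. Convergence of the derivatives holds along a subsequence
  that converges almost everywhere, and the boundary values converge since \<open>P\<close> is a contraction.\<close>

lemma has_trace_P:
  assumes A: "open A" "bounded A" and w: "wk A U p q" and ae: "AE z in lebesgue_on A. u z = U z" and tr: "has_trace A \<Gamma> u g"
  shows "has_trace A \<Gamma> (\<lambda>z. P (u z)) (\<lambda>z. P (g z))"
proof -
  have Ab: "A \<in> sets borel" using A by simp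
  obtain F pn qn where F: "\<And>n::nat. continuous_on (closure A) (F n)"
    and W: "\<And>n. wk A (\<lambda>z. if z \<in> A then F n z else 0) (pn n) (qn n)"
    and lim: "(\<lambda>n. nsq (\<lambda>z. (if z \<in> A then F n z else 0) - U z)) \<longlonglongrightarrow> 0"
      "(\<lambda>n. nsq (\<lambda>z. pn n z - p z)) \<longlonglongrightarrow> 0" "(\<lambda>n. nsq (\<lambda>z. qn n z - q z)) \<longlonglongrightarrow> 0"
    and L2: "tendsto_L2 (hausdorff1_on \<Gamma>) F g sequentially"
    using has_trace_approx[OF A w ae tr] by blast
  define G where "G n z = (if z \<in> A then F n z else 0)" for n z
  note W' = W[folded G_def] and lim' = lim[folded G_def]
  note WD = wkD[OF W'] and wD = wkD[OF w]
  obtain r :: "nat \<Rightarrow> nat" where r: "strict_mono r" "AE z in lborel. (\<lambda>n. G (r n) z - U z) \<longlonglongrightarrow> 0"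
    using nsq_AE_subseq[OF sqint_diff(1)[OF WD(1) wD(1)] lim'(1)] by blast
  have ae2: "AE z in lborel. (\<lambda>n. G (r n) z) \<longlonglongrightarrow> U z" using r(2) by eventually_elim (simp add: LIM_zero_iff)
  have sub: "(\<lambda>n. s (r n)) \<longlonglongrightarrow> 0" if "s \<longlonglongrightarrow> 0" for s :: "nat \<Rightarrow> real"
    using LIMSEQ_subseq_LIMSEQ[OF that r(1)] by (simp add: o_def)
  have l1: "(\<lambda>n. nsq (\<lambda>z. P (G (r n) z) - P (U z))) \<longlonglongrightarrow> 0"
    by (rule tendsto_sandwich[OF _ _ tendsto_const sub[OF lim'(1)]]) (auto simp: nsq_nonneg nsq_P_le[OF WD(1) wD(1)])
  have l2: "(\<lambda>n. nsq (\<lambda>z. DP (G (r n) z) (pn (r n) z) - DP (U z) (p z))) \<longlonglongrightarrow> 0"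
    by (rule DP_tendsto[OF WD(1) wD(1) ae2 WD(2) wD(2) sub[OF lim'(2)]])
  have l3: "(\<lambda>n. nsq (\<lambda>z. DP (G (r n) z) (qn (r n) z) - DP (U z) (q z))) \<longlonglongrightarrow> 0"
    by (rule DP_tendsto[OF WD(1) wD(1) ae2 WD(3) wD(3) sub[OF lim'(3)]])
  have FG: "AE z in lebesgue_on A. F n z = G n z" for n using Ab by (auto simp: AE_restrict_space_iff G_def)
  have eq: "(sobolev_H1_norm A (\<lambda>z. P (F (r n) z) - P (u z)))\<^sup>2 = nsq (\<lambda>z. P (G (r n) z) - P (U z))
      + nsq (\<lambda>z. DP (G (r n) z) (pn (r n) z) - DP (U z) (p z)) + nsq (\<lambda>z. DP (G (r n) z) (qn (r n) z) - DP (U z) (q z))" for n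
  proof (rule sobolev_H1_norm_rep[OF A wk_diff[OF chain_wk[OF A W'] chain_wk[OF A w]]])
    show "AE z in lebesgue_on A. P (F (r n) z) - P (u z) = P (G (r n) z) - P (U z)"
      using ae FG[of "r n"] by eventually_elim simp
  qed
  have "(\<lambda>n. (sobolev_H1_norm A (\<lambda>z. P (F (r n) z) - P (u z)))\<^sup>2) \<longlonglongrightarrow> 0"
    unfolding eq using tendsto_add[OF tendsto_add[OF l1 l2] l3] by simp
  from tendsto_real_sqrt[OF this] have H: "(\<lambda>n. sobolev_H1_norm A (\<lambda>z. P (F (r n) z) - P (u z))) \<longlonglongrightarrow> 0"
    by (simp add: sobolev_H1_norm_def)
  show ?thesis
    unfolding has_trace_def
  proof (intro exI[of _ "\<lambda>n z. P (F (r n) z)"] conjI allI H tendsto_L2_P[OF L2 r(1)])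
    show "(\<lambda>z. P (F (r n) z)) \<in> sobolev_H1 A" for n by (rule sobolev_H1_P[OF A W' FG])
    show "continuous_on (closure A) (\<lambda>z. P (F (r n) z))" for n
      by (rule continuous_on_compose2[OF P_cont F]) auto
  qed
qed

end

section \<open>Modulus of minimizers\<close>

definition trunc_factor :: "real \<Rightarrow> real" where "trunc_factor x = 1 / (1 + pos2 (x - 1) / 8)"

definition trunc_factor' :: "real \<Rightarrow> real" where "trunc_factor' x = - (max 0 (x - 1) / 4) / (1 + pos2 (x - 1) / 8)\<^sup>2"

text \<open>A \<open>C\<^sup>1\<close> contraction of the plane that fixes the unit disc and moves every other
  point closer to the unit circle, as measured by the potential. It replaces the projection onto the disc, which is not differentiable on the circle. The
  constant \<open>1 / 8\<close> is small enough for the radial derivative to stay in \<open>[-1, 1]\<close>.\<close>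

definition trunc :: "complex \<Rightarrow> complex" where "trunc y = trunc_factor ((norm y)\<^sup>2) *\<^sub>R y"

definition trunc' :: "complex \<Rightarrow> complex \<Rightarrow> complex" where
  "trunc' y w = trunc_factor ((norm y)\<^sup>2) *\<^sub>R w + (2 * trunc_factor' ((norm y)\<^sup>2) * (y \<bullet> w)) *\<^sub>R y"

lemma trunc_den: "1 + pos2 x / 8 \<ge> 1" "1 + pos2 x / 8 > 0" "1 + pos2 x / 8 \<noteq> 0"
proof -
  have "pos2 x \<ge> 0" by (simp add: pos2_def)
  then show "1 + pos2 x / 8 \<ge> 1" "1 + pos2 x / 8 > 0" "1 + pos2 x / 8 \<noteq> 0" by auto
qed

lemma trunc_factor_deriv: "(trunc_factor has_real_derivative trunc_factor' x) (at x)"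
proof -
  have "((\<lambda>x. x - 1) has_real_derivative 1) (at x)" by (auto intro!: derivative_eq_intros)
  from DERIV_chain2[OF pos2_deriv this] have p: "((\<lambda>x. pos2 (x - 1)) has_real_derivative 2 * max 0 (x - 1)) (at x)" by simp
  have "((\<lambda>x. 1 + pos2 (x - 1) / 8) has_real_derivative 2 * max 0 (x - 1) / 8) (at x)"
    using DERIV_add[OF DERIV_const[of 1] DERIV_cdivide[OF p, of 8]] by simp
  from DERIV_divide[OF DERIV_const this trunc_den(3), of 1] show ?thesis
    unfolding trunc_factor_def[abs_def] trunc_factor'_def by (simp add: power2_eq_square)
qed

lemma trunc_deriv: "(trunc has_derivative trunc' y) (at y)"
proof -
  have D0: "((\<lambda>y::complex. y \<bullet> y) has_derivative (\<lambda>w. 2 * (y \<bullet> w))) (at y)"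
    by (rule has_derivative_eq_rhs[OF has_derivative_inner[OF has_derivative_ident has_derivative_ident]]) (auto simp: inner_commute)
  have "(trunc_factor has_derivative (*) (trunc_factor' (y \<bullet> y))) (at (y \<bullet> y))"
    using trunc_factor_deriv[of "y \<bullet> y"] by (simp add: has_field_derivative_def)
  from has_derivative_scaleR[OF has_derivative_compose[OF D0 this] has_derivative_ident]
  show ?thesis
    unfolding trunc_def[abs_def] trunc'_def by (simp add: power2_norm_eq_inner mult.assoc mult.left_commute)
qed

text \<open>The derivative is the factor \<open>k\<close> in the tangential direction and \<open>k + 2 k' x\<close> in the radial one, where \<open>x\<close>
  is the square of the modulus; both lie in \<open>[-1, 1]\<close>.\<close>

lemma trunc_contraction: "norm (trunc' y w) \<le> norm w"
proof -
  define p where "p = max 0 ((norm y)\<^sup>2 - 1)"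
  define D where "D = 1 + p\<^sup>2 / 8"
  define k where "k = trunc_factor ((norm y)\<^sup>2)"
  define k' where "k' = trunc_factor' ((norm y)\<^sup>2)"
  define x where "x = (norm y)\<^sup>2"
  define t where "t = y \<bullet> w"
  have p: "p \<ge> 0" by (simp add: p_def)
  have D: "D \<ge> 1" "D > 0" by (auto simp: D_def intro: add_pos_nonneg)
  have k: "k = 1 / D" "k' = - (p / 4) / D\<^sup>2" by (auto simp: k_def k'_def trunc_factor_def trunc_factor'_def D_def p_def pos2_def)
  have k1: "0 \<le> k" "k \<le> 1" "k' \<le> 0" using D p by (auto simp: k)
  have t: "t\<^sup>2 \<le> x * (norm w)\<^sup>2"
    using power_mono[OF Cauchy_Schwarz_ineq2[of y w], of 2] by (simp add: t_def x_def power_mult_distrib)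
  have N: "(norm (trunc' y w))\<^sup>2 = k\<^sup>2 * (norm w)\<^sup>2 + 4 * k' * (k + k' * x) * t\<^sup>2"
  proof -
    have G: "(norm (a *\<^sub>R w + b *\<^sub>R y))\<^sup>2 = a\<^sup>2 * (norm w)\<^sup>2 + 2 * a * b * (y \<bullet> w) + b\<^sup>2 * (norm y)\<^sup>2" for a b
      unfolding power2_norm_eq_inner
      by (simp add: inner_add_left inner_add_right inner_commute[of w y] power2_eq_square algebra_simps)
    have "trunc' y w = k *\<^sub>R w + (2 * k' * t) *\<^sub>R y" by (simp add: trunc'_def k_def k'_def t_def)
    then show ?thesis
      by (simp only: G x_def[symmetric] t_def[symmetric]) (simp add: power2_eq_square algebra_simps)
  qed
  \<comment> \<open>the right side is affine in \<open>t\<^sup>2\<close>, so only its two extreme values matter\<close>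
  have "\<dots> \<le> 1 * (norm w)\<^sup>2"
  proof (cases "k + k' * x \<ge> 0")
    case True
    have "4 * k' * (k + k' * x) * t\<^sup>2 \<le> 0" using True k1 by (intro mult_nonpos_nonneg[of "4 * k' * (k + k' * x)"] mult_nonpos_nonneg[of "4 * k'"]) auto
    moreover have "k\<^sup>2 * (norm w)\<^sup>2 \<le> 1 * (norm w)\<^sup>2" using k1 by (intro mult_right_mono power_le_one) auto
    ultimately show ?thesis by linarith
  next
    case False
    then have px: "x = 1 + p" using k1 unfolding p_def x_def k(2) by (cases "p = 0") (auto simp: k max_def p_def split: if_splits)
    have "0 \<le> 4 * k' * (k + k' * x)" using False k1 by (intro mult_nonpos_nonpos[of "4 * k'"]) auto
    from mult_left_mono[OF t this]
    have "k\<^sup>2 * (norm w)\<^sup>2 + 4 * k' * (k + k' * x) * t\<^sup>2 \<le> (k + 2 * k' * x)\<^sup>2 * (norm w)\<^sup>2"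
      by (simp add: power2_eq_square algebra_simps)
    also have "\<dots> \<le> 1 * (norm w)\<^sup>2"
    proof (intro mult_right_mono)
      have "x \<ge> 0" by (simp add: x_def)
      then have up: "k + 2 * k' * x \<le> 1" using k1 mult_nonpos_nonneg[of k' x] by simp
      have "D\<^sup>2 + D - (p / 2) * (1 + p) = (p\<^sup>2 / 8 - 1)\<^sup>2 + (p - 2)\<^sup>2 / 8 + 1 / 2"
        by (simp add: D_def power2_eq_square field_simps)
      also have "\<dots> \<ge> 0" by simp
      finally have "((p / 2) * (1 + p) - D) / D\<^sup>2 \<le> 1" using D by (simp add: divide_le_eq)
      moreover have "k + 2 * k' * x = - (((p / 2) * (1 + p) - D) / D\<^sup>2)"
        using D unfolding k px by (simp add: field_simps power2_eq_square)
      ultimately have "- 1 \<le> k + 2 * k' * x" by simp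
      then show "(k + 2 * k' * x)\<^sup>2 \<le> 1" using up by (simp add: abs_square_le_1 abs_le_iff)
    qed simp
    finally show ?thesis .
  qed
  then have "(norm (trunc' y w))\<^sup>2 \<le> (norm w)\<^sup>2" unfolding N by simp
  then show ?thesis by (rule power2_le_imp_le) simp
qed

lemma trunc_id: "norm y \<le> 1 \<Longrightarrow> trunc y = y"
proof -
  assume "norm y \<le> 1"
  then have "(norm y)\<^sup>2 \<le> 1" by (simp add: power_le_one)
  then show ?thesis by (simp add: trunc_def trunc_factor_def pos2_def)
qed

text \<open>With \<open>s = (norm y)\<^sup>2 - 1 > 0\<close>, the new squared modulus lies strictly between \<open>1 - s\<close> and \<open>1 + s\<close>.\<close>

lemma trunc_potential:
  shows "norm y > 1 \<Longrightarrow> (1 - (norm (trunc y))\<^sup>2)\<^sup>2 < (1 - (norm y)\<^sup>2)\<^sup>2"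
    and "(1 - (norm (trunc y))\<^sup>2)\<^sup>2 \<le> (1 - (norm y)\<^sup>2)\<^sup>2"
proof -
  show lt: "(1 - (norm (trunc y))\<^sup>2)\<^sup>2 < (1 - (norm y)\<^sup>2)\<^sup>2" if y: "norm y > 1"
  proof -
    define s where "s = (norm y)\<^sup>2 - 1"
    have s: "s > 0" using y by (simp add: s_def one_less_power)
    define D where "D = (1 + s\<^sup>2 / 8)\<^sup>2"
    have D1: "D > 1" using s by (auto simp: D_def intro!: one_less_power)
    have tf: "trunc_factor ((norm y)\<^sup>2) = 1 / (1 + s\<^sup>2 / 8)" using s by (simp add: trunc_factor_def pos2_def s_def max_def)
    have N: "(norm (trunc y))\<^sup>2 = (1 + s) / D"
      unfolding trunc_def norm_scaleR power_mult_distrib tf by (simp add: D_def s_def power_divide)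
    have up: "(1 + s) / D < 1 + s" using D1 s by (simp add: divide_less_eq)
    have "(1 - s) * D < 1 + s"
    proof (cases "s \<ge> 1")
      case True
      then have "(1 - s) * D \<le> 0" using D1 by (intro mult_nonpos_nonneg) auto
      then show ?thesis using s by linarith
    next
      case False
      have s2: "s\<^sup>2 \<le> s" using s False by (simp add: power2_eq_square mult_left_le)
      have "D = 1 + s\<^sup>2 * (1 / 4 + s\<^sup>2 / 64)" by (simp add: D_def power2_eq_square field_simps)
      also have "\<dots> \<le> 1 + s\<^sup>2 * 1" using s2 False by (intro add_left_mono mult_left_mono) auto
      also have "\<dots> \<le> 1 + s" using s2 by simp
      finally have "(1 - s) * D \<le> (1 - s) * (1 + s)" using False by (intro mult_left_mono) auto
      also have "\<dots> = 1 - s * s" by (simp add: algebra_simps)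
      also have "\<dots> < 1 + s" using s mult_pos_pos[OF s s] by linarith
      finally show ?thesis .
    qed
    then have lo: "1 - s < (1 + s) / D" using D1 by (simp add: less_divide_eq)
    have "\<bar>1 - (1 + s) / D\<bar> < \<bar>s\<bar>" using up lo s by (auto simp: abs_less_iff)
    then have "(1 - (1 + s) / D)\<^sup>2 < s\<^sup>2" by (rule power2_strict_mono)
    then show ?thesis unfolding N by (simp add: s_def power2_commute)
  qed
  show "(1 - (norm (trunc y))\<^sup>2)\<^sup>2 \<le> (1 - (norm y)\<^sup>2)\<^sup>2"
    using lt trunc_id[of y] by (cases "norm y \<le> 1") auto
qed

interpretation trunc: contraction_C1 trunc trunc'
proof
  show "(trunc has_derivative trunc' y) (at y)" for y by (rule trunc_deriv)
  show "norm (trunc' y w) \<le> norm w" for y w by (rule trunc_contraction)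
  show "trunc 0 = 0" by (simp add: trunc_def)
  have k: "continuous_on UNIV pos2" using pos2_deriv by (intro DERIV_continuous_on) (auto intro: has_field_derivative_at_within)
  have c: "continuous_on UNIV (\<lambda>y::complex. pos2 ((norm y)\<^sup>2 - 1))"
    by (rule continuous_on_compose2[OF k]) (auto intro!: continuous_intros)
  show "continuous_on UNIV (\<lambda>y. trunc' y w)" for w
    unfolding trunc'_def trunc_factor_def trunc_factor'_def
    by (intro continuous_intros c) (auto simp: trunc_den)
qed

text \<open>Both boundary conditions have values on the unit circle, where \<open>trunc\<close> is the identity.\<close>

lemma GL_admissible_trunc:
  assumes u: "u \<in> GL_admissible R1 R2 n"
  shows "(\<lambda>z. trunc (u z)) \<in> GL_admissible R1 R2 n"
proof -
  let ?A = "annulus R1 R2"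
  have A: "open ?A" "bounded ?A" by (rule annulus_open annulus_bounded)+
  obtain g where u': "u \<in> sobolev_H1 ?A" "has_trace ?A (sphere 0 R2) u (\<lambda>z. cis (real n * Arg z))"
    "has_trace ?A (sphere 0 R1) u g" "AE z in hausdorff1_on (sphere 0 R1). cmod (g z) = 1"
    using u unfolding GL_admissible_def by blast
  obtain U P Q where w: "wk ?A U P Q" "AE z in lebesgue_on ?A. u z = U z" by (rule H1_rep[OF A(1) u'(1)])
  note t = trunc.has_trace_P[OF A w]
  have "has_trace ?A (sphere 0 R2) (\<lambda>z. trunc (u z)) (\<lambda>z. cis (real n * Arg z))"
    using t[OF u'(2)] by (simp add: trunc_id)
  moreover have "has_trace ?A (sphere 0 R1) (\<lambda>z. trunc (u z)) (\<lambda>z. trunc (g z))" by (rule t[OF u'(3)])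
  moreover have "AE z in hausdorff1_on (sphere 0 R1). cmod (trunc (g z)) = 1"
    using u'(4) by eventually_elim (simp add: trunc_id)
  ultimately show ?thesis using trunc.sobolev_H1_P[OF A w] unfolding GL_admissible_def by blast
qed

text \<open>Truncation does not increase the Dirichlet energy and strictly lowers the potential where the modulus
  exceeds one; since the energy is finite, a minimizer exceeds one only on a null set.\<close>

lemma minimizer_le_1:
  assumes \<epsilon>: "\<epsilon> > 0" and min: "GL_minimizer \<epsilon> R1 R2 n u" and fin: "GL_energy \<epsilon> (annulus R1 R2) u < top"
    and w: "wk (annulus R1 R2) U P Q" and ae: "AE z in lebesgue_on (annulus R1 R2). u z = U z"
  shows "AE z in lborel. norm (U z) \<le> 1"
proof -
  let ?A = "annulus R1 R2"
  have A: "open ?A" "bounded ?A" by (rule annulus_open annulus_bounded)+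
  then have [measurable]: "?A \<in> sets borel" by simp
  note [measurable] = sqint_meas[OF wkD(1)[OF w]] trunc.measurable_P
  define G where "G = (\<integral>\<^sup>+z. ennreal ((cmod (P z))\<^sup>2 + (cmod (Q z))\<^sup>2) * indicator ?A z \<partial>lborel)"
  define G' where "G' = (\<integral>\<^sup>+z. ennreal ((cmod (trunc' (U z) (P z)))\<^sup>2 + (cmod (trunc' (U z) (Q z)))\<^sup>2) * indicator ?A z \<partial>lborel)"
  define W where "W = (\<integral>\<^sup>+z. ennreal ((1 - (cmod (U z))\<^sup>2)\<^sup>2) * indicator ?A z \<partial>lborel)"
  define W' where "W' = (\<integral>\<^sup>+z. ennreal ((1 - (cmod (trunc (U z)))\<^sup>2)\<^sup>2) * indicator ?A z \<partial>lborel)"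
  define c where "c = ennreal (1 / (4 * \<epsilon>\<^sup>2))"
  have E: "GL_energy \<epsilon> ?A u = ennreal (1 / 2) * G + c * W"
    unfolding G_def W_def c_def by (rule GL_energy_wk[OF A w ae])
  have E': "GL_energy \<epsilon> ?A (\<lambda>z. trunc (u z)) = ennreal (1 / 2) * G' + c * W'"
    unfolding G'_def W'_def c_def
    by (rule GL_energy_wk[OF A trunc.chain_wk[OF A w]]) (use ae in eventually_elim, simp)
  have le: "ennreal (1 / 2) * G + c * W \<le> ennreal (1 / 2) * G' + c * W'"
    using min GL_admissible_trunc unfolding GL_minimizer_def E[symmetric] E'[symmetric] by blast
  have "G' \<le> G"
    unfolding G_def G'_def by (intro nn_integral_mono mult_right_mono ennreal_leI add_mono power_mono trunc_contraction) auto
  then have "ennreal (1 / 2) * G' + c * W' \<le> ennreal (1 / 2) * G + c * W'" by (intro add_right_mono mult_left_mono) auto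
  from order_trans[OF le this] have "ennreal (1 / 2) * G + c * W \<le> ennreal (1 / 2) * G + c * W'" .
  moreover have ft: "ennreal (1 / 2) * G < top" "c * W < top" using fin unfolding E by (auto simp: less_top)
  ultimately have "c * W \<le> c * W'" by (auto simp: ennreal_add_left_cancel_le)
  moreover have c: "c > 0" "c < top" using \<epsilon> by (auto simp: c_def)
  ultimately have WW: "W \<le> W'" by (subst (asm) ennreal_mult_le_mult_iff) auto
  have "W < top" using ft(2) c by (auto simp: ennreal_mult_less_top)
  have W'W: "W' \<le> W"
    unfolding W_def W'_def by (intro nn_integral_mono mult_right_mono ennreal_leI trunc_potential(2)) auto
  have "(\<integral>\<^sup>+z. ennreal ((1 - (cmod (U z))\<^sup>2)\<^sup>2) * indicator ?A z - ennreal ((1 - (cmod (trunc (U z)))\<^sup>2)\<^sup>2) * indicator ?A z \<partial>lborel) = W - W'"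
    unfolding W_def W'_def
  proof (rule nn_integral_diff)
    show "(\<integral>\<^sup>+z. ennreal ((1 - (cmod (trunc (U z)))\<^sup>2)\<^sup>2) * indicator ?A z \<partial>lborel) \<noteq> \<infinity>"
      using W'W \<open>W < top\<close> unfolding W'_def[symmetric] by auto
    show "AE z in lborel. ennreal ((1 - (cmod (trunc (U z)))\<^sup>2)\<^sup>2) * indicator ?A z \<le> ennreal ((1 - (cmod (U z))\<^sup>2)\<^sup>2) * indicator ?A z"
      by (intro AE_I2 mult_right_mono ennreal_leI trunc_potential(2)) auto
  qed measurable
  also have "W - W' = 0" using WW W'W \<open>W < top\<close> by (simp add: order_antisym)
  finally have "AE z in lborel. ennreal ((1 - (cmod (U z))\<^sup>2)\<^sup>2) * indicator ?A z - ennreal ((1 - (cmod (trunc (U z)))\<^sup>2)\<^sup>2) * indicator ?A z = 0"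
    by (subst (asm) nn_integral_0_iff_AE) auto
  then show ?thesis
  proof eventually_elim
    case (elim z)
    show ?case
    proof (rule ccontr)
      assume n: "\<not> norm (U z) \<le> 1"
      then have "z \<in> ?A" using wkD(4)[OF w, of z] by (cases "z \<in> ?A") simp_all
      then have "(1 - (cmod (U z))\<^sup>2)\<^sup>2 - (1 - (cmod (trunc (U z)))\<^sup>2)\<^sup>2 \<le> 0"
        using elim by (simp add: ennreal_minus ennreal_eq_0_iff)
      then show False using trunc_potential(1)[of "U z"] n by simp
    qed
  qed
qed

lemma minimizer_bounds:
  assumes R: "0 < R1" "R1 < R2"
  obtains C where "C > 0" "\<And>n \<epsilon> u. n > 0 \<Longrightarrow> 0 < \<epsilon> \<Longrightarrow> \<epsilon> < 1 \<Longrightarrow> GL_minimizer \<epsilon> R1 R2 n u \<Longrightarrow>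
    \<exists>U P Q. wk (annulus R1 R2) U P Q \<and> (AE z in lebesgue_on (annulus R1 R2). u z = U z) \<and>
      (AE z in lborel. norm (U z) \<le> 1) \<and> nsq P + nsq Q \<le> C * real n * (1 + \<bar>ln \<epsilon>\<bar>)"
proof -
  let ?A = "annulus R1 R2"
  have A: "open ?A" "bounded ?A" by (rule annulus_open annulus_bounded)+
  obtain C where C: "C > 0" "\<And>n \<epsilon>. n > 0 \<Longrightarrow> 0 < \<epsilon> \<Longrightarrow> \<epsilon> < 1 \<Longrightarrow>
    \<exists>v \<in> GL_admissible R1 R2 n. GL_energy \<epsilon> ?A v \<le> ennreal (C * real n * (1 + \<bar>ln \<epsilon>\<bar>))"
    using comparison_map[OF R] by blast
  show ?thesis
  proof (rule that[of "2 * C"])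
    fix n :: nat and \<epsilon> u assume n: "n > 0" and \<epsilon>: "0 < \<epsilon>" "\<epsilon> < 1" and min: "GL_minimizer \<epsilon> R1 R2 n u"
    define K where "K = C * real n * (1 + \<bar>ln \<epsilon>\<bar>)"
    have K: "K \<ge> 0" using C by (simp add: K_def)
    obtain v where "v \<in> GL_admissible R1 R2 n" "GL_energy \<epsilon> ?A v \<le> ennreal K" using C(2)[OF n \<epsilon>] unfolding K_def by blast
    then have E: "GL_energy \<epsilon> ?A u \<le> ennreal K" using min unfolding GL_minimizer_def by (blast intro: order_trans)
    have "u \<in> sobolev_H1 ?A" using min unfolding GL_minimizer_def GL_admissible_def by blast
    then obtain U P Q where w: "wk ?A U P Q" "AE z in lebesgue_on ?A. u z = U z" by (rule H1_rep[OF A(1)])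
    have i: "integrable lborel (\<lambda>z. (cmod (P z))\<^sup>2)" "integrable lborel (\<lambda>z. (cmod (Q z))\<^sup>2)"
      using wkD(2,3)[OF w(1)] by (auto simp: sqint_def)
    have "(\<integral>\<^sup>+z. ennreal ((cmod (P z))\<^sup>2 + (cmod (Q z))\<^sup>2) * indicator ?A z \<partial>lborel) = (\<integral>\<^sup>+z. ennreal ((cmod (P z))\<^sup>2 + (cmod (Q z))\<^sup>2) \<partial>lborel)"
      using wkD(5,6)[OF w(1)] by (intro nn_integral_cong) (auto simp: indicator_def)
    also have "\<dots> = ennreal (nsq P + nsq Q)"
      unfolding nsq_def using i by (subst nn_integral_eq_integral) auto
    finally have "ennreal (1 / 2) * ennreal (nsq P + nsq Q) \<le> GL_energy \<epsilon> ?A u"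
      unfolding GL_energy_wk[OF A w] by simp
    then have "ennreal (1 / 2 * (nsq P + nsq Q)) \<le> ennreal K" using E by (subst ennreal_mult) (auto simp: nsq_nonneg)
    then have "nsq P + nsq Q \<le> 2 * K" using K by simp
    then have "nsq P + nsq Q \<le> 2 * C * real n * (1 + \<bar>ln \<epsilon>\<bar>)" by (simp add: K_def)
    moreover have "AE z in lborel. norm (U z) \<le> 1"
      by (rule minimizer_le_1[OF \<epsilon>(1) min _ w]) (use E in \<open>auto intro: le_less_trans\<close>)
    ultimately show "\<exists>U P Q. wk ?A U P Q \<and> (AE z in lebesgue_on ?A. u z = U z) \<and> (AE z in lborel. norm (U z) \<le> 1) \<and> nsq P + nsq Q \<le> 2 * C * real n * (1 + \<bar>ln \<epsilon>\<bar>)"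
      using w by blast
  qed (use C in auto)
qed

text \<open>The current of a triple of representatives.\<close>

definition cur :: "(complex \<Rightarrow> complex) \<Rightarrow> (complex \<Rightarrow> complex) \<Rightarrow> (complex \<Rightarrow> complex) \<Rightarrow> complex \<Rightarrow> complex" where
  "cur U P Q z = Complex (wedge (U z) (P z)) (wedge (U z) (Q z))"

text \<open>The bound on the modulus enters here: it makes the current, a product of two \<open>L\<^sup>2\<close> functions, square-integrable.\<close>

lemma cur_sqint:
  assumes w: "wk A U P Q" and le: "AE z in lborel. norm (U z) \<le> 1"
  shows "sqint (cur U P Q)" "nsq (cur U P Q) \<le> nsq P + nsq Q"
proof -
  note [measurable] = sqint_meas[OF wkD(1)[OF w]] sqint_meas[OF wkD(2)[OF w]] sqint_meas[OF wkD(3)[OF w]]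
  have i: "integrable lborel (\<lambda>z. (cmod (P z))\<^sup>2 + (cmod (Q z))\<^sup>2)" using wkD(2,3)[OF w] by (simp add: sqint_def)
  have [measurable]: "cur U P Q \<in> borel_measurable borel" unfolding cur_def[abs_def] by measurable
  have b: "AE z in lborel. (cmod (cur U P Q z))\<^sup>2 \<le> (cmod (P z))\<^sup>2 + (cmod (Q z))\<^sup>2"
    using le
  proof eventually_elim
    case (elim z)
    have "(wedge (U z) a)\<^sup>2 \<le> (cmod a)\<^sup>2" for a
    proof -
      have "\<bar>wedge (U z) a\<bar> \<le> 1 * cmod a" by (rule order_trans[OF wedge_le mult_right_mono[OF elim]]) simp
      then show ?thesis using abs_le_square_iff[of "wedge (U z) a" "cmod a"] by simp
    qed
    then show ?case by (simp add: cur_def cmod_power2 add_mono)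
  qed
  have i2: "integrable lborel (\<lambda>z. (cmod (cur U P Q z))\<^sup>2)"
    by (rule Bochner_Integration.integrable_bound[OF i]) (use b in auto)
  then show "sqint (cur U P Q)" by (simp add: sqint_def)
  have "nsq (cur U P Q) \<le> (\<integral>z. (cmod (P z))\<^sup>2 + (cmod (Q z))\<^sup>2 \<partial>lborel)"
    unfolding nsq_def by (rule integral_mono_AE[OF i2 i b])
  also have "\<dots> = nsq P + nsq Q" unfolding nsq_def using wkD(2,3)[OF w] by (intro Bochner_Integration.integral_add) (auto simp: sqint_def)
  finally show "nsq (cur U P Q) \<le> nsq P + nsq Q" .
qed

section \<open>Vorticity and boundary degree\<close>

text \<open>Cauchy--Schwarz on the circle, with a free parameter in place of the optimal one.\<close>

lemma circle_L1_le_L2: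
  fixes f :: "complex \<Rightarrow> complex"
  assumes R: "R > 0" and f: "continuous_on (sphere 0 R) f" and \<eta>: "\<eta> > 0"
  defines "M \<equiv> hausdorff1_on (sphere 0 R)"
  shows "R * (\<integral>t. indicator angles t * norm (f (of_real R * cis t)) \<partial>lborel) \<le> \<eta> * measure M (space M) + (L2_norm M f)\<^sup>2 / \<eta>"
proof -
  interpret finite_measure M unfolding M_def by (rule finite_measure_circle[OF R])
  have sp: "space M = sphere 0 R" by (simp add: M_def hausdorff1_on_circle[OF R] circle_measure_def space_restrict_space)
  have fm: "f \<in> borel_measurable M" unfolding M_def by (rule circle_cont_borel[OF R f])
  note [measurable] = fm
  obtain B where B: "\<And>z. z \<in> sphere 0 R \<Longrightarrow> norm (f z) \<le> B"
    using compact_imp_bounded[OF compact_continuous_image[OF f compact_sphere]] unfolding bounded_iff by blast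
  have i1: "integrable M (\<lambda>z. norm (f z))" by (rule integrable_const_bound[of _ B]) (use B sp in auto)
  have i2: "integrable M (\<lambda>z. (norm (f z))\<^sup>2)" by (rule integrable_const_bound[of _ "B\<^sup>2"]) (use B sp in \<open>auto intro!: power_mono\<close>)
  have "(\<integral>z. norm (f z) \<partial>M) = (\<integral>t. (R * indicator angles t) *\<^sub>R norm (f (of_real R * cis t)) \<partial>lborel)"
    using circle_integrable_iff(2)[OF R, of "\<lambda>z. norm (f z)"] fm unfolding M_def by simp
  also have "\<dots> = R * (\<integral>t. indicator angles t * norm (f (of_real R * cis t)) \<partial>lborel)"
    by (simp add: mult.assoc)
  finally have "R * (\<integral>t. indicator angles t * norm (f (of_real R * cis t)) \<partial>lborel) = (\<integral>z. norm (f z) \<partial>M)" ..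
  also have "\<dots> \<le> (\<integral>z. \<eta> + (norm (f z))\<^sup>2 / \<eta> \<partial>M)"
  proof (rule integral_mono)
    show "norm (f z) \<le> \<eta> + (norm (f z))\<^sup>2 / \<eta>" for z
    proof -
      have "norm (f z) * \<eta> \<le> \<eta>\<^sup>2 + (norm (f z))\<^sup>2" using sum_squares_bound[of "norm (f z)" \<eta>] zero_le_power2[of \<eta>] zero_le_power2[of "norm (f z)"]
          mult_nonneg_nonneg[OF norm_ge_zero less_imp_le[OF \<eta>], of "f z"] by (simp add: mult.assoc)
      then show ?thesis using \<eta> by (simp add: field_simps power2_eq_square)
    qed
  qed (use i1 i2 in auto)
  also have "\<dots> = \<eta> * measure M (space M) + (\<integral>z. (norm (f z))\<^sup>2 \<partial>M) / \<eta>" using i2 by (simp add: mult.commute)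
  also have "(\<integral>z. (norm (f z))\<^sup>2 \<partial>M) = (L2_norm M f)\<^sup>2" by (simp add: L2_norm_def)
  finally show ?thesis .
qed

lemma circle_L1_tendsto:
  fixes f :: "nat \<Rightarrow> complex \<Rightarrow> complex"
  assumes R: "R > 0" and f: "\<And>n. continuous_on (sphere 0 R) (f n)"
    and lim: "(\<lambda>n. L2_norm (hausdorff1_on (sphere 0 R)) (f n)) \<longlonglongrightarrow> 0"
  shows "(\<lambda>n. \<integral>t. indicator angles t * norm (f n (of_real R * cis t)) \<partial>lborel) \<longlonglongrightarrow> 0"
proof -
  define M where "M = hausdorff1_on (sphere 0 R)"
  define s where "s n = L2_norm M (f n)" for n
  \<comment> \<open>the optimal parameter would be the norm itself; the summand keeps it positive\<close>
  define \<eta> where "\<eta> n = s n + 1 / real (Suc n)" for n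
  have s: "s n \<ge> 0" for n by (simp add: s_def L2_norm_def)
  have \<eta>: "\<eta> n > 0" for n using s[of n] by (simp add: \<eta>_def add_nonneg_pos)
  have sl: "s \<longlonglongrightarrow> 0" using lim unfolding s_def[abs_def] M_def .
  from tendsto_add[OF sl LIMSEQ_inverse_real_of_nat] have \<eta>l: "\<eta> \<longlonglongrightarrow> 0" unfolding \<eta>_def[abs_def] by (simp add: inverse_eq_divide)
  have "(\<integral>t. indicator angles t * norm (f n (of_real R * cis t)) \<partial>lborel) \<le> (\<eta> n * measure M (space M) + \<eta> n) / R" for n
  proof -
    have "s n \<le> \<eta> n" by (simp add: \<eta>_def)
    then have "(s n)\<^sup>2 / \<eta> n \<le> (\<eta> n)\<^sup>2 / \<eta> n" using s[of n] \<eta>[of n] by (intro divide_right_mono power_mono) auto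
    also have "\<dots> = \<eta> n" using \<eta>[of n] by (simp add: power2_eq_square)
    finally show ?thesis
      using circle_L1_le_L2[OF R f[of n] \<eta>[of n]] R unfolding M_def[symmetric] s_def[symmetric] by (simp add: field_simps)
  qed
  moreover have "(\<lambda>n. (\<eta> n * measure M (space M) + \<eta> n) / R) \<longlonglongrightarrow> 0"
    using \<eta>l R by (auto intro!: tendsto_eq_intros)
  ultimately show ?thesis
    by - (rule tendsto_sandwich[OF _ _ tendsto_const], auto)
qed

text \<open>The difference between \<open>u\<close> and \<open>phase n\<close> has zero trace on the outer circle, so it
  extends by zero; adding \<open>phase n\<close> back on the larger annulus glues the two functions.\<close>

lemma degree_extension:
  assumes R: "0 < R1" "R1 < R2" "R2 \<le> S" and w: "wk (annulus R1 R2) U P Q" and ae: "AE z in lebesgue_on (annulus R1 R2). u z = U z"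
    and tr: "has_trace (annulus R1 R2) (sphere 0 R2) u (\<lambda>z. cis (real n * Arg z))"
  defines "glue \<equiv> \<lambda>f h z. if z \<in> annulus R1 R2 then f z else if z \<in> annulus R1 S then h z else (0::complex)"
  shows "wk (annulus R1 S) (glue U (phase n)) (glue P (\<lambda>z. phase n z * \<i> * of_real (- real n * Im z / (norm z)\<^sup>2)))
     (glue Q (\<lambda>z. phase n z * \<i> * of_real (real n * Re z / (norm z)\<^sup>2)))"
proof -
  let ?A = "annulus R1 R2" and ?B = "annulus R1 S"
  define h where "h = phase n"
  define hx where "hx z = phase n z * \<i> * of_real (- real n * Im z / (norm z)\<^sup>2)" for z
  define hy where "hy z = phase n z * \<i> * of_real (real n * Re z / (norm z)\<^sup>2)" for z
  define res where "res D f z = (if z \<in> D then f z else 0)" for D and f :: "complex \<Rightarrow> complex" and z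
  have A: "open ?A" "bounded ?A" and B: "open ?B" "bounded ?B" by (rule annulus_open annulus_bounded)+
  have AB: "?A \<subseteq> ?B" using R by (auto simp: annulus_iff)
  have B0: "?B \<subseteq> - {0}" using R by (auto simp: annulus_iff)
  have C: "C1on (- {0}) h hx hy" unfolding h_def hx_def[abs_def] hy_def[abs_def] by (rule C1on_phase)
  define b where "b = max 1 (real n / R1)"
  have bd: "norm (h z) \<le> b" "norm (hx z) \<le> b" "norm (hy z) \<le> b" if "z \<in> ?B" for z
  proof -
    have z: "z \<noteq> 0" "R1 < norm z" using that R by (auto simp: annulus_iff)
    have "real n / norm z \<le> real n / R1" using z R by (intro divide_left_mono mult_pos_pos) auto
    then show "norm (h z) \<le> b" "norm (hx z) \<le> b" "norm (hy z) \<le> b"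
      using norm_phase[OF z(1), of n] norm_phase_deriv[OF z(1), of n] unfolding h_def hx_def hy_def b_def by linarith+
  qed
  have wB: "wk ?B (res ?B h) (res ?B hx) (res ?B hy)"
    unfolding res_def[abs_def] by (rule wk_C1on[OF B C1on_subset[OF C B0] bd])
  have wA: "wk ?A (res ?A h) (res ?A hx) (res ?A hy)"
    unfolding res_def[abs_def] by (rule wk_C1on[OF A C1on_subset[OF C]]) (use AB B0 bd in auto)
  obtain F pn qn where F: "\<And>m::nat. continuous_on (closure ?A) (F m)"
    and W: "\<And>m. wk ?A (\<lambda>z. if z \<in> ?A then F m z else 0) (pn m) (qn m)"
    and lim: "(\<lambda>m. nsq (\<lambda>z. (if z \<in> ?A then F m z else 0) - U z)) \<longlonglongrightarrow> 0"
      "(\<lambda>m. nsq (\<lambda>z. pn m z - P z)) \<longlonglongrightarrow> 0" "(\<lambda>m. nsq (\<lambda>z. qn m z - Q z)) \<longlonglongrightarrow> 0"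
    and L2: "tendsto_L2 (hausdorff1_on (sphere 0 R2)) F (\<lambda>z. cis (real n * Arg z)) sequentially"
    using has_trace_approx[OF A w ae tr] by blast
  have "closure ?A \<subseteq> {z. R1 \<le> norm z}"
    by (rule closure_minimal) (auto simp: annulus_iff intro!: closed_Collect_le continuous_intros)
  then have cl0: "closure ?A \<subseteq> - {0}" using R by auto
  have Fh: "continuous_on (closure ?A) (\<lambda>z. F m z - h z)" for m
    by (intro continuous_intros F continuous_on_subset[OF C1on_continuous(1)[OF C] cl0])
  have R2: "R2 > 0" using R by simp
  have sp: "space (hausdorff1_on (sphere 0 R2)) = sphere 0 R2" by (simp add: hausdorff1_on_circle[OF R2] circle_measure_def space_restrict_space)
  have "L2_norm (hausdorff1_on (sphere 0 R2)) (\<lambda>z. F m z - h z) = L2_norm (hausdorff1_on (sphere 0 R2)) (\<lambda>z. F m z - cis (real n * Arg z))" for m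
    unfolding L2_norm_def
  proof (intro arg_cong[where f = sqrt] Bochner_Integration.integral_cong refl)
    fix z assume "z \<in> space (hausdorff1_on (sphere 0 R2))"
    then have "z \<noteq> 0" using R by (auto simp: sp)
    then show "(cmod (F m z - h z))\<^sup>2 = (cmod (F m z - cis (real n * Arg z)))\<^sup>2" by (simp add: h_def phase_Arg)
  qed
  then have "(\<lambda>m. L2_norm (hausdorff1_on (sphere 0 R2)) (\<lambda>z. F m z - h z)) \<longlonglongrightarrow> 0"
    using L2 unfolding tendsto_L2_def by simp
  from circle_L1_tendsto[OF R2 continuous_on_subset[OF Fh closure_annulus(2)[OF R(1,2)]] this]
  have T: "(\<lambda>m. \<integral>t. indicator angles t * norm (F m (of_real R2 * cis t) - h (of_real R2 * cis t)) \<partial>lborel) \<longlonglongrightarrow> 0" .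
  have e: "(\<lambda>z. if z \<in> ?A then F m z - h z else 0) = (\<lambda>z. (if z \<in> ?A then F m z else 0) - res ?A h z)" for m
    by (auto simp: res_def)
  have f: "wk ?B (\<lambda>z. U z - res ?A h z) (\<lambda>z. P z - res ?A hx z) (\<lambda>z. Q z - res ?A hy z)"
  proof (rule zero_trace_extension[OF R wk_diff[OF w wA] Fh])
    show "wk ?A (\<lambda>z. if z \<in> ?A then F m z - h z else 0) (\<lambda>z. pn m z - res ?A hx z) (\<lambda>z. qn m z - res ?A hy z)" for m
      unfolding e by (rule wk_diff[OF W wA])
    show "(\<lambda>m. nsq (\<lambda>z. (if z \<in> ?A then F m z - h z else 0) - (U z - res ?A h z))) \<longlonglongrightarrow> 0"
      unfolding e[unfolded fun_eq_iff, rule_format] using lim(1) by simp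
  qed (use lim T in simp_all)
  have "wk ?B (\<lambda>z. (U z - res ?A h z) - (0 - res ?B h z)) (\<lambda>z. (P z - res ?A hx z) - (0 - res ?B hx z)) (\<lambda>z. (Q z - res ?A hy z) - (0 - res ?B hy z))"
    by (rule wk_diff[OF f wk_diff[OF wk_zero wB]])
  moreover have "(f z - res ?A k z) - (0 - res ?B k z) = glue f k z" if "\<And>z. z \<notin> ?A \<Longrightarrow> f z = 0" for f k z
    using that[of z] AB by (auto simp: res_def glue_def)
  ultimately show ?thesis
    using wkD(4,5,6)[OF w] by (simp add: h_def hx_def[abs_def] hy_def[abs_def])
qed

text \<open>Apply \<open>wedge_identity\<close> on the larger annulus to \<open>u\<close> continued by \<open>phase n\<close>. Outside the outer circle
  the continuation takes values in the unit circle, so it carries no vorticity there, while its current is \<open>n / norm z\<close> times the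
  angular direction; by \<open>radial_integral\<close> this current contributes the integral of \<open>\<phi>\<close> over the angle. Thus the concentration of the limit
  comes from the outside.\<close>

lemma vorticity_identity:
  assumes R: "0 < R1" "R1 < R2" "R2 \<le> S" and w: "wk (annulus R1 R2) U P Q" and ae: "AE z in lebesgue_on (annulus R1 R2). u z = U z"
    and tr: "has_trace (annulus R1 R2) (sphere 0 R2) u (\<lambda>z. cis (real n * Arg z))"
    and J: "sqint (cur U P Q)" and \<phi>: "C1c K \<phi> \<phi>x \<phi>y" "K \<subseteq> annulus R1 S"
  shows "(\<integral>z. 2 * wedge (P z) (Q z) * \<phi> z \<partial>lborel)
    = real n * (\<integral>t. indicator angles t * \<phi> (of_real R2 * cis t) \<partial>lborel) - (\<integral>z. wedge (Complex (\<phi>x z) (\<phi>y z)) (cur U P Q z) \<partial>lborel)"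
proof -
  let ?A = "annulus R1 R2" and ?B = "annulus R1 S"
  have R2: "R2 > 0" using R by simp
  have AB: "?A \<subseteq> ?B" using R by (auto simp: annulus_iff)
  have B: "open ?B" "bounded ?B" by (rule annulus_open annulus_bounded)+
  define glue where "glue f h z = (if z \<in> ?A then f z else if z \<in> ?B then h z else 0)" for f h :: "complex \<Rightarrow> complex" and z
  define hx where "hx z = phase n z * \<i> * of_real (- real n * Im z / (norm z)\<^sup>2)" for z
  define hy where "hy z = phase n z * \<i> * of_real (real n * Re z / (norm z)\<^sup>2)" for z
  have W: "wk ?B (glue U (phase n)) (glue P hx) (glue Q hy)"
    unfolding glue_def[abs_def] hx_def[abs_def] hy_def[abs_def] by (rule degree_extension[OF R w ae tr])
  have w0: "\<And>z. z \<notin> ?A \<Longrightarrow> U z = 0" "\<And>z. z \<notin> ?A \<Longrightarrow> P z = 0" "\<And>z. z \<notin> ?A \<Longrightarrow> Q z = 0" using wkD[OF w] by auto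
  have \<phi>0: "\<And>z. z \<notin> ?B \<Longrightarrow> \<phi>x z = 0" "\<And>z. z \<notin> ?B \<Longrightarrow> \<phi>y z = 0" using \<phi> by (auto simp: C1c_def)
  note [measurable] = C1c_measurable[OF \<phi>(1)] sqint_meas[OF wkD(1)[OF W]] sqint_meas[OF wkD(2)[OF W]] sqint_meas[OF wkD(3)[OF W]] sqint_meas[OF J]
  have s\<phi>: "sqint (\<lambda>z. Complex (\<phi>x z) (\<phi>y z))"
  proof -
    have "integrable lborel (\<lambda>z. (\<phi>x z)\<^sup>2 + (\<phi>y z)\<^sup>2)" using C1c_sqint(2,3)[OF \<phi>(1)] by (simp add: sqint_def)
    then show ?thesis by (simp add: sqint_def cmod_power2)
  qed
  let ?G = "\<lambda>z. indicator {z. R2 < norm z} z * ((\<phi>x z * Re z + \<phi>y z * Im z) / (norm z)\<^sup>2)"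
  have wp: "wedge (hx z) (hy z) = 0" "z \<noteq> 0 \<Longrightarrow> wedge (phase n z) (hx z) = - real n * Im z / (norm z)\<^sup>2"
    "z \<noteq> 0 \<Longrightarrow> wedge (phase n z) (hy z) = real n * Re z / (norm z)\<^sup>2" for z
  proof -
    have a: "wedge c (c * \<i> * of_real r) = r * (cmod c)\<^sup>2" for c r unfolding wedge_eq cmod_power2 by (simp add: power2_eq_square algebra_simps)
    have b: "wedge (c * \<i> * of_real r) (c * \<i> * of_real s) = 0" for c r s by (simp add: wedge_eq algebra_simps)
    show "wedge (hx z) (hy z) = 0" unfolding hx_def hy_def by (rule b)
    show "wedge (phase n z) (hx z) = - real n * Im z / (norm z)\<^sup>2" "wedge (phase n z) (hy z) = real n * Re z / (norm z)\<^sup>2" if "z \<noteq> 0"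
      unfolding hx_def hy_def a norm_phase[OF that] by simp_all
  qed
  have "(\<integral>z. 2 * wedge (P z) (Q z) * \<phi> z \<partial>lborel) = (\<integral>z. 2 * wedge (glue P hx z) (glue Q hy z) * \<phi> z \<partial>lborel)"
    by (intro Bochner_Integration.integral_cong refl) (simp add: glue_def w0 wp(1) wedge_linear(8,9))
  also have "\<dots> = - (\<integral>z. \<phi>x z * wedge (glue U (phase n) z) (glue Q hy z) - \<phi>y z * wedge (glue U (phase n) z) (glue P hx z) \<partial>lborel)"
    by (rule wedge_identity[OF B W \<phi>])
  also have "(\<integral>z. \<phi>x z * wedge (glue U (phase n) z) (glue Q hy z) - \<phi>y z * wedge (glue U (phase n) z) (glue P hx z) \<partial>lborel)
    = (\<integral>z. wedge (Complex (\<phi>x z) (\<phi>y z)) (cur U P Q z) + real n * ?G z \<partial>lborel)"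
  proof (rule integral_cong_AE)
    \<comment> \<open>the circle belongs neither to the smaller annulus nor to the exterior, and is negligible\<close>
    have null: "AE z in lborel. z \<notin> sphere (0::complex) R2"
      by (rule AE_not_in) (simp add: negligible_sphere null_sets_completion_iff[symmetric] negligible_iff_null_sets[symmetric])
    then show "AE z in lborel. \<phi>x z * wedge (glue U (phase n) z) (glue Q hy z) - \<phi>y z * wedge (glue U (phase n) z) (glue P hx z)
      = wedge (Complex (\<phi>x z) (\<phi>y z)) (cur U P Q z) + real n * ?G z"
    proof eventually_elim
      case (elim z)
      consider "z \<in> ?A" | "z \<notin> ?A" "z \<in> ?B" | "z \<notin> ?B" by blast
      then show ?case
      proof cases
        case 1
        then have "\<not> R2 < norm z" by (simp add: annulus_iff)
        with 1 show ?thesis by (simp add: glue_def cur_def wedge_eq[of "Complex _ _"])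
      next
        case 2
        then have z: "R2 < norm z" "z \<noteq> 0" using elim R by (auto simp: annulus_iff)
        with 2 show ?thesis
          by (simp add: glue_def cur_def w0 wedge_linear(8,9) wp Complex_eq_0 zero_complex.code[symmetric] add_divide_distrib distrib_left mult.left_commute mult.commute)
      next
        case 3
        then show ?thesis using \<phi>0[OF 3] by (simp add: zero_complex.code[symmetric] wedge_linear(8,9))
      qed
    qed
  qed measurable
  also have "\<dots> = (\<integral>z. wedge (Complex (\<phi>x z) (\<phi>y z)) (cur U P Q z) \<partial>lborel) + real n * (\<integral>z. ?G z \<partial>lborel)"
  proof -
    have "(\<integral>z. f z + c * g z \<partial>lborel) = (\<integral>z. f z \<partial>lborel) + c * (\<integral>z. g z \<partial>lborel)"
      if "integrable lborel f" "integrable lborel g" for c and f g :: "complex \<Rightarrow> real" using that by simp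
    from this[OF wedge_integrable(1)[OF s\<phi> J] radial_integral(1)[OF \<phi>(1) R2]] show ?thesis .
  qed
  also have "(\<integral>z. ?G z \<partial>lborel) = - (\<integral>t. indicator angles t * \<phi> (of_real R2 * cis t) \<partial>lborel)"
    by (rule radial_integral(2)[OF \<phi>(1) R2])
  finally show ?thesis by simp
qed


section \<open>Currents and vorticities of minimizers\<close>

text \<open>Both conclusions of the theorem rest on one number, the \<open>L\<^sup>2\<close> norm of the current: it
  bounds the current itself, and by duality it bounds the distance of the vorticity from the measure on the circle.\<close>

lemma minimizer_estimates:
  assumes R: "0 < R1" "R1 < R2"
  obtains C where "C > 0" "\<And>n \<epsilon> u. n > 0 \<Longrightarrow> 0 < \<epsilon> \<Longrightarrow> \<epsilon> < 1 \<Longrightarrow> GL_minimizer \<epsilon> R1 R2 n u \<Longrightarrow>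
      current (annulus R1 R2) u \<in> L2 (lebesgue_on (annulus R1 R2)) \<and>
      (L2_norm (lebesgue_on (annulus R1 R2)) (current (annulus R1 R2) u))\<^sup>2 \<le> C * real n * (1 + \<bar>ln \<epsilon>\<bar>) \<and>
      (\<forall>S\<ge>R2. \<forall>\<phi>\<in>test_functions (annulus R1 S).
         \<bar>distr_of_fun (annulus R1 S) (extended_vorticity (annulus R1 R2) u) \<phi>
           - real n * (\<integral>t. indicator angles t * \<phi> (of_real R2 * cis t) \<partial>lborel)\<bar>
         \<le> sqrt (nsq (\<lambda>z. Complex (pderiv_dir 1 \<phi> z) (pderiv_dir \<i> \<phi> z)) * (C * real n * (1 + \<bar>ln \<epsilon>\<bar>))))"
proof -
  let ?A = "annulus R1 R2"
  have A: "open ?A" "bounded ?A" by (rule annulus_open annulus_bounded)+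
  have Ab: "?A \<in> sets borel" using A by simp
  obtain C where C: "C > 0" "\<And>n \<epsilon> u. n > 0 \<Longrightarrow> 0 < \<epsilon> \<Longrightarrow> \<epsilon> < 1 \<Longrightarrow> GL_minimizer \<epsilon> R1 R2 n u \<Longrightarrow>
    \<exists>U P Q. wk ?A U P Q \<and> (AE z in lebesgue_on ?A. u z = U z) \<and> (AE z in lborel. norm (U z) \<le> 1) \<and>
      nsq P + nsq Q \<le> C * real n * (1 + \<bar>ln \<epsilon>\<bar>)"
    using minimizer_bounds[OF R] by blast
  show ?thesis
  proof (rule that[OF C(1)], intro conjI allI ballI impI)
    fix n :: nat and \<epsilon> u assume n: "n > 0" "0 < \<epsilon>" "\<epsilon> < 1" and min: "GL_minimizer \<epsilon> R1 R2 n u"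
    define E where "E = C * real n * (1 + \<bar>ln \<epsilon>\<bar>)"
    obtain U P Q where w: "wk ?A U P Q" and ae: "AE z in lebesgue_on ?A. u z = U z"
      and le: "AE z in lborel. norm (U z) \<le> 1" and E: "nsq P + nsq Q \<le> E"
      using C(2)[OF n min] unfolding E_def by blast
    note D = wk_unique[OF A w ae] and J = cur_sqint[OF w le]
    have JE: "nsq (cur U P Q) \<le> E" using J(2) E by linarith
    have z0: "cur U P Q z = 0" if "z \<notin> ?A" for z
      using wkD(4)[OF w that] by (simp add: cur_def wedge_linear(8,9) zero_complex.code[symmetric])
    have aeJ: "AE z in lebesgue_on ?A. current ?A u z = cur U P Q z"
      using ae D by eventually_elim (simp add: current_def cur_def)
    show "current ?A u \<in> L2 (lebesgue_on ?A)" by (rule L2_norm_rep(1)[OF Ab J(1) z0 aeJ])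
    have "(L2_norm (lebesgue_on ?A) (current ?A u))\<^sup>2 = nsq (cur U P Q)" by (rule L2_norm_rep(2)[OF Ab J(1) z0 aeJ])
    then show "(L2_norm (lebesgue_on ?A) (current ?A u))\<^sup>2 \<le> C * real n * (1 + \<bar>ln \<epsilon>\<bar>)" using JE by (simp add: E_def)
    fix S \<phi> assume S: "R2 \<le> S" and \<phi>: "\<phi> \<in> test_functions (annulus R1 S)"
    let ?B = "annulus R1 S"
    obtain K where K: "K \<subseteq> ?B" "C1c K \<phi> (pderiv_dir 1 \<phi>) (pderiv_dir \<i> \<phi>)" by (rule C1c_test[OF \<phi>])
    have Bb: "?B \<in> sets borel" using annulus_open by simp
    note [measurable] = C1c_measurable[OF K(2)] sqint_meas[OF wkD(2)[OF w]] sqint_meas[OF wkD(3)[OF w]]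
    have "distr_of_fun ?B (extended_vorticity ?A u) \<phi> = (\<integral>z. 2 * wedge (P z) (Q z) * \<phi> z \<partial>lborel)"
      unfolding distr_of_fun_def
    proof (rule lebesgue_on_rep(3)[OF Bb])
      show "2 * wedge (P z) (Q z) * \<phi> z = 0" if "z \<notin> ?B" for z using that K by (auto simp: C1c_def)
      have "AE z in lebesgue. z \<in> ?A \<longrightarrow> wderiv ?A 1 u z = P z \<and> wderiv ?A \<i> u z = Q z"
        using D Ab by (auto simp: AE_restrict_space_iff elim: eventually_elim2)
      then show "AE z in lebesgue_on ?B. extended_vorticity ?A u z * \<phi> z = 2 * wedge (P z) (Q z) * \<phi> z"
        using Bb wkD(5)[OF w] by (auto simp: AE_restrict_space_iff extended_vorticity_def vorticity_def wedge_linear(8,9) elim!: eventually_mono)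
    qed measurable
    also have "\<dots> = real n * (\<integral>t. indicator angles t * \<phi> (of_real R2 * cis t) \<partial>lborel)
        - (\<integral>z. wedge (Complex (pderiv_dir 1 \<phi> z) (pderiv_dir \<i> \<phi> z)) (cur U P Q z) \<partial>lborel)"
      by (rule vorticity_identity[OF R S w ae _ J(1) K(2,1)]) (use min in \<open>auto simp: GL_minimizer_def GL_admissible_def\<close>)
    finally have e: "\<bar>distr_of_fun ?B (extended_vorticity ?A u) \<phi> - real n * (\<integral>t. indicator angles t * \<phi> (of_real R2 * cis t) \<partial>lborel)\<bar>
       = \<bar>\<integral>z. wedge (Complex (pderiv_dir 1 \<phi> z) (pderiv_dir \<i> \<phi> z)) (cur U P Q z) \<partial>lborel\<bar>" by simp
    have "sqint (\<lambda>z. Complex (pderiv_dir 1 \<phi> z) (pderiv_dir \<i> \<phi> z))"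
      using C1c_sqint(2,3)[OF K(2)] by (simp add: sqint_def cmod_power2)
    from wedge_integrable(2)[OF this J(1)]
    have "\<bar>\<integral>z. wedge (Complex (pderiv_dir 1 \<phi> z) (pderiv_dir \<i> \<phi> z)) (cur U P Q z) \<partial>lborel\<bar>
      \<le> sqrt (nsq (\<lambda>z. Complex (pderiv_dir 1 \<phi> z) (pderiv_dir \<i> \<phi> z)) * nsq (cur U P Q))" .
    also have "\<dots> \<le> sqrt (nsq (\<lambda>z. Complex (pderiv_dir 1 \<phi> z) (pderiv_dir \<i> \<phi> z)) * E)"
      using JE by (intro real_sqrt_le_mono mult_left_mono nsq_nonneg)
    finally show "\<bar>distr_of_fun ?B (extended_vorticity ?A u) \<phi> - real n * (\<integral>t. indicator angles t * \<phi> (of_real R2 * cis t) \<partial>lborel)\<bar>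
      \<le> sqrt (nsq (\<lambda>z. Complex (pderiv_dir 1 \<phi> z) (pderiv_dir \<i> \<phi> z)) * (C * real n * (1 + \<bar>ln \<epsilon>\<bar>)))"
      unfolding e E_def .
  qed
qed

theorem proposition1p3:
  fixes R\<^sub>1 R\<^sub>2 \<delta> :: real and d :: "real \<Rightarrow> nat" and u :: "real \<Rightarrow> complex \<Rightarrow> complex"
  assumes "0 < R\<^sub>1" and "R\<^sub>1 < R\<^sub>2"
    and "\<And>\<epsilon>. \<epsilon> > 0 \<Longrightarrow> d \<epsilon> > 0"
    and "\<And>\<epsilon>. \<epsilon> > 0 \<Longrightarrow> GL_minimizer \<epsilon> R\<^sub>1 R\<^sub>2 (d \<epsilon>) (u \<epsilon>)"
    and "\<delta> > 0"
    and "(\<lambda>\<epsilon>. \<bar>ln \<epsilon>\<bar>) \<in> o[at_right 0](\<lambda>\<epsilon>. real (d \<epsilon>))"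
    and "(\<lambda>\<epsilon>. real (d \<epsilon>)) \<in> o[at_right 0](\<lambda>\<epsilon>. \<epsilon> powr (\<delta> - 1))"
  shows "tendsto_L2 (lebesgue_on (annulus R\<^sub>1 R\<^sub>2))
           (\<lambda>\<epsilon> z. current (annulus R\<^sub>1 R\<^sub>2) (u \<epsilon>) z / of_nat (d \<epsilon>)) (\<lambda>z. 0) (at_right 0)
       \<and> (\<forall>a>0. tendsto_distr (annulus R\<^sub>1 (R\<^sub>2 + a))
           (\<lambda>\<epsilon>. distr_of_fun (annulus R\<^sub>1 (R\<^sub>2 + a))
                  (\<lambda>z. extended_vorticity (annulus R\<^sub>1 R\<^sub>2) (u \<epsilon>) z / real (d \<epsilon>)))
           (\<lambda>\<phi>. (1 / R\<^sub>2) * distr_of_measure (hausdorff1_on (sphere 0 R\<^sub>2)) \<phi>)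
           (at_right 0))"
proof -
  let ?A = "annulus R\<^sub>1 R\<^sub>2"
  note R = assms(1,2)
  have R2: "R\<^sub>2 > 0" using R by simp
  obtain C where C: "C > 0" and est: "\<And>n \<epsilon> u. n > 0 \<Longrightarrow> 0 < \<epsilon> \<Longrightarrow> \<epsilon> < 1 \<Longrightarrow> GL_minimizer \<epsilon> R\<^sub>1 R\<^sub>2 n u \<Longrightarrow>
      current ?A u \<in> L2 (lebesgue_on ?A) \<and>
      (L2_norm (lebesgue_on ?A) (current ?A u))\<^sup>2 \<le> C * real n * (1 + \<bar>ln \<epsilon>\<bar>) \<and>
      (\<forall>S\<ge>R\<^sub>2. \<forall>\<phi>\<in>test_functions (annulus R\<^sub>1 S).
         \<bar>distr_of_fun (annulus R\<^sub>1 S) (extended_vorticity ?A u) \<phi> - real n * (\<integral>t. indicator angles t * \<phi> (of_real R\<^sub>2 * cis t) \<partial>lborel)\<bar>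
         \<le> sqrt (nsq (\<lambda>z. Complex (pderiv_dir 1 \<phi> z) (pderiv_dir \<i> \<phi> z)) * (C * real n * (1 + \<bar>ln \<epsilon>\<bar>))))"
    using minimizer_estimates[OF R] by blast
  define \<sigma> where "\<sigma> \<epsilon> = C * (1 + \<bar>ln \<epsilon>\<bar>) / real (d \<epsilon>)" for \<epsilon>
  have \<sigma>0: "\<sigma> \<epsilon> \<ge> 0" for \<epsilon> using C by (simp add: \<sigma>_def)
  have scale: "C * real (d \<epsilon>) * (1 + \<bar>ln \<epsilon>\<bar>) = \<sigma> \<epsilon> * (real (d \<epsilon>))\<^sup>2" for \<epsilon>
    by (cases "d \<epsilon> = 0") (simp_all add: \<sigma>_def power2_eq_square)
  \<comment> \<open>below \<open>exp (- 1)\<close> the logarithm exceeds one and absorbs the constant in the energy bound\<close>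
  have small: "\<forall>\<^sub>F \<epsilon> in at_right 0. 0 < \<epsilon> \<and> \<epsilon> < exp (- 1 :: real)"
    using eventually_at_right_real[of 0 "exp (- 1)"] by (auto elim: eventually_mono)
  have ev1: "\<forall>\<^sub>F \<epsilon> in at_right 0. 0 < \<epsilon> \<and> \<epsilon> < (1 :: real)"
    using eventually_at_right_real[of 0 1] by (auto elim: eventually_mono)
  have L: "((\<lambda>\<epsilon>. \<bar>ln \<epsilon>\<bar> / real (d \<epsilon>)) \<longlongrightarrow> 0) (at_right 0)" by (rule smalloD_tendsto[OF assms(6)])
  have \<sigma>: "(\<sigma> \<longlongrightarrow> 0) (at_right 0)"
  proof (rule tendsto_sandwich[OF _ _ tendsto_const])
    show "((\<lambda>\<epsilon>. 2 * C * (\<bar>ln \<epsilon>\<bar> / real (d \<epsilon>))) \<longlongrightarrow> 0) (at_right 0)"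
      using tendsto_mult[OF tendsto_const L, of "2 * C"] by simp
    show "\<forall>\<^sub>F \<epsilon> in at_right 0. \<sigma> \<epsilon> \<le> 2 * C * (\<bar>ln \<epsilon>\<bar> / real (d \<epsilon>))"
      using small
    proof eventually_elim
      case (elim \<epsilon>)
      have "ln \<epsilon> < ln (exp (- 1))" using elim by (subst ln_less_cancel_iff) auto
      then have "1 + \<bar>ln \<epsilon>\<bar> \<le> 2 * \<bar>ln \<epsilon>\<bar>" by simp
      then have "C * (1 + \<bar>ln \<epsilon>\<bar>) / real (d \<epsilon>) \<le> C * (2 * \<bar>ln \<epsilon>\<bar>) / real (d \<epsilon>)" using C by (intro divide_right_mono mult_left_mono) auto
      then show ?case by (simp add: \<sigma>_def mult.commute mult.left_commute)
    qed
  qed (simp add: \<sigma>0)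
  from tendsto_real_sqrt[OF \<sigma>] have sqrt\<sigma>: "((\<lambda>\<epsilon>. sqrt (\<sigma> \<epsilon>)) \<longlongrightarrow> 0) (at_right 0)" by simp
  have cur: "(\<lambda>z. current ?A (u \<epsilon>) z / of_nat (d \<epsilon>)) \<in> L2 (lebesgue_on ?A) \<and>
      L2_norm (lebesgue_on ?A) (\<lambda>z. current ?A (u \<epsilon>) z / of_nat (d \<epsilon>)) \<le> sqrt (\<sigma> \<epsilon>)" if \<epsilon>: "0 < \<epsilon> \<and> \<epsilon> < 1" for \<epsilon>
  proof -
    have d: "d \<epsilon> > 0" using assms(3) \<epsilon> by blast
    have e: "current ?A (u \<epsilon>) \<in> L2 (lebesgue_on ?A)" "(L2_norm (lebesgue_on ?A) (current ?A (u \<epsilon>)))\<^sup>2 \<le> \<sigma> \<epsilon> * (real (d \<epsilon>))\<^sup>2"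
      using est[OF d _ _ assms(4)] \<epsilon> unfolding scale by blast+
    have m: "L2_norm (lebesgue_on ?A) (\<lambda>z. current ?A (u \<epsilon>) z / of_nat (d \<epsilon>)) = L2_norm (lebesgue_on ?A) (current ?A (u \<epsilon>)) / real (d \<epsilon>)"
      by (simp add: L2_norm_def norm_divide power_divide real_sqrt_divide)
    have "L2_norm (lebesgue_on ?A) (current ?A (u \<epsilon>)) \<le> sqrt (\<sigma> \<epsilon> * (real (d \<epsilon>))\<^sup>2)" by (rule real_le_rsqrt[OF e(2)])
    also have "\<dots> = sqrt (\<sigma> \<epsilon>) * real (d \<epsilon>)" by (simp add: real_sqrt_mult)
    finally have "L2_norm (lebesgue_on ?A) (current ?A (u \<epsilon>)) / real (d \<epsilon>) \<le> sqrt (\<sigma> \<epsilon>)" using d by (simp add: divide_le_eq)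
    then show ?thesis using e(1) unfolding m by (auto simp: L2_def norm_divide power_divide)
  qed
  have "tendsto_L2 (lebesgue_on ?A) (\<lambda>\<epsilon> z. current ?A (u \<epsilon>) z / of_nat (d \<epsilon>)) (\<lambda>z. 0) (at_right 0)"
    unfolding tendsto_L2_def
  proof (intro conjI)
    show "\<forall>\<^sub>F \<epsilon> in at_right 0. (\<lambda>z. current ?A (u \<epsilon>) z / of_nat (d \<epsilon>)) \<in> L2 (lebesgue_on ?A)"
      using ev1 by eventually_elim (use cur in blast)
    show "((\<lambda>\<epsilon>. L2_norm (lebesgue_on ?A) (\<lambda>z. current ?A (u \<epsilon>) z / of_nat (d \<epsilon>) - 0)) \<longlongrightarrow> 0) (at_right 0)"
    proof (rule tendsto_sandwich[OF _ _ tendsto_const sqrt\<sigma>])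
      show "\<forall>\<^sub>F \<epsilon> in at_right 0. L2_norm (lebesgue_on ?A) (\<lambda>z. current ?A (u \<epsilon>) z / of_nat (d \<epsilon>) - 0) \<le> sqrt (\<sigma> \<epsilon>)"
        using ev1 by eventually_elim (use cur in auto)
    qed (simp add: L2_norm_def)
  qed (simp add: L2_def)
  moreover have "tendsto_distr (annulus R\<^sub>1 (R\<^sub>2 + a))
      (\<lambda>\<epsilon>. distr_of_fun (annulus R\<^sub>1 (R\<^sub>2 + a)) (\<lambda>z. extended_vorticity ?A (u \<epsilon>) z / real (d \<epsilon>)))
      (\<lambda>\<phi>. (1 / R\<^sub>2) * distr_of_measure (hausdorff1_on (sphere 0 R\<^sub>2)) \<phi>) (at_right 0)" if a: "a > 0" for a
    unfolding tendsto_distr_def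
  proof
    fix \<phi> assume \<phi>: "\<phi> \<in> test_functions (annulus R\<^sub>1 (R\<^sub>2 + a))"
    define I where "I = (\<integral>t. indicator angles t * \<phi> (of_real R\<^sub>2 * cis t) \<partial>lborel)"
    define N where "N = nsq (\<lambda>z. Complex (pderiv_dir 1 \<phi> z) (pderiv_dir \<i> \<phi> z))"
    define T where "T \<epsilon> = distr_of_fun (annulus R\<^sub>1 (R\<^sub>2 + a)) (extended_vorticity ?A (u \<epsilon>)) \<phi>" for \<epsilon>
    have "continuous_on UNIV \<phi>" using C1c_test[OF \<phi>] C1c_continuous(1) by metis
    then have "\<phi> \<in> borel_measurable (hausdorff1_on (sphere 0 R\<^sub>2))"
      by (intro circle_cont_borel[OF R2]) (rule continuous_on_subset, auto)
    from circle_integrable_iff(2)[OF R2 this]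
    have lim: "(1 / R\<^sub>2) * distr_of_measure (hausdorff1_on (sphere 0 R\<^sub>2)) \<phi> = I"
      using R2 by (simp add: distr_of_measure_def I_def mult.assoc)
    have T: "distr_of_fun (annulus R\<^sub>1 (R\<^sub>2 + a)) (\<lambda>z. extended_vorticity ?A (u \<epsilon>) z / real (d \<epsilon>)) \<phi> = T \<epsilon> / real (d \<epsilon>)" for \<epsilon>
      unfolding T_def distr_of_fun_def by simp
    have "((\<lambda>\<epsilon>. T \<epsilon> / real (d \<epsilon>) - I) \<longlongrightarrow> 0) (at_right 0)"
    proof (rule Lim_null_comparison)
      show "((\<lambda>\<epsilon>. sqrt N * sqrt (\<sigma> \<epsilon>)) \<longlongrightarrow> 0) (at_right 0)" using tendsto_mult[OF tendsto_const sqrt\<sigma>, of "sqrt N"] by simp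
      show "\<forall>\<^sub>F \<epsilon> in at_right 0. norm (T \<epsilon> / real (d \<epsilon>) - I) \<le> sqrt N * sqrt (\<sigma> \<epsilon>)"
        using ev1
      proof eventually_elim
        case (elim \<epsilon>)
        have d: "d \<epsilon> > 0" using assms(3) elim by blast
        have "\<bar>T \<epsilon> - real (d \<epsilon>) * I\<bar> \<le> sqrt (N * (\<sigma> \<epsilon> * (real (d \<epsilon>))\<^sup>2))"
          using est[OF d _ _ assms(4)] elim \<phi> a unfolding scale T_def I_def N_def by simp
        also have "\<dots> = sqrt N * sqrt (\<sigma> \<epsilon>) * real (d \<epsilon>)" by (simp add: real_sqrt_mult)
        finally have "\<bar>T \<epsilon> - real (d \<epsilon>) * I\<bar> / real (d \<epsilon>) \<le> sqrt N * sqrt (\<sigma> \<epsilon>)" using d by (simp add: divide_le_eq)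
        moreover have "T \<epsilon> / real (d \<epsilon>) - I = (T \<epsilon> - real (d \<epsilon>) * I) / real (d \<epsilon>)" using d by (simp add: diff_divide_distrib)
        ultimately show ?case by (simp add: abs_divide)
      qed
    qed
    then show "((\<lambda>\<epsilon>. distr_of_fun (annulus R\<^sub>1 (R\<^sub>2 + a)) (\<lambda>z. extended_vorticity ?A (u \<epsilon>) z / real (d \<epsilon>)) \<phi>)
        \<longlongrightarrow> (1 / R\<^sub>2) * distr_of_measure (hausdorff1_on (sphere 0 R\<^sub>2)) \<phi>) (at_right 0)"
      unfolding T lim by (rule LIM_zero_cancel)
  qed
  ultimately show ?thesis by blast
qed

end
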